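(* Let $m\ge2$ and let $(\sigma_1,\ldots,\sigma_m)$ generate the Nikishin system $\mathcal{N}(\sigma_1,\ldots,\sigma_m)$. For each $n\in\mathbb{N}$, let $a_{n,0},a_{n,1},\ldots,a_{n,m}$ be the collection of ML (or, equivalently, DR) Hermite-Padé polynomials associated with $\mathcal{N}(\sigma_1,\ldots,\sigma_m)$. Suppose that either the sequence of moments of $\sigma_m$ satisfies Carleman's condition, or $\Delta_{m-1}$ is a bounded interval contained in $\mathbb{C}\setminus\Delta_m$. Then, for $j=0,\ldots,m-1$, $$\lim_{n\to\infty}\frac{a_{n,j}}{a_{n,m}}=\widehat s_{m,j+1}$$ uniformly on each compact subset $\mathcal{K}\subset\mathbb{C}\setminus\Delta_m$. Moreover, for $j=0,\ldots,m-1$, $$\lim_{n\to\infty}\left((-1)^j\frac{a_{n,j}(z)}{a_{n,m}(z)}+\sum_{k=j+1}^{m-1}(-1)^k\frac{a_{n,k}(z)}{a_{n,m}(z)}\widehat s_{j+1,k}(z)+(-1)^m\widehat s_{j+1,m}(z)\right)=0$$ uniformly on each compact subset $\mathcal{K}\subset\mathbb{C}\setminus(\Delta_{j+1}\cup\Delta_m)$.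
   Context: $\mathbb{N}=\{1,2,\ldots\}$. For an interval $\Delta\subset\mathbb{R}$, $\mathcal{M}(\Delta)$ is the class of Borel measures $s$ of constant sign whose support consists of infinitely many points and is contained in $\Delta$, with $x^\nu\in L_1(s)$ for all integers $\nu\ge0$. The Cauchy transform is $\widehat{s}(z)=\int\frac{ds(x)}{z-x}$; it has the expansion $\widehat{s}(z)\sim\sum_{j\ge0}c_j/z^{j+1}$, $c_j=\int x^j\,ds(x)$, at $\infty$, convergent near $\infty$ if the support is bounded and otherwise asymptotic (limits taken along curves non-tangential to the support at $\infty$). All symbols $\mathcal{O}(1/z^N)$ refer to $z\to\infty$ in this sense. A measure $\sigma\in\mathcal{M}(\Delta)$ with moments $c_\nu=\int x^\nu d\sigma(x)$ satisfies Carleman's condition if $\sum_{\nu\ge1}|c_\nu|^{-1/(2\nu)}=\infty$. For $\sigma_\alpha\in\mathcal{M}(\Delta_\alpha)$, $\sigma_\beta\in\mathcal{M}(\Delta_\beta)$, with $\Delta_\alpha,\Delta_\beta$ having at most one common point and $\widehat\sigma_\beta\in L_1(\sigma_\alpha)$, define the measure $d\langle\sigma_\alpha,\sigma_\beta\rangle(x):=\widehat\sigma_\beta(x)\,d\sigma_\alpha(x)$. Longer products are defined recursively, $\langle\sigma_j,\sigma_{j+1},\ldots,\sigma_k\rangle:=\langle\sigma_j,\langle\sigma_{j+1},\ldots,\sigma_k\rangle\rangle$. Let $\Delta_1,\ldots,\Delta_m$ be intervals in $\mathbb{R}$ such that for each $j=1,\ldots,m-1$ either $\Delta_j\cap\Delta_{j+1}=\emptyset$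 or $\Delta_j\cap\Delta_{j+1}=\{x_{j,j+1}\}$ is a single point. Let $\sigma_j\in\mathcal{M}(\Delta_j)$ with the convex hull of $\operatorname{supp}(\sigma_j)$ equal to $\Delta_j$, $j=1,\ldots,m$; if $\Delta_j\cap\Delta_{j+1}=\{x_{j,j+1}\}$, then $x_{j,j+1}$ is not a mass point of $\sigma_j$ or of $\sigma_{j+1}$. For $1\le j\le k\le m$ put $s_{j,k}:=\langle\sigma_j,\sigma_{j+1},\ldots,\sigma_k\rangle$ and $s_{k,j}:=\langle\sigma_k,\sigma_{k-1},\ldots,\sigma_j\rangle$ (so $s_{j,j}=\sigma_j$). All these products are assumed well defined (the required integrability holds), with $s_{j,k}\in\mathcal{M}(\Delta_j)$ and $s_{k,j}\in\mathcal{M}(\Delta_k)$. The system $(s_{1,1},\ldots,s_{1,m})=\mathcal{N}(\sigma_1,\ldots,\sigma_m)$ is the Nikishin system generated by $(\sigma_1,\ldots,\sigma_m)$. ML (multi-level) Hermite-Padé polynomials: for $n\in\mathbb{N}$, polynomials $a_{n,0},\ldots,a_{n,m}$, not all identically zero, with $\deg a_{n,j}\le n-1$ for $j=0,\ldots,m-1$ and $\deg a_{n,m}\le n$, such that, with $$\mathcal{A}_{n,j}:=(-1)^ja_{n,j}+\sum_{k=j+1}^m(-1)^k a_{n,k}\widehat s_{j+1,k},\qquad j=0,\ldots,m-1,$$ one has $\mathcal{A}_{n,0}(z)=\mathcal{O}(1/z^{n+1})$ and $\mathcal{A}_{n,j}(z)=\mathcal{O}(1/z)$ for $j=1,\ldots,m-1$.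 DR (direct/reversed) Hermite-Padé polynomials: same degree and non-triviality conditions, with $\mathcal{A}_{n,0}(z)=\mathcal{O}(1/z^{n+1})$ and $(a_{n,j}-a_{n,m}\widehat s_{m,j+1})(z)=\mathcal{O}(1/z)$ for $j=1,\ldots,m-1$. For each $n$ the two notions coincide and the vector is unique up to a constant multiple. *)

theory Defs
  imports "HOL-Analysis.Analysis" "HOL-Library.Landau_Symbols"
    "HOL-Computational_Algebra.Polynomial"
begin

text \<open>A Borel measure of constant sign is stored as a sign (required to be \<open>1\<close> or \<open>-1\<close> in
  \<open>class_M\<close> below) together with its total variation, an ordinary positive measure.\<close>

datatype sgn_measure = SgnMeasure (sm_sign: real) (sm_var: "real measure")

definition sm_integral ::
    "sgn_measure \<Rightarrow> (real \<Rightarrow> 'a) \<Rightarrow> 'a::{banach, second_countable_topology}" where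
  "sm_integral s f = sm_sign s *\<^sub>R (LINT x|sm_var s. f x)"

definition sm_support :: "sgn_measure \<Rightarrow> real set" where
  "sm_support s = {x. \<forall>U. open U \<and> x \<in> U \<longrightarrow> emeasure (sm_var s) U \<noteq> 0}"

definition mass_point :: "sgn_measure \<Rightarrow> real \<Rightarrow> bool" where
  "mass_point s x \<longleftrightarrow> emeasure (sm_var s) {x} \<noteq> 0"

definition class_M :: "real set \<Rightarrow> sgn_measure set" where
  "class_M \<Delta> = {s. sm_sign s \<in> {1, -1} \<and> sets (sm_var s) = sets borel \<and>
     infinite (sm_support s) \<and> sm_support s \<subseteq> \<Delta> \<and>
     (\<forall>\<nu>::nat. integrable (sm_var s) (\<lambda>x. x ^ \<nu>))}"

definition moment :: "sgn_measure \<Rightarrow> nat \<Rightarrow> real" where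
  "moment s \<nu> = sm_integral s (\<lambda>x. x ^ \<nu>)"

text \<open>Since \<open>0 powr a = 0\<close>, vanishing moments are left out of the series. Counting them as
  \<open>\<infinity>\<close> would make the condition hold as soon as a single moment vanishes, which a mere
  translation of the measure can achieve.\<close>

definition carleman :: "sgn_measure \<Rightarrow> bool" where
  "carleman s \<longleftrightarrow>
     \<not> summable (\<lambda>i. \<bar>moment s (Suc i)\<bar> powr (- 1 / (2 * real (Suc i))))"

text \<open>The Cauchy transform is used both at complex points and, as a density, at real points.\<close>

definition cauchy_transform :: "sgn_measure \<Rightarrow> 'a \<Rightarrow>
    'a::{real_normed_field, banach, second_countable_topology}" where
  "cauchy_transform s z = sm_integral s (\<lambda>x. 1 / (z - of_real x))"

text \<open>The product \<open>\<langle>\<alpha>, \<beta>\<rangle>\<close>, that is, the measure with density \<open>cauchy_transform \<beta>\<close> with respect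
  to \<open>\<alpha>\<close>. Its sign is the sign of its total mass. This represents the product correctly when the
  density is integrable and of constant sign, which is what \<open>sm_prod_defined\<close> says.\<close>

definition sm_prod :: "sgn_measure \<Rightarrow> sgn_measure \<Rightarrow> sgn_measure" where
  "sm_prod \<alpha> \<beta> = SgnMeasure
     (sgn (sm_integral \<alpha> (cauchy_transform \<beta> :: real \<Rightarrow> real)))
     (density (sm_var \<alpha>) (\<lambda>x. ennreal \<bar>cauchy_transform \<beta> x\<bar>))"

definition sm_prod_defined :: "sgn_measure \<Rightarrow> sgn_measure \<Rightarrow> bool" where
  "sm_prod_defined \<alpha> \<beta> \<longleftrightarrow>
     integrable (sm_var \<alpha>) (cauchy_transform \<beta> :: real \<Rightarrow> real) \<and>
     ((AE x in sm_var \<alpha>. cauchy_transform \<beta> x \<ge> 0) \<or>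
      (AE x in sm_var \<alpha>. cauchy_transform \<beta> x \<le> 0))"

text \<open>\<open>sm_bracket \<alpha> [\<beta>\<^sub>1, \<dots>, \<beta>\<^sub>r]\<close> is \<open>\<langle>\<alpha>, \<beta>\<^sub>1, \<dots>, \<beta>\<^sub>r\<rangle>\<close>.\<close>

fun sm_bracket :: "sgn_measure \<Rightarrow> sgn_measure list \<Rightarrow> sgn_measure" where
  "sm_bracket \<alpha> [] = \<alpha>"
| "sm_bracket \<alpha> (\<beta> # \<beta>s) = sm_prod \<alpha> (sm_bracket \<beta> \<beta>s)"

definition nik :: "(nat \<Rightarrow> sgn_measure) \<Rightarrow> nat \<Rightarrow> nat \<Rightarrow> sgn_measure" where
  "nik \<sigma> j k =
     (if j \<le> k then sm_bracket (\<sigma> j) (map \<sigma> [Suc j..<Suc k])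
      else sm_bracket (\<sigma> j) (map \<sigma> (rev [k..<j])))"

definition nikishin :: "nat \<Rightarrow> (nat \<Rightarrow> real set) \<Rightarrow> (nat \<Rightarrow> sgn_measure) \<Rightarrow> bool" where
  "nikishin m \<Delta> \<sigma> \<longleftrightarrow>
     (\<forall>j\<in>{1..m}. is_interval (\<Delta> j) \<and> \<sigma> j \<in> class_M (\<Delta> j) \<and>
        convex hull (sm_support (\<sigma> j)) = \<Delta> j) \<and>
     (\<forall>j\<in>{1..<m}. \<Delta> j \<inter> \<Delta> (j + 1) = {} \<or>
        (\<exists>x. \<Delta> j \<inter> \<Delta> (j + 1) = {x} \<and> \<not> mass_point (\<sigma> j) x \<and> \<not> mass_point (\<sigma> (j + 1)) x)) \<and>
     (\<forall>j k. 1 \<le> j \<and> j < k \<and> k \<le> m \<longrightarrow>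
        sm_prod_defined (\<sigma> j) (nik \<sigma> (j + 1) k) \<and> nik \<sigma> j k \<in> class_M (\<Delta> j) \<and>
        sm_prod_defined (\<sigma> k) (nik \<sigma> (k - 1) j) \<and> nik \<sigma> k j \<in> class_M (\<Delta> k))"

text \<open>\<open>f = O(1/z\<^sup>N)\<close> as \<open>z \<rightarrow> \<infinity>\<close> non-tangentially to \<open>\<Delta>\<close>. For an unbounded interval the regions
  below are complements of sectors around its directions; for a bounded one they contain, for
  \<open>\<delta> < 1\<close>, a full neighbourhood of \<open>\<infinity>\<close>, so that this is then the ordinary \<open>O\<close> at \<open>\<infinity>\<close>.\<close>

definition bigo_inf :: "real set \<Rightarrow> nat \<Rightarrow> (complex \<Rightarrow> complex) \<Rightarrow> bool" where
  "bigo_inf \<Delta> N f \<longleftrightarrow>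
     (\<forall>\<delta>>0. f \<in> O[inf at_infinity
        (principal {z. infdist z (complex_of_real ` \<Delta>) \<ge> \<delta> * norm z})](\<lambda>z. 1 / z ^ N))"

definition hp_form :: "nat \<Rightarrow> (nat \<Rightarrow> sgn_measure) \<Rightarrow> (nat \<Rightarrow> complex poly) \<Rightarrow> nat \<Rightarrow>
    complex \<Rightarrow> complex" where
  "hp_form m \<sigma> a j z = (-1) ^ j * poly (a j) z +
     (\<Sum>k=j+1..m. (-1) ^ k * poly (a k) z * cauchy_transform (nik \<sigma> (j + 1) k) z)"

definition hp_degrees :: "nat \<Rightarrow> nat \<Rightarrow> (nat \<Rightarrow> complex poly) \<Rightarrow> bool" where
  "hp_degrees m n a \<longleftrightarrow> (\<exists>j\<le>m. a j \<noteq> 0) \<and> (\<forall>j<m. degree (a j) \<le> n - 1) \<and> degree (a m) \<le> n"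

definition ml_hermite_pade :: "nat \<Rightarrow> (nat \<Rightarrow> real set) \<Rightarrow> (nat \<Rightarrow> sgn_measure) \<Rightarrow> nat \<Rightarrow>
    (nat \<Rightarrow> complex poly) \<Rightarrow> bool" where
  "ml_hermite_pade m \<Delta> \<sigma> n a \<longleftrightarrow> hp_degrees m n a \<and>
     bigo_inf (\<Delta> 1) (n + 1) (hp_form m \<sigma> a 0) \<and>
     (\<forall>j\<in>{1..<m}. bigo_inf (\<Delta> (j + 1)) 1 (hp_form m \<sigma> a j))"

definition dr_hermite_pade :: "nat \<Rightarrow> (nat \<Rightarrow> real set) \<Rightarrow> (nat \<Rightarrow> sgn_measure) \<Rightarrow> nat \<Rightarrow>
    (nat \<Rightarrow> complex poly) \<Rightarrow> bool" where
  "dr_hermite_pade m \<Delta> \<sigma> n a \<longleftrightarrow> hp_degrees m n a \<and>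
     bigo_inf (\<Delta> 1) (n + 1) (hp_form m \<sigma> a 0) \<and>
     (\<forall>j\<in>{1..<m}. bigo_inf (\<Delta> m) 1
        (\<lambda>z. poly (a j) z - poly (a m) z * cauchy_transform (nik \<sigma> m (j + 1)) z))"

end

theory Submission
  imports Defs "HOL-Complex_Analysis.Complex_Analysis"
    "HOL-Computational_Algebra.Fundamental_Theorem_Algebra"
begin

text \<open>
  The forms \<open>A\<^sub>j\<close> satisfy \<open>A\<^sub>j(z) = \<integral> A\<^sub>j\<^sub>+\<^sub>1(x) d\<sigma>\<^sub>j\<^sub>+\<^sub>1(x) / (z - x)\<close>, and \<open>A\<^sub>1\<close> is orthogonal to all polynomials of
  degree less than \<open>n\<close>. Hence \<open>A\<^sub>1\<close> has at least \<open>n\<close> sign changes on \<open>\<Delta>\<^sub>1\<close>; dividing by the polynomial of its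
  zeros gives orthogonality relations for \<open>A\<^sub>2\<close>, and so on up to \<open>A\<^sub>m = \<plusminus>a\<^sub>m\<close>, whose degree forces exactly
  \<open>n\<close> sign changes on every level. In the same way the transforms of \<open>A\<^sub>l\<close> against the reversed products
  \<open>s\<^sub>l\<^sub>,\<^sub>j\<^sub>+\<^sub>1\<close> alternate in sign at the zeros of \<open>A\<^sub>l\<^sub>-\<^sub>1\<close>, so that \<open>a\<^sub>m\<close> is orthogonal to the polynomials of degree
  less than \<open>n - 1\<close> with respect to \<open>s\<^sub>m\<^sub>,\<^sub>j\<^sub>+\<^sub>1\<close> divided by a polynomial with \<open>n - 1\<close> zeros on \<open>\<Delta>\<^sub>m\<^sub>-\<^sub>1\<close>. Therefore
  all residues of \<open>a\<^sub>j / a\<^sub>m\<close> have the same sign: \<open>a\<^sub>j / a\<^sub>m\<close> is the Cauchy transform of a positive (or negative)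
  quadrature of \<open>s\<^sub>m\<^sub>,\<^sub>j\<^sub>+\<^sub>1\<close>. These transforms form a normal family, so convergence need only be shown on
  some real interval off \<open>\<Delta>\<^sub>m\<close>. If \<open>\<Delta>\<^sub>m\<^sub>-\<^sub>1\<close> is bounded and disjoint from \<open>\<Delta>\<^sub>m\<close>, rational approximation of the
  Cauchy kernel converges geometrically in the gap between the two intervals; under Carleman's condition the Cauchy
  kernel is approximated by polynomials, with an error controlled by Christoffel functions. The limits of
  the linear forms follow from an algebraic identity between the transforms \<open>s\<^sub>j\<^sub>,\<^sub>k\<close> and \<open>s\<^sub>k\<^sub>,\<^sub>j\<close>.
\<close>

section \<open>Interpolation at real nodes and sign changes\<close>

text \<open>The quadrature has n nodes, and positivity of its weights means integrating squares of
  Lagrange polynomials, of degree 2n - 2, against \<open>nik \<sigma> m j\<close> divided by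
  \<open>nodal W\<close>. Orthogonality up to degree n - 2 covers this, so the order lost when n
  alternating signs yield only n - 1 zeros is harmless; nor does the loss accumulate, as every level
  starts again from all n zeros of \<open>A b l\<close>. Three obstacles shape the proof.
  Neighbouring intervals may touch, and densities may blow up there: zeros are sought on
  \<open>S l\<close>, without the common point, and integrability of products of densities is
  derived by Tonelli from constant signs. The moments of \<open>\<sigma> m\<close> are not those of
  \<open>nik \<sigma> m j\<close> about a point off \<open>\<Delta> m\<close>; as
  \<open>\<Delta> (m - 1)\<close> confines \<open>\<Delta> m\<close> to a half-line, the exponent
  1/(2\<nu>) on the \<nu>-th moment gives the Stieltjes form of Carleman's condition, which survives
  shift, reflection and the density. Finally the given polynomials are complex, and uniqueness shows
  that they are a constant times real ones.\<close>

definition nodal :: "real set \<Rightarrow> real poly" where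
  "nodal Z = (\<Prod>z\<in>Z. [:- z, 1:])"

definition lagr :: "real set \<Rightarrow> real \<Rightarrow> real poly" where
  "lagr Z z = smult (inverse (poly (nodal (Z - {z})) z)) (nodal (Z - {z}))"

lemma poly_nodal: "poly (nodal Z) x = (\<Prod>z\<in>Z. x - z)"
  by (simp add: nodal_def poly_prod)

lemma poly_nodal_eq_0_iff: "finite Z \<Longrightarrow> poly (nodal Z) x = 0 \<longleftrightarrow> x \<in> Z"
  by (auto simp: poly_nodal)

lemma nodal_nonzero: "nodal Z \<noteq> 0"
  unfolding nodal_def by (cases "finite Z") auto

text \<open>The equation survives infinite \<open>Z\<close>: the product is then 1 and
  \<open>card Z\<close> is 0.\<close>

lemma degree_nodal: "degree (nodal Z) = card Z"
  unfolding nodal_def by (subst degree_prod_eq_sum_degree) auto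

lemma nodal_insert: "finite Z \<Longrightarrow> z \<notin> Z \<Longrightarrow> nodal (insert z Z) = [:- z, 1:] * nodal Z"
  by (simp add: nodal_def)

lemma nodal_remove: "finite Z \<Longrightarrow> z \<in> Z \<Longrightarrow> nodal Z = [:- z, 1:] * nodal (Z - {z})"
  by (simp add: nodal_def prod.remove)

lemma nodal_dvd:
  assumes "finite Z" "\<And>z. z \<in> Z \<Longrightarrow> poly p z = 0"
  shows "nodal Z dvd p"
  using assms
proof (induction Z arbitrary: p rule: finite_induct)
  case empty
  then show ?case by (simp add: nodal_def)
next
  case (insert z Z)
  then obtain q where q: "p = [:- z, 1:] * q"
    by (metis insertI1 poly_eq_0_iff_dvd dvdE)
  have "poly q y = 0" if "y \<in> Z" for y
    using insert.prems[of y] insert.hyps(2) that unfolding q by auto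
  then have "nodal Z dvd q" by (rule insert.IH)
  then show ?case
    unfolding nodal_insert[OF insert.hyps] q by (rule mult_dvd_mono[OF dvd_refl])
qed

lemma degree_lagr: "finite Z \<Longrightarrow> z \<in> Z \<Longrightarrow> degree (lagr Z z) < card Z"
  unfolding lagr_def using degree_smult_le[of _ "nodal (Z - {z})"]
  by (metis card_Diff1_less degree_nodal le_less_trans)

lemma poly_lagr:
  assumes "finite Z" "z \<in> Z" "y \<in> Z"
  shows "poly (lagr Z z) y = (if y = z then 1 else 0)"
  using assms by (auto simp: lagr_def poly_nodal_eq_0_iff field_simps)

lemma lagrange_interpolation:
  assumes "finite Z" "degree p < card Z"
  shows "p = (\<Sum>z\<in>Z. smult (poly p z) (lagr Z z))"
proof (rule poly_eqI_degree[of Z])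
  fix y assume y: "y \<in> Z"
  have "(\<Sum>z\<in>Z. poly p z * poly (lagr Z z) y) = (\<Sum>z\<in>Z. if z = y then poly p z else 0)"
    by (rule sum.cong) (auto simp: poly_lagr assms y)
  then show "poly p y = poly (\<Sum>z\<in>Z. smult (poly p z) (lagr Z z)) y"
    using assms y by (simp add: poly_sum)
next
  have "card Z > 0" using assms by linarith
  then show "degree (\<Sum>z\<in>Z. smult (poly p z) (lagr Z z)) < card Z"
    by (intro degree_sum_less) (use assms degree_lagr degree_smult_le le_less_trans in blast)+
qed (use assms in auto)

text \<open>Induction on the number of zeros, splitting at the largest one. To its right
  \<open>f\<close> has constant sign and \<open>nodal Z\<close> is nonnegative, so that zero joins
  \<open>Z\<close> exactly when the sign disagrees with the pattern found on the left.
  \<open>Z\<close> thus consists of the sign changes only.\<close>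

lemma sign_pattern:
  fixes f :: "real \<Rightarrow> real"
  assumes "is_interval S" "continuous_on S f" "finite {x \<in> S. f x = 0}"
  shows "\<exists>Z \<subseteq> {x \<in> S. f x = 0}. \<exists>e \<in> {1, -1}. \<forall>x\<in>S. e * f x * poly (nodal Z) x \<ge> 0"
  using assms
proof (induction "card {x \<in> S. f x = 0}" arbitrary: S)
  case 0
  then have nz: "f x \<noteq> 0" if "x \<in> S" for x using that by auto
  have "connected S" using 0 by (simp add: is_interval_connected)
  then have "connected (f ` S)" using 0 connected_continuous_image by blast
  then have iv: "is_interval (f ` S)" by (simp add: is_interval_connected_1)
  have "(\<forall>x\<in>S. f x \<ge> 0) \<or> (\<forall>x\<in>S. f x \<le> 0)"
  proof (rule ccontr)
    assume "\<not> ?thesis"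
    then obtain x y where "x \<in> S" "f x < 0" "y \<in> S" "f y > 0" by force
    then have "0 \<in> f ` S" using iv unfolding is_interval_1 by (meson imageI less_imp_le)
    then show False using nz by auto
  qed
  then show ?case
    by (intro exI[of _ "{}"]) (auto simp: nodal_def)
next
  case (Suc n)
  let ?Z = "{x \<in> S. f x = 0}"
  have ne: "?Z \<noteq> {}" using Suc(2) by (metis card.empty nat.distinct(1))
  define z where "z = Max ?Z"
  have z: "z \<in> ?Z" "\<And>x. x \<in> ?Z \<Longrightarrow> x \<le> z"
    using Max_in[OF Suc(5) ne] Max_ge[OF Suc(5)] unfolding z_def by auto
  let ?L = "S \<inter> {..<z}" and ?R = "S \<inter> {z<..}"
  have LZ: "{x \<in> ?L. f x = 0} = ?Z - {z}" using z by force
  have "n = card {x \<in> ?L. f x = 0}" unfolding LZ using Suc(2,5) z(1) by simp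
  moreover have "is_interval ?L" "is_interval ?R"
    using Suc(3) unfolding is_interval_1 by auto
  moreover have "finite {x \<in> ?L. f x = 0}" unfolding LZ using Suc(5) by auto
  moreover have "continuous_on ?L f" "continuous_on ?R f" using Suc(4) continuous_on_subset by blast+
  ultimately obtain Z e where Z: "Z \<subseteq> {x \<in> ?L. f x = 0}" "e \<in> {1, -1}"
      "\<And>x. x \<in> ?L \<Longrightarrow> e * f x * poly (nodal Z) x \<ge> 0"
    using Suc(1)[of ?L] by blast
  have finZ: "finite Z" using Z(1) \<open>finite {x \<in> ?L. f x = 0}\<close> finite_subset by blast
  have Rnz: "f x \<noteq> 0" if "x \<in> ?R" for x using z(2)[of x] that by auto
  have "connected ?R" using \<open>is_interval ?R\<close> is_interval_connected by blast
  then have "connected (f ` ?R)" using \<open>continuous_on ?R f\<close> connected_continuous_image by blast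
  then have iv: "is_interval (f ` ?R)" by (simp add: is_interval_connected_1)
  have R: "(\<forall>x\<in>?R. f x \<ge> 0) \<or> (\<forall>x\<in>?R. f x \<le> 0)"
  proof (rule ccontr)
    assume "\<not> ?thesis"
    then obtain x y where "x \<in> ?R" "f x < 0" "y \<in> ?R" "f y > 0" by force
    then have "0 \<in> f ` ?R" using iv unfolding is_interval_1 by (meson imageI less_imp_le)
    then show False using Rnz by auto
  qed
  have posR: "poly (nodal Z) x \<ge> 0" if "x \<in> ?R" for x
    unfolding poly_nodal by (rule prod_nonneg) (use Z(1) that in force)
  have zZ: "z \<notin> Z" using Z(1) by auto
  have ins: "poly (nodal (insert z Z)) x = (x - z) * poly (nodal Z) x" for x
    by (simp add: nodal_insert[OF finZ zZ] algebra_simps)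
  show ?case
  proof (cases "\<forall>x\<in>?R. e * f x \<ge> 0")
    case True
    have "e * f x * poly (nodal Z) x \<ge> 0" if "x \<in> S" for x
    proof -
      consider "x < z" | "x = z" | "x > z" by linarith
      then show ?thesis
        by cases (use Z(3)[of x] z(1) True posR that in auto)
    qed
    then show ?thesis using Z by blast
  next
    case False
    then have neg: "\<forall>x\<in>?R. - e * f x \<ge> 0" using R Z(2) by auto
    have "- e * f x * poly (nodal (insert z Z)) x \<ge> 0" if "x \<in> S" for x
    proof -
      consider "x < z" | "x = z" | "x > z" by linarith
      then show ?thesis
      proof cases
        case 1
        then have "(z - x) * (e * f x * poly (nodal Z) x) \<ge> 0"
          using Z(3)[of x] that by simp
        then show ?thesis unfolding ins by (simp add: algebra_simps)
      next
        case 2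
        then show ?thesis using z(1) by simp
      next
        case 3
        then have "x \<in> ?R" using that by simp
        then have "(- e * f x) * poly (nodal Z) x \<ge> 0"
          using neg posR[of x] mult_nonneg_nonneg by blast
        then have "(x - z) * ((- e * f x) * poly (nodal Z) x) \<ge> 0"
          using 3 by (metis diff_ge_0_iff_ge less_imp_le mult_nonneg_nonneg)
        then show ?thesis unfolding ins by (simp add: algebra_simps)
      qed
    qed
    moreover have "insert z Z \<subseteq> ?Z" using Z(1) z(1) by auto
    moreover have "- e \<in> {1, -1}" using Z(2) by auto
    ultimately show ?thesis by blast
  qed
qed

text \<open>Carleman's inequality by Polya's argument. The weights \<open>c i\<close> multiply up to
  a (k+1)-st power of k + 2, so the arithmetic-geometric mean inequality bounds each geometric mean
  by partial sums that telescope, and what remains of \<open>c i\<close> is (1 + 1/(i+1))^(i+1), at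
  most e.\<close>

lemma summable_geometric_means:
  fixes a :: "nat \<Rightarrow> real"
  assumes pos: "\<And>k. a k > 0" and "summable a"
  shows "summable (\<lambda>k. (\<Prod>i\<le>k. a i) powr (1 / real (Suc k)))"
proof (rule summableI_nonneg_bounded)
  define c :: "nat \<Rightarrow> real" where "c i = real (i + 2) ^ (i + 1) / real (i + 1) ^ i" for i
  have cpos: "c i > 0" for i by (simp add: c_def)
  have cprod: "(\<Prod>i\<le>k. c i) = real (k + 2) ^ (k + 1)" for k
  proof (induction k)
    case (Suc k)
    have "c (Suc k) * real (k + 2) ^ (k + 1) = real (Suc k + 2) ^ (Suc k + 1)"
      by (simp add: c_def)
    then show ?case using Suc by (simp add: mult.commute)
  qed (simp add: c_def)
  have cle: "c i / real (i + 1) \<le> exp 1" for i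
  proof -
    have "c i / real (i + 1) = (1 + 1 / real (i + 1)) ^ (i + 1)"
      by (simp add: c_def field_simps power_divide)
    also have "\<dots> \<le> exp (1 / real (i + 1)) ^ (i + 1)"
      by (intro power_mono exp_ge_add_one_self) auto
    also have "\<dots> = exp 1"
      by (subst exp_of_nat_mult[symmetric]) (simp add: field_simps)
    finally show ?thesis .
  qed
  fix n :: nat
  have gm_le: "(\<Prod>i\<le>k. a i) powr (1 / real (Suc k)) \<le> (\<Sum>i\<le>k. a i * c i) * (1 / real (k + 1) - 1 / real (k + 2))" for k
  proof -
    have "(\<Prod>i\<le>k. a i * c i) powr (1 / real (card {..k})) \<le> (\<Sum>i\<le>k. a i * c i / real (card {..k}))"
      by (rule arith_geom_mean) (auto simp: less_imp_le pos cpos)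
    moreover have "(\<Prod>i\<le>k. a i * c i) powr (1 / real (Suc k))
        = (\<Prod>i\<le>k. a i) powr (1 / real (Suc k)) * real (k + 2)"
    proof -
      have "(\<Prod>i\<le>k. a i) > 0" by (intro prod_pos) (use pos in auto)
      moreover have "(real (k + 2) ^ (k + 1)) powr (1 / real (Suc k)) = real (k + 2)"
        by (subst powr_realpow[symmetric]) (auto simp: powr_powr)
      ultimately show ?thesis by (simp add: prod.distrib cprod powr_mult del: of_nat_Suc power_Suc)
    qed
    ultimately have "(\<Prod>i\<le>k. a i) powr (1 / real (Suc k)) * real (k + 2) \<le> (\<Sum>i\<le>k. a i * c i) / real (k + 1)"
      by (simp add: sum_divide_distrib)
    then have "(\<Prod>i\<le>k. a i) powr (1 / real (Suc k)) \<le> (\<Sum>i\<le>k. a i * c i) / real (k + 1) / real (k + 2)"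
      by (subst pos_le_divide_eq) auto
    also have "\<dots> = (\<Sum>i\<le>k. a i * c i) * (1 / real (k + 1) - 1 / real (k + 2))"
      by (simp add: field_simps)
    finally show ?thesis .
  qed
  \<comment> \<open>Interchange of summation: the factors belonging to a fixed i add up to 1/(i+1) -
    1/(n+1).\<close>
  have tele: "(\<Sum>k<n. (\<Sum>i\<le>k. g i) * (1 / real (k + 1) - 1 / real (k + 2)))
      = (\<Sum>i<n. g i / real (i + 1)) - (\<Sum>i<n. g i) / real (n + 1)" for g :: "nat \<Rightarrow> real"
  proof (induction n)
    case (Suc n)
    have "(\<Sum>i\<le>n. g i) = (\<Sum>i<n. g i) + g n" by (simp add: lessThan_Suc_atMost[symmetric])
    then have "(\<Sum>k<Suc n. (\<Sum>i\<le>k. g i) * (1 / real (k + 1) - 1 / real (k + 2)))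
        = (\<Sum>i<n. g i / real (i + 1)) - (\<Sum>i<n. g i) / real (n + 1)
          + ((\<Sum>i<n. g i) + g n) * (1 / real (n + 1) - 1 / real (n + 2))"
      using Suc by simp
    also have "\<dots> = (\<Sum>i<Suc n. g i / real (i + 1)) - (\<Sum>i<Suc n. g i) / real (Suc n + 1)"
      by (simp add: divide_inverse algebra_simps)
    finally show ?case .
  qed simp
  have "(\<Sum>k<n. (\<Prod>i\<le>k. a i) powr (1 / real (Suc k)))
      \<le> (\<Sum>k<n. (\<Sum>i\<le>k. a i * c i) * (1 / real (k + 1) - 1 / real (k + 2)))"
    by (intro sum_mono gm_le)
  also have "\<dots> \<le> (\<Sum>i<n. a i * c i / real (i + 1))"
    unfolding tele by (simp add: sum_nonneg pos cpos less_imp_le)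
  also have "\<dots> \<le> (\<Sum>i<n. a i * exp 1)"
  proof (rule sum_mono)
    fix i show "a i * c i / real (i + 1) \<le> a i * exp 1"
      using mult_left_mono[OF cle[of i] less_imp_le[OF pos[of i]]] by simp
  qed
  also have "\<dots> \<le> suminf a * exp 1"
    unfolding sum_distrib_right[symmetric]
    by (intro mult_right_mono sum_le_suminf assms) (auto simp: less_imp_le pos)
  finally show "(\<Sum>k<n. (\<Prod>i\<le>k. a i) powr (1 / real (Suc k))) \<le> suminf a * exp 1" .
qed simp

section \<open>Orthogonal polynomials under Carleman's condition\<close>

text \<open>Abstracts integration against a measure with infinite support in the half-line u >= 0.
  The half-line enters through \<open>L_pos'\<close>, and the values on monomials form a Stieltjes
  moment sequence.\<close>

locale stieltjes_functional =
  fixes L :: "real poly \<Rightarrow> real"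
  assumes L_add: "L (p + q) = L p + L q"
    and L_smult: "L (smult c p) = c * L p"
    and L_pos: "p \<noteq> 0 \<Longrightarrow> L (p * p) > 0"
    and L_pos': "p \<noteq> 0 \<Longrightarrow> L ([:0, 1:] * p * p) > 0"
begin

lemma L_0 [simp]: "L 0 = 0"
  using L_smult[of 0 0] by simp

lemma L_sum: "L (\<Sum>i\<in>I. f i) = (\<Sum>i\<in>I. L (f i))"
  by (induction I rule: infinite_finite_induct) (auto simp: L_add)

lemma L_diff: "L (p - q) = L p - L q"
  using L_add[of p "smult (-1) q"] L_smult[of "-1" q] by simp

text \<open>With \<open>u = t\<^sup>2\<close>, the polynomials \<open>G (2 * k)\<close> in \<open>t\<^sup>2\<close> and \<open>t * G (2 * k + 1)\<close> are the monic orthogonal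
  polynomials of the symmetric functional in \<open>t\<close> induced by \<open>L\<close>; \<open>ev k\<close> is the resulting weight.\<close>

definition ev :: "nat \<Rightarrow> real poly" where
  "ev k = (if even k then 1 else [:0, 1:])"

definition B :: "nat \<Rightarrow> real poly \<Rightarrow> real poly \<Rightarrow> real" where
  "B k p q = L (ev k * p * q)"

fun G :: "nat \<Rightarrow> real poly" where
  "G 0 = 1"
| "G (Suc 0) = 1"
| "G (Suc (Suc k)) = ev (Suc k) * G (Suc k)
     - smult (B (Suc k) (G (Suc k)) (G (Suc k)) / B k (G k) (G k)) (G k)"

definition h :: "nat \<Rightarrow> real" where
  "h k = B k (G k) (G k)"

text \<open>Coefficients of the three-term recurrence in t. The value 0 at index 0 makes
  \<open>L_shift\<close> valid for k = 0, where \<open>k - 1\<close> is 0 again.\<close>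

definition \<beta> :: "nat \<Rightarrow> real" where
  "\<beta> k = (if k = 0 then 0 else h k / h (k - 1))"

text \<open>Up to the unit i^k this is the value at t = i, that is at u = -1, of the monic
  orthogonal polynomial P_k in t. With the unit removed, the recurrence has only positive
  coefficients.\<close>

definition \<pi> :: "nat \<Rightarrow> real" where
  "\<pi> k = (-1) ^ (k div 2) * poly (G k) (-1)"

lemma B_pos: "p \<noteq> 0 \<Longrightarrow> B k p p > 0"
  using L_pos[of p] L_pos'[of p] by (auto simp: B_def ev_def)

lemma G_rec: "G (Suc (Suc k)) = ev (Suc k) * G (Suc k) - smult (\<beta> (Suc k)) (G k)"
  by (simp add: \<beta>_def h_def)

lemma \<pi>_rec: "\<pi> (Suc (Suc k)) = \<pi> (Suc k) + \<beta> (Suc k) * \<pi> k"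
proof (cases "even k")
  case True
  then have "Suc k div 2 = k div 2" by simp
  then show ?thesis using True by (simp add: \<pi>_def G_rec ev_def algebra_simps del: G.simps)
next
  case False
  then have "Suc k div 2 = Suc (k div 2)" by simp
  then show ?thesis using False by (simp add: \<pi>_def G_rec ev_def algebra_simps del: G.simps)
qed

text \<open>The two claims feed each other: \<open>\<pi> k > 0\<close> follows from the recurrence
  once earlier norms are positive, and it shows that \<open>G k\<close> is not the zero polynomial,
  which makes \<open>h k\<close> positive.\<close>

lemma \<pi>_pos_h_pos: "\<pi> k > 0 \<and> h k > 0"
proof (induction k rule: less_induct)
  case (less k)
  have "\<pi> k > 0"
  proof (cases k rule: G.cases)
    case (3 i)
    then have "h i > 0" "h (Suc i) > 0" "\<pi> i > 0" "\<pi> (Suc i) > 0" using less by auto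
    then show ?thesis unfolding 3 \<pi>_rec \<beta>_def by (auto intro!: add_pos_pos mult_pos_pos divide_pos_pos)
  qed (auto simp: \<pi>_def)
  moreover from this have "G k \<noteq> 0" by (auto simp: \<pi>_def)
  ultimately show ?case unfolding h_def using B_pos by simp
qed

lemmas \<pi>_pos = \<pi>_pos_h_pos[THEN conjunct1] and h_pos = \<pi>_pos_h_pos[THEN conjunct2]

lemma \<beta>_h: "\<beta> (Suc k) * h k = h (Suc k)"
  using h_pos[of k] by (simp add: \<beta>_def)

text \<open>The relation t P_k = P_{k+1} + \<beta>_k P_{k-1}, written in u for both parities at
  once.\<close>

lemma L_shift: "L ([:0, 1:] * G k * q) = B (Suc k) (G (Suc k)) q + \<beta> k * B (k - 1) (G (k - 1)) q"
proof (cases k)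
  case 0
  then show ?thesis by (simp add: B_def ev_def \<beta>_def)
next
  case (Suc i)
  have "[:0, 1:] * G k * q = ev (Suc k) * G (Suc k) * q + smult (\<beta> k) (ev i * G i * q)"
    unfolding Suc G_rec by (auto simp: ev_def algebra_simps smult_diff_right)
  then show ?thesis using Suc by (simp add: L_add L_smult B_def)
qed

lemma B_commute: "B k p q = B k q p"
  by (simp add: B_def ac_simps)

text \<open>Only equal parities need an argument; opposite ones are orthogonal by symmetry in t. The
  recurrence for \<open>G j\<close> moves a factor t onto \<open>G i\<close>, where
  \<open>L_shift\<close> applies. The two surviving terms both vanish, or for i = j - 2 cancel
  because \<open>\<beta>\<close> is a quotient of consecutive norms.\<close>

lemma G_orth: "i < j \<Longrightarrow> even i \<longleftrightarrow> even j \<Longrightarrow> B i (G i) (G j) = 0"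
proof (induction j arbitrary: i rule: less_induct)
  case (less j)
  obtain k where j: "j = Suc (Suc k)"
    using less.prems by (cases j rule: G.cases) auto
  have evs: "ev i * ev (Suc k) = [:0, 1:]" using less.prems unfolding j by (auto simp: ev_def)
  have "B i (G i) (G j) = L (ev i * ev (Suc k) * G i * G (Suc k) - smult (\<beta> (Suc k)) (ev i * G i * G k))"
    unfolding j G_rec B_def by (simp add: algebra_simps)
  also have "\<dots> = L ([:0, 1:] * G i * G (Suc k)) - \<beta> (Suc k) * B i (G i) (G k)"
    unfolding evs L_diff L_smult B_def ..
  also have "\<dots> = B (Suc i) (G (Suc i)) (G (Suc k)) + \<beta> i * B (i - 1) (G (i - 1)) (G (Suc k))
      - \<beta> (Suc k) * B i (G i) (G k)"
    unfolding L_shift ..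
  also have "\<beta> i * B (i - 1) (G (i - 1)) (G (Suc k)) = 0"
  proof (cases i)
    case (Suc i')
    then show ?thesis using less.IH[of "Suc k" i'] less.prems unfolding j by auto
  qed (simp add: \<beta>_def)
  also have "B (Suc i) (G (Suc i)) (G (Suc k)) = \<beta> (Suc k) * B i (G i) (G k)"
  proof (cases "i = k")
    case True
    then show ?thesis using \<beta>_h[of k] by (simp add: h_def)
  next
    case False
    with less.prems have "i < k" unfolding j by (auto elim: less_SucE)
    then show ?thesis using less.IH[of "Suc k" "Suc i"] less.IH[of k i] less.prems unfolding j by auto
  qed
  finally show ?case by simp
qed

text \<open>In t this pairs P_k with t^i. Raising i by one moves one factor t across, which
  \<open>L_shift\<close> expresses through the neighbours of k.\<close>

lemma B_G_monom:
  "i \<le> k \<Longrightarrow> even i \<longleftrightarrow> even k \<Longrightarrow> B k (G k) (monom 1 (i div 2)) = (if i = k then h k else 0)"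
proof (induction i arbitrary: k)
  case 0
  have 1: "monom 1 0 = (1 :: real poly)" by (simp add: one_pCons monom_0)
  show ?case
  proof (cases "k = 0")
    case True
    then show ?thesis by (simp add: h_def 1)
  next
    case False
    have "B 0 (G 0) (G k) = B k (G k) 1" using 0 by (simp add: B_def ev_def)
    then show ?thesis using G_orth[of 0 k] 0 False by (simp add: 1)
  qed
next
  case (Suc i)
  then obtain k' where k': "k = Suc k'" by (cases k) auto
  have "ev k * monom 1 (Suc i div 2) = [:0, 1:] * monom 1 (i div 2)"
    using Suc.prems by (auto simp: ev_def monom_altdef)
  from arg_cong[OF this, of "\<lambda>p. p * G k"]
  have "ev k * G k * monom 1 (Suc i div 2) = [:0, 1:] * G k * monom 1 (i div 2)"
    by (simp only: mult_ac)
  then have "B k (G k) (monom 1 (Suc i div 2)) = L ([:0, 1:] * G k * monom 1 (i div 2))"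
    unfolding B_def by (rule arg_cong)
  also have "\<dots> = B (Suc k) (G (Suc k)) (monom 1 (i div 2)) + \<beta> k * B k' (G k') (monom 1 (i div 2))"
    unfolding L_shift k' by simp
  also have "\<dots> = (if Suc i = k then h k else 0)"
    using Suc.IH[of "Suc k"] Suc.IH[of k'] Suc.prems \<beta>_h[of k'] unfolding k' by auto
  finally show ?case .
qed

text \<open>Among monic polynomials in t of degree k the orthogonal one has least norm, and the
  squared norm of t^k is the k-th moment of \<open>L\<close>.\<close>

lemma h_le_moment: "h k \<le> L (monom 1 k)"
proof -
  let ?q = "monom 1 (k div 2) :: real poly"
  have "0 \<le> B k (G k - ?q) (G k - ?q)"
    using B_pos[of "G k - ?q" k] by (cases "G k - ?q = 0") (auto simp: B_def)
  have "ev k * (G k - ?q) * (G k - ?q)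
      = (ev k * G k * G k - ev k * G k * ?q) - (ev k * ?q * G k - ev k * ?q * ?q)"
    by (simp add: algebra_simps)
  then have "B k (G k - ?q) (G k - ?q) = h k - 2 * B k (G k) ?q + B k ?q ?q"
    unfolding h_def using B_commute[of k ?q "G k"] by (simp only: B_def L_diff)
  also have "B k (G k) ?q = h k" using B_G_monom[of k k] by simp
  also have "ev k * ?q * ?q = monom 1 k"
    by (cases "even k") (auto simp: ev_def monom_altdef mult_2 simp flip: power_add power_Suc elim!: evenE oddE)
  then have "B k ?q ?q = L (monom 1 k)" by (simp add: B_def)
  finally show ?thesis using \<open>0 \<le> B k (G k - ?q) (G k - ?q)\<close> by simp
qed

text \<open>\<open>F\<close> is the reproducing kernel at u = -1 built from indices of a single
  parity, so that one weight \<open>ev d\<close> fits all summands. Divided by its own value there,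
  it has squared norm equal to the reciprocal of that value, a Christoffel function.\<close>

lemma kernel_poly:
  assumes "finite E" "E \<noteq> {}" "\<And>k. k \<in> E \<Longrightarrow> even k \<longleftrightarrow> even d"
  shows "\<exists>S. poly S (-1) = 1 \<and> B d S S = 1 / (\<Sum>k\<in>E. (\<pi> k)\<^sup>2 / h k)"
proof -
  define T where "T = (\<Sum>k\<in>E. (\<pi> k)\<^sup>2 / h k)"
  have T: "T > 0"
    unfolding T_def using assms(1,2) \<pi>_pos h_pos by (intro sum_pos) (auto simp: less_imp_neq[symmetric])
  define c where "c k = poly (G k) (-1) / h k" for k
  define F where "F = (\<Sum>k\<in>E. smult (c k) (G k))"
  have sq: "(poly (G k) (-1))\<^sup>2 = (\<pi> k)\<^sup>2" for k by (simp add: \<pi>_def power_mult_distrib flip: power_mult)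
  have F1: "poly F (-1) = T"
    unfolding F_def T_def c_def poly_sum sq[symmetric] by (simp add: power2_eq_square)
  have ortho: "B d (G i) (G k) = (if i = k then h k else 0)" if "i \<in> E" "k \<in> E" for i k
  proof -
    have "ev d = ev i" "ev d = ev k" "even i \<longleftrightarrow> even k" using assms(3) that by (auto simp: ev_def)
    then have "B d = B i" "B d = B k" by (simp_all add: B_def fun_eq_iff)
    then show ?thesis
      using G_orth[of i k] G_orth[of k i] B_commute[of d "G i" "G k"] \<open>even i \<longleftrightarrow> even k\<close>
      by (cases i k rule: linorder_cases) (simp_all add: h_def)
  qed
  have "B d F F = (\<Sum>i\<in>E. \<Sum>k\<in>E. c i * c k * B d (G i) (G k))"
  proof -
    have "ev d * F * F = (\<Sum>i\<in>E. \<Sum>k\<in>E. smult (c i * c k) (ev d * G i * G k))"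
    proof -
      have "F * F = (\<Sum>i\<in>E. \<Sum>k\<in>E. smult (c i) (G i) * smult (c k) (G k))"
        unfolding F_def by (rule sum_product)
      then show ?thesis
        unfolding mult.assoc by (simp add: sum_distrib_left mult.commute[of "c _" "c _"])
    qed
    then show ?thesis unfolding B_def by (simp add: L_sum L_smult)
  qed
  also have "\<dots> = (\<Sum>i\<in>E. \<Sum>k\<in>E. if k = i then c i * c i * h i else 0)"
    by (intro sum.cong refl) (auto simp: ortho)
  also have "\<dots> = T"
    unfolding T_def using assms(1) h_pos
    by (simp add: sum.delta c_def power2_eq_square less_imp_neq[symmetric] sq[unfolded power2_eq_square])
  finally have "B d F F = T" .
  then have "B d (smult (1 / T) F) (smult (1 / T) F) = 1 / T"
    using T by (simp add: B_def L_smult)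
  moreover have "poly (smult (1 / T) F) (-1) = 1" using T F1 by simp
  ultimately show ?thesis unfolding T_def by blast
qed

text \<open>The Christoffel-Darboux formula at the pair t = i, t = -i.\<close>

lemma \<pi>_product: "\<pi> (Suc k) * \<pi> k / h k = (\<Sum>i\<le>k. (\<pi> i)\<^sup>2 / h i)"
proof (induction k)
  case 0
  then show ?case by (simp add: \<pi>_def power2_eq_square)
next
  case (Suc k)
  have "\<pi> (Suc (Suc k)) * \<pi> (Suc k) / h (Suc k)
      = (\<pi> (Suc k))\<^sup>2 / h (Suc k) + \<pi> (Suc k) * \<pi> k / h k"
    unfolding \<pi>_rec \<beta>_def using h_pos[of k] h_pos[of "Suc k"] by (simp add: field_simps power2_eq_square)
  then show ?case using Suc by simp
qed

text \<open>By \<open>\<pi>_product\<close> the product of neighbouring terms is bounded below, so a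
  convergent kernel would make the numbers \<open>a k\<close>, the reciprocal square roots of the
  recurrence coefficients, summable. Carleman's inequality then bounds the roots of
  \<open>h\<close>, and by \<open>h_le_moment\<close> those of the moments, contradicting the
  divergence.\<close>

lemma carleman_kernel_unbounded:
  assumes "\<not> summable (\<lambda>k. L (monom 1 (Suc k)) powr (- 1 / (2 * real (Suc k))))"
  shows "\<not> summable (\<lambda>k. (\<pi> k)\<^sup>2 / h k)"
proof
  let ?t = "\<lambda>k. (\<pi> k)\<^sup>2 / h k"
  assume sm: "summable ?t"
  define a where "a k = sqrt (h k / h (Suc k))" for k
  have apos: "a k > 0" for k using h_pos by (simp add: a_def)
  have t0: "?t k \<ge> 0" for k using h_pos[of k] by simp
  have le: "norm (a k) \<le> h 0 * ((?t k + ?t (Suc k)) / 2)" for k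
  proof -
    \<comment> \<open>The left side is the term of index 0.\<close>
    have "1 / h 0 \<le> (\<Sum>i\<le>k. ?t i)"
      using sum_mono2[of "{..k}" "{0}" ?t] t0 by (auto simp: \<pi>_def)
    also have "\<dots> = \<pi> (Suc k) * \<pi> k / h k" by (rule \<pi>_product[symmetric])
    finally have "1 \<le> h 0 * (\<pi> (Suc k) * \<pi> k / h k)"
      using h_pos[of 0] by (simp add: pos_divide_le_eq mult.commute)
    from mult_left_mono[OF this less_imp_le[OF apos[of k]]]
    have "a k \<le> h 0 * (a k * (\<pi> (Suc k) * \<pi> k / h k))" by (simp only: mult_ac mult_1_right)
    also have "a k * (\<pi> (Suc k) * \<pi> k / h k) = (\<pi> k / sqrt (h k)) * (\<pi> (Suc k) / sqrt (h (Suc k)))"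
    proof -
      have "sqrt (h k) * sqrt (h k) = h k" using h_pos[of k] by simp
      then show ?thesis using h_pos[of k] h_pos[of "Suc k"]
        unfolding a_def real_sqrt_divide
        by (simp add: field_simps)
    qed
    also have "\<dots> \<le> ((\<pi> k / sqrt (h k))\<^sup>2 + (\<pi> (Suc k) / sqrt (h (Suc k)))\<^sup>2) / 2"
      using sum_squares_bound[of "\<pi> k / sqrt (h k)" "\<pi> (Suc k) / sqrt (h (Suc k))"] by (simp add: mult_ac)
    also have "\<dots> = (?t k + ?t (Suc k)) / 2"
      using h_pos[of k] h_pos[of "Suc k"] by (simp add: power_divide)
    finally show ?thesis using apos[of k] h_pos[of 0] by simp
  qed
  have "summable a"
    by (rule summable_comparison_test'[where N = 0, OF _ le])
       (intro summable_mult summable_divide summable_add sm summable_Suc_iff[THEN iffD2])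
  then have "summable (\<lambda>k. (\<Prod>i\<le>k. a i) powr (1 / real (Suc k)))"
    by (intro summable_geometric_means apos)
  moreover have prod: "(\<Prod>i\<le>k. a i) = sqrt (h 0 / h (Suc k))" for k
  proof (induction k)
    case (Suc k)
    then show ?case using h_pos[of "Suc k"] by (simp add: a_def flip: real_sqrt_mult)
  qed (simp add: a_def)
  \<comment> \<open>Absorbs the power of 1 / \<open>h 0\<close>, whose exponent lies between 0 and
    1.\<close>
  define C where "C = max 1 (1 / h 0)"
  have "summable (\<lambda>k. C * (\<Prod>i\<le>k. a i) powr (1 / real (Suc k)))"
    by (intro summable_mult calculation)
  note big = this
  have small: "norm (L (monom 1 (Suc k)) powr (- 1 / (2 * real (Suc k))))
      \<le> C * (\<Prod>i\<le>k. a i) powr (1 / real (Suc k))" for k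
  proof -
    have e: "(\<Prod>i\<le>k. a i) powr (1 / real (Suc k)) = (h 0 / h (Suc k)) powr (1 / (2 * real (Suc k)))"
      unfolding prod using h_pos[of 0] h_pos[of "Suc k"]
      by (subst powr_half_sqrt[symmetric]) (auto simp: powr_powr)
    have "L (monom 1 (Suc k)) powr (- 1 / (2 * real (Suc k))) \<le> h (Suc k) powr (- 1 / (2 * real (Suc k)))"
      by (rule powr_mono2') (use h_pos[of "Suc k"] h_le_moment[of "Suc k"] in auto)
    also have "\<dots> = (1 / h 0) powr (1 / (2 * real (Suc k))) * (h 0 / h (Suc k)) powr (1 / (2 * real (Suc k)))"
    proof -
      have "1 / h 0 * (h 0 / h (Suc k)) = 1 / h (Suc k)" using h_pos[of 0] by simp
      moreover have "h (Suc k) powr (- 1 / (2 * real (Suc k))) = (1 / h (Suc k)) powr (1 / (2 * real (Suc k)))"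
        using h_pos[of "Suc k"] by (simp add: powr_divide powr_minus_divide)
      ultimately show ?thesis
        using h_pos[of 0] h_pos[of "Suc k"] by (subst powr_mult[symmetric]) auto
    qed
    also have "\<dots> \<le> C * (h 0 / h (Suc k)) powr (1 / (2 * real (Suc k)))"
    proof (rule mult_right_mono)
      have "(1 / h 0) powr (1 / (2 * real (Suc k))) \<le> C powr (1 / (2 * real (Suc k)))"
        by (rule powr_mono2) (use h_pos[of 0] in \<open>auto simp: C_def\<close>)
      also have "\<dots> \<le> C powr 1" by (rule powr_mono) (auto simp: C_def)
      finally show "(1 / h 0) powr (1 / (2 * real (Suc k))) \<le> C" by (simp add: C_def)
    qed simp
    finally show ?thesis unfolding e by simp
  qed
  have "summable (\<lambda>k. L (monom 1 (Suc k)) powr (- 1 / (2 * real (Suc k))))"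
    by (rule summable_comparison_test'[where N = 0, OF big small])
  with assms show False by blast
qed

theorem carleman_small_polynomials:
  assumes "\<not> summable (\<lambda>k. L (monom 1 (Suc k)) powr (- 1 / (2 * real (Suc k))))" and "\<epsilon> > 0"
  shows "\<exists>S. poly S (-1) = 1 \<and> (L (S * S) < \<epsilon> \<or> L ([:0, 1:] * S * S) < \<epsilon>)"
proof -
  let ?t = "\<lambda>k. (\<pi> k)\<^sup>2 / h k"
  have t0: "?t k \<ge> 0" for k using h_pos[of k] by simp
  \<comment> \<open>Twice the required size, so that the even or the odd indices alone reach
    it.\<close>
  have "\<exists>n. (\<Sum>k<n. ?t k) > 2 * (1 + 1 / \<epsilon>)"
    using carleman_kernel_unbounded[OF assms(1)] summableI_nonneg_bounded[of ?t "2 * (1 + 1 / \<epsilon>)"] t0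
    by (meson not_le)
  then obtain n where n: "(\<Sum>k<n. ?t k) > 2 * (1 + 1 / \<epsilon>)" by blast
  let ?E = "\<lambda>d. {k \<in> {..<n}. even k \<longleftrightarrow> even (d::nat)}"
  have eq: "(\<Sum>k<n. ?t k) = sum ?t (?E 0) + sum ?t (?E 1)"
    by (subst sum.union_disjoint[symmetric]) (auto intro!: sum.cong)
  have "sum ?t (?E 0) > 1 + 1 / \<epsilon> \<or> sum ?t (?E 1) > 1 + 1 / \<epsilon>"
  proof (rule ccontr)
    assume "\<not> ?thesis"
    then have "sum ?t (?E 0) \<le> 1 + 1 / \<epsilon>" "sum ?t (?E 1) \<le> 1 + 1 / \<epsilon>"
      unfolding de_Morgan_disj not_less by (rule conjunct1, rule conjunct2)
    then show False using n eq by argo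
  qed
  then have "\<exists>d\<in>{0, 1}. sum ?t (?E d) > 1 + 1 / \<epsilon>"
    by (simp only: bex_simps simp_thms)
  then obtain d where d: "d \<in> {0, 1}" "sum ?t (?E d) > 1 + 1 / \<epsilon>"
    by (rule bexE)
  have "1 / \<epsilon> > 0" using assms(2) by simp
  then have "sum ?t (?E d) > 0" using d(2) by linarith
  then have ne: "?E d \<noteq> {}" by (metis less_irrefl sum.empty)
  obtain S where S: "poly S (-1) = 1" "B d S S = 1 / sum ?t (?E d)"
  proof -
    have "finite (?E d)" "\<And>k. k \<in> ?E d \<Longrightarrow> even k \<longleftrightarrow> even d" by simp_all
    from kernel_poly[OF this(1) ne this(2)] show ?thesis using that by blast
  qed
  have "1 / sum ?t (?E d) < 1 / (1 / \<epsilon>)"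
    using d(2) \<open>1 / \<epsilon> > 0\<close> \<open>sum ?t (?E d) > 0\<close>
    by (intro divide_strict_left_mono mult_pos_pos) linarith+
  then have "B d S S < \<epsilon>" unfolding S(2) by simp
  then show ?thesis using S(1) d(1) by (auto simp: B_def ev_def)
qed

end

section \<open>Measures of constant sign and Cauchy transforms\<close>

text \<open>The complement is a union of open null sets, and by Lindelof countably many of them
  suffice.\<close>

lemma borel_null_complement_support:
  assumes "sets M = sets (borel :: real measure)"
  shows "- {x. \<forall>U. open U \<and> x \<in> U \<longrightarrow> emeasure M U \<noteq> 0} \<in> null_sets M"
    and "closed {x. \<forall>U. open U \<and> x \<in> U \<longrightarrow> emeasure M U \<noteq> 0}"
proof -
  let ?F = "{U. open U \<and> emeasure M U = 0}"
  have eq: "- {x. \<forall>U. open U \<and> x \<in> U \<longrightarrow> emeasure M U \<noteq> 0} = \<Union>?F" by auto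
  obtain F' where F': "F' \<subseteq> ?F" "countable F'" "\<Union>F' = \<Union>?F"
    using Lindelof[of ?F] by auto
  have "\<Union>F' \<in> null_sets M"
    using F' assms by (intro null_sets_UN'[of F' "\<lambda>x. x", simplified]) (auto simp: null_sets_def)
  then show "- {x. \<forall>U. open U \<and> x \<in> U \<longrightarrow> emeasure M U \<noteq> 0} \<in> null_sets M"
    unfolding eq F'(3) .
  show "closed {x. \<forall>U. open U \<and> x \<in> U \<longrightarrow> emeasure M U \<noteq> 0}"
    unfolding closed_def eq by (intro open_Union) auto
qed

text \<open>A limit point missing from the hull would have the closed set on one side of it at
  positive distance, hence also the hull. This is how the intervals \<open>\<Delta> l\<close> are
  seen to be closed.\<close>

lemma closed_convex_hull_real:
  assumes "closed (S :: real set)"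
  shows "closed (convex hull S)"
proof (cases "S = {}")
  case False
  let ?H = "convex hull S"
  have H: "is_interval ?H" by (simp add: is_interval_convex_1)
  have "y \<in> ?H" if y: "y \<in> closure ?H" for y
  proof (rule ccontr)
    assume "y \<notin> ?H"
    then have nS: "y \<notin> S" using hull_subset[of S convex] by auto
    have "(\<forall>x\<in>?H. x < y) \<or> (\<forall>x\<in>?H. y < x)"
      using H \<open>y \<notin> ?H\<close> unfolding is_interval_1 by (metis linorder_neqE less_imp_le)
    moreover have "open (- S)" using assms by (simp add: open_Compl)
    then obtain e where e: "e > 0" "ball y e \<subseteq> - S" using nS open_contains_ball by (metis ComplI)
    ultimately have "S \<subseteq> {..y - e} \<or> S \<subseteq> {y + e..}"
    proof (elim disjE)
      assume *: "\<forall>x\<in>?H. x < y"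
      have "x \<le> y - e" if "x \<in> S" for x
        using * e that hull_subset[of S convex] by (force simp: dist_real_def subset_iff)
      then show ?thesis by auto
    next
      assume *: "\<forall>x\<in>?H. y < x"
      have "x \<ge> y + e" if "x \<in> S" for x
        using * e that hull_subset[of S convex] by (force simp: dist_real_def subset_iff)
      then show ?thesis by auto
    qed
    then have "?H \<subseteq> {..y - e} \<or> ?H \<subseteq> {y + e..}"
      by (meson hull_minimal convex_real_interval)
    then have "closure ?H \<subseteq> {..y - e} \<or> closure ?H \<subseteq> {y + e..}"
      by (meson closure_minimal closed_atMost closed_atLeast)
    then show False using y e by auto
  qed
  then show ?thesis by (metis closure_subset closure_eq subsetI subset_antisym)
qed simp

lemma closed_of_real_dist:
  fixes z :: "'a :: real_normed_field"
  assumes "closed C" "z \<notin> of_real ` C"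
  obtains e where "e > 0" "\<And>x. x \<in> C \<Longrightarrow> e \<le> norm (z - of_real x)"
proof (cases "C = {}")
  case True
  then show ?thesis using that[of 1] by simp
next
  case False
  then obtain x0 where x0: "x0 \<in> C" by auto
  let ?f = "\<lambda>x. norm (z - of_real x)"
  \<comment> \<open>Points outside this ball are farther from \<open>z\<close> than
    \<open>x0\<close>, so the minimum over the compact part is a minimum over
    \<open>C\<close>.\<close>
  let ?K = "C \<inter> cball x0 (2 * ?f x0)"
  have "compact ?K" using assms by (intro closed_Int_compact) auto
  moreover have "x0 \<in> ?K" using x0 by simp
  moreover have "continuous_on ?K ?f" by (intro continuous_intros)
  ultimately obtain x1 where x1: "x1 \<in> ?K" "\<And>y. y \<in> ?K \<Longrightarrow> ?f x1 \<le> ?f y"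
    using continuous_attains_inf[of ?K ?f] by blast
  have "?f x1 > 0" using x1(1) assms(2) by auto
  moreover have "?f x1 \<le> ?f x" if "x \<in> C" for x
  proof (cases "x \<in> ?K")
    case False
    then have "dist x0 x > 2 * ?f x0" using that by simp
    also have "dist x0 x = norm ((z - of_real x) - (z - of_real x0))"
    proof -
      have "(z - of_real x) - (z - of_real x0) = of_real (x0 - x)" by simp
      then show ?thesis by (simp add: dist_real_def flip: of_real_diff)
    qed
    also have "\<dots> \<le> ?f x + ?f x0" by (rule norm_triangle_ineq4)
    finally have "?f x0 \<le> ?f x" by simp
    then show ?thesis using x1(2)[OF \<open>x0 \<in> ?K\<close>] by linarith
  qed (use x1 in auto)
  ultimately show ?thesis using that by blast
qed

lemma integrable_cauchy_kernel:
  fixes z :: "'a :: {real_normed_field, banach, second_countable_topology}"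
  assumes sets: "sets M = sets borel" and g: "integrable M (g :: real \<Rightarrow> real)"
    and AE: "AE x in M. x \<in> C" and e: "e > 0" "\<And>x. x \<in> C \<Longrightarrow> e \<le> norm (z - of_real x)"
  shows "integrable M (\<lambda>x. g x *\<^sub>R (1 / (z - of_real x)))"
proof (rule Bochner_Integration.integrable_bound)
  show "integrable M (\<lambda>x. g x / e)" using g by simp
  have [measurable_cong]: "sets M = sets borel" by fact
  have [measurable]: "g \<in> borel_measurable M" using g by auto
  show "(\<lambda>x. g x *\<^sub>R (1 / (z - of_real x))) \<in> borel_measurable M" by measurable
  show "AE x in M. norm (g x *\<^sub>R (1 / (z - of_real x))) \<le> norm (g x / e)"
    using AE
  proof eventually_elim
    case (elim x)
    have "\<bar>g x\<bar> / norm (z - of_real x) \<le> \<bar>g x\<bar> / e"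
      using e(1) e(2)[OF elim] by (intro divide_left_mono mult_pos_pos) linarith+
    then show ?case using e(1) by (simp add: norm_divide)
  qed
qed

lemma cauchy_kernel_diff:
  fixes z h x :: "'a :: field"
  assumes "z - x \<noteq> 0" "z + h - x \<noteq> 0" "h \<noteq> 0"
  shows "(1 / (z + h - x) - 1 / (z - x)) / h + 1 / (z - x)\<^sup>2 = h / ((z + h - x) * (z - x)\<^sup>2)"
proof -
  define a where "a = z - x"
  have eq: "z + h - x = a + h" by (simp add: a_def)
  show ?thesis using assms unfolding a_def[symmetric] eq
    by (simp add: divide_simps power2_eq_square)
qed

text \<open>The error of the difference quotient is bounded explicitly. For h shorter than e/2 the
  point z + h keeps distance e/2 from \<open>C\<close>, whence the constant 2/e^3.\<close>

lemma has_field_derivative_cauchy_kernel: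
  fixes z :: "'a :: {real_normed_field, banach, second_countable_topology}"
  assumes sets: "sets M = sets borel" and g: "integrable M (g :: real \<Rightarrow> real)"
    and AE: "AE x in M. x \<in> C" and e: "e > 0" "\<And>x. x \<in> C \<Longrightarrow> e \<le> norm (z - of_real x)"
  shows "((\<lambda>z. LINT x|M. g x *\<^sub>R (1 / (z - of_real x))) has_field_derivative
           (- (LINT x|M. g x *\<^sub>R (1 / (z - of_real x)\<^sup>2)))) (at z)"
  unfolding DERIV_def
proof (rule Lim_null[THEN iffD2], rule Lim_null_comparison)
  have [measurable_cong]: "sets M = sets borel" by fact
  have [measurable]: "g \<in> borel_measurable M" using g by auto
  let ?F = "\<lambda>z::'a. LINT x|M. g x *\<^sub>R (1 / (z - of_real x))"
  let ?D = "LINT x|M. g x *\<^sub>R (1 / (z - of_real x)\<^sup>2)"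
  have i2: "integrable M (\<lambda>x. g x *\<^sub>R (1 / (z - of_real x)\<^sup>2))"
  proof (rule Bochner_Integration.integrable_bound)
    show "integrable M (\<lambda>x. g x / e\<^sup>2)" using g by simp
    show "AE x in M. norm (g x *\<^sub>R (1 / (z - of_real x)\<^sup>2)) \<le> norm (g x / e\<^sup>2)"
      using AE
    proof eventually_elim
      case (elim x)
      have "e\<^sup>2 \<le> (norm (z - of_real x))\<^sup>2" using e elim by (intro power_mono) auto
      then show ?case using e elim
        by (auto simp: norm_divide norm_power intro!: divide_left_mono mult_pos_pos zero_less_power dest: less_le_trans)
    qed
  qed measurable
  have "norm ((?F (z + h) - ?F z) / h - - ?D) \<le> norm h * (2 / e ^ 3 * (LINT x|M. \<bar>g x\<bar>))"
    if h: "h \<noteq> 0" "norm h < e / 2" for h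
  proof -
    have e': "e / 2 \<le> norm (z + h - of_real x)" if "x \<in> C" for x
    proof -
      have "norm (z - of_real x) \<le> norm (z + h - of_real x) + norm h"
        by (metis add_diff_cancel_right' add_diff_eq diff_add_eq norm_triangle_sub norm_triangle_ineq4)
      then show ?thesis using e(2)[OF that] h by linarith
    qed
    have i1: "integrable M (\<lambda>x. g x *\<^sub>R (1 / (z - of_real x)))"
      by (rule integrable_cauchy_kernel[OF sets g AE e])
    have i3: "integrable M (\<lambda>x. g x *\<^sub>R (1 / (z + h - of_real x)))"
      by (rule integrable_cauchy_kernel[OF sets g AE _ e']) (use e in auto)
    have "(?F (z + h) - ?F z) / h + ?D =
       (LINT x|M. (g x *\<^sub>R (1 / (z + h - of_real x)) - g x *\<^sub>R (1 / (z - of_real x))) / h + g x *\<^sub>R (1 / (z - of_real x)\<^sup>2))"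
      using i1 i2 i3 by (simp add: Bochner_Integration.integral_add Bochner_Integration.integral_diff)
    also have "norm \<dots> \<le> (LINT x|M. norm h * (2 / e ^ 3) * \<bar>g x\<bar>)"
    proof (rule order_trans[OF integral_norm_bound], rule integral_mono_AE)
      show "integrable M (\<lambda>x. norm h * (2 / e ^ 3) * \<bar>g x\<bar>)" using g by auto
    next
      show "integrable M (\<lambda>x. norm ((g x *\<^sub>R (1 / (z + h - of_real x)) - g x *\<^sub>R (1 / (z - of_real x))) / h + g x *\<^sub>R (1 / (z - of_real x)\<^sup>2)))"
        using i1 i2 i3 by auto
    next
      show "AE x in M. norm ((g x *\<^sub>R (1 / (z + h - of_real x)) - g x *\<^sub>R (1 / (z - of_real x))) / h + g x *\<^sub>R (1 / (z - of_real x)\<^sup>2)) \<le> norm h * (2 / e ^ 3) * \<bar>g x\<bar>"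
        using AE
      proof eventually_elim
        case (elim x)
        have nz: "z - of_real x \<noteq> 0" "z + h - of_real x \<noteq> 0"
          using e(2)[OF elim] e'[OF elim] e(1) by auto
        have "(g x *\<^sub>R (1 / (z + h - of_real x)) - g x *\<^sub>R (1 / (z - of_real x))) / h + g x *\<^sub>R (1 / (z - of_real x)\<^sup>2)
            = g x *\<^sub>R ((1 / (z + h - of_real x) - 1 / (z - of_real x)) / h + 1 / (z - of_real x)\<^sup>2)"
          by (simp add: scaleR_conv_of_real algebra_simps diff_divide_distrib)
        also have "\<dots> = g x *\<^sub>R (h / ((z + h - of_real x) * (z - of_real x)\<^sup>2))"
          using cauchy_kernel_diff[OF nz h(1)] by simp
        also have "norm \<dots> = \<bar>g x\<bar> * (norm h / (norm (z + h - of_real x) * (norm (z - of_real x))\<^sup>2))"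
          by (simp add: norm_divide norm_mult norm_power)
        also have "\<dots> \<le> \<bar>g x\<bar> * (norm h / (e / 2 * e\<^sup>2))"
          using e e'[OF elim] e(2)[OF elim]
          by (intro mult_left_mono divide_left_mono mult_mono power_mono mult_pos_pos)
             (auto intro: less_le_trans)
        also have "\<dots> = norm h * (2 / e ^ 3) * \<bar>g x\<bar>"
          using e by (simp add: power2_eq_square power3_eq_cube mult_ac)
        finally show ?case .
      qed
    qed
    also have "\<dots> = norm h * (2 / e ^ 3 * (LINT x|M. \<bar>g x\<bar>))"
      by (simp only: integral_mult_right_zero mult.assoc)
    finally show ?thesis by simp
  qed
  then show "\<forall>\<^sub>F h in at 0. norm ((?F (z + h) - ?F z) / h - - ?D) \<le> norm h * (2 / e ^ 3 * (LINT x|M. \<bar>g x\<bar>))"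
    unfolding eventually_at using e(1) by (intro exI[of _ "e / 2"]) (auto simp: dist_norm)
  show "((\<lambda>h::'a. norm h * (2 / e ^ 3 * (LINT x|M. \<bar>g x\<bar>))) \<longlongrightarrow> 0) (at 0)"
    by (intro tendsto_mult_left_zero tendsto_norm_zero tendsto_ident_at)
qed

lemma class_MD:
  assumes "s \<in> class_M D"
  shows "sm_sign s \<in> {1, -1}" "sets (sm_var s) = sets borel" "space (sm_var s) = UNIV"
    "infinite (sm_support s)" "sm_support s \<subseteq> D" "finite_measure (sm_var s)"
    "AE x in sm_var s. x \<in> sm_support s" "AE x in sm_var s. x \<in> D" "closed (sm_support s)"
    "integrable (sm_var s) (\<lambda>x. x ^ k)" "integrable (sm_var s) (poly p)"
proof -
  show 1: "sm_sign s \<in> {1, -1}" "sets (sm_var s) = sets borel" "infinite (sm_support s)" "sm_support s \<subseteq> D"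
    and i: "integrable (sm_var s) (\<lambda>x. x ^ k)" for k
    using assms by (auto simp: class_M_def)
  show "space (sm_var s) = UNIV" using 1(2) by (metis sets_eq_imp_space_eq space_borel)
  show "finite_measure (sm_var s)"
    using i[of 0] by (intro finite_measureI) (auto simp: integrable_iff_bounded)
  show AE: "AE x in sm_var s. x \<in> sm_support s"
    unfolding sm_support_def
    by (rule AE_I'[OF borel_null_complement_support(1)[OF 1(2)]]) auto
  show "AE x in sm_var s. x \<in> D" using AE 1(4) by auto
  show "closed (sm_support s)"
    unfolding sm_support_def by (rule borel_null_complement_support(2)[OF 1(2)])
  have "poly p = (\<lambda>x. \<Sum>j\<le>degree p. coeff p j * x ^ j)" by (auto simp: poly_altdef)
  then show "integrable (sm_var s) (poly p)" using i by simp
qed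

text \<open>The product is stored as a sign and the density of absolute value. With the constant
  sign \<open>e\<close> of the Cauchy transform, the stored sign is
  \<open>sm_sign \<alpha> * e\<close>, and the two occurrences of \<open>e\<close> cancel.
  Membership of the sign in {1, -1} excludes zero total mass, where \<open>sgn\<close> would lose
  the information.\<close>

lemma sm_prod_integral:
  fixes f :: "real \<Rightarrow> 'a :: {banach, second_countable_topology}"
  assumes def: "sm_prod_defined \<alpha> \<beta>" and sign: "sm_sign \<alpha> \<in> {1, -1}" "sm_sign (sm_prod \<alpha> \<beta>) \<in> {1, -1}"
    and sets: "sets (sm_var \<alpha>) = sets borel" and f: "f \<in> borel_measurable borel"
  shows "integrable (sm_var (sm_prod \<alpha> \<beta>)) f \<longleftrightarrow> integrable (sm_var \<alpha>) (\<lambda>x. cauchy_transform \<beta> x *\<^sub>R f x)"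
    and "sm_integral (sm_prod \<alpha> \<beta>) f = sm_integral \<alpha> (\<lambda>x. cauchy_transform \<beta> x *\<^sub>R f x)"
proof -
  let ?c = "cauchy_transform \<beta> :: real \<Rightarrow> real" and ?M = "sm_var \<alpha>"
  have [measurable_cong]: "sets ?M = sets borel" by fact
  have [measurable]: "f \<in> borel_measurable ?M" using f by measurable
  have ci: "integrable ?M ?c" using def by (simp add: sm_prod_defined_def)
  then have [measurable]: "?c \<in> borel_measurable ?M" by auto
  have ac: "\<exists>e\<in>{1,-1}. AE x in ?M. \<bar>?c x\<bar> = e * ?c x"
    using def unfolding sm_prod_defined_def
  proof (elim conjE disjE)
    assume "AE x in ?M. ?c x \<ge> 0"
    then show ?thesis by (intro bexI[of _ 1]) auto
  next
    assume "AE x in ?M. ?c x \<le> 0"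
    then show ?thesis by (intro bexI[of _ "-1"]) auto
  qed
  then obtain e where e: "e \<in> {1, -1}" "AE x in ?M. \<bar>?c x\<bar> = e * ?c x" by blast
  have sgn_eq: "sm_sign (sm_prod \<alpha> \<beta>) = sm_sign \<alpha> * e"
  proof -
    have "(LINT x|?M. \<bar>?c x\<bar>) = e * (LINT x|?M. ?c x)"
      by (subst integral_mult_right_zero[symmetric], rule integral_cong_AE) (use e in auto)
    moreover have "(LINT x|?M. \<bar>?c x\<bar>) \<ge> 0" by simp
    moreover have "sm_sign (sm_prod \<alpha> \<beta>) = sgn (sm_sign \<alpha> * (LINT x|?M. ?c x))"
      by (simp add: sm_prod_def sm_integral_def)
    moreover from this have "(LINT x|?M. ?c x) \<noteq> 0" using sign(2) by auto
    ultimately show ?thesis using e(1) sign(1) by (auto simp: sgn_if mult_less_0_iff split: if_splits)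
  qed
  have ae: "AE x in ?M. \<bar>?c x\<bar> *\<^sub>R f x = e *\<^sub>R (?c x *\<^sub>R f x)" using e(2) by eventually_elim simp
  have "integrable (sm_var (sm_prod \<alpha> \<beta>)) f \<longleftrightarrow> integrable ?M (\<lambda>x. \<bar>?c x\<bar> *\<^sub>R f x)"
    unfolding sm_prod_def sgn_measure.sel by (rule integrable_density) auto
  also have "\<dots> \<longleftrightarrow> integrable ?M (\<lambda>x. e *\<^sub>R (?c x *\<^sub>R f x))"
    by (rule integrable_cong_AE) (use ae in auto)
  finally show "integrable (sm_var (sm_prod \<alpha> \<beta>)) f \<longleftrightarrow> integrable ?M (\<lambda>x. ?c x *\<^sub>R f x)"
    using e(1) by auto
  have "(LINT x|sm_var (sm_prod \<alpha> \<beta>). f x) = (LINT x|?M. \<bar>?c x\<bar> *\<^sub>R f x)"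
    unfolding sm_prod_def sgn_measure.sel by (rule integral_density) auto
  also have "\<dots> = (LINT x|?M. e *\<^sub>R (?c x *\<^sub>R f x))"
    by (rule integral_cong_AE) (use ae in auto)
  finally have "(LINT x|sm_var (sm_prod \<alpha> \<beta>). f x) = e *\<^sub>R (LINT x|?M. ?c x *\<^sub>R f x)"
    by (simp only: integral_scaleR_right)
  then show "sm_integral (sm_prod \<alpha> \<beta>) f = sm_integral \<alpha> (\<lambda>x. ?c x *\<^sub>R f x)"
    using e(1) sgn_eq by (auto simp: sm_integral_def)
qed

section \<open>Nikishin systems\<close>

text \<open>The neighbour of \<open>l\<close> in the direction of \<open>k\<close>, which lets the
  ascending and descending products share every recursion.\<close>

definition step :: "nat \<Rightarrow> nat \<Rightarrow> nat" where
  "step l k = (if l < k then Suc l else l - 1)"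

text \<open>The density of \<open>nik \<sigma> l k\<close> with respect to \<open>\<sigma> l\<close>, for both orders of \<open>l\<close> and \<open>k\<close>.\<close>

definition dens :: "(nat \<Rightarrow> sgn_measure) \<Rightarrow> nat \<Rightarrow> nat \<Rightarrow> 'a \<Rightarrow>
    'a :: {real_normed_field, banach, second_countable_topology}" where
  "dens \<sigma> l k z = (if l = k then 1 else cauchy_transform (nik \<sigma> (step l k) k) z)"

lemma borel_measurable_poly [measurable]: "poly (p :: real poly) \<in> borel_measurable borel"
  by (intro borel_measurable_continuous_onI continuous_intros)

lemma dens_same [simp]: "dens \<sigma> l l = (\<lambda>_. 1)"
  by (simp add: dens_def fun_eq_iff)

lemma nik_same [simp]: "nik \<sigma> l l = \<sigma> l"
  by (simp add: nik_def)

lemma nik_step: "l \<noteq> k \<Longrightarrow> nik \<sigma> l k = sm_prod (\<sigma> l) (nik \<sigma> (step l k) k)"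
proof (cases "l < k")
  case True
  then have "[Suc l..<Suc k] = Suc l # [Suc (Suc l)..<Suc k]" by (simp add: upt_conv_Cons)
  then show ?thesis using True by (simp add: nik_def step_def del: upt_Suc)
next
  case False
  moreover assume "l \<noteq> k"
  ultimately obtain i where i: "l = Suc i" "k \<le> i" by (cases l) auto
  then show ?thesis by (auto simp: nik_def step_def)
qed

lemma sm_integral_of_real:
  "sm_integral s (\<lambda>x. of_real (f x) :: complex) = of_real (sm_integral s f)"
  by (simp add: sm_integral_def scaleR_conv_of_real)

lemma cauchy_transform_of_real:
  "cauchy_transform s (of_real x :: complex) = of_real (cauchy_transform s x)"
  unfolding cauchy_transform_def sm_integral_of_real[symmetric] by simp

lemma dens_of_real: "dens \<sigma> l k (of_real x :: complex) = of_real (dens \<sigma> l k x)"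
  by (simp add: dens_def cauchy_transform_of_real)

text \<open>Separation makes \<open>x - t\<close> of constant sign on the product of the intervals,
  from which all sign arguments start. Infinite size matters: a one-point interval inside another
  meets it in a single point without being separated from it.\<close>

lemma separated_intervals:
  fixes I J :: "real set"
  assumes "is_interval I" "is_interval J" "infinite I" "infinite J" "I \<inter> J \<subseteq> {x}"
  obtains p where "I \<subseteq> {..p} \<and> J \<subseteq> {p..} \<or> I \<subseteq> {p..} \<and> J \<subseteq> {..p}"
proof -
  have gen: "\<exists>p. I \<subseteq> {..p} \<and> J \<subseteq> {p..}"
    if "is_interval I" "is_interval J" "I \<inter> J \<subseteq> {x}" "i \<in> I" "j \<in> J" "i < j" "infinite I" "infinite J" for I J i j
  proof -
    have le: "a \<le> b" if "a \<in> I" "b \<in> J" for a b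
    proof (rule ccontr)
      assume "\<not> a \<le> b"
      have c: "c = x" if "max i b \<le> c" "c \<le> min a j" for c
      proof -
        have "i \<le> c" "c \<le> a" "b \<le> c" "c \<le> j" using that by auto
        then have "c \<in> I" "c \<in> J"
          using \<open>is_interval I\<close> \<open>is_interval J\<close> \<open>i \<in> I\<close> \<open>a \<in> I\<close> \<open>b \<in> J\<close> \<open>j \<in> J\<close>
          unfolding is_interval_1 by blast+
        then show ?thesis using \<open>I \<inter> J \<subseteq> {x}\<close> by auto
      qed
      show False
      proof (cases "max i b < min a j")
        case True
        then show ?thesis using c[of "max i b"] c[of "min a j"] by linarith
      next
        case False
        then consider "i \<ge> a" | "b \<ge> j" using \<open>i < j\<close> \<open>\<not> a \<le> b\<close> by linarith
        then show ?thesis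
        proof cases
          case 1
          then have "b < i" "i < j" using \<open>\<not> a \<le> b\<close> \<open>i < j\<close> by auto
          then have "i \<in> J" using \<open>is_interval J\<close> \<open>b \<in> J\<close> \<open>j \<in> J\<close> unfolding is_interval_1 by (meson less_imp_le)
          then have ix: "i = x" using \<open>i \<in> I\<close> \<open>I \<inter> J \<subseteq> {x}\<close> by auto
          obtain i' where i': "i' \<in> I" "i' \<noteq> i"
            using \<open>infinite I\<close> by (metis finite.simps finite_insert infinite_super insertCI subsetI)
          \<comment> \<open>A second common point: move from \<open>i\<close> towards
            \<open>i'\<close>, but stop before leaving the range between \<open>b\<close> and
            \<open>j\<close>.\<close>
          define k where "k = (if i' < i then max i' b else min i' j)"
          have "k \<in> I"
            using \<open>is_interval I\<close> i' \<open>i \<in> I\<close> \<open>b < i\<close> \<open>i < j\<close> unfolding is_interval_1 k_def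
            by (smt (verit))
          moreover have "k \<in> J"
            using \<open>is_interval J\<close> i' \<open>b \<in> J\<close> \<open>j \<in> J\<close> \<open>b < i\<close> \<open>i < j\<close> unfolding is_interval_1 k_def
            by (smt (verit))
          moreover have "k \<noteq> i" using i' \<open>b < i\<close> \<open>i < j\<close> unfolding k_def by auto
          ultimately show False using \<open>I \<inter> J \<subseteq> {x}\<close> ix by auto
        next
          case 2
          then have "j < a" "i < j" using \<open>\<not> a \<le> b\<close> \<open>i < j\<close> by auto
          then have "j \<in> I" using \<open>is_interval I\<close> \<open>i \<in> I\<close> \<open>a \<in> I\<close> unfolding is_interval_1 by (meson less_imp_le)
          then have jx: "j = x" using \<open>j \<in> J\<close> \<open>I \<inter> J \<subseteq> {x}\<close> by auto
          obtain j' where j': "j' \<in> J" "j' \<noteq> j"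
            using \<open>infinite J\<close> by (metis finite.simps finite_insert infinite_super insertCI subsetI)
          define k where "k = (if j' < j then max j' i else min j' a)"
          have "k \<in> J"
            using \<open>is_interval J\<close> j' \<open>j \<in> J\<close> \<open>j < a\<close> \<open>i < j\<close> unfolding is_interval_1 k_def
            by (smt (verit))
          moreover have "k \<in> I"
            using \<open>is_interval I\<close> j' \<open>i \<in> I\<close> \<open>a \<in> I\<close> \<open>j < a\<close> \<open>i < j\<close> unfolding is_interval_1 k_def
            by (smt (verit))
          moreover have "k \<noteq> j" using j' \<open>j < a\<close> \<open>i < j\<close> unfolding k_def by auto
          ultimately show False using \<open>I \<inter> J \<subseteq> {x}\<close> jx by auto
        qed
      qed
    qed
    show ?thesis
    proof (intro exI conjI subsetI)
      fix a assume "a \<in> I"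
      then show "a \<in> {..Inf J}" using le \<open>j \<in> J\<close> by (auto intro!: cInf_greatest)
    next
      fix b assume "b \<in> J"
      then show "b \<in> {Inf J..}" using le[OF \<open>i \<in> I\<close>] by (auto intro!: cInf_lower bdd_belowI)
    qed
  qed
  obtain i where i: "i \<in> I" using assms(3) by (metis finite.emptyI equals0I)
  obtain j where j: "j \<in> J" "j \<noteq> i"
    using \<open>infinite J\<close> by (metis finite.simps finite_insert infinite_super insertCI subsetI)
  show thesis
  proof (cases "i < j")
    case True
    then show ?thesis using gen[of I J i j] assms i j that by blast
  next
    case False
    then have "j < i" using j by auto
    then show ?thesis using gen[of J I j i] assms i j that by (metis inf_commute)
  qed
qed

section \<open>Densities of the products and their integrability\<close>

locale nikishin_system =
  fixes m :: nat and \<Delta> :: "nat \<Rightarrow> real set" and \<sigma> :: "nat \<Rightarrow> sgn_measure"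
  assumes m2: "m \<ge> 2" and nikishin: "nikishin m \<Delta> \<sigma>"
begin

abbreviation \<mu> :: "nat \<Rightarrow> real measure" where
  "\<mu> l \<equiv> sm_var (\<sigma> l)"

lemma nikishin_interval: "l \<in> {1..m} \<Longrightarrow> is_interval (\<Delta> l)"
  and class_M_gen: "l \<in> {1..m} \<Longrightarrow> \<sigma> l \<in> class_M (\<Delta> l)"
  and hull_support: "l \<in> {1..m} \<Longrightarrow> convex hull (sm_support (\<sigma> l)) = \<Delta> l"
  using nikishin by (auto simp: nikishin_def)

lemma closed_\<Delta>: "l \<in> {1..m} \<Longrightarrow> closed (\<Delta> l)"
  using closed_convex_hull_real[OF class_MD(9)[OF class_M_gen]] hull_support by metis

lemma infinite_\<Delta>: "l \<in> {1..m} \<Longrightarrow> infinite (\<Delta> l)"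
  using class_MD(4,5)[OF class_M_gen] infinite_super by blast

lemma nikishin_pair:
  assumes "1 \<le> j" "j < k" "k \<le> m"
  shows "sm_prod_defined (\<sigma> j) (nik \<sigma> (j + 1) k)" "nik \<sigma> j k \<in> class_M (\<Delta> j)"
    "sm_prod_defined (\<sigma> k) (nik \<sigma> (k - 1) j)" "nik \<sigma> k j \<in> class_M (\<Delta> k)"
  using nikishin assms by (auto simp: nikishin_def)

lemma class_M_nik: "l \<in> {1..m} \<Longrightarrow> k \<in> {1..m} \<Longrightarrow> nik \<sigma> l k \<in> class_M (\<Delta> l)"
  using nikishin_pair[of l k] nikishin_pair[of k l] class_M_gen[of l]
  by (cases l k rule: linorder_cases) auto

lemma step_in: "l \<in> {1..m} \<Longrightarrow> k \<in> {1..m} \<Longrightarrow> l \<noteq> k \<Longrightarrow> step l k \<in> {1..m}"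
  by (auto simp: step_def)

lemma prod_defined: "l \<in> {1..m} \<Longrightarrow> k \<in> {1..m} \<Longrightarrow> l \<noteq> k \<Longrightarrow> sm_prod_defined (\<sigma> l) (nik \<sigma> (step l k) k)"
  using nikishin_pair(1)[of l k] nikishin_pair(3)[of k l]
  by (cases l k rule: linorder_cases) (auto simp: step_def)

definition adj :: "nat \<Rightarrow> nat \<Rightarrow> bool" where
  "adj l k \<longleftrightarrow> l \<in> {1..m} \<and> k \<in> {1..m} \<and> (k = Suc l \<or> l = Suc k)"

lemma adj_sym: "adj l k \<Longrightarrow> adj k l" by (auto simp: adj_def)

lemma adj_step: "l \<in> {1..m} \<Longrightarrow> k \<in> {1..m} \<Longrightarrow> l \<noteq> k \<Longrightarrow> adj l (step l k)"
  by (auto simp: adj_def step_def)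

lemma adj_inter:
  assumes "adj l k"
  shows "\<exists>x. \<Delta> l \<inter> \<Delta> k \<subseteq> {x} \<and> (\<Delta> l \<inter> \<Delta> k \<noteq> {} \<longrightarrow> \<not> mass_point (\<sigma> l) x \<and> \<not> mass_point (\<sigma> k) x)"
proof -
  have *: "\<exists>x. \<Delta> i \<inter> \<Delta> (i + 1) \<subseteq> {x} \<and> (\<Delta> i \<inter> \<Delta> (i + 1) \<noteq> {} \<longrightarrow> \<not> mass_point (\<sigma> i) x \<and> \<not> mass_point (\<sigma> (i + 1)) x)"
    if "i \<in> {1..<m}" for i
    using nikishin that unfolding nikishin_def by (metis subset_refl empty_subsetI)
  show ?thesis
  proof (cases "k = Suc l")
    case True
    then show ?thesis using *[of l] assms by (auto simp: adj_def)
  next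
    case False
    then have "l = Suc k" using assms by (auto simp: adj_def)
    then show ?thesis using *[of k] assms by (auto simp: adj_def Int_commute)
  qed
qed

lemma adj_separated:
  assumes "adj l k"
  obtains p where "\<Delta> l \<subseteq> {..p} \<and> \<Delta> k \<subseteq> {p..} \<or> \<Delta> l \<subseteq> {p..} \<and> \<Delta> k \<subseteq> {..p}"
proof -
  have "l \<in> {1..m}" "k \<in> {1..m}" using assms by (auto simp: adj_def)
  then show thesis
    using adj_inter[OF assms] separated_intervals[of "\<Delta> l" "\<Delta> k"] nikishin_interval infinite_\<Delta> that
    by metis
qed

lemma adj_sign:
  assumes "adj l k"
  obtains e :: real where "e \<in> {1, -1}" "\<And>x t. x \<in> \<Delta> l \<Longrightarrow> t \<in> \<Delta> k \<Longrightarrow> \<bar>x - t\<bar> = e * (x - t)"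
proof -
  obtain p where p: "\<Delta> l \<subseteq> {..p} \<and> \<Delta> k \<subseteq> {p..} \<or> \<Delta> l \<subseteq> {p..} \<and> \<Delta> k \<subseteq> {..p}"
    using adj_separated[OF assms] by blast
  then show thesis
  proof
    assume *: "\<Delta> l \<subseteq> {..p} \<and> \<Delta> k \<subseteq> {p..}"
    have "\<bar>x - t\<bar> = - 1 * (x - t)" if "x \<in> \<Delta> l" "t \<in> \<Delta> k" for x t
    proof -
      have "x \<le> p" "p \<le> t" using * that by auto
      then show ?thesis by simp
    qed
    then show thesis by (intro that[of "-1"]) auto
  next
    assume *: "\<Delta> l \<subseteq> {p..} \<and> \<Delta> k \<subseteq> {..p}"
    have "\<bar>x - t\<bar> = 1 * (x - t)" if "x \<in> \<Delta> l" "t \<in> \<Delta> k" for x t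
    proof -
      have "p \<le> x" "t \<le> p" using * that by auto
      then show ?thesis by simp
    qed
    then show thesis by (intro that[of 1]) auto
  qed
qed

text \<open>The only possible common point carries no mass. Almost every point therefore has
  positive distance from the neighbouring interval, where Cauchy integrals converge
  absolutely.\<close>

lemma AE_adj:
  assumes "adj l k"
  shows "AE x in \<mu> l. x \<in> \<Delta> l \<and> x \<notin> \<Delta> k"
proof -
  have l: "\<sigma> l \<in> class_M (\<Delta> l)" using assms class_M_gen by (auto simp: adj_def)
  obtain x where x: "\<Delta> l \<inter> \<Delta> k \<subseteq> {x}" "\<Delta> l \<inter> \<Delta> k \<noteq> {} \<longrightarrow> \<not> mass_point (\<sigma> l) x"
    using adj_inter[OF assms] by blast
  have "AE y in \<mu> l. y \<notin> \<Delta> l \<inter> \<Delta> k"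
  proof (cases "\<Delta> l \<inter> \<Delta> k = {}")
    case False
    then have "{x} \<in> null_sets (\<mu> l)"
      using x(2) class_MD(2)[OF l] by (auto simp: mass_point_def null_sets_def)
    then show ?thesis by (rule AE_I') (use x in auto)
  qed simp
  then show ?thesis using class_MD(8)[OF l] by eventually_elim auto
qed

lemma nik_integral:
  fixes f :: "real \<Rightarrow> 'a :: {banach, second_countable_topology}"
  assumes l: "l \<in> {1..m}" and k: "k \<in> {1..m}" and f: "f \<in> borel_measurable borel"
  shows "integrable (sm_var (nik \<sigma> l k)) f \<longleftrightarrow> integrable (\<mu> l) (\<lambda>x. dens \<sigma> l k x *\<^sub>R f x)"
    and "sm_integral (nik \<sigma> l k) f = sm_integral (\<sigma> l) (\<lambda>x. dens \<sigma> l k x *\<^sub>R f x)"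
proof -
  have "(integrable (sm_var (nik \<sigma> l k)) f \<longleftrightarrow> integrable (\<mu> l) (\<lambda>x. dens \<sigma> l k x *\<^sub>R f x)) \<and>
    sm_integral (nik \<sigma> l k) f = sm_integral (\<sigma> l) (\<lambda>x. dens \<sigma> l k x *\<^sub>R f x)"
  proof (cases "l = k")
    case False
    have "sm_sign (sm_prod (\<sigma> l) (nik \<sigma> (step l k) k)) \<in> {1, -1}"
      using class_MD(1)[OF class_M_nik[OF l k]] by (simp add: nik_step[OF False])
    then show ?thesis
      using sm_prod_integral[OF prod_defined[OF l k False] class_MD(1)[OF class_M_gen[OF l]] _
          class_MD(2)[OF class_M_gen[OF l]] f] False
      by (simp add: nik_step[OF False] dens_def)
  qed simp
  then show "integrable (sm_var (nik \<sigma> l k)) f \<longleftrightarrow> integrable (\<mu> l) (\<lambda>x. dens \<sigma> l k x *\<^sub>R f x)"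
    and "sm_integral (nik \<sigma> l k) f = sm_integral (\<sigma> l) (\<lambda>x. dens \<sigma> l k x *\<^sub>R f x)" by blast+
qed

lemma cauchy_transform_nik:
  fixes z :: "'a :: {real_normed_field, banach, second_countable_topology}"
  assumes "l \<in> {1..m}" "k \<in> {1..m}"
  shows "cauchy_transform (nik \<sigma> l k) z = sm_integral (\<sigma> l) (\<lambda>x. dens \<sigma> l k x *\<^sub>R (1 / (z - of_real x)))"
  unfolding cauchy_transform_def by (rule nik_integral(2)[OF assms]) measurable

lemma dens_conv:
  assumes "l \<in> {1..m}" "k \<in> {1..m}" "l \<noteq> k"
  shows "dens \<sigma> l k z = sm_integral (\<sigma> (step l k)) (\<lambda>x. dens \<sigma> (step l k) k x *\<^sub>R (1 / (z - of_real x)))"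
  using assms cauchy_transform_nik[OF step_in[OF assms] assms(2)] by (simp add: dens_def)

lemma integrable_poly_dens:
  assumes "l \<in> {1..m}" "k \<in> {1..m}"
  shows "integrable (\<mu> l) (\<lambda>x. dens \<sigma> l k x * poly p x)"
  using nik_integral(1)[OF assms, of "poly p"] class_MD(11)[OF class_M_nik[OF assms]] by simp

lemma integrable_dens: "l \<in> {1..m} \<Longrightarrow> k \<in> {1..m} \<Longrightarrow> integrable (\<mu> l) (dens \<sigma> l k :: real \<Rightarrow> real)"
  using integrable_poly_dens[of l k 1] by simp

lemma measurable_dens: "l \<in> {1..m} \<Longrightarrow> k \<in> {1..m} \<Longrightarrow> (dens \<sigma> l k :: real \<Rightarrow> real) \<in> borel_measurable borel"
  using borel_measurable_integrable[OF integrable_dens[of l k]] class_MD(2)[OF class_M_gen[of l]]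
    measurable_cong_sets by blast

lemma dens_AE_sign:
  assumes "l \<in> {1..m}" "k \<in> {1..m}"
  obtains e :: real where "e \<in> {1, -1}" "AE x in \<mu> l. \<bar>dens \<sigma> l k x\<bar> = e * dens \<sigma> l k x"
proof (cases "l = k")
  case True
  then show ?thesis by (intro that[of 1]) auto
next
  case False
  then have "(AE x in \<mu> l. dens \<sigma> l k x \<ge> (0::real)) \<or> (AE x in \<mu> l. dens \<sigma> l k x \<le> (0::real))"
    using prod_defined[OF assms False] by (simp add: sm_prod_defined_def dens_def)
  then show ?thesis
  proof
    assume "AE x in \<mu> l. dens \<sigma> l k x \<ge> (0::real)"
    then show ?thesis by (intro that[of 1]) (auto elim!: eventually_mono)
  next
    assume "AE x in \<mu> l. dens \<sigma> l k x \<le> (0::real)"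
    then show ?thesis by (intro that[of "-1"]) (auto elim!: eventually_mono)
  qed
qed

text \<open>Density and kernel both have constant sign, so the absolute value of the integral is the
  integral of absolute values. This form feeds Tonelli where integrability is not yet known.\<close>

lemma nn_integral_dens:
  assumes l: "l \<in> {1..m}" and k: "k \<in> {1..m}" and lk: "l \<noteq> k" and x: "x \<in> \<Delta> l" "x \<notin> \<Delta> (step l k)"
  shows "(\<integral>\<^sup>+t. ennreal (\<bar>dens \<sigma> (step l k) k t\<bar> / \<bar>x - t\<bar>) \<partial>\<mu> (step l k)) = ennreal \<bar>dens \<sigma> l k x\<bar>"
proof -
  let ?l = "step l k" and ?d = "dens \<sigma> (step l k) k :: real \<Rightarrow> real"
  have l': "?l \<in> {1..m}" using step_in[OF l k lk] .
  note M = class_MD[OF class_M_gen[OF l']]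
  obtain a :: real where a: "a \<in> {1, -1}" "AE t in \<mu> ?l. \<bar>?d t\<bar> = a * ?d t"
    by (rule dens_AE_sign[OF l' k])
  obtain b :: real where b: "b \<in> {1, -1}" "\<And>t. t \<in> \<Delta> ?l \<Longrightarrow> \<bar>x - t\<bar> = b * (x - t)"
    by (rule adj_sign[OF adj_step[OF l k lk]]) (use x(1) in blast)
  have xn: "x \<notin> of_real ` \<Delta> ?l" using x by simp
  obtain e where e: "e > 0" "\<And>t. t \<in> \<Delta> ?l \<Longrightarrow> e \<le> norm (x - of_real t)"
    by (rule closed_of_real_dist[OF closed_\<Delta>[OF l'] xn]) metis
  have int: "integrable (\<mu> ?l) (\<lambda>t. ?d t *\<^sub>R (1 / (x - of_real t)))"
    by (rule integrable_cauchy_kernel[OF M(2) integrable_dens[OF l' k] M(8) e])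
  have ae: "AE t in \<mu> ?l. \<bar>?d t\<bar> / \<bar>x - t\<bar> = (a * b) * (?d t *\<^sub>R (1 / (x - of_real t)))"
    using a(2) M(8)
  proof eventually_elim
    case (elim t)
    show ?case unfolding elim(1) b(2)[OF elim(2)]
      using b(1) by (cases "x = t") (auto simp: field_simps)
  qed
  have "(\<integral>\<^sup>+t. ennreal (\<bar>?d t\<bar> / \<bar>x - t\<bar>) \<partial>\<mu> ?l) = ennreal (LINT t|\<mu> ?l. \<bar>?d t\<bar> / \<bar>x - t\<bar>)"
  proof (rule nn_integral_eq_integral)
    have "(\<lambda>t. \<bar>?d t\<bar> / \<bar>x - t\<bar>) = (\<lambda>t. norm (?d t *\<^sub>R (1 / (x - of_real t))))"
      by (simp add: fun_eq_iff abs_mult)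
    then show "integrable (\<mu> ?l) (\<lambda>t. \<bar>?d t\<bar> / \<bar>x - t\<bar>)"
      using integrable_norm[OF int] by (simp only:)
  qed simp
  also have "(LINT t|\<mu> ?l. \<bar>?d t\<bar> / \<bar>x - t\<bar>) = \<bar>dens \<sigma> l k x\<bar>"
  proof -
    have [measurable_cong]: "sets (\<mu> ?l) = sets borel" by (rule M(2))
    have [measurable]: "?d \<in> borel_measurable borel" by (rule measurable_dens[OF l' k])
    have "(LINT t|\<mu> ?l. \<bar>?d t\<bar> / \<bar>x - t\<bar>) = (LINT t|\<mu> ?l. (a * b) * (?d t *\<^sub>R (1 / (x - of_real t))))"
      by (rule integral_cong_AE) (use ae in measurable)
    also have "\<dots> = (a * b) * (LINT t|\<mu> ?l. ?d t *\<^sub>R (1 / (x - of_real t)))"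
      by (rule integral_mult_right_zero)
    finally have 1: "(LINT t|\<mu> ?l. \<bar>?d t\<bar> / \<bar>x - t\<bar>) = (a * b) * (LINT t|\<mu> ?l. ?d t *\<^sub>R (1 / (x - of_real t)))" .
    have "dens \<sigma> l k x = sm_sign (\<sigma> ?l) * (LINT t|\<mu> ?l. ?d t *\<^sub>R (1 / (x - of_real t)))"
      unfolding dens_conv[OF l k lk] sm_integral_def by simp
    moreover have "(LINT t|\<mu> ?l. \<bar>?d t\<bar> / \<bar>x - t\<bar>) \<ge> 0" by (rule integral_nonneg_AE) simp
    ultimately show ?thesis using 1 a(1) b(1) M(1) by (auto simp: abs_mult)
  qed
  finally show ?thesis .
qed

lemma sets_\<mu> [measurable_cong]: "l \<in> {1..m} \<Longrightarrow> sets (\<mu> l) = sets borel"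
  using class_MD(2)[OF class_M_gen] .

lemma sigma_finite_\<mu>: "l \<in> {1..m} \<Longrightarrow> sigma_finite_measure (\<mu> l)"
  using class_MD(6)[OF class_M_gen] finite_measure.axioms(1) by blast

lemma AE_\<Delta>: "l \<in> {1..m} \<Longrightarrow> AE x in \<mu> l. x \<in> \<Delta> l"
  using class_MD(8)[OF class_M_gen] .

lemma pair_sf: "l \<in> {1..m} \<Longrightarrow> i \<in> {1..m} \<Longrightarrow> pair_sigma_finite (\<mu> l) (\<mu> i)"
  by (simp add: pair_sigma_finite_def sigma_finite_\<mu>)

text \<open>Both sides are the same double integral over \<open>\<Delta> (Suc i)\<close> and
  \<open>\<Delta> i\<close>, evaluated in the two orders.\<close>

lemma dens_pair_shift:
  assumes "1 \<le> j" "j \<le> i" "Suc i \<le> k" "k \<le> m"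
  shows "(\<integral>\<^sup>+x. ennreal \<bar>dens \<sigma> (Suc i) j x * dens \<sigma> (Suc i) k x\<bar> \<partial>\<mu> (Suc i))
       = (\<integral>\<^sup>+x. ennreal \<bar>dens \<sigma> i j x * dens \<sigma> i k x\<bar> \<partial>\<mu> i)"
proof -
  let ?l = "Suc i"
  have in1: "?l \<in> {1..m}" "i \<in> {1..m}" "j \<in> {1..m}" "k \<in> {1..m}" using assms by auto
  have st: "step ?l j = i" "step i k = ?l" "?l \<noteq> j" "i \<noteq> k" using assms by (auto simp: step_def)
  have adjs: "adj ?l i" "adj i ?l" using in1 by (auto simp: adj_def)
  interpret pair_sigma_finite "\<mu> ?l" "\<mu> i" by (rule pair_sf[OF in1(1,2)])
  have [measurable]: "(dens \<sigma> i j :: real \<Rightarrow> real) \<in> borel_measurable borel"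
    "(dens \<sigma> ?l k :: real \<Rightarrow> real) \<in> borel_measurable borel"
    using measurable_dens in1 by blast+
  have [measurable_cong]: "sets (\<mu> ?l) = sets borel" "sets (\<mu> i) = sets borel" using sets_\<mu> in1 by blast+
  have "(\<integral>\<^sup>+x. ennreal \<bar>dens \<sigma> ?l j x * dens \<sigma> ?l k x\<bar> \<partial>\<mu> ?l)
      = (\<integral>\<^sup>+x. (\<integral>\<^sup>+t. ennreal (\<bar>dens \<sigma> i j t\<bar> * \<bar>dens \<sigma> ?l k x\<bar> / \<bar>x - t\<bar>) \<partial>\<mu> i) \<partial>\<mu> ?l)"
  proof (rule nn_integral_cong_AE)
    show "AE x in \<mu> ?l. ennreal \<bar>dens \<sigma> ?l j x * dens \<sigma> ?l k x\<bar>
        = (\<integral>\<^sup>+t. ennreal (\<bar>dens \<sigma> i j t\<bar> * \<bar>dens \<sigma> ?l k x\<bar> / \<bar>x - t\<bar>) \<partial>\<mu> i)"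
      using AE_adj[OF adjs(1)]
    proof eventually_elim
      case (elim x)
      have "ennreal \<bar>dens \<sigma> ?l j x * dens \<sigma> ?l k x\<bar> = ennreal \<bar>dens \<sigma> ?l k x\<bar> * ennreal \<bar>dens \<sigma> ?l j x\<bar>"
        by (simp add: abs_mult mult.commute ennreal_mult)
      also have "ennreal \<bar>dens \<sigma> ?l j x\<bar> = (\<integral>\<^sup>+t. ennreal (\<bar>dens \<sigma> i j t\<bar> / \<bar>x - t\<bar>) \<partial>\<mu> i)"
        using nn_integral_dens[OF in1(1,3) st(3), of x] elim by (simp add: st)
      also have "ennreal \<bar>dens \<sigma> ?l k x\<bar> * \<dots> = (\<integral>\<^sup>+t. ennreal \<bar>dens \<sigma> ?l k x\<bar> * ennreal (\<bar>dens \<sigma> i j t\<bar> / \<bar>x - t\<bar>) \<partial>\<mu> i)"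
        by (rule nn_integral_cmult[symmetric]) measurable
      finally show ?case by (simp add: ennreal_mult[symmetric] mult.commute)
    qed
  qed
  also have "\<dots> = (\<integral>\<^sup>+t. (\<integral>\<^sup>+x. ennreal (\<bar>dens \<sigma> i j t\<bar> * \<bar>dens \<sigma> ?l k x\<bar> / \<bar>x - t\<bar>) \<partial>\<mu> ?l) \<partial>\<mu> i)"
    by (rule Fubini'[symmetric]) measurable
  also have "\<dots> = (\<integral>\<^sup>+x. ennreal \<bar>dens \<sigma> i j x * dens \<sigma> i k x\<bar> \<partial>\<mu> i)"
  proof (rule nn_integral_cong_AE)
    show "AE t in \<mu> i. (\<integral>\<^sup>+x. ennreal (\<bar>dens \<sigma> i j t\<bar> * \<bar>dens \<sigma> ?l k x\<bar> / \<bar>x - t\<bar>) \<partial>\<mu> ?l)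
        = ennreal \<bar>dens \<sigma> i j t * dens \<sigma> i k t\<bar>"
      using AE_adj[OF adjs(2)]
    proof eventually_elim
      case (elim t)
      have "(\<integral>\<^sup>+x. ennreal (\<bar>dens \<sigma> i j t\<bar> * \<bar>dens \<sigma> ?l k x\<bar> / \<bar>x - t\<bar>) \<partial>\<mu> ?l)
         = (\<integral>\<^sup>+x. ennreal \<bar>dens \<sigma> i j t\<bar> * ennreal (\<bar>dens \<sigma> ?l k x\<bar> / \<bar>t - x\<bar>) \<partial>\<mu> ?l)"
        by (simp add: ennreal_mult[symmetric] abs_minus_commute)
      also have "\<dots> = ennreal \<bar>dens \<sigma> i j t\<bar> * (\<integral>\<^sup>+x. ennreal (\<bar>dens \<sigma> ?l k x\<bar> / \<bar>t - x\<bar>) \<partial>\<mu> ?l)"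
        by (rule nn_integral_cmult) measurable
      also have "(\<integral>\<^sup>+x. ennreal (\<bar>dens \<sigma> ?l k x\<bar> / \<bar>t - x\<bar>) \<partial>\<mu> ?l) = ennreal \<bar>dens \<sigma> i k t\<bar>"
        using nn_integral_dens[OF in1(2,4) st(4), of t] elim by (simp add: st)
      finally show ?case by (simp add: abs_mult ennreal_mult)
    qed
  qed
  finally show ?thesis .
qed

text \<open>A product of two densities is not covered by the definition of the system. Shifting down
  to level j makes one factor equal to 1, and the other is integrable there.\<close>

lemma integrable_dens_pair:
  assumes "1 \<le> j" "j \<le> l" "l \<le> k" "k \<le> m"
  shows "integrable (\<mu> l) (\<lambda>x. dens \<sigma> l j x * dens \<sigma> l k x)"
proof -
  have "(\<integral>\<^sup>+x. ennreal \<bar>dens \<sigma> l j x * dens \<sigma> l k x\<bar> \<partial>\<mu> l) < \<infinity>"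
    using assms(2,3)
  proof (induction l rule: dec_induct)
    case base
    have "integrable (\<mu> j) (dens \<sigma> j k :: real \<Rightarrow> real)"
      using assms by (intro integrable_dens) auto
    then show ?case by (simp add: integrable_iff_bounded)
  next
    case (step l)
    then show ?case using dens_pair_shift[of j l k] assms by auto
  qed
  moreover have "(\<lambda>x. dens \<sigma> l j x * dens \<sigma> l k x :: real) \<in> borel_measurable (\<mu> l)"
  proof -
    have "l \<in> {1..m}" "j \<in> {1..m}" "k \<in> {1..m}" using assms by auto
    then have [measurable_cong]: "sets (\<mu> l) = sets borel" and
      [measurable]: "(dens \<sigma> l j :: real \<Rightarrow> real) \<in> borel_measurable borel"
        "(dens \<sigma> l k :: real \<Rightarrow> real) \<in> borel_measurable borel"
      using sets_\<mu> measurable_dens by blast+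
    show ?thesis by measurable
  qed
  ultimately show ?thesis by (simp add: integrable_iff_bounded)
qed

text \<open>With \<open>p\<close> between the intervals, \<open>\<bar>x - t\<bar>\<close> is at
  least \<open>\<bar>x - p\<bar>\<close> for all t in the next interval, so the total mass of the
  density serves as \<open>C\<close>.\<close>

lemma dens_decay:
  assumes l: "l \<in> {1..m}" and k: "k \<in> {1..m}" and lk: "l \<noteq> k"
  obtains p C where "\<And>x. x \<in> \<Delta> l \<Longrightarrow> \<bar>x - p\<bar> * \<bar>dens \<sigma> l k x\<bar> \<le> C"
    "\<Delta> (step l k) \<subseteq> {..p} \<and> \<Delta> l \<subseteq> {p..} \<or> \<Delta> (step l k) \<subseteq> {p..} \<and> \<Delta> l \<subseteq> {..p}"
proof -
  let ?i = "step l k" and ?d = "dens \<sigma> (step l k) k :: real \<Rightarrow> real"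
  have i: "?i \<in> {1..m}" by (rule step_in[OF l k lk])
  obtain p where p: "\<Delta> ?i \<subseteq> {..p} \<and> \<Delta> l \<subseteq> {p..} \<or> \<Delta> ?i \<subseteq> {p..} \<and> \<Delta> l \<subseteq> {..p}"
    by (rule adj_separated[OF adj_sym[OF adj_step[OF l k lk]]])
  define C where "C = (LINT t|\<mu> ?i. \<bar>?d t\<bar>)"
  have C0: "C \<ge> 0" by (simp add: C_def)
  have "\<bar>x - p\<bar> * \<bar>dens \<sigma> l k x\<bar> \<le> C" if x: "x \<in> \<Delta> l" for x
  proof (cases "x = p")
    case False
    have ge: "\<bar>x - p\<bar> \<le> \<bar>x - t\<bar>" if "t \<in> \<Delta> ?i" for t
    proof -
      have "p \<le> x \<and> t \<le> p \<or> x \<le> p \<and> p \<le> t" using p x that by blast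
      then show ?thesis by linarith
    qed
    have "\<bar>dens \<sigma> l k x\<bar> = \<bar>LINT t|\<mu> ?i. ?d t * (1 / (x - t))\<bar>"
      using class_MD(1)[OF class_M_gen[OF i]]
      unfolding dens_conv[OF l k lk] sm_integral_def by (auto simp: abs_mult)
    also have "\<dots> \<le> (LINT t|\<mu> ?i. \<bar>?d t\<bar> / \<bar>x - p\<bar>)"
    proof (rule order_trans[OF integral_abs_bound], rule integral_mono_AE')
      show "integrable (\<mu> ?i) (\<lambda>t. \<bar>?d t\<bar> / \<bar>x - p\<bar>)" using integrable_dens[OF i k] by auto
      show "AE t in \<mu> ?i. \<bar>?d t * (1 / (x - t))\<bar> \<le> \<bar>?d t\<bar> / \<bar>x - p\<bar>"
        using AE_\<Delta>[OF i]
      proof eventually_elim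
        case (elim t)
        have "0 < \<bar>x - p\<bar>" using False by simp
        then have "\<bar>?d t\<bar> / \<bar>x - t\<bar> \<le> \<bar>?d t\<bar> / \<bar>x - p\<bar>"
          using ge[OF elim] by (intro divide_left_mono mult_pos_pos) linarith+
        then show ?case by (simp add: abs_mult)
      qed
    qed simp
    also have "\<dots> = C / \<bar>x - p\<bar>" by (simp add: C_def)
    finally show ?thesis using False by (simp add: field_simps)
  qed (use C0 in simp)
  then show thesis using that p by blast
qed

text \<open>Divide \<open>q\<close> by x - p: the factor x - p tames one density, leaving a
  polynomial times the other, and the constant remainder is handled by
  \<open>integrable_dens_pair\<close>.\<close>

lemma integrable_poly_dens_pair:
  assumes "1 \<le> j" "j \<le> l" "l \<le> k" "k \<le> m"
  shows "integrable (\<mu> l) (\<lambda>x. poly q x * dens \<sigma> l k x * dens \<sigma> l j x)"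
proof (cases "j = l")
  case True
  then show ?thesis using integrable_poly_dens[of l k q] assms by (simp add: mult.commute)
next
  case False
  have in1: "l \<in> {1..m}" "j \<in> {1..m}" "k \<in> {1..m}" using assms by auto
  then have [measurable_cong]: "sets (\<mu> l) = sets borel" and
      [measurable]: "(dens \<sigma> l j :: real \<Rightarrow> real) \<in> borel_measurable borel"
        "(dens \<sigma> l k :: real \<Rightarrow> real) \<in> borel_measurable borel"
      using sets_\<mu> measurable_dens by blast+
  obtain p C where pC: "\<And>x. x \<in> \<Delta> l \<Longrightarrow> \<bar>x - p\<bar> * \<bar>dens \<sigma> l j x\<bar> \<le> C"
    by (rule dens_decay[OF in1(1,2)]) (use False in auto)
  define r where "r = synthetic_div q p"
  have q: "poly q x = (x - p) * poly r x + poly q p" for x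
    using arg_cong[OF synthetic_div_correct'[of p q], of "\<lambda>q. poly q x"] unfolding r_def
    by (simp add: algebra_simps)
  show ?thesis
  proof (rule Bochner_Integration.integrable_bound)
    show "integrable (\<mu> l) (\<lambda>x. C * \<bar>dens \<sigma> l k x * poly r x\<bar> + \<bar>poly q p\<bar> * \<bar>dens \<sigma> l j x * dens \<sigma> l k x\<bar>)"
      using integrable_dens_pair[OF assms] integrable_poly_dens[OF in1(1,3), of r] by auto
    show "AE x in \<mu> l. norm (poly q x * dens \<sigma> l k x * dens \<sigma> l j x)
        \<le> norm (C * \<bar>dens \<sigma> l k x * poly r x\<bar> + \<bar>poly q p\<bar> * \<bar>dens \<sigma> l j x * dens \<sigma> l k x\<bar>)"
      using AE_\<Delta>[OF in1(1)]
    proof eventually_elim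
      case (elim x)
      let ?j = "dens \<sigma> l j x :: real" and ?k = "dens \<sigma> l k x :: real"
      have "poly q x * ?k * ?j = ((x - p) * ?j) * (?k * poly r x) + poly q p * (?j * ?k)"
        by (subst q) (simp add: algebra_simps)
      then have "norm (poly q x * ?k * ?j) \<le> (\<bar>x - p\<bar> * \<bar>?j\<bar>) * \<bar>?k * poly r x\<bar> + \<bar>poly q p\<bar> * \<bar>?j * ?k\<bar>"
        by (metis abs_mult abs_triangle_ineq real_norm_def)
      also have "\<dots> \<le> C * \<bar>?k * poly r x\<bar> + \<bar>poly q p\<bar> * \<bar>?j * ?k\<bar>"
        by (intro add_right_mono mult_right_mono pC elim) simp
      also have "\<dots> \<le> norm \<dots>" by simp
      finally show ?case .
    qed
  qed measurable
qed

section \<open>Cauchy transforms of functions against \<open>\<sigma> l\<close>, and products of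
  such transforms\<close>

definition T :: "nat \<Rightarrow> (real \<Rightarrow> real) \<Rightarrow> 'a \<Rightarrow>
    'a :: {real_normed_field, banach, second_countable_topology}" where
  "T l g z = sm_integral (\<sigma> l) (\<lambda>t. g t *\<^sub>R (1 / (z - of_real t)))"

lemma T_of_real: "T l g (of_real x :: complex) = of_real (T l g x)"
proof -
  have "(\<lambda>t. g t *\<^sub>R (1 / (complex_of_real x - of_real t))) = (\<lambda>t. of_real (g t *\<^sub>R (1 / (x - of_real t))))"
    by (simp add: fun_eq_iff scaleR_conv_of_real)
  then show ?thesis unfolding T_def by (simp only: sm_integral_of_real)
qed

lemma cauchy_transform_T:
  "l \<in> {1..m} \<Longrightarrow> k \<in> {1..m} \<Longrightarrow> cauchy_transform (nik \<sigma> l k) = T l (dens \<sigma> l k)"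
  by (simp add: fun_eq_iff T_def cauchy_transform_nik)

lemma dens_T:
  "l \<in> {1..m} \<Longrightarrow> k \<in> {1..m} \<Longrightarrow> l \<noteq> k \<Longrightarrow> dens \<sigma> l k = T (step l k) (dens \<sigma> (step l k) k)"
  by (simp add: fun_eq_iff T_def dens_conv)

lemma integrable_kernel:
  fixes z :: "'a :: {real_normed_field, banach, second_countable_topology}"
  assumes "l \<in> {1..m}" "integrable (\<mu> l) g" "z \<notin> of_real ` \<Delta> l"
  shows "integrable (\<mu> l) (\<lambda>t. g t *\<^sub>R (1 / (z - of_real t)))"
proof -
  obtain e where "e > 0" "\<And>x. x \<in> \<Delta> l \<Longrightarrow> e \<le> norm (z - of_real x)"
    by (rule closed_of_real_dist[OF closed_\<Delta>[OF assms(1)] assms(3)]) metis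
  then show ?thesis
    by (rule integrable_cauchy_kernel[OF sets_\<mu>[OF assms(1)] assms(2) AE_\<Delta>[OF assms(1)]])
qed

lemma T_has_derivative:
  fixes z :: "'a :: {real_normed_field, banach, second_countable_topology}"
  assumes "l \<in> {1..m}" "integrable (\<mu> l) g" "z \<notin> of_real ` \<Delta> l"
  shows "\<exists>D. (T l g has_field_derivative D) (at z)"
proof -
  obtain e where e: "e > 0" "\<And>x. x \<in> \<Delta> l \<Longrightarrow> e \<le> norm (z - of_real x)"
    by (rule closed_of_real_dist[OF closed_\<Delta>[OF assms(1)] assms(3)]) metis
  have "T l g = (\<lambda>z. of_real (sm_sign (\<sigma> l)) * (LINT x|\<mu> l. g x *\<^sub>R (1 / (z - of_real x))))"
    by (simp add: fun_eq_iff T_def sm_integral_def scaleR_conv_of_real)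
  note T = this
  have "((\<lambda>z. LINT x|\<mu> l. g x *\<^sub>R (1 / (z - of_real x))) has_field_derivative
      (- (LINT x|\<mu> l. g x *\<^sub>R (1 / (z - of_real x)\<^sup>2)))) (at z)"
    by (rule has_field_derivative_cauchy_kernel[OF sets_\<mu>[OF assms(1)] assms(2) AE_\<Delta>[OF assms(1)] e])
  from DERIV_cmult[OF this, of "of_real (sm_sign (\<sigma> l))"]
  show ?thesis unfolding T by (rule exI)
qed

lemma T_add:
  fixes z :: "'a :: {real_normed_field, banach, second_countable_topology}"
  assumes "l \<in> {1..m}" "integrable (\<mu> l) f" "integrable (\<mu> l) g" "z \<notin> of_real ` \<Delta> l"
  shows "T l (\<lambda>x. f x + g x) z = T l f z + T l g z"
  using integrable_kernel[OF assms(1,2,4)] integrable_kernel[OF assms(1,3,4)]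
  by (simp add: T_def sm_integral_def scaleR_add_left scaleR_add_right)

lemma T_cmult: "T l (\<lambda>x. c * f x) z = of_real c * T l f z"
proof -
  have "(\<lambda>x. (c * f x) *\<^sub>R (1 / (z - of_real x))) = (\<lambda>x. c *\<^sub>R (f x *\<^sub>R (1 / (z - of_real x))))"
    by (simp add: fun_eq_iff)
  then show ?thesis unfolding T_def sm_integral_def
    by (simp only: integral_scaleR_right) (simp add: scaleR_conv_of_real)
qed

lemma T_sum:
  fixes z :: "'a :: {real_normed_field, banach, second_countable_topology}"
  assumes "l \<in> {1..m}" "\<And>i. i \<in> I \<Longrightarrow> integrable (\<mu> l) (f i)" "z \<notin> of_real ` \<Delta> l"
  shows "T l (\<lambda>x. \<Sum>i\<in>I. f i x) z = (\<Sum>i\<in>I. T l (f i) z)"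
proof -
  have "(LINT x|\<mu> l. (\<Sum>i\<in>I. f i x *\<^sub>R (1 / (z - of_real x)))) = (\<Sum>i\<in>I. LINT x|\<mu> l. f i x *\<^sub>R (1 / (z - of_real x)))"
    by (rule Bochner_Integration.integral_sum) (rule integrable_kernel[OF assms(1) _ assms(3)], rule assms(2))
  then show ?thesis by (simp only: T_def sm_integral_def scaleR_sum_left scaleR_sum_right)
qed

text \<open>Off \<open>\<Delta> l\<close> and for z different from w, minus the divided difference
  of \<open>T l f\<close> between z and w; the integral form keeps a meaning at z = w.\<close>

definition T2 :: "nat \<Rightarrow> (real \<Rightarrow> real) \<Rightarrow> 'a \<Rightarrow> 'a \<Rightarrow>
    'a :: {real_normed_field, banach, second_countable_topology}" where
  "T2 l f z w = sm_integral (\<sigma> l) (\<lambda>t. f t *\<^sub>R (1 / ((z - of_real t) * (w - of_real t))))"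

lemma T2_mult:
  fixes z w :: "'a :: {real_normed_field, banach, second_countable_topology}"
  assumes l: "l \<in> {1..m}" and f: "integrable (\<mu> l) f" and z: "z \<notin> of_real ` \<Delta> l" and w: "w \<notin> of_real ` \<Delta> l"
  shows "(z - w) * T2 l f z w = T l f w - T l f z"
proof -
  have [measurable_cong]: "sets (\<mu> l) = sets borel" using sets_\<mu>[OF l] .
  have [measurable]: "f \<in> borel_measurable (\<mu> l)" using f by auto
  have "(z - w) * T2 l f z w
      = sm_sign (\<sigma> l) *\<^sub>R (LINT t|\<mu> l. (z - w) * (f t *\<^sub>R (1 / ((z - of_real t) * (w - of_real t)))))"
    unfolding T2_def sm_integral_def by (subst integral_mult_right_zero) (rule mult_scaleR_right)
  also have "(LINT t|\<mu> l. (z - w) * (f t *\<^sub>R (1 / ((z - of_real t) * (w - of_real t)))))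
      = (LINT t|\<mu> l. f t *\<^sub>R (1 / (w - of_real t)) - f t *\<^sub>R (1 / (z - of_real t)))"
  proof (rule integral_cong_AE)
    show "AE t in \<mu> l. (z - w) * (f t *\<^sub>R (1 / ((z - of_real t) * (w - of_real t))))
        = f t *\<^sub>R (1 / (w - of_real t)) - f t *\<^sub>R (1 / (z - of_real t))"
      using AE_\<Delta>[OF l]
    proof eventually_elim
      case (elim t)
      then have "z - of_real t \<noteq> 0" "w - of_real t \<noteq> 0" using z w by auto
      then have "(z - w) * (1 / ((z - of_real t) * (w - of_real t))) = 1 / (w - of_real t) - 1 / (z - of_real t)"
        by (simp add: divide_simps)
      then show ?case by (simp only: mult_scaleR_right scaleR_diff_right)
    qed
  qed measurable
  also have "\<dots> = (LINT t|\<mu> l. f t *\<^sub>R (1 / (w - of_real t))) - (LINT t|\<mu> l. f t *\<^sub>R (1 / (z - of_real t)))"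
    by (rule Bochner_Integration.integral_diff[OF integrable_kernel[OF l f w] integrable_kernel[OF l f z]])
  finally show ?thesis by (simp add: T_def sm_integral_def scaleR_diff_right)
qed

text \<open>Integrating the kernel over x first turns \<open>dens \<sigma> i j\<close> into
  \<open>dens \<sigma> l j\<close>; the minus sign comes from the kernel 1/(x - t) in place of 1/(t
  - x). Absolute convergence holds since \<open>nn_integral_dens\<close> evaluates the inner
  integral of the norm.\<close>

lemma T2_fubini:
  fixes z :: "'a :: {real_normed_field, banach, second_countable_topology}"
  assumes l: "l \<in> {1..m}" and j: "j \<in> {1..m}" and lj: "l \<noteq> j" and f [measurable]: "f \<in> borel_measurable borel"
    and int: "integrable (\<mu> l) (\<lambda>t. f t * dens \<sigma> l j t)" and z: "z \<notin> of_real ` \<Delta> l"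
  defines "i \<equiv> step l j"
  shows "integrable (\<mu> i) (\<lambda>x. dens \<sigma> i j x *\<^sub>R T2 l f z (of_real x))"
    and "sm_integral (\<sigma> i) (\<lambda>x. dens \<sigma> i j x *\<^sub>R T2 l f z (of_real x)) = - T l (\<lambda>t. f t * dens \<sigma> l j t) z"
proof -
  have i: "i \<in> {1..m}" unfolding i_def by (rule step_in[OF l j lj])
  have adjs: "adj l i" unfolding i_def by (rule adj_step[OF l j lj])
  let ?d = "dens \<sigma> i j :: real \<Rightarrow> real"
  have [measurable]: "?d \<in> borel_measurable borel" "(dens \<sigma> l j :: real \<Rightarrow> real) \<in> borel_measurable borel"
    using measurable_dens i j l by blast+
  have [measurable_cong]: "sets (\<mu> l) = sets borel" "sets (\<mu> i) = sets borel" using sets_\<mu> i l by blast+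
  interpret pair_sigma_finite "\<mu> i" "\<mu> l" by (rule pair_sf[OF i l])
  define g where "g x t = (?d x * f t) *\<^sub>R (1 / ((z - of_real t) * (of_real x - of_real t)) :: 'a)" for x t
  have gm [measurable]: "(\<lambda>(x, t). g x t) \<in> borel_measurable (\<mu> i \<Otimes>\<^sub>M \<mu> l)"
    unfolding g_def by measurable
  obtain e where e: "e > 0" "\<And>x. x \<in> \<Delta> l \<Longrightarrow> e \<le> norm (z - of_real x)"
    by (rule closed_of_real_dist[OF closed_\<Delta>[OF l] z]) metis
  have gint: "integrable (\<mu> i \<Otimes>\<^sub>M \<mu> l) (\<lambda>(x, t). g x t)"
  proof (rule integrableI_bounded)
    have "(\<integral>\<^sup>+p. ennreal (norm (case p of (x, t) \<Rightarrow> g x t)) \<partial>(\<mu> i \<Otimes>\<^sub>M \<mu> l))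
        = (\<integral>\<^sup>+t. (\<integral>\<^sup>+x. ennreal (norm (g x t)) \<partial>\<mu> i) \<partial>\<mu> l)"
      by (subst nn_integral_snd[symmetric]) (auto simp: split_beta')
    also have "\<dots> \<le> (\<integral>\<^sup>+t. ennreal (norm (f t * dens \<sigma> l j t / e)) \<partial>\<mu> l)"
    proof (rule nn_integral_mono_AE)
      show "AE t in \<mu> l. (\<integral>\<^sup>+x. ennreal (norm (g x t)) \<partial>\<mu> i) \<le> ennreal (norm (f t * dens \<sigma> l j t / e))"
        using AE_adj[OF adjs]
      proof eventually_elim
        case (elim t)
        have ng: "norm (g x t) = (\<bar>f t\<bar> / norm (z - of_real t)) * (\<bar>?d x\<bar> / \<bar>t - x\<bar>)" for x
          unfolding g_def by (simp add: norm_divide norm_mult abs_minus_commute abs_mult flip: of_real_diff)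
        have "(\<integral>\<^sup>+x. ennreal (norm (g x t)) \<partial>\<mu> i)
            = (\<integral>\<^sup>+x. ennreal (\<bar>f t\<bar> / norm (z - of_real t)) * ennreal (\<bar>?d x\<bar> / \<bar>t - x\<bar>) \<partial>\<mu> i)"
          unfolding ng by (intro nn_integral_cong ennreal_mult) auto
        also have "\<dots> = ennreal (\<bar>f t\<bar> / norm (z - of_real t)) * (\<integral>\<^sup>+x. ennreal (\<bar>?d x\<bar> / \<bar>t - x\<bar>) \<partial>\<mu> i)"
          by (rule nn_integral_cmult) measurable
        also have "(\<integral>\<^sup>+x. ennreal (\<bar>?d x\<bar> / \<bar>t - x\<bar>) \<partial>\<mu> i) = ennreal \<bar>dens \<sigma> l j t\<bar>"
          using nn_integral_dens[OF l j lj, of t] elim by (simp add: i_def)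
        also have "ennreal (\<bar>f t\<bar> / norm (z - of_real t)) * ennreal \<bar>dens \<sigma> l j t\<bar>
            \<le> ennreal (\<bar>f t\<bar> / e) * ennreal \<bar>dens \<sigma> l j t\<bar>"
        proof (intro mult_right_mono ennreal_leI divide_left_mono)
          have "e \<le> norm (z - of_real t)" using e(2) elim by blast
          then show "e \<le> norm (z - of_real t)" "0 < norm (z - of_real t) * e"
            using e(1) by (auto intro!: mult_pos_pos dest: less_le_trans simp del: zero_less_norm_iff)
        qed auto
        also have "\<dots> = ennreal (norm (f t * dens \<sigma> l j t / e))"
          using e(1) by (subst ennreal_mult[symmetric]) (auto simp: abs_mult)
        finally show ?case .
      qed
    qed
    also have "\<dots> < \<infinity>" using int e(1) by (subst integrable_iff_bounded[THEN iffD1, THEN conjunct2]) auto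
    finally show "(\<integral>\<^sup>+p. ennreal (norm (case p of (x, t) \<Rightarrow> g x t)) \<partial>(\<mu> i \<Otimes>\<^sub>M \<mu> l)) < \<infinity>" .
  qed measurable
  let ?e = "sm_sign (\<sigma> l)" and ?e' = "sm_sign (\<sigma> i)"
  have inner: "dens \<sigma> i j x *\<^sub>R T2 l f z (of_real x) = ?e *\<^sub>R (LINT t|\<mu> l. g x t)" for x
    unfolding T2_def g_def sm_integral_def by (simp only: scaleR_scaleR[symmetric] integral_scaleR_right) (simp add: mult.commute)
  show "integrable (\<mu> i) (\<lambda>x. dens \<sigma> i j x *\<^sub>R T2 l f z (of_real x))"
    unfolding inner using integrable_fst[OF gint] by simp
  have "sm_integral (\<sigma> i) (\<lambda>x. dens \<sigma> i j x *\<^sub>R T2 l f z (of_real x)) = ?e' *\<^sub>R ?e *\<^sub>R (LINT x|\<mu> i. LINT t|\<mu> l. g x t)"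
    unfolding inner sm_integral_def by (simp only: integral_scaleR_right)
  also have "(LINT x|\<mu> i. LINT t|\<mu> l. g x t) = (LINT t|\<mu> l. LINT x|\<mu> i. g x t)"
    using Fubini_integral[OF gint] by simp
  also have "\<dots> = (LINT t|\<mu> l. - ?e' *\<^sub>R ((f t * dens \<sigma> l j t) *\<^sub>R (1 / (z - of_real t))))"
  proof (rule integral_cong_AE)
    show "AE t in \<mu> l. (LINT x|\<mu> i. g x t) = - ?e' *\<^sub>R ((f t * dens \<sigma> l j t) *\<^sub>R (1 / (z - of_real t)))"
      using AE_adj[OF adjs]
    proof eventually_elim
      case (elim t)
      have "t \<notin> of_real ` \<Delta> i" using elim by simp
      from integrable_kernel[OF i integrable_dens[OF i j] this]
      have ik: "integrable (\<mu> i) (\<lambda>x. ?d x * (1 / (t - x)))" by simp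
      have "g x t = (?d x * (1 / (t - x))) *\<^sub>R (- f t *\<^sub>R (1 / (z - of_real t)))" for x
      proof -
        have "1 / ((z - of_real t) * (of_real x - of_real t)) = (1 / (t - x)) *\<^sub>R (- 1 / (z - of_real t))"
          by (simp add: scaleR_conv_of_real minus_divide_right[symmetric] divide_simps)
        then show ?thesis unfolding g_def by (simp only:) simp
      qed
      then have "(LINT x|\<mu> i. g x t) = (LINT x|\<mu> i. (?d x * (1 / (t - x))) *\<^sub>R (- f t *\<^sub>R (1 / (z - of_real t))))"
        by simp
      also have "\<dots> = (LINT x|\<mu> i. ?d x * (1 / (t - x))) *\<^sub>R (- f t *\<^sub>R (1 / (z - of_real t)))"
        by (rule integral_scaleR_left) (rule ik)
      also have "(LINT x|\<mu> i. ?d x * (1 / (t - x))) = ?e' * dens \<sigma> l j t"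
        using class_MD(1)[OF class_M_gen[OF i]] unfolding dens_conv[OF l j lj] i_def[symmetric] sm_integral_def by auto
      finally show ?case by (simp add: mult_ac)
    qed
  qed measurable
  also have "\<dots> = - ?e' *\<^sub>R (LINT t|\<mu> l. (f t * dens \<sigma> l j t) *\<^sub>R (1 / (z - of_real t)))"
    by (rule integral_scaleR_right)
  finally show "sm_integral (\<sigma> i) (\<lambda>x. dens \<sigma> i j x *\<^sub>R T2 l f z (of_real x)) = - T l (\<lambda>t. f t * dens \<sigma> l j t) z"
    using class_MD(1)[OF class_M_gen[OF i]] by (auto simp: T_def sm_integral_def)
qed

text \<open>For measures \<alpha> and \<beta> the product of the Cauchy transforms is the sum of the
  transforms of \<langle>\<alpha>, \<beta>\<rangle> and \<langle>\<beta>, \<alpha>\<rangle>; here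
  \<alpha> has density \<open>f\<close> and \<beta> is \<open>nik \<sigma> i j\<close>. Replacing
  \<open>T l f x\<close> by its value at \<open>z\<close> plus a divided difference reduces this to
  \<open>T2_fubini\<close>.\<close>

lemma T_product:
  fixes z :: complex
  assumes l: "l \<in> {1..m}" and j: "j \<in> {1..m}" and lj: "l \<noteq> j" and f: "f \<in> borel_measurable borel" "integrable (\<mu> l) f"
    and int: "integrable (\<mu> l) (\<lambda>t. f t * dens \<sigma> l j t)"
    and z: "z \<notin> of_real ` \<Delta> l" "z \<notin> of_real ` \<Delta> (step l j)"
  defines "i \<equiv> step l j"
  shows "T l f z * T i (dens \<sigma> i j) z = T i (\<lambda>x. dens \<sigma> i j x * T l f x) z + T l (\<lambda>t. f t * dens \<sigma> l j t) z"
proof -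
  have i: "i \<in> {1..m}" unfolding i_def by (rule step_in[OF l j lj])
  have adjs: "adj i l" unfolding i_def by (rule adj_sym[OF adj_step[OF l j lj]])
  let ?d = "dens \<sigma> i j :: real \<Rightarrow> real"
  have zi: "z \<notin> of_real ` \<Delta> i" using z i_def by simp
  note Q = T2_fubini[OF l j lj f(1) int z(1), folded i_def]
  have ik: "integrable (\<mu> i) (\<lambda>x. ?d x *\<^sub>R (1 / (z - of_real x)))"
    by (rule integrable_kernel[OF i integrable_dens[OF i j] zi])
  have ae: "AE x in \<mu> i. (?d x * T l f x) *\<^sub>R (1 / (z - of_real x))
      = ?d x *\<^sub>R T2 l f z (of_real x) + T l f z * (?d x *\<^sub>R (1 / (z - of_real x)))"
    using AE_adj[OF adjs]
  proof eventually_elim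
    case (elim x)
    have x: "complex_of_real x \<notin> of_real ` \<Delta> l" using elim by auto
    have nz: "z - of_real x \<noteq> 0" using zi elim by auto
    define k where "k = 1 / (z - of_real x)"
    have T2: "T2 l f z (of_real x) = (of_real (T l f x) - T l f z) * k"
      using T2_mult[OF l f(2) z(1) x] nz by (simp add: T_of_real field_simps k_def)
    show ?case unfolding T2 k_def[symmetric] by (simp add: scaleR_conv_of_real algebra_simps)
  qed
  have "T i (\<lambda>x. ?d x * T l f x) z = sm_sign (\<sigma> i) *\<^sub>R (LINT x|\<mu> i. ?d x *\<^sub>R T2 l f z (of_real x) + T l f z * (?d x *\<^sub>R (1 / (z - of_real x))))"
    unfolding T_def[of i] sm_integral_def
  proof (rule arg_cong[where f = "scaleR _"], rule integral_cong_AE)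
    have [measurable_cong]: "sets (\<mu> i) = sets borel" using sets_\<mu> i by blast
    have "integrable (\<mu> i) (\<lambda>x. ?d x *\<^sub>R T2 l f z (of_real x) + T l f z * (?d x *\<^sub>R (1 / (z - of_real x))))"
      by (intro Bochner_Integration.integrable_add Q(1) integrable_mult_right ik)
    then show "(\<lambda>x. ?d x *\<^sub>R T2 l f z (of_real x) + T l f z * (?d x *\<^sub>R (1 / (z - of_real x)))) \<in> borel_measurable (\<mu> i)"
      by (rule borel_measurable_integrable)
    interpret sigma_finite_measure "\<mu> l" by (rule sigma_finite_\<mu>[OF l])
    have [measurable]: "f \<in> borel_measurable borel" by (rule f)
    have [measurable_cong]: "sets (\<mu> l) = sets borel" using sets_\<mu> l by blast
    have [measurable]: "(\<lambda>x. T l f x :: real) \<in> borel_measurable borel"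
      unfolding T_def sm_integral_def by measurable
    have [measurable]: "?d \<in> borel_measurable borel" using measurable_dens i j by blast
    show "(\<lambda>x. (?d x * T l f x) *\<^sub>R (1 / (z - of_real x))) \<in> borel_measurable (\<mu> i)"
      by measurable
  qed (rule ae)
  also have "\<dots> = sm_integral (\<sigma> i) (\<lambda>x. ?d x *\<^sub>R T2 l f z (of_real x)) + T l f z * T i (dens \<sigma> i j) z"
    unfolding sm_integral_def T_def[of i]
    by (subst Bochner_Integration.integral_add[OF Q(1) integrable_mult_right[OF ik]])
       (subst integral_mult_right_zero, simp only: scaleR_add_right mult_scaleR_right)
  finally show ?thesis unfolding Q(2) by simp
qed

text \<open>By \<open>T_product\<close> each summand with l < k splits as E l + E (l + 1), so the
  alternating sum telescopes and its last summand cancels E k. A nonreal \<open>z\<close> avoids all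
  the intervals at once.\<close>

lemma dens_identity:
  fixes z :: complex
  assumes z: "z \<notin> \<real>" and jk: "1 \<le> j" "j \<le> k" "k \<le> m"
  shows "(\<Sum>l=j..k. (-1) ^ l * (T l (dens \<sigma> l j) z * dens \<sigma> l k z)) = (-1) ^ j * T j (dens \<sigma> j k) z"
proof -
  define E where "E l = T l (\<lambda>x. dens \<sigma> l j x * dens \<sigma> l k x) z" for l
  have zn: "z \<notin> of_real ` \<Delta> i" for i using z by auto
  have tele: "T l (dens \<sigma> l j) z * dens \<sigma> l k z = E l + E (Suc l)" if l: "j \<le> l" "l < k" for l
  proof -
    have in1: "l \<in> {1..m}" "Suc l \<in> {1..m}" "j \<in> {1..m}" "k \<in> {1..m}" using l jk by auto
    have st: "step (Suc l) j = l" "step l k = Suc l" using l by (auto simp: step_def)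
    have ip: "integrable (\<mu> (Suc l)) (\<lambda>t. dens \<sigma> (Suc l) k t * dens \<sigma> (Suc l) j t)"
      using integrable_dens_pair[of j "Suc l" k] l jk by (simp add: mult.commute)
    have "T (Suc l) (dens \<sigma> (Suc l) k) z * T l (dens \<sigma> l j) z
        = T l (\<lambda>x. dens \<sigma> l j x * T (Suc l) (dens \<sigma> (Suc l) k) x) z + T (Suc l) (\<lambda>t. dens \<sigma> (Suc l) k t * dens \<sigma> (Suc l) j t) z"
      using T_product[OF in1(2,3) _ measurable_dens[OF in1(2,4)] integrable_dens[OF in1(2,4)] ip zn zn] l st by simp
    moreover have "dens \<sigma> l k = (T (Suc l) (dens \<sigma> (Suc l) k) :: real \<Rightarrow> real)"
      "dens \<sigma> l k = (T (Suc l) (dens \<sigma> (Suc l) k) :: complex \<Rightarrow> complex)"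
      using dens_T[OF in1(1,4)] l st by simp_all
    ultimately show ?thesis by (simp add: E_def mult.commute)
  qed
  have part: "(\<Sum>l=j..<n. (-1) ^ l * (T l (dens \<sigma> l j) z * dens \<sigma> l k z)) = (-1) ^ j * E j - (-1) ^ n * E n"
    if "j \<le> n" "n \<le> k" for n
    using that
  proof (induction n rule: dec_induct)
    case (step n)
    then have "(\<Sum>l=j..<Suc n. (-1) ^ l * (T l (dens \<sigma> l j) z * dens \<sigma> l k z))
        = (-1) ^ j * E j - (-1) ^ n * E n + (-1) ^ n * (T n (dens \<sigma> n j) z * dens \<sigma> n k z)"
      by simp
    also have "T n (dens \<sigma> n j) z * dens \<sigma> n k z = E n + E (Suc n)"
      by (rule tele) (use step in auto)
    finally show ?case by (simp add: algebra_simps)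
  qed simp
  have "{j..k} = insert k {j..<k}" using jk by auto
  then have "(\<Sum>l=j..k. (-1) ^ l * (T l (dens \<sigma> l j) z * dens \<sigma> l k z))
      = (-1) ^ k * (T k (dens \<sigma> k j) z * dens \<sigma> k k z) + ((-1) ^ j * E j - (-1) ^ k * E k)"
    using part[of k] jk by simp
  then show ?thesis by (simp add: E_def)
qed

end

section \<open>Zeros of the linear forms\<close>

lemma lead_coeff_nodal: "coeff (nodal Z) (card Z) = 1"
proof -
  have "lead_coeff (nodal Z) = 1" unfolding nodal_def by (simp add: lead_coeff_prod)
  then show ?thesis by (simp add: degree_nodal)
qed

lemma obtain_finite_subset_card:
  assumes "infinite A \<or> N \<le> card A"
  obtains B where "B \<subseteq> A" "finite B" "card B = N"
proof (cases "finite A")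
  case True
  then obtain B where "B \<subseteq> A" "card B = N"
    using assms obtain_subset_with_card_n by blast
  then show thesis using that True finite_subset by blast
next
  case False
  then show thesis using infinite_arbitrarily_large[of A N] that by blast
qed

text \<open>The sum is the top coefficient of the Lagrange interpolant of \<open>p\<close>, which is
  \<open>p\<close> itself.\<close>

lemma divided_difference_nodal:
  assumes "finite Z" "Z \<noteq> {}" "degree p < card Z - 1"
  shows "(\<Sum>z\<in>Z. poly p z / poly (nodal (Z - {z})) z) = 0"
proof -
  have "degree p < card Z" using assms(3) by simp
  then have "coeff p (card Z - 1) = coeff (\<Sum>z\<in>Z. smult (poly p z) (lagr Z z)) (card Z - 1)"
    using lagrange_interpolation[OF assms(1)] by metis
  also have "\<dots> = (\<Sum>z\<in>Z. poly p z * (inverse (poly (nodal (Z - {z})) z) * coeff (nodal (Z - {z})) (card Z - 1)))"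
    by (simp add: coeff_sum lagr_def mult.assoc)
  also have "\<dots> = (\<Sum>z\<in>Z. poly p z / poly (nodal (Z - {z})) z)"
  proof (rule sum.cong[OF refl])
    fix z assume "z \<in> Z"
    then have "card Z - 1 = card (Z - {z})" using assms(1) by simp
    then show "poly p z * (inverse (poly (nodal (Z - {z})) z) * coeff (nodal (Z - {z})) (card Z - 1))
      = poly p z / poly (nodal (Z - {z})) z" by (simp only: lead_coeff_nodal) (simp add: field_simps)
  qed
  finally show ?thesis using coeff_eq_0[OF assms(3)] by simp
qed

lemma degree_less_coeff_0:
  "coeff p n = 0 \<Longrightarrow> degree p \<le> n \<Longrightarrow> 0 < n \<Longrightarrow> degree p < n" for p :: "real poly"
  by (cases "degree p = n") auto

text \<open>Expansion of the difference quotient of \<open>nodal X\<close> in the basis of the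
  products \<open>nodal (X - {y})\<close>; integrated over x it will show the quadrature weights as
  residues. Both sides agree on \<open>X\<close> and are monic of degree \<open>card X\<close>, the
  latter because the Lagrange polynomials add up to 1.\<close>

lemma nodal_difference_quotient:
  assumes X: "finite X" "X \<noteq> {}"
  shows "[:- x, 1:] * (\<Sum>y\<in>X. smult (poly (lagr X y) x) (nodal (X - {y}))) = nodal X - [:poly (nodal X) x:]"
proof -
  have val: "(y - x) * (poly (lagr X y) x * poly (nodal (X - {y})) y) = - poly (nodal X) x" if y: "y \<in> X" for y
  proof -
    have nz: "poly (nodal (X - {y})) y \<noteq> 0" using X(1) by (simp add: poly_nodal_eq_0_iff)
    have "poly (nodal X) x = (x - y) * poly (nodal (X - {y})) x"
      unfolding nodal_remove[OF X(1) y] by (simp add: algebra_simps)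
    then show ?thesis using nz by (simp add: lagr_def field_simps)
  qed
  let ?Q = "\<Sum>y\<in>X. smult (poly (lagr X y) x) (nodal (X - {y}))"
  have Qy: "poly ?Q y = poly (lagr X y) x * poly (nodal (X - {y})) y" if y: "y \<in> X" for y
  proof -
    have "poly ?Q y = (\<Sum>y'\<in>X. if y' = y then poly (lagr X y) x * poly (nodal (X - {y})) y else 0)"
      unfolding poly_sum poly_smult
      by (rule sum.cong[OF refl]) (use X(1) y in \<open>auto simp: poly_nodal_eq_0_iff\<close>)
    then show ?thesis using X(1) y by simp
  qed
  let ?D = "[:- x, 1:] * ?Q - (nodal X - [:poly (nodal X) x:])"
  have zero: "poly ?D y = 0" if "y \<in> X" for y
    using val[OF that] Qy[OF that] X(1) that by (simp add: poly_nodal_eq_0_iff left_diff_distrib)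
  then have "nodal X dvd ?D" by (intro nodal_dvd X(1))
  then obtain r where r: "?D = nodal X * r" by (rule dvdE)
  obtain N where N: "card X = Suc N" using X by (metis card_gt_0_iff gr0_implies_Suc)
  have cN: "card (X - {y}) = N" if "y \<in> X" for y using N X(1) that by simp
  have sum1: "(\<Sum>y\<in>X. poly (lagr X y) x) = 1"
  proof -
    have "degree (1 :: real poly) < card X" using N by simp
    from arg_cong[OF lagrange_interpolation[OF X(1) this], of "\<lambda>p. poly p x"] show ?thesis
      by (simp add: poly_sum)
  qed
  have dQ: "degree ?Q \<le> N"
    by (rule degree_sum_le[OF X(1)]) (use cN in \<open>auto intro!: order_trans[OF degree_smult_le] simp: degree_nodal\<close>)
  have "coeff ?Q N = (\<Sum>y\<in>X. poly (lagr X y) x)"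
    unfolding coeff_sum coeff_smult
    by (rule sum.cong[OF refl]) (use cN lead_coeff_nodal in \<open>metis mult.right_neutral\<close>)
  then have Q1: "coeff ?Q N = 1" using sum1 by simp
  have Q0: "coeff ?Q (Suc N) = 0" by (rule coeff_eq_0) (use dQ in simp)
  have "coeff ?D (card X) = 0"
    using Q1 Q0 lead_coeff_nodal[of X] unfolding N by simp
  moreover have "degree ?D \<le> card X"
  proof (intro degree_diff_le)
    show "degree ([:- x, 1:] * ?Q) \<le> card X"
      using degree_mult_le[of "[:- x, 1:]" ?Q] dQ N by simp
  qed (auto simp: degree_nodal)
  moreover have "0 < card X" using N by simp
  ultimately have "degree ?D < card X" by (rule degree_less_coeff_0)
  then have "?D = 0" unfolding r using degree_mult_eq[OF nodal_nonzero, of r X] by (cases "r = 0") (auto simp: degree_nodal)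
  then show ?thesis by simp
qed

text \<open>If there were fewer than \<open>card Z - 1\<close> zeros, a polynomial changing sign with \<open>D\<close> would have a
  nonzero divided difference of too high an order.\<close>

lemma alternating_zeros:
  fixes D :: "real \<Rightarrow> real"
  assumes Z: "finite Z" "Z \<noteq> {}" "Z \<subseteq> S" and S: "is_interval S" "continuous_on S D"
    and alt: "\<And>z. z \<in> Z \<Longrightarrow> c * D z * poly (nodal (Z - {z})) z > 0"
  shows "\<exists>W\<subseteq>S. finite W \<and> card W = card Z - 1 \<and> (\<forall>w\<in>W. D w = 0)"
proof (cases "finite {x \<in> S. D x = 0} \<and> card {x \<in> S. D x = 0} < card Z - 1")
  case False
  then have "infinite {x \<in> S. D x = 0} \<or> card Z - 1 \<le> card {x \<in> S. D x = 0}" by auto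
  then obtain W where "W \<subseteq> {x \<in> S. D x = 0}" "finite W" "card W = card Z - 1"
    by (rule obtain_finite_subset_card)
  then show ?thesis by blast
next
  case True
  then obtain Y e where Y: "Y \<subseteq> {x \<in> S. D x = 0}" and e: "e \<in> {1, -1}"
      and pos: "\<And>x. x \<in> S \<Longrightarrow> e * D x * poly (nodal Y) x \<ge> 0"
    using sign_pattern[OF S] by blast
  have fY: "finite Y" using Y True finite_subset by blast
  have "card Y \<le> card {x \<in> S. D x = 0}" using Y True by (intro card_mono) auto
  then have dY: "degree (nodal Y) < card Z - 1" using True by (simp add: degree_nodal)
  have term_pos: "(e * c) * (poly (nodal Y) z / poly (nodal (Z - {z})) z) > 0" if z: "z \<in> Z" for z
  proof -
    define u where "u = poly (nodal Y) z"
    define v where "v = poly (nodal (Z - {z})) z"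
    have 1: "c * D z * v > 0" using alt[OF z] by (simp add: v_def)
    then have nz: "D z \<noteq> 0" "v \<noteq> 0" by auto
    then have "z \<notin> Y" using Y by auto
    then have "u \<noteq> 0" unfolding u_def using fY by (simp add: poly_nodal_eq_0_iff)
    moreover have "e * D z * u \<ge> 0" using pos z Z(3) unfolding u_def by blast
    ultimately have 2: "e * D z * u > 0" using nz e by (auto simp: less_le)
    \<comment> \<open>Multiplication by squares turns the quotient into a product of two expressions
      already known to be positive.\<close>
    have "(e * c * (u / v)) * ((D z)\<^sup>2 * v\<^sup>2) = (e * D z * u) * (c * D z * v)"
      using nz by (simp add: power2_eq_square)
    also have "\<dots> > 0" using 1 2 by (rule mult_pos_pos[rotated])
    finally have "0 < (e * c * (u / v)) * ((D z)\<^sup>2 * v\<^sup>2)" .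
    moreover have "(D z)\<^sup>2 * v\<^sup>2 > 0" using nz by simp
    ultimately show ?thesis unfolding u_def[symmetric] v_def[symmetric] by (rule zero_less_mult_pos2)
  qed
  have "0 < (\<Sum>z\<in>Z. (e * c) * (poly (nodal Y) z / poly (nodal (Z - {z})) z))"
    by (rule sum_pos[OF Z(1,2) term_pos])
  also have "\<dots> = 0"
    using divided_difference_nodal[OF Z(1,2) dY] by (simp only: sum_distrib_left[symmetric] mult_zero_right)
  finally show ?thesis by simp
qed

text \<open>With fewer than \<open>N\<close> sign changes, \<open>nodal Z\<close> would be an
  admissible test polynomial making the integrand of constant sign, so a zero integral would force
  \<open>f\<close> to vanish almost everywhere.\<close>

lemma orthogonal_sign_changes:
  fixes f :: "real \<Rightarrow> real"
  assumes S: "is_interval S" "continuous_on S f" "finite {x \<in> S. f x = 0}" and AE: "AE x in M. x \<in> S"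
    and sets: "sets M = sets borel"
    and orth: "\<And>q. degree q < N \<Longrightarrow> integrable M (\<lambda>x. poly q x * f x) \<and> (LINT x|M. poly q x * f x) = 0"
    and nz: "\<not> (AE x in M. f x = 0)"
  shows "\<exists>Z\<subseteq>{x \<in> S. f x = 0}. N \<le> card Z \<and> (\<exists>e\<in>{1, -1}. \<forall>x\<in>S. e * f x * poly (nodal Z) x \<ge> 0)"
proof -
  obtain Z e where Z: "Z \<subseteq> {x \<in> S. f x = 0}" "e \<in> {1, -1}" "\<And>x. x \<in> S \<Longrightarrow> e * f x * poly (nodal Z) x \<ge> 0"
    using sign_pattern[OF S] by blast
  have fZ: "finite Z" using Z(1) S(3) finite_subset by blast
  have "N \<le> card Z"
  proof (rule ccontr)
    assume "\<not> N \<le> card Z"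
    then have "degree (nodal Z) < N" by (simp add: degree_nodal)
    from orth[OF this] have o: "integrable M (\<lambda>x. poly (nodal Z) x * f x)" "(LINT x|M. poly (nodal Z) x * f x) = 0"
      by auto
    have "AE x in M. e * (poly (nodal Z) x * f x) = 0"
    proof (rule integral_nonneg_eq_0_iff_AE[THEN iffD1])
      show "integrable M (\<lambda>x. e * (poly (nodal Z) x * f x))" using o(1) by auto
      show "AE x in M. 0 \<le> e * (poly (nodal Z) x * f x)"
        using AE by eventually_elim (use Z(3) in \<open>simp add: mult_ac\<close>)
      show "(LINT x|M. e * (poly (nodal Z) x * f x)) = 0" using o(2) by simp
    qed
    then have "AE x in M. f x = 0"
    proof eventually_elim
      case (elim x)
      then show ?case using Z(1,2) fZ by (auto simp: poly_nodal_eq_0_iff)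
    qed
    with nz show False by blast
  qed
  then show ?thesis using Z by blast
qed

lemma integrable_div_nodal_gen:
  assumes M: "sets M = sets borel" "closed C" "AE x in M. x \<in> C" and g: "integrable M (g :: real \<Rightarrow> real)"
    and W: "finite W" "W \<inter> C = {}"
  shows "integrable M (\<lambda>x. g x / poly (nodal W) x)"
  using W
proof (induction W rule: finite_induct)
  case empty
  then show ?case using g by (simp add: nodal_def)
next
  case (insert w W)
  then have "integrable M (\<lambda>x. g x / poly (nodal W) x)" by auto
  note int = this
  have "w \<notin> of_real ` C" using insert by auto
  then obtain e where e: "e > 0" "\<And>x. x \<in> C \<Longrightarrow> e \<le> norm (w - of_real x)"
    by (rule closed_of_real_dist[OF M(2)]) metis
  have "integrable M (\<lambda>x. (g x / poly (nodal W) x) *\<^sub>R (1 / (w - of_real x)))"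
    by (rule integrable_cauchy_kernel[OF M(1) int M(3) e])
  then have "integrable M (\<lambda>x. - ((g x / poly (nodal W) x) *\<^sub>R (1 / (w - of_real x))))"
    by (rule integrable_minus)
  moreover have "- ((g x / poly (nodal W) x) *\<^sub>R (1 / (w - of_real x))) = g x / poly (nodal (insert w W)) x" for x
  proof -
    have "poly (nodal (insert w W)) x = (x - w) * poly (nodal W) x"
      using insert by (simp add: nodal_insert algebra_simps)
    moreover have "1 / (w - x) = - (1 / (x - w))" by (simp add: minus_divide_right)
    ultimately show ?thesis by simp
  qed
  ultimately show ?case by (simp only:)
qed

lemma synthetic_div_poly: "poly p x = poly p c + (x - c) * poly (synthetic_div p c) x" for x :: real
  using arg_cong[OF synthetic_div_correct'[of c p], of "\<lambda>q. poly q x"] by (simp add: algebra_simps)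

text \<open>The alternative \<open>= 0\<close> is what remains for n = 0. The same disjunction
  reappears in \<open>quasi_orth\<close>, where for n = 1 no degree is below n - 1.\<close>

lemma degree_synthetic_div_less:
  assumes "degree p \<le> n"
  shows "synthetic_div p c = 0 \<or> degree (synthetic_div p c) < n"
  using assms by (metis degree_0 degree_synthetic_div diff_less gr0I le_less_trans less_le_trans less_numeral_extra(1)
      order.strict_iff_order synthetic_div_eq_0_iff diff_0_eq_0)

section \<open>Zeros on one interval as orthogonality on the next\<close>

context nikishin_system
begin

text \<open>On this set the transforms over the next interval are continuous, and zeros found here
  lie off \<open>\<Delta> (Suc l)\<close>, so one may divide by their nodal polynomial
  there.\<close>

definition S :: "nat \<Rightarrow> real set" where
  "S l = \<Delta> l - (if l < m then \<Delta> (Suc l) else {})"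

lemma S_subset: "S l \<subseteq> \<Delta> l" by (auto simp: S_def)

lemma S_disjoint: "l < m \<Longrightarrow> x \<in> S l \<Longrightarrow> x \<notin> \<Delta> (Suc l)"
  by (simp add: S_def)

lemma AE_S: "l \<in> {1..m} \<Longrightarrow> AE x in \<mu> l. x \<in> S l"
proof (cases "l < m")
  case True
  assume "l \<in> {1..m}"
  with True have "adj l (Suc l)" by (auto simp: adj_def)
  from AE_adj[OF this] show ?thesis using True by (simp add: S_def)
qed (use AE_\<Delta> in \<open>auto simp: S_def\<close>)

text \<open>By separation the common point can only be an endpoint of
  \<open>\<Delta> l\<close>.\<close>

lemma S_interval:
  assumes l: "l \<in> {1..m}"
  shows "is_interval (S l)"
proof (cases "l < m")
  case True
  with l have "adj l (Suc l)" by (auto simp: adj_def)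
  then obtain p where p: "\<Delta> l \<subseteq> {..p} \<and> \<Delta> (Suc l) \<subseteq> {p..} \<or> \<Delta> l \<subseteq> {p..} \<and> \<Delta> (Suc l) \<subseteq> {..p}"
    by (rule adj_separated)
  show ?thesis unfolding is_interval_1
  proof (intro ballI allI impI, elim conjE)
    fix a b x assume *: "a \<in> S l" "b \<in> S l" "a \<le> x" "x \<le> b"
    have ab: "a \<in> \<Delta> l" "b \<in> \<Delta> l" "a \<notin> \<Delta> (Suc l)" "b \<notin> \<Delta> (Suc l)"
      using * True by (auto simp: S_def)
    then have x: "x \<in> \<Delta> l" using nikishin_interval[OF l] * unfolding is_interval_1 by blast
    moreover have "x \<notin> \<Delta> (Suc l)"
    proof
      assume "x \<in> \<Delta> (Suc l)"
      with p ab have "(b \<le> p \<and> p \<le> x) \<or> (p \<le> a \<and> x \<le> p)" by blast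
      with * have "x = a \<or> x = b" by linarith
      then show False using ab \<open>x \<in> \<Delta> (Suc l)\<close> by auto
    qed
    ultimately show "x \<in> S l" using True by (simp add: S_def)
  qed
next
  case False
  then show ?thesis using nikishin_interval[OF l] by (simp add: S_def)
qed

lemma finite_\<Delta>_minus_S:
  assumes l: "l \<in> {1..m}"
  shows "finite (\<Delta> l - S l)"
proof (cases "l < m")
  case True
  with l have "adj l (Suc l)" by (auto simp: adj_def)
  from adj_inter[OF this] obtain x where "\<Delta> l \<inter> \<Delta> (Suc l) \<subseteq> {x}" by blast
  moreover have "\<Delta> l - S l = \<Delta> l \<inter> \<Delta> (Suc l)" using True by (auto simp: S_def)
  ultimately show ?thesis by (simp add: finite_subset)
qed (simp add: S_def)

lemma infinite_S: "l \<in> {1..m} \<Longrightarrow> infinite (S l)"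
  using finite_\<Delta>_minus_S infinite_\<Delta> finite_Diff2 by metis

text \<open>Continuity spreads almost everywhere vanishing to every support point in
  \<open>S l\<close>, and only finitely many support points lie outside \<open>S l\<close>. Used to
  refute vanishing when there are finitely many zeros.\<close>

lemma AE_zero_infinite_zeros:
  assumes l: "l \<in> {1..m}" and s: "s \<in> class_M (\<Delta> l)"
    and cont: "\<And>x. x \<in> S l \<Longrightarrow> isCont f x" and AE: "AE x in sm_var s. f x = (0::real)"
  shows "infinite {x \<in> S l. f x = 0}"
proof -
  note M = class_MD[OF s]
  have "f x = 0" if x: "x \<in> sm_support s" "x \<in> S l" for x
  proof (rule ccontr)
    assume nz: "f x \<noteq> 0"
    have "\<forall>\<^sub>F y in nhds x. f y \<noteq> 0"
      using cont[OF x(2)] nz unfolding isCont_def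
      by (metis tendsto_at_iff_tendsto_nhds tendsto_imp_eventually_ne)
    then obtain U where U: "open U" "x \<in> U" "\<And>y. y \<in> U \<Longrightarrow> f y \<noteq> 0"
      unfolding eventually_nhds by blast
    have "AE y in sm_var s. y \<notin> U" using AE by eventually_elim (use U(3) in blast)
    then have "emeasure (sm_var s) U = 0"
      using U(1) M(2,3) by (subst (asm) AE_iff_measurable[of U]) auto
    then show False using x(1) U(1,2) by (auto simp: sm_support_def)
  qed
  then have "sm_support s \<inter> S l \<subseteq> {x \<in> S l. f x = 0}" by auto
  moreover have "infinite (sm_support s \<inter> S l)"
  proof
    assume "finite (sm_support s \<inter> S l)"
    moreover have "sm_support s \<subseteq> (sm_support s \<inter> S l) \<union> (\<Delta> l - S l)" using M(5) by auto
    ultimately have "finite (sm_support s)" using finite_\<Delta>_minus_S[OF l] finite_subset by blast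
    then show False using M(4) by blast
  qed
  ultimately show ?thesis using finite_subset by blast
qed

lemma integrable_div_nodal:
  assumes l: "l \<in> {1..m}" and g: "integrable (\<mu> l) g" and W: "finite W" "W \<inter> \<Delta> l = {}"
  shows "integrable (\<mu> l) (\<lambda>x. g x / poly (nodal W) x)"
  by (rule integrable_div_nodal_gen[OF sets_\<mu>[OF l] closed_\<Delta>[OF l] AE_\<Delta>[OF l] g W])

text \<open>Partial fractions: \<open>q\<close> over \<open>nodal Z\<close> is a combination of 1/(x
  - z), and each of these integrates against \<open>g\<close> to a multiple of
  \<open>T l g z\<close>, which is 0.\<close>

lemma zeros_orthogonality:
  assumes l: "l \<in> {1..m}" and g: "integrable (\<mu> l) g" and Z: "finite Z" "Z \<inter> \<Delta> l = {}"
    and zero: "\<And>z. z \<in> Z \<Longrightarrow> T l g z = (0::real)" and q: "degree q < card Z"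
  shows "sm_integral (\<sigma> l) (\<lambda>x. poly q x * g x / poly (nodal Z) x) = 0"
proof -
  define c where "c z = poly q z * inverse (poly (nodal (Z - {z})) z)" for z
  have eq: "poly q x * g x / poly (nodal Z) x = (\<Sum>z\<in>Z. - c z * (g x *\<^sub>R (1 / (z - of_real x))))"
    if "x \<in> \<Delta> l" for x
  proof -
    have xZ: "x \<notin> Z" using that Z(2) by auto
    have nz: "poly (nodal Z) x \<noteq> 0" using xZ Z(1) by (simp add: poly_nodal_eq_0_iff)
    have "poly q x = (\<Sum>z\<in>Z. poly q z * poly (lagr Z z) x)"
      using arg_cong[OF lagrange_interpolation[OF Z(1) q], of "\<lambda>p. poly p x"] by (simp add: poly_sum)
    also have "\<dots> = (\<Sum>z\<in>Z. c z * poly (nodal (Z - {z})) x)"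
      by (simp add: lagr_def c_def mult.assoc)
    also have "\<dots> = (\<Sum>z\<in>Z. c z / (x - z)) * poly (nodal Z) x"
      unfolding sum_distrib_right
    proof (rule sum.cong[OF refl])
      fix z assume z: "z \<in> Z"
      have "poly (nodal Z) x = (x - z) * poly (nodal (Z - {z})) x"
        unfolding nodal_remove[OF Z(1) z] by (simp add: algebra_simps)
      then show "c z * poly (nodal (Z - {z})) x = c z / (x - z) * poly (nodal Z) x"
        using z xZ by auto
    qed
    finally have "poly q x / poly (nodal Z) x = (\<Sum>z\<in>Z. c z / (x - z))" using nz by simp
    then have "poly q x * g x / poly (nodal Z) x = (\<Sum>z\<in>Z. c z / (x - z)) * g x"
      by (metis times_divide_eq_left)
    also have "\<dots> = (\<Sum>z\<in>Z. - c z * (g x *\<^sub>R (1 / (z - of_real x))))"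
      unfolding sum_distrib_right
    proof (rule sum.cong[OF refl])
      fix z
      have "c z / (x - z) = - c z * (1 / (z - x))" by (cases "x = z") (auto simp: field_simps)
      then show "c z / (x - z) * g x = - c z * (g x *\<^sub>R (1 / (z - of_real x)))" by simp
    qed
    finally show ?thesis .
  qed
  have ik: "integrable (\<mu> l) (\<lambda>x. g x *\<^sub>R (1 / (z - of_real x)))" if "z \<in> Z" for z :: real
    using integrable_kernel[OF l g, of z] that Z(2) by auto
  have [measurable_cong]: "sets (\<mu> l) = sets borel" using sets_\<mu> l by blast
  have [measurable]: "g \<in> borel_measurable (\<mu> l)" using g by auto
  have "(LINT x|\<mu> l. poly q x * g x / poly (nodal Z) x) = (LINT x|\<mu> l. (\<Sum>z\<in>Z. - c z * (g x *\<^sub>R (1 / (z - of_real x)))))"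
  proof (rule integral_cong_AE)
    show "AE x in \<mu> l. poly q x * g x / poly (nodal Z) x = (\<Sum>z\<in>Z. - c z * (g x *\<^sub>R (1 / (z - of_real x))))"
      using AE_\<Delta>[OF l] by eventually_elim (rule eq)
  qed measurable
  also have "\<dots> = (\<Sum>z\<in>Z. - c z * (LINT x|\<mu> l. g x *\<^sub>R (1 / (z - of_real x))))"
  proof (subst Bochner_Integration.integral_sum)
    show "integrable (\<mu> l) (\<lambda>x. - c z * (g x *\<^sub>R (1 / (z - of_real x))))" if "z \<in> Z" for z
      using ik[OF that] by (intro integrable_mult_right)
  qed (simp only: integral_mult_right_zero)
  finally have "sm_integral (\<sigma> l) (\<lambda>x. poly q x * g x / poly (nodal Z) x) = (\<Sum>z\<in>Z. - c z * T l g z)"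
    by (simp only: sm_integral_def T_def real_scaleR_def sum_distrib_left mult.left_commute)
  then show ?thesis using zero by simp
qed

lemma nodal_sign:
  assumes "adj l k" "finite Z" "Z \<subseteq> \<Delta> l" "Z \<inter> \<Delta> k = {}"
  obtains e :: real where "e \<in> {1, -1}" "\<And>x. x \<in> \<Delta> k \<Longrightarrow> e * poly (nodal Z) x > 0"
proof -
  obtain e :: real where e: "e \<in> {1, -1}" "\<And>x t. x \<in> \<Delta> k \<Longrightarrow> t \<in> \<Delta> l \<Longrightarrow> \<bar>x - t\<bar> = e * (x - t)"
    by (rule adj_sign[OF adj_sym[OF assms(1)]]) metis
  have "e ^ card Z * poly (nodal Z) x > 0" if x: "x \<in> \<Delta> k" for x
  proof -
    have "e ^ card Z * poly (nodal Z) x = (\<Prod>z\<in>Z. e * (x - z))"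
      by (simp add: poly_nodal prod.distrib)
    also have "\<dots> = (\<Prod>z\<in>Z. \<bar>x - z\<bar>)"
      by (rule prod.cong[OF refl]) (use e(2)[OF x] assms(3) in auto)
    also have "\<dots> > 0" by (rule prod_pos) (use assms(4) x in auto)
    finally show ?thesis .
  qed
  moreover have "e ^ card Z \<in> {1, -1}" using e(1) by (cases "even (card Z)") auto
  ultimately show thesis using that by blast
qed

end

section \<open>Real polynomials evaluated at complex points\<close>

lemma poly_map_of_real_real [simp]: "poly (map_poly of_real p) (x :: real) = poly p x"
proof -
  have "map_poly (of_real :: real \<Rightarrow> real) p = p" by (rule poly_eqI) (simp add: coeff_map_poly)
  then show ?thesis by simp
qed

lemma poly_map_of_real: "poly (map_poly of_real p) (of_real x :: complex) = of_real (poly p x)"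
  by (induction p) (auto simp: map_poly_pCons)

abbreviation cp :: "real poly \<Rightarrow> complex \<Rightarrow> complex" where
  "cp p z \<equiv> poly (map_poly of_real p) z"

lemma map_poly_of_real_add: "map_poly of_real (p + q) = (map_poly of_real p + map_poly of_real q :: complex poly)"
  by (rule poly_eqI) (simp add: coeff_map_poly)

lemma map_poly_of_real_diff: "map_poly of_real (p - q) = (map_poly of_real p - map_poly of_real q :: complex poly)"
  by (rule poly_eqI) (simp add: coeff_map_poly)

lemma map_poly_of_real_smult: "map_poly of_real (smult c p) = (smult (of_real c) (map_poly of_real p) :: complex poly)"
  by (rule poly_eqI) (simp add: coeff_map_poly)

lemma map_poly_of_real_sum: "map_poly of_real (sum f I) = (\<Sum>i\<in>I. map_poly of_real (f i) :: complex poly)"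
  by (induction I rule: infinite_finite_induct) (auto simp: map_poly_of_real_add)

lemma map_poly_of_real_mult: "map_poly of_real (p * q) = (map_poly of_real p * map_poly of_real q :: complex poly)"
  by (rule poly_eqI) (simp add: coeff_map_poly coeff_mult)

lemma map_poly_of_real_eq_0: "map_poly of_real p = (0 :: complex poly) \<longleftrightarrow> p = 0"
  by (auto simp: poly_eq_iff coeff_map_poly)

lemma real_poly_eqI:
  assumes "\<And>z. z \<notin> \<real> \<Longrightarrow> cp p z = cp q z"
  shows "p = q"
proof -
  have "range (\<lambda>n. of_nat n + \<i>) \<subseteq> {z. cp (p - q) z = 0}"
    using assms by (auto simp: complex_is_Real_iff map_poly_of_real_diff)
  moreover have "infinite (range (\<lambda>n. of_nat n + \<i>))"
    by (rule range_inj_infinite) (simp add: inj_def)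
  ultimately have "map_poly of_real (p - q) = (0 :: complex poly)"
    using poly_roots_finite finite_subset by blast
  then show ?thesis by (simp add: map_poly_of_real_eq_0)
qed

section \<open>Counting the zeros of the forms\<close>

context nikishin_system
begin

text \<open>For l < m this is \<open>hp_form\<close> with real polynomials; the additional form l =
  m is \<open>b m\<close> up to sign and ends the recursion. Evaluation at real and complex points
  shares one definition.\<close>

definition A :: "(nat \<Rightarrow> real poly) \<Rightarrow> nat \<Rightarrow> 'a \<Rightarrow> 'a :: {real_normed_field, banach, second_countable_topology}" where
  "A b l z = (\<Sum>k=l..m. (-1) ^ k * poly (map_poly of_real (b k)) z * dens \<sigma> l k z)"

lemma A_of_real: "A b l (of_real x :: complex) = of_real (A b l x)"
  unfolding A_def of_real_sum by (intro sum.cong) (simp_all add: poly_map_of_real dens_of_real)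

lemma A_m: "A b m x = (-1) ^ m * poly (b m) (x::real)"
  by (simp add: A_def)

lemma A_real: "A b l (x::real) = (\<Sum>k=l..m. (-1) ^ k * poly (b k) x * dens \<sigma> l k x)"
  by (simp add: A_def)

lemma measurable_A: "l \<in> {1..m} \<Longrightarrow> (A b l :: real \<Rightarrow> real) \<in> borel_measurable borel"
  unfolding A_real[abs_def]
  by (intro borel_measurable_sum borel_measurable_times borel_measurable_const measurable_dens) auto

lemma integrable_poly_A_dens:
  assumes "1 \<le> j" "j \<le> l" "l \<le> m"
  shows "integrable (\<mu> l) (\<lambda>x. poly q x * A b l x * dens \<sigma> l j x)"
proof -
  have "(\<lambda>x. poly q x * A b l x * dens \<sigma> l j x)
      = (\<lambda>x. \<Sum>k=l..m. (-1) ^ k * (poly (q * b k) x * dens \<sigma> l k x * dens \<sigma> l j x))"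
    by (simp add: A_real fun_eq_iff sum_distrib_left sum_distrib_right mult_ac)
  moreover have "integrable (\<mu> l) (\<lambda>x. \<Sum>k=l..m. (-1) ^ k * (poly (q * b k) x * dens \<sigma> l k x * dens \<sigma> l j x))"
    by (intro Bochner_Integration.integrable_sum integrable_mult_right integrable_poly_dens_pair) (use assms in auto)
  ultimately show ?thesis by (simp only:)
qed

lemma integrable_poly_A: "l \<in> {1..m} \<Longrightarrow> integrable (\<mu> l) (\<lambda>x. poly q x * A b l x)"
  using integrable_poly_A_dens[of l l q b] by simp

lemma integrable_A: "l \<in> {1..m} \<Longrightarrow> integrable (\<mu> l) (A b l :: real \<Rightarrow> real)"
  using integrable_poly_A[of l 1 b] by simp

lemma isCont_T:
  assumes "l \<in> {1..m}" "integrable (\<mu> l) g" "x \<notin> \<Delta> l"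
  shows "isCont (T l g) (x :: real)"
proof -
  obtain D where "(T l g has_field_derivative D) (at x)"
    using T_has_derivative[OF assms(1,2), of x] assms(3) by auto
  then show ?thesis by (rule DERIV_isCont)
qed

lemma isCont_A:
  assumes l: "l \<in> {1..m}" and x: "x \<in> S l"
  shows "isCont (A b l) (x :: real)"
proof -
  have "isCont (dens \<sigma> l k) x" if k: "k \<in> {l..m}" for k
  proof (cases "k = l")
    case False
    then have k': "l < k" "k \<in> {1..m}" "Suc l \<in> {1..m}" "l \<noteq> k" "step l k = Suc l" using k l by (auto simp: step_def)
    have "x \<notin> \<Delta> (Suc l)" using S_disjoint[of l x] x k' by auto
    then have "isCont (T (Suc l) (dens \<sigma> (Suc l) k)) x"
      using isCont_T[OF k'(3) integrable_dens[OF k'(3,2)]] by blast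
    moreover have "(dens \<sigma> l k :: real \<Rightarrow> real) = T (Suc l) (dens \<sigma> (Suc l) k)"
      using dens_T[OF l k'(2,4)] k'(5) by simp
    ultimately show ?thesis by simp
  qed simp
  then show ?thesis
    unfolding A_real[abs_def] by (intro continuous_intros) auto
qed

text \<open>The vanishing of the polynomial parts and the orthogonality relations into which the
  Hermite--Pade conditions translate, for real polynomials.\<close>

definition solution :: "nat \<Rightarrow> (nat \<Rightarrow> real poly) \<Rightarrow> bool" where
  "solution n b \<longleftrightarrow> degree (b m) \<le> n \<and>
     (\<forall>j<m. \<forall>z::complex. z \<notin> of_real ` \<Delta> (Suc j) \<longrightarrow> A b j z = T (Suc j) (A b (Suc j)) z) \<and>
     (\<forall>q. degree q < n \<longrightarrow> sm_integral (\<sigma> 1) (\<lambda>x. poly q x * A b 1 x) = 0)"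

lemma solution_A:
  assumes "solution n b" "j < m" "x \<notin> \<Delta> (Suc j)"
  shows "A b j x = T (Suc j) (A b (Suc j)) (x::real)"
proof -
  have "complex_of_real x \<notin> of_real ` \<Delta> (Suc j)" using assms(3) by auto
  then have "A b j (complex_of_real x) = T (Suc j) (A b (Suc j)) (of_real x)"
    using assms unfolding solution_def by blast
  then show ?thesis by (simp add: A_of_real T_of_real)
qed

text \<open>Descending induction: once all later polynomials vanish, so does
  \<open>A b (Suc j)\<close>, and its transform equals \<open>b j\<close> up to sign.\<close>

lemma solution_trivial:
  assumes sol: "solution n b" and bm: "b m = 0" and k: "k \<le> m"
  shows "b k = 0"
proof -
  have "\<forall>i. k \<le> i \<and> i \<le> m \<longrightarrow> b i = 0"
    using k
  proof (induction k rule: inc_induct)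
    case base
    then show ?case using bm by auto
  next
    case (step j)
    then have zero: "b i = 0" if "j < i" "i \<le> m" for i using that by auto
    have A0: "A b (Suc j) = (\<lambda>x::real. 0)" by (simp add: A_real zero fun_eq_iff)
    have "b j = 0"
    proof (rule real_poly_eqI)
      fix z :: complex assume "z \<notin> \<real>"
      then have "z \<notin> of_real ` \<Delta> (Suc j)" by auto
      then have "A b j z = T (Suc j) (\<lambda>x. 0) z"
        using sol step(2) unfolding solution_def A0[symmetric] by blast
      also have "\<dots> = 0" by (simp add: T_def sm_integral_def)
      also have "A b j z = (-1) ^ j * poly (map_poly of_real (b j)) z"
      proof -
        have "{j..m} = insert j {Suc j..m}" using step(2) by auto
        then show ?thesis unfolding A_def by (simp add: zero)
      qed
      finally show "cp (b j) z = cp 0 z" by simp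
    qed
    then show ?case using step.IH by (metis le_antisym not_less_eq_eq)
  qed
  then show ?thesis using k by blast
qed

definition Zs :: "(nat \<Rightarrow> real poly) \<Rightarrow> nat \<Rightarrow> real set" where
  "Zs b l = {x \<in> S l. A b l x = 0}"

lemma Zs_S: "Zs b l \<subseteq> S l" by (auto simp: Zs_def)

lemma zero_transform:
  assumes "solution n b" "l < m" "Z \<subseteq> Zs b l" "z \<in> Z"
  shows "T (Suc l) (A b (Suc l)) z = (0::real)" and "z \<notin> \<Delta> (Suc l)"
  using assms S_disjoint[OF assms(2), of z] solution_A[OF assms(1,2), of z] by (auto simp: Zs_def)

text \<open>\<open>nodal W\<close> has constant sign on \<open>\<Delta> l\<close>, so dividing by it
  changes neither zeros nor sign changes while giving the orthogonality to which
  \<open>orthogonal_sign_changes\<close> applies.\<close>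

lemma A_div_nodal_signs:
  assumes sol: "solution n b" and l: "l \<in> {1..m}"
    and W: "finite W" "W \<inter> \<Delta> l = {}"
    and e: "e \<in> {1, -1}" "\<And>x. x \<in> \<Delta> l \<Longrightarrow> e * poly (nodal W) x > 0"
    and orth: "\<And>q. degree q < N \<Longrightarrow> sm_integral (\<sigma> l) (\<lambda>x. poly q x * A b l x / poly (nodal W) x) = 0"
  shows "infinite (Zs b l) \<or>
    (\<exists>Z\<subseteq>Zs b l. N \<le> card Z \<and> (\<exists>e\<in>{1, -1}. \<forall>x\<in>S l. e * A b l x * poly (nodal Z) x \<ge> 0))"
proof (rule disjCI)
  assume "\<not> (\<exists>Z\<subseteq>Zs b l. N \<le> card Z \<and> (\<exists>e\<in>{1, -1}. \<forall>x\<in>S l. e * A b l x * poly (nodal Z) x \<ge> 0))"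
  note no = this
  show "infinite (Zs b l)"
  proof
    assume fin: "finite (Zs b l)"
    define f where "f x = A b l x / poly (nodal W) x" for x
    have nz: "poly (nodal W) x \<noteq> 0" if "x \<in> S l" for x
      using e(2)[of x] that S_subset by force
    have cont: "isCont f x" if "x \<in> S l" for x
      unfolding f_def using isCont_A[OF l that] nz[OF that] by (intro continuous_intros)
    have zeq: "{x \<in> S l. f x = 0} = Zs b l"
      unfolding f_def Zs_def using nz by auto
    have 1: "integrable (\<mu> l) (\<lambda>x. poly q x * f x) \<and> (LINT x|\<mu> l. poly q x * f x) = 0" if "degree q < N" for q
    proof
      show "integrable (\<mu> l) (\<lambda>x. poly q x * f x)"
        using integrable_div_nodal[OF l integrable_poly_A[OF l] W, of q b] by (simp add: f_def)
      show "(LINT x|\<mu> l. poly q x * f x) = 0"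
        using orth[OF that] class_MD(1)[OF class_M_gen[OF l]] by (auto simp: sm_integral_def f_def)
    qed
    have 2: "\<not> (AE x in \<mu> l. f x = 0)"
      using AE_zero_infinite_zeros[OF l class_M_gen[OF l] cont] fin unfolding zeq by blast
    have "continuous_on (S l) f" using cont by (simp add: continuous_at_imp_continuous_on)
    then have "\<exists>Z\<subseteq>{x \<in> S l. f x = 0}. N \<le> card Z \<and> (\<exists>e\<in>{1, -1}. \<forall>x\<in>S l. e * f x * poly (nodal Z) x \<ge> 0)"
    proof (rule orthogonal_sign_changes[OF S_interval[OF l] _ _ AE_S[OF l] sets_\<mu>[OF l] 1 2])
      show "finite {x \<in> S l. f x = 0}" unfolding zeq by (rule fin)
    qed
    then obtain Z e' where Z: "Z \<subseteq> Zs b l" "N \<le> card Z" "e' \<in> {1, -1}"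
      and s: "\<forall>x\<in>S l. e' * f x * poly (nodal Z) x \<ge> 0"
      unfolding zeq by (elim exE conjE bexE) (rule that)
    have "(e * e') * A b l x * poly (nodal Z) x \<ge> 0" if x: "x \<in> S l" for x
    proof -
      have p: "e * poly (nodal W) x > 0" using e(2)[of x] x S_subset by blast
      have "(e' * f x * poly (nodal Z) x) * (e * poly (nodal W) x) \<ge> 0"
        by (rule mult_nonneg_nonneg[OF bspec[OF s x] less_imp_le[OF p]])
      also have "(e' * f x * poly (nodal Z) x) * (e * poly (nodal W) x) = (e * e') * A b l x * poly (nodal Z) x"
        unfolding f_def using nz[OF x] by simp
      finally show ?thesis .
    qed
    moreover have "e * e' \<in> {1, -1}" using e(1) Z(3) by auto
    ultimately show False using no Z(1,2) by blast
  qed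
qed

lemma zeros_sign_next:
  assumes sol: "solution n b" and l: "1 \<le> l" "l < m" and Z: "Z \<subseteq> Zs b l" "finite Z" "card Z = N"
  shows "infinite (Zs b (Suc l)) \<or>
    (\<exists>Z\<subseteq>Zs b (Suc l). N \<le> card Z \<and> (\<exists>e\<in>{1, -1}. \<forall>x\<in>S (Suc l). e * A b (Suc l) x * poly (nodal Z) x \<ge> 0))"
proof -
  have in1: "Suc l \<in> {1..m}" "adj l (Suc l)" using l by (auto simp: adj_def)
  have ZD: "Z \<subseteq> \<Delta> l" "Z \<inter> \<Delta> (Suc l) = {}"
    using Z(1) Zs_S S_subset S_disjoint[OF l(2)] by blast+
  obtain e :: real where e: "e \<in> {1, -1}" "\<And>x. x \<in> \<Delta> (Suc l) \<Longrightarrow> e * poly (nodal Z) x > 0"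
    by (rule nodal_sign[OF in1(2) Z(2) ZD]) metis
  show ?thesis
  proof (rule A_div_nodal_signs[OF sol in1(1) Z(2) ZD(2) e])
    fix q :: "real poly" assume "degree q < N"
    then show "sm_integral (\<sigma> (Suc l)) (\<lambda>x. poly q x * A b (Suc l) x / poly (nodal Z) x) = 0"
      using zeros_orthogonality[OF in1(1) integrable_A[OF in1(1)] Z(2) ZD(2)]
        zero_transform(1)[OF sol l(2) Z(1)] Z(3) by blast
  qed
qed

text \<open>Infinitely many zeros must be carried as an alternative: finiteness comes only from the
  degree of \<open>b m\<close>, at the last level.\<close>

lemma zeros_propagate:
  assumes sol: "solution n b" and l: "1 \<le> l" "l \<le> k" "k \<le> m" and Z: "infinite (Zs b l) \<or> N \<le> card (Zs b l)"
  shows "infinite (Zs b k) \<or> N \<le> card (Zs b k)"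
  using l(2,3)
proof (induction k rule: dec_induct)
  case base
  show ?case by (rule Z)
next
  case (step i)
  then have "infinite (Zs b i) \<or> N \<le> card (Zs b i)" by simp
  then obtain Y where Y: "Y \<subseteq> Zs b i" "finite Y" "card Y = N"
    by (rule obtain_finite_subset_card)
  have "1 \<le> i" "i < m" using step l by auto
  from zeros_sign_next[OF sol this Y] have "infinite (Zs b (Suc i)) \<or> (\<exists>Z\<subseteq>Zs b (Suc i). N \<le> card Z)"
    by blast
  then show ?case
  proof (elim disjE exE conjE)
    fix Z assume "Z \<subseteq> Zs b (Suc i)" "N \<le> card Z"
    then show ?case using card_mono[of "Zs b (Suc i)" Z] by (cases "finite (Zs b (Suc i))") auto
  qed simp
qed

lemma degree_bound_zeros:
  assumes "solution n b" "b m \<noteq> 0"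
  shows "finite (Zs b m)" "card (Zs b m) \<le> degree (b m)" "degree (b m) \<le> n"
proof -
  have "Zs b m \<subseteq> {x. poly (b m) x = 0}" by (auto simp: Zs_def A_m)
  moreover have "finite {x. poly (b m) x = 0}" by (rule poly_roots_finite[OF assms(2)])
  ultimately show "finite (Zs b m)" "card (Zs b m) \<le> degree (b m)"
    using finite_subset[of "Zs b m"] card_poly_roots_bound[OF assms(2)] card_mono[of _ "Zs b m"]
    by (auto intro: le_trans)
  show "degree (b m) \<le> n" using assms by (simp add: solution_def)
qed

lemma zeros_first_sign:
  assumes "solution n b"
  shows "infinite (Zs b 1) \<or>
    (\<exists>Z\<subseteq>Zs b 1. n \<le> card Z \<and> (\<exists>e\<in>{1, -1}. \<forall>x\<in>S 1. e * A b 1 x * poly (nodal Z) x \<ge> 0))"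
  by (rule A_div_nodal_signs[OF assms, of 1 "{}" 1])
     (use m2 assms in \<open>auto simp: nodal_def solution_def\<close>)

text \<open>A level with n + 1 zeros would pass n + 1 zeros on to \<open>b m\<close>, whose degree
  is at most n; and n sign changes on the first level pass on to all others. Equality leaves no zero
  without a sign change, hence the sign statement for the full set.\<close>

lemma zeros_exact:
  assumes sol: "solution n b" and bm: "b m \<noteq> 0" and l: "l \<in> {1..m}"
  shows "finite (Zs b l)" "card (Zs b l) = n"
    "\<exists>e\<in>{1, -1}. \<forall>x\<in>S l. e * A b l x * poly (nodal (Zs b l)) x \<ge> 0"
proof -
  have upper: "finite (Zs b i) \<and> card (Zs b i) \<le> n" if "i \<in> {1..m}" for i
  proof (rule ccontr)
    assume "\<not> (finite (Zs b i) \<and> card (Zs b i) \<le> n)"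
    then have "infinite (Zs b i) \<or> Suc n \<le> card (Zs b i)" by auto
    then have "infinite (Zs b m) \<or> Suc n \<le> card (Zs b m)"
      by (rule zeros_propagate[OF sol, rotated 3]) (use that in auto)
    then show False using degree_bound_zeros[OF sol bm] by linarith
  qed
  have 1: "1 \<in> {1..m}" using m2 by auto
  have "n \<le> card (Zs b 1)"
  proof -
    obtain Z where "Z \<subseteq> Zs b 1" "n \<le> card Z"
      using zeros_first_sign[OF sol] upper[OF 1] by blast
    then show ?thesis using card_mono[of "Zs b 1" Z] upper[OF 1] by linarith
  qed
  then have lower: "n \<le> card (Zs b i)" if "i \<in> {1..m}" for i
    using zeros_propagate[OF sol, of 1 i n] upper[OF that] that by auto
  show fin: "finite (Zs b l)" and card: "card (Zs b l) = n"
    using upper[OF l] lower[OF l] by auto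
  have "infinite (Zs b l) \<or>
    (\<exists>Z\<subseteq>Zs b l. n \<le> card Z \<and> (\<exists>e\<in>{1, -1}. \<forall>x\<in>S l. e * A b l x * poly (nodal Z) x \<ge> 0))"
  proof (cases "l = 1")
    case True
    then show ?thesis using zeros_first_sign[OF sol] by simp
  next
    case False
    then obtain i where i: "l = Suc i" "1 \<le> i" "i < m" using l by (cases l) auto
    then have "i \<in> {1..m}" by auto
    then have "finite (Zs b i)" "card (Zs b i) = n" using upper[of i] lower[of i] by auto
    then show ?thesis using zeros_sign_next[OF sol i(2,3) subset_refl] i(1) by blast
  qed
  then obtain Z where Z: "Z \<subseteq> Zs b l" "n \<le> card Z"
    and s: "\<exists>e\<in>{1, -1}. \<forall>x\<in>S l. e * A b l x * poly (nodal Z) x \<ge> 0"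
    using fin by blast
  have "Z = Zs b l" using card_seteq[OF fin Z(1)] Z(2) card by simp
  then show "\<exists>e\<in>{1, -1}. \<forall>x\<in>S l. e * A b l x * poly (nodal (Zs b l)) x \<ge> 0" using s by simp
qed

lemma solution_degree:
  assumes "solution n b" "b m \<noteq> 0"
  shows "degree (b m) = n"
  using degree_bound_zeros[OF assms] zeros_exact(2)[OF assms, of m] m2 by auto

end

lemma sm_integral_add:
  "integrable (sm_var s) f \<Longrightarrow> integrable (sm_var s) g \<Longrightarrow>
    sm_integral s (\<lambda>x. f x + g x) = sm_integral s f + sm_integral s g" for f g :: "real \<Rightarrow> real"
  by (simp add: sm_integral_def distrib_left)

lemma sm_integral_cmult: "sm_integral s (\<lambda>x. c * f x) = c * sm_integral s f" for f :: "real \<Rightarrow> real"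
  by (simp add: sm_integral_def)

lemma sm_integral_cong_AE:
  fixes f g :: "real \<Rightarrow> real"
  assumes "AE x in sm_var s. f x = g x" "f \<in> borel_measurable (sm_var s)" "g \<in> borel_measurable (sm_var s)"
  shows "sm_integral s f = sm_integral s g"
  unfolding sm_integral_def using integral_cong_AE[OF assms(2,3,1)] by simp

section \<open>Orthogonality with respect to the reversed products\<close>

context nikishin_system
begin

lemma integrable_poly_A_dens_div:
  assumes "1 \<le> j" "j \<le> l" "l \<le> m" "finite W" "W \<inter> \<Delta> l = {}"
  shows "integrable (\<mu> l) (\<lambda>x. poly q x * A b l x * dens \<sigma> l j x / poly (nodal W) x)"
  by (rule integrable_div_nodal) (use assms integrable_poly_A_dens in auto)

text \<open>Orthogonality with respect to the varying measure \<open>nik \<sigma> l j\<close> divided by \<open>nodal W\<close>; on the first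
  interval no division is needed.\<close>

definition quasi_orth :: "nat \<Rightarrow> (nat \<Rightarrow> real poly) \<Rightarrow> nat \<Rightarrow> nat \<Rightarrow> real set \<Rightarrow> bool" where
  "quasi_orth n b l j W \<longleftrightarrow> finite W \<and>
     (if l = 1 then W = {} else W \<subseteq> S (l - 1) \<and> card W = n - 1) \<and>
     (\<forall>q. q = 0 \<or> degree q < n - 1 \<longrightarrow>
        sm_integral (\<sigma> l) (\<lambda>x. poly q x * A b l x * dens \<sigma> l j x / poly (nodal W) x) = 0)"

lemma quasi_orthD:
  assumes "quasi_orth n b l j W" "l \<in> {1..m}"
  shows "finite W" "W \<inter> \<Delta> l = {}" "degree (nodal W) \<le> n - 1"
    "\<And>q. q = 0 \<or> degree q < n - 1 \<Longrightarrow>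
        sm_integral (\<sigma> l) (\<lambda>x. poly q x * A b l x * dens \<sigma> l j x / poly (nodal W) x) = 0"
    "\<exists>e\<in>{1, -1}. \<forall>x\<in>\<Delta> l. e * poly (nodal W) x > 0"
proof -
  show fin: "finite W" and "\<And>q. q = 0 \<or> degree q < n - 1 \<Longrightarrow>
        sm_integral (\<sigma> l) (\<lambda>x. poly q x * A b l x * dens \<sigma> l j x / poly (nodal W) x) = 0"
    using assms(1) unfolding quasi_orth_def by blast+
  show "degree (nodal W) \<le> n - 1"
    using assms(1) unfolding quasi_orth_def by (auto simp: degree_nodal split: if_splits)
  have "W \<inter> \<Delta> l = {} \<and> (\<exists>e\<in>{1, -1}. \<forall>x\<in>\<Delta> l. e * poly (nodal W) x > 0)"
  proof (cases "l = 1")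
    case True
    then have "W = {}" using assms(1) by (simp add: quasi_orth_def)
    then show ?thesis by (auto simp: nodal_def)
  next
    case False
    then obtain i where i: "l = Suc i" "i \<in> {1..m}" "i < m" using assms(2) by (cases l) auto
    then have W: "W \<subseteq> S i" using assms(1) False by (simp add: quasi_orth_def)
    then have "W \<subseteq> \<Delta> i" "W \<inter> \<Delta> l = {}" using S_subset S_disjoint[OF i(3)] i(1) by blast+
    moreover have "adj i l" using i by (auto simp: adj_def)
    ultimately obtain e :: real where "e \<in> {1, -1}" "\<And>x. x \<in> \<Delta> l \<Longrightarrow> e * poly (nodal W) x > 0"
      using nodal_sign[OF _ fin] by metis
    then show ?thesis using \<open>W \<inter> \<Delta> l = {}\<close> by blast
  qed
  then show "W \<inter> \<Delta> l = {}" "\<exists>e\<in>{1, -1}. \<forall>x\<in>\<Delta> l. e * poly (nodal W) x > 0" by auto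
qed

text \<open>For j = l the density is 1 and the relations are already known. One of the n zeros on
  the preceding interval is dropped to match the count n - 1 of the later levels.\<close>

lemma quasi_orth_start:
  assumes sol: "solution n b" and bm: "b m \<noteq> 0" and l: "l \<in> {1..m}" and n: "n \<ge> 1"
  shows "\<exists>W. quasi_orth n b l l W"
proof (cases "l = 1")
  case True
  have "sm_integral (\<sigma> 1) (\<lambda>x. poly q x * A b 1 x) = 0" if "q = 0 \<or> degree q < n - 1" for q
  proof (cases "q = 0")
    case False
    then have "degree q < n" using that by auto
    then show ?thesis using sol by (simp add: solution_def)
  qed (simp add: sm_integral_def)
  then have "quasi_orth n b 1 1 {}" by (simp add: quasi_orth_def nodal_def)
  then show ?thesis using True by blast
next
  case False
  then obtain i where i: "l = Suc i" "i \<in> {1..m}" "i < m" using l by (cases l) auto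
  have "n - 1 \<le> card (Zs b i)" using zeros_exact(2)[OF sol bm i(2)] by simp
  then have "infinite (Zs b i) \<or> n - 1 \<le> card (Zs b i)" by simp
  then obtain W where W: "W \<subseteq> Zs b i" "finite W" "card W = n - 1"
    by (rule obtain_finite_subset_card)
  have WS: "W \<subseteq> S i" using W(1) Zs_S by blast
  then have Wl: "W \<inter> \<Delta> l = {}" using S_disjoint[OF i(3)] i(1) by blast
  have "sm_integral (\<sigma> l) (\<lambda>x. poly q x * A b l x / poly (nodal W) x) = 0" if "q = 0 \<or> degree q < n - 1" for q
  proof (cases "q = 0")
    case False
    then have "degree q < card W" using that W(3) by simp
    then show ?thesis
      using zeros_orthogonality[OF l integrable_A[OF l] W(2) Wl] zero_transform(1)[OF sol i(3) W(1)] i(1) by blast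
  qed (simp add: sm_integral_def)
  then have "quasi_orth n b l l W" using W(2,3) WS i by (auto simp: quasi_orth_def)
  then show ?thesis by blast
qed

text \<open>The transform of \<open>A b (Suc l)\<close> against \<open>nik \<sigma> (Suc l) j\<close> alternates in sign at the zeros of \<open>A b l\<close>:
  by Fubini it is minus the integral of the divided difference \<open>Q\<close> of \<open>A b l\<close> at such a zero \<open>z\<close>, and
  quasi-orthogonality allows multiplying \<open>Q\<close> by the factors that make it of constant sign.\<close>

lemma transform_alternates:
  assumes sol: "solution n b" and bm: "b m \<noteq> 0" and n: "n \<ge> 1" and jl: "1 \<le> j" "j \<le> l" "l < m"
    and W: "quasi_orth n b l j W"
  shows "\<exists>c. \<forall>z\<in>Zs b l. c * T (Suc l) (\<lambda>t. A b (Suc l) t * dens \<sigma> (Suc l) j t) z * poly (nodal (Zs b l - {z})) z > (0::real)"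
proof -
  let ?L = "Suc l" and ?Z = "Zs b l" and ?d = "dens \<sigma> l j :: real \<Rightarrow> real" and ?A = "A b l :: real \<Rightarrow> real"
  have in1: "l \<in> {1..m}" "?L \<in> {1..m}" "j \<in> {1..m}" "?L \<noteq> j" and st: "step ?L j = l"
    using jl by (auto simp: step_def)
  note Z = zeros_exact[OF sol bm in1(1)]
  note WD = quasi_orthD[OF W in1(1)]
  obtain eA where eA: "eA \<in> {1, -1}" "\<And>x. x \<in> S l \<Longrightarrow> eA * ?A x * poly (nodal ?Z) x \<ge> 0"
    using Z(3) by blast
  obtain eW where eW: "eW \<in> {1, -1}" "\<And>x. x \<in> \<Delta> l \<Longrightarrow> eW * poly (nodal W) x > 0"
    using WD(5) by blast
  let ?s = "nik \<sigma> l j"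
  have s: "?s \<in> class_M (\<Delta> l)" by (rule class_M_nik[OF in1(1,3)])
  have [measurable_cong]: "sets (\<mu> l) = sets borel" "sets (\<mu> ?L) = sets borel" "sets (sm_var ?s) = sets borel"
    using sets_\<mu> in1 class_MD(2)[OF s] by blast+
  have [measurable]: "?d \<in> borel_measurable borel" "?A \<in> borel_measurable borel"
    "(A b ?L :: real \<Rightarrow> real) \<in> borel_measurable borel" "(dens \<sigma> ?L j :: real \<Rightarrow> real) \<in> borel_measurable borel"
    using measurable_dens measurable_A in1 by blast+
  let ?D = "\<lambda>z. T ?L (\<lambda>t. A b ?L t * dens \<sigma> ?L j t) z :: real"
  have Wnz: "poly (nodal W) x \<noteq> 0" if "x \<in> \<Delta> l" for x using eW(2)[OF that] by auto
  have main: "sm_sign ?s * eA * ?D z * poly (nodal (?Z - {z})) z > 0"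
    if z: "z \<in> ?Z" for z
  proof -
    have zS: "z \<in> S l" "?A z = 0" "z \<in> \<Delta> l" "z \<notin> \<Delta> ?L"
      using z S_subset S_disjoint[OF jl(3)] by (auto simp: Zs_def)
    have zc: "z \<notin> of_real ` \<Delta> ?L" using zS by simp
    \<comment> \<open>Since \<open>A b l\<close> vanishes at \<open>z\<close>, on \<open>S l\<close>
      this is \<open>A b l x\<close> divided by z - x, extended continuously to x = z.\<close>
    define Q where "Q x = T2 ?L (A b ?L) z x" for x
    have intf: "integrable (\<mu> ?L) (\<lambda>t. A b ?L t * dens \<sigma> ?L j t)"
      using integrable_poly_A_dens[of j ?L 1 b] jl by simp
    note fub = T2_fubini[OF in1(2,3,4) measurable_A[OF in1(2), of b] intf zc, unfolded st]
    have Qint: "integrable (\<mu> l) (\<lambda>x. ?d x * Q x)" and DQ: "?D z = - sm_integral (\<sigma> l) (\<lambda>x. ?d x * Q x)"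
      using fub by (simp_all add: Q_def)
    have QA: "(z - x) * Q x = ?A x" if x: "x \<in> S l" for x
    proof -
      have xL: "x \<notin> \<Delta> ?L" using S_disjoint[OF jl(3) x] .
      then have "x \<notin> of_real ` \<Delta> ?L" by simp
      from T2_mult[OF in1(2) integrable_A[OF in1(2)] zc this, of b]
      have "(z - x) * Q x = T ?L (A b ?L) x - T ?L (A b ?L) z" by (simp add: Q_def)
      also have "\<dots> = ?A x - ?A z"
        using solution_A[OF sol jl(3) xL] solution_A[OF sol jl(3) zS(4)] by simp
      finally show ?thesis using zS(2) by simp
    qed
    have Qcont: "isCont Q x" if x: "x \<in> S l" for x
    proof -
      have "Q = T ?L (\<lambda>t. A b ?L t *\<^sub>R (1 / (z - of_real t)))"
        by (simp add: Q_def T2_def T_def fun_eq_iff)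
      moreover have "isCont (T ?L (\<lambda>t. A b ?L t *\<^sub>R (1 / (z - of_real t)))) x"
        by (rule isCont_T[OF in1(2) integrable_kernel[OF in1(2) integrable_A[OF in1(2)] zc] S_disjoint[OF jl(3) x]])
      ultimately show ?thesis by simp
    qed
    have Qm: "(\<lambda>x. ?d x * Q x) \<in> borel_measurable (\<mu> l)" using Qint by auto
    define I where "I p = sm_integral (\<sigma> l) (\<lambda>x. poly p x * (?d x * Q x) / poly (nodal W) x)" for p
    have pint: "integrable (\<mu> l) (\<lambda>x. poly p x * (?d x * Q x) / poly (nodal W) x)" for p
    proof (rule integrable_div_nodal[OF in1(1) _ WD(1,2)])
      have eq: "poly p x * (?d x * Q x) = poly p z * (?d x * Q x) - poly (synthetic_div p z) x * ?A x * ?d x"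
        if "x \<in> S l" for x
        by (subst synthetic_div_poly[of p x z], subst QA[OF that, symmetric]) (simp add: algebra_simps)
      have "AE x in \<mu> l. poly p z * (?d x * Q x) - poly (synthetic_div p z) x * ?A x * ?d x = poly p x * (?d x * Q x)"
        using AE_S[OF in1(1)] by eventually_elim (rule eq[symmetric])
      note ae = this
      have int: "integrable (\<mu> l) (\<lambda>x. poly p z * (?d x * Q x) - poly (synthetic_div p z) x * ?A x * ?d x)"
        using Qint integrable_poly_A_dens[of j l "synthetic_div p z" b] jl by auto
      have "(\<lambda>x. poly p x * (?d x * Q x)) \<in> borel_measurable (\<mu> l)"
        using Qm by measurable
      then show "integrable (\<mu> l) (\<lambda>x. poly p x * (?d x * Q x))"
        using integrable_cong_AE_imp[OF int _ ae] by blast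
    qed
    \<comment> \<open>\<open>p\<close> differs from its value at \<open>z\<close> by a multiple of x
      - z. That factor turns \<open>Q\<close> into \<open>- A b l\<close>, and quasi-orthogonality
      annihilates the result because the cofactor has degree below n - 1. So \<open>I p\<close>
      depends only on \<open>p\<close> at \<open>z\<close>, and \<open>p\<close> may be exchanged
      freely.\<close>
    have red: "I p = poly p z * I 1" if p: "degree p \<le> n - 1" for p
    proof -
      let ?r = "synthetic_div p z"
      have r: "?r = 0 \<or> degree ?r < n - 1" by (rule degree_synthetic_div_less[OF p])
      have "I p = sm_integral (\<sigma> l) (\<lambda>x. poly p z * (poly 1 x * (?d x * Q x) / poly (nodal W) x)
          + (- 1) * (poly ?r x * ?A x * ?d x / poly (nodal W) x))"
        unfolding I_def
      proof (rule sm_integral_cong_AE)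
        show "AE x in \<mu> l. poly p x * (?d x * Q x) / poly (nodal W) x
          = poly p z * (poly 1 x * (?d x * Q x) / poly (nodal W) x) + (- 1) * (poly ?r x * ?A x * ?d x / poly (nodal W) x)"
          using AE_S[OF in1(1)]
        proof eventually_elim
          case (elim x)
          have "poly p x * (?d x * Q x) = poly p z * (?d x * Q x) - poly ?r x * ?A x * ?d x"
            by (subst synthetic_div_poly[of p x z], subst QA[OF elim, symmetric]) (simp add: algebra_simps)
          then show ?case by (simp add: diff_divide_distrib)
        qed
        show "(\<lambda>x. poly p x * (?d x * Q x) / poly (nodal W) x) \<in> borel_measurable (\<mu> l)"
          using pint by auto
        show "(\<lambda>x. poly p z * (poly 1 x * (?d x * Q x) / poly (nodal W) x)
          + (- 1) * (poly ?r x * ?A x * ?d x / poly (nodal W) x)) \<in> borel_measurable (\<mu> l)"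
          using pint[of 1] by measurable
      qed
      also have "\<dots> = poly p z * I 1 + (- 1) * sm_integral (\<sigma> l) (\<lambda>x. poly ?r x * ?A x * ?d x / poly (nodal W) x)"
        unfolding I_def sm_integral_cmult[symmetric]
      proof (rule sm_integral_add)
        show "integrable (\<mu> l) (\<lambda>x. poly p z * (poly 1 x * (?d x * Q x) / poly (nodal W) x))"
          using pint[of 1] by (rule integrable_mult_right)
        show "integrable (\<mu> l) (\<lambda>x. - 1 * (poly ?r x * ?A x * ?d x / poly (nodal W) x))"
          using integrable_poly_A_dens_div[of j l W ?r b] jl WD(1,2) by (intro integrable_mult_right) auto
      qed
      also have "sm_integral (\<sigma> l) (\<lambda>x. poly ?r x * ?A x * ?d x / poly (nodal W) x) = 0"
        by (rule WD(4)[OF r])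
      finally show ?thesis by simp
    qed
    \<comment> \<open>Two choices of \<open>p\<close>: \<open>nodal W\<close> cancels the
      denominator and gives the transform itself, while \<open>?v\<close> makes the integrand of
      constant sign.\<close>
    let ?v = "nodal (?Z - {z})"
    have dv: "degree ?v \<le> n - 1" using Z(1,2) z by (simp add: degree_nodal)
    have "I (nodal W) = sm_integral (\<sigma> l) (\<lambda>x. ?d x * Q x)"
      unfolding I_def
    proof (rule sm_integral_cong_AE)
      show "AE x in \<mu> l. poly (nodal W) x * (?d x * Q x) / poly (nodal W) x = ?d x * Q x"
        using AE_\<Delta>[OF in1(1)] by eventually_elim (use Wnz in simp)
    qed (use Qm pint[of "nodal W"] in auto)
    then have D1: "?D z = - (poly (nodal W) z * I 1)"
      using DQ red[OF WD(3)] by simp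
    define h where "h x = poly ?v x * Q x / poly (nodal W) x" for x
    have hm: "h \<in> borel_measurable borel"
    proof -
      have "h = (\<lambda>x. poly ?v x * T ?L (\<lambda>t. A b ?L t *\<^sub>R (1 / (z - of_real t))) x / poly (nodal W) x)"
        by (simp add: h_def Q_def T2_def T_def fun_eq_iff)
      moreover
      interpret sigma_finite_measure "\<mu> ?L" by (rule sigma_finite_\<mu>[OF in1(2)])
      have "(\<lambda>x. poly ?v x * T ?L (\<lambda>t. A b ?L t *\<^sub>R (1 / (z - of_real t))) x / poly (nodal W) x) \<in> borel_measurable borel"
        unfolding T_def sm_integral_def by measurable
      ultimately show ?thesis by simp
    qed
    have dh: "(\<lambda>x. ?d x *\<^sub>R h x) = (\<lambda>x. poly ?v x * (?d x * Q x) / poly (nodal W) x)"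
      by (simp add: h_def fun_eq_iff)
    have hint: "integrable (sm_var ?s) h"
      unfolding nik_integral(1)[OF in1(1,3) hm] dh by (rule pint)
    have Iv: "sm_integral ?s h = I ?v"
      unfolding nik_integral(2)[OF in1(1,3) hm] dh I_def ..
    have hcont: "isCont h x" if x: "x \<in> S l" for x
      unfolding h_def using Qcont[OF x] Wnz[of x] x S_subset by (intro continuous_intros) auto
    \<comment> \<open>Off \<open>z\<close>, \<open>?v\<close> times \<open>Q\<close> is minus
      \<open>A b l\<close> times the full nodal polynomial divided by a square. At \<open>z\<close>
      itself the sign follows by continuity, as \<open>z\<close> is a limit point of
      \<open>S l\<close>.\<close>
    have hsign: "(- eA * eW) * h x \<ge> 0" if x: "x \<in> S l" for x
    proof -
      have off: "(- eA * eW) * h y \<ge> 0" if y: "y \<in> S l" "y \<noteq> z" for y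
      proof -
        have N: "poly (nodal ?Z) y = (y - z) * poly ?v y"
          unfolding nodal_remove[OF Z(1) z] by (simp add: algebra_simps)
        have "eA * ?A y * poly (nodal ?Z) y = (- eA * (Q y * poly ?v y)) * (y - z)\<^sup>2"
          unfolding N QA[OF y(1), symmetric] by (simp add: power2_eq_square algebra_simps)
        then have "0 \<le> (- eA * (Q y * poly ?v y)) * (y - z)\<^sup>2" using eA(2)[OF y(1)] by simp
        moreover have "(y - z)\<^sup>2 > 0" using y(2) by simp
        ultimately have 1: "0 \<le> - eA * (Q y * poly ?v y)" using zero_le_mult_iff[of "- eA * (Q y * poly ?v y)" "(y - z)\<^sup>2"] by linarith
        have p: "eW * poly (nodal W) y > 0" using eW(2) y(1) S_subset by blast
        have "(- eA * eW) * h y = (- eA * (Q y * poly ?v y)) * (eW * eW) / (eW * poly (nodal W) y)"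
          unfolding h_def using eW(1) by auto
        also have "\<dots> \<ge> 0" by (rule divide_nonneg_pos[OF mult_nonneg_nonneg[OF 1 zero_le_square] p])
        finally show ?thesis .
      qed
      show ?thesis
      proof (cases "x = z")
        case True
        have "connected (S l)" using S_interval[OF in1(1)] is_interval_connected by blast
        moreover have "\<nexists>a. S l = {a}" using infinite_S[OF in1(1)] by (metis finite.emptyI finite_insert)
        ultimately have lim: "z islimpt S l" using connected_imp_perfect zS(1) by blast
        have "((\<lambda>y. (- eA * eW) * h y) \<longlongrightarrow> (- eA * eW) * h z) (at z within S l)"
          using hcont[OF zS(1)] unfolding isCont_def
          by (intro tendsto_mult tendsto_const) (rule tendsto_within_subset, auto)
        moreover have "\<forall>\<^sub>F y in at z within S l. 0 \<le> (- eA * eW) * h y"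
          unfolding eventually_at_filter using off by (auto intro: eventuallyI)
        moreover have "at z within S l \<noteq> bot" using lim by (simp add: trivial_limit_within)
        ultimately have "0 \<le> (- eA * eW) * h z" by (rule tendsto_lowerbound)
        then show ?thesis using True by simp
      qed (rule off[OF x])
    qed
    \<comment> \<open>The removed finite set is null for \<open>\<mu> l\<close>, hence for
      \<open>nik \<sigma> l j\<close>, which has a density with respect to it.\<close>
    have AES: "AE x in sm_var ?s. x \<in> S l"
    proof -
      have fin: "finite (\<Delta> l - S l)" by (rule finite_\<Delta>_minus_S[OF in1(1)])
      then have Bs [measurable]: "\<Delta> l - S l \<in> sets borel" by (intro borel_closed finite_imp_closed)
      have "sm_integral ?s (indicator (\<Delta> l - S l) :: real \<Rightarrow> real) = sm_integral (\<sigma> l) (\<lambda>x. ?d x *\<^sub>R indicator (\<Delta> l - S l) x)"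
        by (intro nik_integral(2)[OF in1(1,3)]) measurable
      also have "\<dots> = sm_integral (\<sigma> l) (\<lambda>x. 0)"
      proof (rule sm_integral_cong_AE)
        show "AE x in \<mu> l. ?d x *\<^sub>R indicator (\<Delta> l - S l) x = (0::real)"
          using AE_S[OF in1(1)] by eventually_elim simp
        show "(\<lambda>x. ?d x *\<^sub>R indicator (\<Delta> l - S l) x :: real) \<in> borel_measurable (\<mu> l)" by measurable
      qed simp
      finally have "(LINT x|sm_var ?s. indicator (\<Delta> l - S l) x) = (0::real)"
        using class_MD(1)[OF s] by (auto simp: sm_integral_def)
      then have "measure (sm_var ?s) (\<Delta> l - S l) = 0"
        using class_MD(3)[OF s] by simp
      then have "\<Delta> l - S l \<in> null_sets (sm_var ?s)"
        using Bs class_MD(2)[OF s] by (simp add: null_sets_def finite_measure.emeasure_eq_measure[OF class_MD(6)[OF s]])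
      from AE_not_in[OF this] class_MD(8)[OF s] show ?thesis by eventually_elim blast
    qed
    have nz: "\<not> (AE x in sm_var ?s. h x = 0)"
    proof
      assume "AE x in sm_var ?s. h x = 0"
      then have "infinite {x \<in> S l. h x = 0}"
        using AE_zero_infinite_zeros[OF in1(1) s hcont] by blast
      moreover have "{x \<in> S l. h x = 0} \<subseteq> ?Z"
      proof safe
        fix x assume x: "x \<in> S l" "h x = 0"
        then have "poly ?v x = 0 \<or> Q x = 0" using Wnz[of x] S_subset by (auto simp: h_def)
        then show "x \<in> ?Z"
        proof
          assume "poly ?v x = 0"
          then show ?thesis using Z(1) by (simp add: poly_nodal_eq_0_iff)
        next
          assume "Q x = 0"
          then show ?thesis using QA[OF x(1)] x(1) by (simp add: Zs_def)
        qed
      qed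
      ultimately show False using Z(1) finite_subset by blast
    qed
    have "(LINT x|sm_var ?s. (- eA * eW) * h x) > 0"
    proof -
      have i: "integrable (sm_var ?s) (\<lambda>x. (- eA * eW) * h x)" using hint by (rule integrable_mult_right)
      have ae: "AE x in sm_var ?s. 0 \<le> (- eA * eW) * h x" using AES by eventually_elim (rule hsign)
      have "(LINT x|sm_var ?s. (- eA * eW) * h x) \<noteq> 0"
      proof
        assume "(LINT x|sm_var ?s. (- eA * eW) * h x) = 0"
        then have "AE x in sm_var ?s. (- eA * eW) * h x = 0"
          using integral_nonneg_eq_0_iff_AE[OF i ae] by blast
        then have "AE x in sm_var ?s. h x = 0"
          by eventually_elim (use eA(1) eW(1) in auto)
        with nz show False by blast
      qed
      moreover have "(LINT x|sm_var ?s. (- eA * eW) * h x) \<ge> 0" using ae by (rule integral_nonneg_AE)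
      ultimately show ?thesis by linarith
    qed
    moreover have "sm_sign ?s * I ?v = (LINT x|sm_var ?s. h x)"
      unfolding Iv[symmetric] sm_integral_def using class_MD(1)[OF s] by auto
    ultimately have pos: "(- eA * eW) * (sm_sign ?s * I ?v) > 0"
      by (simp only: integral_mult_right_zero)
    have Iv1: "I ?v = poly ?v z * I 1" by (rule red[OF dv])
    have wz: "eW * poly (nodal W) z > 0" using eW(2) zS(3) by blast
    have "0 < ((- eA * eW) * (sm_sign ?s * (poly ?v z * I 1))) * (eW * poly (nodal W) z)"
      using pos wz unfolding Iv1 by (rule mult_pos_pos)
    also have "\<dots> = (eW * eW) * (sm_sign ?s * eA * (- (poly (nodal W) z * I 1)) * poly ?v z)"
      by (simp add: mult_ac)
    finally show "sm_sign ?s * eA * ?D z * poly ?v z > 0"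
      unfolding D1 using eW(1) by auto
  qed
  then show ?thesis by blast
qed

text \<open>Alternation at n points gives n - 1 zeros of the transform, and these give the relations
  on the next interval by \<open>zeros_orthogonality\<close>. The next step alternates at all n
  zeros again, so the count stays n - 1.\<close>

lemma quasi_orth_step:
  assumes sol: "solution n b" and bm: "b m \<noteq> 0" and n: "n \<ge> 1" and jl: "1 \<le> j" "j \<le> l" "l < m"
    and W: "quasi_orth n b l j W"
  shows "\<exists>W. quasi_orth n b (Suc l) j W"
proof -
  let ?L = "Suc l" and ?Z = "Zs b l"
  have in1: "l \<in> {1..m}" "?L \<in> {1..m}" using jl by auto
  let ?g = "\<lambda>t. A b ?L t * dens \<sigma> ?L j t :: real"
  let ?D = "\<lambda>z. T ?L ?g z :: real"
  have gint: "integrable (\<mu> ?L) ?g" using integrable_poly_A_dens[of j ?L 1 b] jl by simp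
  note Z = zeros_exact[OF sol bm in1(1)]
  have Zne: "?Z \<noteq> {}" using Z(2) n by auto
  obtain c where c: "\<And>z. z \<in> ?Z \<Longrightarrow> c * ?D z * poly (nodal (?Z - {z})) z > 0"
    using transform_alternates[OF assms] by blast
  have cont: "continuous_on (S l) ?D"
    using isCont_T[OF in1(2) gint] S_disjoint[OF jl(3)] by (intro continuous_at_imp_continuous_on) blast
  obtain W' where W': "W' \<subseteq> S l" "finite W'" "card W' = card ?Z - 1" "\<And>w. w \<in> W' \<Longrightarrow> ?D w = 0"
    using alternating_zeros[OF Z(1) Zne Zs_S S_interval[OF in1(1)] cont c] by blast
  have disj: "W' \<inter> \<Delta> ?L = {}" using W'(1) S_disjoint[OF jl(3)] by blast
  have "sm_integral (\<sigma> ?L) (\<lambda>x. poly q x * A b ?L x * dens \<sigma> ?L j x / poly (nodal W') x) = 0"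
    if "q = 0 \<or> degree q < n - 1" for q
  proof (cases "q = 0")
    case False
    then have "degree q < card W'" using that W'(3) Z(2) by simp
    from zeros_orthogonality[OF in1(2) gint W'(2) disj W'(4) this] show ?thesis by (simp add: mult.assoc)
  qed (simp add: sm_integral_def)
  then have "quasi_orth n b ?L j W'"
    using W'(1-3) Z(2) jl by (simp add: quasi_orth_def)
  then show ?thesis by blast
qed

lemma quasi_orth_m:
  assumes "solution n b" "b m \<noteq> 0" "n \<ge> 1" "j \<in> {1..m}"
  shows "\<exists>W. quasi_orth n b m j W"
proof -
  have "\<exists>W. quasi_orth n b l j W" if "j \<le> l" "l \<le> m" for l
    using that
  proof (induction l rule: dec_induct)
    case base
    then show ?case using quasi_orth_start[OF assms(1,2,4,3)] by blast
  next
    case (step l)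
    then obtain W where W: "quasi_orth n b l j W" by auto
    show ?case using quasi_orth_step[OF assms(1,2,3) _ _ _ W] step assms(4) by auto
  qed
  then show ?thesis using assms(4) by auto
qed

end

section \<open>Quadrature formulas and their convergence\<close>

text \<open>Interpolatory quadrature at the zeros \<open>X\<close>, whose nodal polynomial is
  orthogonal to degrees below n - 1 for \<open>M\<close> divided by \<open>nodal W\<close>.\<close>

locale quadrature =
  fixes M :: "real measure" and C X W :: "real set" and n :: nat and e :: real
  assumes sets_M: "sets M = sets borel" and closed_C: "closed C" and AE_C: "AE x in M. x \<in> C"
    and poly_int: "\<And>p. integrable M (poly p)"
    and X: "finite X" "X \<subseteq> C" "card X = n" and n: "n \<ge> 1"
    and W: "finite W" "W \<inter> C = {}" "card W \<le> n - 1"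
    and e: "e \<in> {1, -1}" "\<And>x. x \<in> C \<Longrightarrow> e * poly (nodal W) x > 0"
    and orth: "\<And>q. q = 0 \<or> degree q < n - 1 \<Longrightarrow> (LINT x|M. poly q x * poly (nodal X) x / poly (nodal W) x) = 0"
begin

definition wt :: "real \<Rightarrow> real" where
  "wt x = (LINT t|M. poly (lagr X x) t)"

lemma int_div: "integrable M (\<lambda>x. poly p x / poly (nodal W) x)"
  by (rule integrable_div_nodal_gen[OF sets_M closed_C AE_C poly_int W(1,2)])

lemma nodal_W_nz: "x \<in> C \<Longrightarrow> poly (nodal W) x \<noteq> 0"
  using e(2)[of x] by auto

lemma quad_poly:
  assumes "degree p < n"
  shows "(\<Sum>x\<in>X. wt x * poly p x) = (LINT x|M. poly p x)"
proof -
  have eq: "p = (\<Sum>x\<in>X. smult (poly p x) (lagr X x))"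
    using lagrange_interpolation[OF X(1)] assms X(3) by blast
  have "poly p t = (\<Sum>x\<in>X. poly p x * poly (lagr X x) t)" for t
    using arg_cong[OF eq, of "\<lambda>q. poly q t"] unfolding poly_sum poly_smult .
  then have "(LINT x|M. poly p x) = (LINT t|M. (\<Sum>x\<in>X. poly p x * poly (lagr X x) t))"
    by (rule Bochner_Integration.integral_cong[OF refl])
  also have "\<dots> = (\<Sum>x\<in>X. poly p x * wt x)"
    unfolding wt_def by (subst Bochner_Integration.integral_sum) (auto intro: poly_int)
  finally show ?thesis by (simp add: mult.commute)
qed

lemma measurable_poly_M [measurable]: "poly p \<in> borel_measurable M"
  using poly_int by (rule borel_measurable_integrable)

text \<open>With l the Lagrange polynomial at x, l times \<open>nodal W\<close> minus W(x) l^2 is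
  divisible by \<open>nodal X\<close>, with quotient of degree below n - 1, so it integrates to 0
  after division by \<open>nodal W\<close>. The weight becomes W(x) times the integral of l^2 /
  \<open>nodal W\<close>, where both signs agree.\<close>

lemma wt_nonneg:
  assumes x: "x \<in> X"
  shows "wt x \<ge> 0"
proof -
  define \<l> where "\<l> = lagr X x"
  define c where "c = inverse (poly (nodal (X - {x})) x)"
  define u where "u = nodal W - smult (poly (nodal W) x) \<l>"
  define r where "r = synthetic_div u x"
  have xC: "x \<in> C" using x X(2) by blast
  have "degree \<l> \<le> n - 1" using degree_lagr[OF X(1) x] X(3) unfolding \<l>_def by simp
  then have "degree u \<le> n - 1"
    unfolding u_def using W(3) by (intro degree_diff_le order_trans[OF degree_smult_le]) (auto simp: degree_nodal)
  then have r: "r = 0 \<or> degree r < n - 1" unfolding r_def by (rule degree_synthetic_div_less)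
  have "poly u x = 0" using poly_lagr[OF X(1) x x] by (simp add: u_def \<l>_def)
  then have u: "poly u t = (t - x) * poly r t" for t
    using synthetic_div_poly[of u t x] by (simp add: r_def)
  have l: "(t - x) * poly \<l> t = c * poly (nodal X) t" for t
    unfolding \<l>_def lagr_def c_def nodal_remove[OF X(1) x] by (simp add: algebra_simps)
  have eq: "poly \<l> t = poly (nodal W) x * (poly (\<l> * \<l>) t / poly (nodal W) t) + c * (poly r t * poly (nodal X) t / poly (nodal W) t)"
    if "t \<in> C" for t
  proof -
    have "poly \<l> t * poly (nodal W) t = poly (nodal W) x * poly (\<l> * \<l>) t + poly \<l> t * poly u t"
      by (simp add: u_def algebra_simps)
    also have "poly \<l> t * poly u t = c * (poly r t * poly (nodal X) t)"
    proof -
      have "poly \<l> t * poly u t = ((t - x) * poly \<l> t) * poly r t" unfolding u by (simp only: mult_ac)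
      then show ?thesis unfolding l by (simp only: mult_ac)
    qed
    finally show ?thesis using nodal_W_nz[OF that] by (simp add: field_simps)
  qed
  have i2: "integrable M (\<lambda>t. poly r t * poly (nodal X) t / poly (nodal W) t)"
    using int_div[of "r * nodal X"] by simp
  have "wt x = (LINT t|M. poly (nodal W) x * (poly (\<l> * \<l>) t / poly (nodal W) t) + c * (poly r t * poly (nodal X) t / poly (nodal W) t))"
    unfolding wt_def \<l>_def[symmetric]
  proof (rule integral_cong_AE)
    show "AE t in M. poly \<l> t = poly (nodal W) x * (poly (\<l> * \<l>) t / poly (nodal W) t) + c * (poly r t * poly (nodal X) t / poly (nodal W) t)"
      using AE_C by eventually_elim (rule eq)
  qed measurable
  also have "\<dots> = (LINT t|M. poly (nodal W) x * (poly (\<l> * \<l>) t / poly (nodal W) t)) + c * (LINT t|M. poly r t * poly (nodal X) t / poly (nodal W) t)"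
    by (subst Bochner_Integration.integral_add[OF integrable_mult_right[OF int_div] integrable_mult_right[OF i2]])
       (simp only: integral_mult_right_zero)
  also have "\<dots> = (LINT t|M. poly (nodal W) x * (poly (\<l> * \<l>) t / poly (nodal W) t))"
    using orth[OF r] by simp
  also have "\<dots> \<ge> 0"
  proof (rule integral_nonneg_AE)
    show "AE t in M. 0 \<le> poly (nodal W) x * (poly (\<l> * \<l>) t / poly (nodal W) t)"
      using AE_C
    proof eventually_elim
      case (elim t)
      have "poly (nodal W) x * (poly (\<l> * \<l>) t / poly (nodal W) t)
          = (e * poly (nodal W) x) * (poly \<l> t)\<^sup>2 / (e * poly (nodal W) t)"
        using e(1) by (auto simp: power2_eq_square)
      also have "\<dots> \<ge> 0"
        by (rule divide_nonneg_pos[OF mult_nonneg_nonneg[OF less_imp_le[OF e(2)[OF xC]] zero_le_power2] e(2)[OF elim]])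
      finally show ?case .
    qed
  qed
  finally show ?thesis .
qed

text \<open>Interpolate p / \<open>nodal W\<close> on \<open>X\<close> by u. Then
  \<open>nodal W * u - p\<close> is a multiple of \<open>nodal X\<close> of degree at most 2n - 2,
  so its cofactor is annihilated by the orthogonality and exactness for u carries over.\<close>

lemma quad_rational:
  assumes p: "degree p < n"
  shows "(\<Sum>x\<in>X. wt x * (poly p x / poly (nodal W) x)) = (LINT x|M. poly p x / poly (nodal W) x)"
proof -
  define u where "u = (\<Sum>x\<in>X. smult (poly p x / poly (nodal W) x) (lagr X x))"
  have du: "degree u < n"
    unfolding u_def
    by (rule degree_sum_less) (use n degree_lagr[OF X(1)] X(3) in \<open>auto intro: le_less_trans[OF degree_smult_le]\<close>)
  have ux: "poly u y = poly p y / poly (nodal W) y" if y: "y \<in> X" for y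
  proof -
    have "poly u y = (\<Sum>x\<in>X. if x = y then poly p x / poly (nodal W) x else 0)"
      unfolding u_def poly_sum by (rule sum.cong) (auto simp: poly_lagr[OF X(1) _ y])
    then show ?thesis using X(1) y by simp
  qed
  have "nodal X dvd nodal W * u - p"
    by (rule nodal_dvd[OF X(1)]) (use ux nodal_W_nz X(2) in auto)
  then obtain r where r: "nodal W * u - p = nodal X * r" by (rule dvdE)
  have r': "r = 0 \<or> degree r < n - 1"
  proof (rule disjCI)
    assume "\<not> degree r < n - 1"
    moreover have "degree (nodal W * u - p) \<le> (n - 1) + (n - 1)"
    proof (rule degree_diff_le)
      show "degree (nodal W * u) \<le> (n - 1) + (n - 1)"
        using degree_mult_le[of "nodal W" u] W(3) du by (simp add: degree_nodal)
    qed (use p in simp)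
    ultimately show "r = 0"
      unfolding r using degree_mult_eq[OF nodal_nonzero, of r X] X(3) n by (cases "r = 0") (auto simp: degree_nodal)
  qed
  have i2: "integrable M (\<lambda>t. poly r t * poly (nodal X) t / poly (nodal W) t)"
    using int_div[of "r * nodal X"] by simp
  have "(\<Sum>x\<in>X. wt x * (poly p x / poly (nodal W) x)) = (\<Sum>x\<in>X. wt x * poly u x)"
    by (rule sum.cong) (simp_all add: ux)
  also have "\<dots> = (LINT x|M. poly u x)" by (rule quad_poly[OF du])
  also have "\<dots> = (LINT x|M. poly p x / poly (nodal W) x + poly r x * poly (nodal X) x / poly (nodal W) x)"
  proof (rule integral_cong_AE)
    show "AE x in M. poly u x = poly p x / poly (nodal W) x + poly r x * poly (nodal X) x / poly (nodal W) x"
      using AE_C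
    proof eventually_elim
      case (elim x)
      have "poly (nodal W) x * poly u x - poly p x = poly (nodal X) x * poly r x"
        using arg_cong[OF r, of "\<lambda>q. poly q x"] by simp
      then show ?case using nodal_W_nz[OF elim] by (simp add: field_simps)
    qed
  qed measurable
  also have "\<dots> = (LINT x|M. poly p x / poly (nodal W) x)"
    using Bochner_Integration.integral_add[OF int_div[of p] i2] orth[OF r'] by simp
  finally show ?thesis .
qed

lemma wt_sum: "(\<Sum>x\<in>X. wt x) = measure M (space M)"
  using quad_poly[of 1] n by simp

text \<open>Nonnegative weights let the pointwise majorant pass through the quadrature sum just as
  through the integral.\<close>

lemma error_bound:
  assumes F: "\<And>x. x \<in> C \<Longrightarrow> \<bar>f x - g x\<bar> \<le> h x" and exact: "(\<Sum>x\<in>X. wt x * g x) = (LINT x|M. g x)"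
    and int: "integrable M f" "integrable M g" "integrable M h"
  shows "\<bar>(\<Sum>x\<in>X. wt x * f x) - (LINT x|M. f x)\<bar> \<le> (\<Sum>x\<in>X. wt x * h x) + (LINT x|M. h x)"
proof -
  have "(\<Sum>x\<in>X. wt x * f x) - (LINT x|M. f x) = (\<Sum>x\<in>X. wt x * (f x - g x)) - (LINT x|M. f x - g x)"
    using exact int by (simp add: right_diff_distrib sum_subtractf)
  moreover have "\<bar>\<Sum>x\<in>X. wt x * (f x - g x)\<bar> \<le> (\<Sum>x\<in>X. wt x * h x)"
    by (rule order_trans[OF sum_abs]) (use X(2) F wt_nonneg in \<open>auto intro!: sum_mono mult_left_mono simp: abs_mult\<close>)
  moreover have "\<bar>LINT x|M. f x - g x\<bar> \<le> (LINT x|M. h x)"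
  proof (rule order_trans[OF integral_abs_bound], rule integral_mono_AE)
    show "AE x in M. \<bar>f x - g x\<bar> \<le> h x" using AE_C by eventually_elim (rule F)
  qed (use int in auto)
  ultimately show ?thesis by linarith
qed

lemma int_kernel:
  assumes "d > 0" "\<And>x. x \<in> C \<Longrightarrow> d \<le> \<bar>z - x\<bar>"
  shows "integrable M (\<lambda>x. 1 / (z - x))"
  using integrable_cauchy_kernel[OF sets_M poly_int[of 1] AE_C assms(1), of z] assms(2) by simp

text \<open>The rational function p / \<open>nodal W\<close> approximating the Cauchy kernel leaves
  the error W(z) / (W(x) (z - x)), where \<theta> bounds the quotient of the nodal values.\<close>

lemma error_geometric:
  assumes d: "d > 0" "\<And>x. x \<in> C \<Longrightarrow> d \<le> \<bar>z - x\<bar>" and \<theta>: "\<And>x. x \<in> C \<Longrightarrow> \<bar>poly (nodal W) z\<bar> \<le> \<theta> * \<bar>poly (nodal W) x\<bar>"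
  shows "\<bar>(\<Sum>x\<in>X. wt x * (1 / (z - x))) - (LINT x|M. 1 / (z - x))\<bar> \<le> 2 * (\<theta> / d * measure M (space M))"
proof -
  define p where "p = - synthetic_div (nodal W) z"
  have dp: "degree p < n"
    using degree_synthetic_div[of "nodal W" z] W(3) n by (simp add: p_def degree_nodal)
  interpret finite_measure M
    using poly_int[of 1] by (intro finite_measureI) (simp add: integrable_iff_bounded)
  have bound: "\<bar>1 / (z - x) - poly p x / poly (nodal W) x\<bar> \<le> \<theta> / d" if x: "x \<in> C" for x
  proof -
    have nz: "z - x \<noteq> 0" "poly (nodal W) x \<noteq> 0" using d(1) d(2)[OF x] nodal_W_nz[OF x] by auto
    have "poly (nodal W) x = poly (nodal W) z + (z - x) * poly p x"
      using synthetic_div_poly[of "nodal W" x z] by (simp add: p_def algebra_simps)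
    then have "1 / (z - x) - poly p x / poly (nodal W) x = poly (nodal W) z / poly (nodal W) x / (z - x)"
      using nz by (simp add: field_simps)
    then have "\<bar>1 / (z - x) - poly p x / poly (nodal W) x\<bar> = \<bar>poly (nodal W) z\<bar> / \<bar>poly (nodal W) x\<bar> / \<bar>z - x\<bar>"
      by (simp add: abs_mult)
    also have "\<dots> \<le> \<theta> / d"
    proof (rule frac_le)
      show "\<bar>poly (nodal W) z\<bar> / \<bar>poly (nodal W) x\<bar> \<le> \<theta>" using \<theta>[OF x] nz by (simp add: pos_divide_le_eq)
      then show "0 \<le> \<theta>" by (meson order_trans abs_ge_zero divide_nonneg_nonneg)
    qed (use d(1) d(2)[OF x] in auto)
    finally show ?thesis .
  qed
  have "\<bar>(\<Sum>x\<in>X. wt x * (1 / (z - x))) - (LINT x|M. 1 / (z - x))\<bar> \<le> (\<Sum>x\<in>X. wt x * (\<theta> / d)) + (LINT x|M. \<theta> / d)"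
    by (rule error_bound[OF bound quad_rational[OF dp] int_kernel[OF d] int_div]) auto
  also have "\<dots> = 2 * (\<theta> / d * measure M (space M))"
    by (simp only: sum_distrib_right[symmetric] wt_sum lebesgue_integral_const) simp
  finally show ?thesis .
qed

text \<open>Constant sign of \<open>q\<close>, recorded by \<eta>, makes the error majorant
  \<open>\<eta> * q\<close> a polynomial again, so the quadrature sum of the majorant equals its
  integral and needs no bound uniform in n.\<close>

lemma error_polynomial:
  assumes d: "\<And>x. x \<in> C \<Longrightarrow> 1 \<le> \<bar>z - x\<bar>" and q: "degree q < n" "poly q z = 1"
    and \<eta>: "\<And>x. x \<in> C \<Longrightarrow> \<bar>poly q x\<bar> = \<eta> * poly q x"
  shows "\<bar>(\<Sum>x\<in>X. wt x * (1 / (z - x))) - (LINT x|M. 1 / (z - x))\<bar> \<le> 2 * (\<eta> * (LINT x|M. poly q x))"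
proof -
  define p where "p = synthetic_div q z"
  have dp: "degree p < n" using degree_synthetic_div[of q z] q by (simp add: p_def)
  have bound: "\<bar>1 / (z - x) - poly p x\<bar> \<le> \<eta> * poly q x" if x: "x \<in> C" for x
  proof -
    have nz: "z - x \<noteq> 0" using d[OF x] by auto
    have "poly q x = 1 + (x - z) * poly p x"
      using synthetic_div_poly[of q x z] q(2) by (simp add: p_def)
    then have "1 / (z - x) - poly p x = poly q x / (z - x)" using nz by (simp add: field_simps)
    then have "\<bar>1 / (z - x) - poly p x\<bar> = \<bar>poly q x\<bar> / \<bar>z - x\<bar>" by simp
    also have "\<dots> \<le> \<bar>poly q x\<bar> / 1" by (rule divide_left_mono) (use d[OF x] in auto)
    finally show ?thesis using \<eta>[OF x] by simp
  qed
  have "\<bar>(\<Sum>x\<in>X. wt x * (1 / (z - x))) - (LINT x|M. 1 / (z - x))\<bar>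
      \<le> (\<Sum>x\<in>X. wt x * (\<eta> * poly q x)) + (LINT x|M. \<eta> * poly q x)"
    by (rule error_bound[OF bound quad_poly[OF dp] int_kernel[of 1]]) (use d poly_int in auto)
  also have "(\<Sum>x\<in>X. wt x * (\<eta> * poly q x)) = \<eta> * (\<Sum>x\<in>X. wt x * poly q x)"
    by (simp add: sum_distrib_left mult_ac)
  also have "\<dots> + (LINT x|M. \<eta> * poly q x) = 2 * (\<eta> * (LINT x|M. poly q x))"
    using quad_poly[OF q(1)] by simp
  finally show ?thesis .
qed

end

section \<open>Analytic tools: connectedness, normal families, comparison of moment
  conditions\<close>

lemma closed_of_real_image: "closed C \<Longrightarrow> closed (complex_of_real ` C)"
  by (rule closed_injective_linear_image) (auto simp: inj_def linear_iff scaleR_conv_of_real)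

text \<open>Each open half-plane together with the real gaps is connected, and the two sets share a
  gap.\<close>

lemma connected_complement_of_real:
  assumes "closed C" "C \<noteq> (UNIV :: real set)"
  shows "connected (- complex_of_real ` C)"
proof -
  let ?U = "{z. Im z > 0}" and ?L = "{z. Im z < 0}" and ?R = "complex_of_real ` (- C)"
  have U: "connected ?U" "connected ?L"
    by (intro convex_connected convex_halfspace_Im_gt convex_halfspace_Im_lt)+
  have cU: "?R \<subseteq> closure ?U" and cL: "?R \<subseteq> closure ?L"
  proof -
    have "of_real x \<in> closure ?U" "of_real x \<in> closure ?L" for x :: real
    proof -
      have lim: "(\<lambda>n. of_real x + c * \<i> * of_real (inverse (real (Suc n)))) \<longlonglongrightarrow> of_real x + c * \<i> * of_real 0" for c
        by (intro tendsto_intros LIMSEQ_inverse_real_of_nat)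
      show "of_real x \<in> closure ?U"
        using lim[of 1] unfolding closure_sequential by (intro exI[of _ "\<lambda>n. of_real x + 1 * \<i> * of_real (inverse (real (Suc n)))"]) auto
      show "of_real x \<in> closure ?L"
        using lim[of "-1"] unfolding closure_sequential by (intro exI[of _ "\<lambda>n. of_real x + (-1) * \<i> * of_real (inverse (real (Suc n)))"]) auto
    qed
    then show "?R \<subseteq> closure ?U" "?R \<subseteq> closure ?L" by auto
  qed
  have "connected (?U \<union> ?R)"
    by (rule connected_intermediate_closure[OF U(1) Un_upper1 Un_least[OF closure_subset cU]])
  moreover have "connected (?L \<union> ?R)"
    by (rule connected_intermediate_closure[OF U(2) Un_upper1 Un_least[OF closure_subset cL]])
  moreover have "(?U \<union> ?R) \<inter> (?L \<union> ?R) \<noteq> {}" using assms(2) by auto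
  ultimately have "connected ((?U \<union> ?R) \<union> (?L \<union> ?R))" by (rule connected_Un)
  moreover have "(?U \<union> ?R) \<union> (?L \<union> ?R) = - complex_of_real ` C"
  proof (intro set_eqI iffI)
    fix z assume "z \<in> - complex_of_real ` C"
    moreover have "z = of_real (Re z)" if "Im z = 0" using that by (simp add: complex_eq_iff)
    ultimately show "z \<in> (?U \<union> ?R) \<union> (?L \<union> ?R)"
      by (cases "Im z" "0 :: real" rule: linorder_cases) (auto simp: image_iff)
  qed auto
  ultimately show ?thesis by simp
qed

text \<open>Vitali's theorem for limit 0: a subsequence staying away from 0 on \<open>K\<close>
  would by Montel have a locally uniform limit, which vanishes on \<open>U\<close> and hence on all
  of \<open>S\<close>.\<close>

lemma vitali_zero:
  assumes S: "open S" "connected S" and hol: "\<And>n. f n holomorphic_on S"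
    and bdd: "\<And>K. compact K \<Longrightarrow> K \<subseteq> S \<Longrightarrow> \<exists>B. \<forall>n. \<forall>z\<in>K. norm (f n z) \<le> B"
    and U: "U \<subseteq> S" "\<xi> \<in> S" "\<xi> islimpt U" and lim: "\<And>z. z \<in> U \<Longrightarrow> (\<lambda>n. f n z) \<longlonglongrightarrow> 0"
    and K: "compact K" "K \<subseteq> S"
  shows "uniform_limit K f (\<lambda>_. 0) sequentially"
proof (rule ccontr)
  assume "\<not> ?thesis"
  then obtain \<epsilon> where \<epsilon>: "\<epsilon> > 0" "\<exists>\<^sub>F n in sequentially. \<not> (\<forall>z\<in>K. dist (f n z) 0 < \<epsilon>)"
    unfolding uniform_limit_iff frequently_def by auto
  then have "infinite {n. \<not> (\<forall>z\<in>K. dist (f n z) 0 < \<epsilon>)}"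
    by (simp add: frequently_cofinite cofinite_eq_sequentially[symmetric])
  then obtain r0 :: "nat \<Rightarrow> nat" where r0: "strict_mono r0" "\<And>i. r0 i \<in> {n. \<not> (\<forall>z\<in>K. dist (f n z) 0 < \<epsilon>)}"
    using infinite_enumerate by blast
  obtain g r where g: "g holomorphic_on S" "strict_mono (r :: nat \<Rightarrow> nat)"
      "\<And>x. x \<in> S \<Longrightarrow> ((\<lambda>n. f (r0 (r n)) x) \<longlonglongrightarrow> g x)"
      "\<And>K. \<lbrakk>compact K; K \<subseteq> S\<rbrakk> \<Longrightarrow> uniform_limit K ((\<lambda>i. f (r0 i)) \<circ> r) g sequentially"
  proof (rule Montel[of S "range f" "\<lambda>i. f (r0 i)"])
    show "open S" by fact
    show "\<And>h. h \<in> range f \<Longrightarrow> h holomorphic_on S" using hol by auto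
    show "\<exists>B. \<forall>h\<in>range f. \<forall>z\<in>K. norm (h z) \<le> B" if "compact K" "K \<subseteq> S" for K
      using bdd[OF that] by auto
    show "range (\<lambda>i. f (r0 i)) \<subseteq> range f" by auto
  qed blast
  have "g z = 0" if "z \<in> U" for z
  proof -
    have "(\<lambda>n. f (r0 (r n)) z) \<longlonglongrightarrow> 0"
      using LIMSEQ_subseq_LIMSEQ[OF lim[OF that] strict_mono_o[OF r0(1) g(2)]] by (simp add: o_def)
    then show ?thesis using g(3)[of z] U(1) that LIMSEQ_unique by blast
  qed
  then have g0: "g z = 0" if "z \<in> S" for z
    using analytic_continuation[OF g(1) S U] that by blast
  have "uniform_limit K ((\<lambda>i. f (r0 i)) \<circ> r) g sequentially" by (rule g(4)[OF K])
  then have "\<forall>\<^sub>F n in sequentially. \<forall>z\<in>K. dist (((\<lambda>i. f (r0 i)) \<circ> r) n z) (g z) < \<epsilon>"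
    using \<epsilon>(1) unfolding uniform_limit_iff by blast
  then obtain n where "\<forall>z\<in>K. dist (f (r0 (r n)) z) (g z) < \<epsilon>"
    by (auto simp: eventually_sequentially)
  then have "\<forall>z\<in>K. dist (f (r0 (r n)) z) 0 < \<epsilon>" using g0 K(2) by (metis subsetD)
  then show False using r0(2)[of "r n"] by blast
qed

text \<open>Geometric factors only change the 2k-th roots by a bounded factor. The summand 1 is met
  by truncating the series for \<open>c\<close> at 1; if the truncated series converges, its terms
  tend to 0 and truncation eventually has no effect. Vanishing \<open>c\<close> contributes 0 by the
  convention for \<open>powr\<close>.\<close>

lemma carleman_comparison:
  fixes c b :: "nat \<Rightarrow> real"
  assumes div: "\<not> summable (\<lambda>i. \<bar>c (Suc i)\<bar> powr (- 1 / (2 * real (Suc i))))"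
    and bpos: "\<And>k. b k > 0" and K: "K \<ge> 1" "R \<ge> 1"
    and le: "\<And>k. b k \<le> K * R ^ k * (\<bar>c k\<bar> + 1)"
  shows "\<not> summable (\<lambda>i. b (Suc i) powr (- 1 / (2 * real (Suc i))))"
proof
  let ?a = "\<lambda>i. \<bar>c (Suc i)\<bar> powr (- 1 / (2 * real (Suc i)))"
  let ?b = "\<lambda>i. b (Suc i) powr (- 1 / (2 * real (Suc i)))"
  assume sb: "summable ?b"
  have key: "norm (min (?a i) 1) \<le> 2 * K * R * ?b i" for i
  proof (cases "c (Suc i) = 0")
    case False
    define k where "k = Suc i"
    define M where "M = max \<bar>c k\<bar> 1"
    define t where "t = 1 / (2 * real k)"
    have t: "0 < t" "t \<le> 1" "real k * t = 1 / 2" by (auto simp: t_def k_def)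
    have M: "M \<ge> 1" by (simp add: M_def)
    have "b k \<le> K * R ^ k * (\<bar>c k\<bar> + 1)" by (rule le)
    also have "\<dots> \<le> K * R ^ k * (2 * M)"
      using K by (intro mult_left_mono) (auto simp: M_def)
    finally have bk: "b k \<le> (2 * K) * R ^ k * M" by (simp add: mult_ac)
    have "b k powr t \<le> ((2 * K) * R ^ k * M) powr t"
      using bk bpos[of k] t by (intro powr_mono2) auto
    also have "\<dots> = (2 * K) powr t * (R powr (real k * t)) * M powr t"
      using K M by (simp add: powr_mult powr_realpow[symmetric] powr_powr)
    also have "\<dots> \<le> (2 * K) * R * M powr t"
    proof (intro mult_right_mono mult_mono)
      show "(2 * K) powr t \<le> 2 * K" using powr_mono[of t 1 "2 * K"] t K by simp
      show "R powr (real k * t) \<le> R" unfolding t(3) using powr_mono[of "1 / 2" 1 R] K by simp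
    qed (use K in auto)
    finally have 1: "b k powr t \<le> (2 * K * R) * M powr t" .
    have "min (?a i) 1 = M powr (- t)"
    proof (cases "\<bar>c k\<bar> \<le> 1")
      case True
      have "1 = 1 powr (- t)" by simp
      also have "\<dots> \<le> \<bar>c k\<bar> powr (- t)"
        by (rule powr_mono2') (use t True False in \<open>auto simp: k_def\<close>)
      finally show ?thesis using True by (simp add: M_def t_def k_def min_def)
    next
      case False
      then have "\<bar>c k\<bar> powr (- t) \<le> 1 powr (- t)"
        by (intro powr_mono2') (use t in auto)
      then show ?thesis using False by (simp add: M_def t_def k_def min_def)
    qed
    also have "\<dots> \<le> 2 * K * R * b k powr (- t)"
      using 1 bpos[of k] M by (simp add: powr_minus field_simps)
    finally have "min (?a i) 1 \<le> 2 * K * R * ?b i" by (simp add: t_def k_def)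
    then show ?thesis by simp
  qed (use K in simp)
  have sm: "summable (\<lambda>i. min (?a i) 1)"
    by (rule summable_comparison_test'[where N = 0, OF summable_mult[OF sb] key])
  have "(\<lambda>i. min (?a i) 1) \<longlonglongrightarrow> 0" by (rule summable_LIMSEQ_zero[OF sm])
  then have "\<forall>\<^sub>F i in sequentially. min (?a i) 1 < 1" by (rule order_tendstoD) simp
  then have "\<forall>\<^sub>F i in sequentially. min (?a i) 1 = ?a i" by eventually_elim (simp add: min_def split: if_splits)
  then have "summable (\<lambda>i. min (?a i) 1) = summable ?a" by (rule summable_cong)
  then have "summable ?a" using sm by blast
  with div show False by blast
qed

section \<open>Convergence of the quadratures for the reversed products\<close>

context nikishin_system
begin

lemma adj_last: "adj (m - 1) m"
  using m2 by (auto simp: adj_def)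

lemma m_in: "m \<in> {1..m}" "m - 1 \<in> {1..m}"
  using m2 by auto

lemma last_interval_side:
  obtains s p :: real where "s \<in> {1, -1}" "\<And>x. x \<in> \<Delta> m \<Longrightarrow> s * (x - p) \<ge> 0"
    "\<And>x. x \<in> \<Delta> (m - 1) \<Longrightarrow> s * (x - p) \<le> 0"
proof -
  obtain p where p: "\<Delta> (m - 1) \<subseteq> {..p} \<and> \<Delta> m \<subseteq> {p..} \<or> \<Delta> (m - 1) \<subseteq> {p..} \<and> \<Delta> m \<subseteq> {..p}"
    by (rule adj_separated[OF adj_last])
  then show thesis
    using that[of 1 p] that[of "-1" p] by fastforce
qed

lemma nik_m: "j \<in> {1..m} \<Longrightarrow> nik \<sigma> m j \<in> class_M (\<Delta> m)"
  using class_M_nik m_in by blast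

lemma integral_nik_m_pos:
  assumes j: "j \<in> {1..m}" and q: "q \<noteq> 0" "\<And>x. x \<in> \<Delta> m \<Longrightarrow> poly q x \<ge> 0"
  shows "(LINT x|sm_var (nik \<sigma> m j). poly q x) > 0"
proof -
  let ?M = "sm_var (nik \<sigma> m j)"
  note M = class_MD[OF nik_m[OF j]]
  have ae: "AE x in ?M. 0 \<le> poly q x" using M(8) by eventually_elim (rule q(2))
  have "(LINT x|?M. poly q x) \<noteq> 0"
  proof
    assume "(LINT x|?M. poly q x) = 0"
    then have "AE x in ?M. poly q x = 0" using integral_nonneg_eq_0_iff_AE[OF M(11) ae] by blast
    then have "infinite {x \<in> S m. poly q x = 0}"
      by (intro AE_zero_infinite_zeros[OF m_in(1) nik_m[OF j]]) (auto intro!: continuous_intros)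
    moreover have "finite {x \<in> S m. poly q x = 0}"
      using poly_roots_finite[OF q(1)] by (rule rev_finite_subset) auto
    ultimately show False by blast
  qed
  moreover have "(LINT x|?M. poly q x) \<ge> 0" using ae by (rule integral_nonneg_AE)
  ultimately show ?thesis by linarith
qed

lemma integral_nik_m_le:
  assumes j: "j \<in> {1..m}" and q: "\<And>x. x \<in> \<Delta> m \<Longrightarrow> poly q x \<ge> 0"
  shows "(LINT x|sm_var (nik \<sigma> m j). poly q x) \<le> (LINT x|\<mu> m. \<bar>dens \<sigma> m j x\<bar> * \<bar>poly q x\<bar>)"
proof -
  let ?M = "sm_var (nik \<sigma> m j)"
  have "sm_integral (nik \<sigma> m j) (poly q) = sm_integral (\<sigma> m) (\<lambda>x. dens \<sigma> m j x *\<^sub>R poly q x)"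
    by (rule nik_integral(2)[OF m_in(1) j]) measurable
  then have "\<bar>LINT x|?M. poly q x\<bar> = \<bar>LINT x|\<mu> m. dens \<sigma> m j x * poly q x\<bar>"
    using class_MD(1)[OF nik_m[OF j]] class_MD(1)[OF class_M_gen[OF m_in(1)]]
    by (auto simp: sm_integral_def)
  also have "\<dots> \<le> (LINT x|\<mu> m. \<bar>dens \<sigma> m j x * poly q x\<bar>)" by (rule integral_abs_bound)
  finally show ?thesis by (simp add: abs_mult)
qed

text \<open>Transfers bounds from powers of x against \<open>\<sigma> m\<close> to powers about
  \<open>c\<close> against \<open>nik \<sigma> m j\<close>. At distance at least 1 from p' the
  density is bounded; closer to p' the power itself is bounded by that of D + 1.\<close>

lemma moments_bound:
  assumes j: "j \<in> {1..m}" and s: "s \<in> {1, -1}" "\<And>x. x \<in> \<Delta> m \<Longrightarrow> s * (x - p) \<ge> 0" and c: "s * (c - p) \<le> 0"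
  shows "\<exists>K\<ge>1. \<exists>R\<ge>1. \<forall>k. (LINT x|sm_var (nik \<sigma> m j). (s * (x - c)) ^ k) \<le> K * R ^ k * (\<bar>moment (\<sigma> m) k\<bar> + 1)"
proof -
  let ?d = "dens \<sigma> m j :: real \<Rightarrow> real" and ?N = "measure (\<mu> m) (space (\<mu> m))"
  have u0: "s * (x - c) \<ge> 0" if "x \<in> \<Delta> m" for x
    using s(2)[OF that] c by (simp add: algebra_simps)
  note M = class_MD[OF class_M_gen[OF m_in(1)]]
  have [measurable_cong]: "sets (\<mu> m) = sets borel" by (rule M(2))
  have [measurable]: "?d \<in> borel_measurable borel" by (rule measurable_dens[OF m_in(1) j])
  interpret finite_measure "\<mu> m" by (rule M(6))
  obtain C p' where C: "\<And>x. x \<in> \<Delta> m \<Longrightarrow> \<bar>x - p'\<bar> \<ge> 1 \<Longrightarrow> \<bar>?d x\<bar> \<le> C"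
  proof (cases "j = m")
    case True
    then show ?thesis using that[of 0 1] by simp
  next
    case False
    obtain p' C where *: "\<And>x. x \<in> \<Delta> m \<Longrightarrow> \<bar>x - p'\<bar> * \<bar>?d x\<bar> \<le> C"
      by (rule dens_decay[OF m_in(1) j]) (use False in auto)
    have "\<bar>?d x\<bar> \<le> C" if "x \<in> \<Delta> m" "\<bar>x - p'\<bar> \<ge> 1" for x
      using mult_right_mono[OF that(2), of "\<bar>?d x\<bar>"] *[OF that(1)] by simp
    then show ?thesis using that by blast
  qed
  define C' where "C' = \<bar>C\<bar>"
  define D where "D = \<bar>c - p'\<bar>"
  define E where "E = (LINT x|\<mu> m. \<bar>?d x\<bar>)"
  define K where "K = 1 + C' + 3 * C' * ?N + E"
  \<comment> \<open>Dominates 2, 2 * \<bar>p\<bar>, 2 * \<bar>c\<bar> and D + 1, the bases of all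
    powers met below.\<close>
  define R where "R = 2 * (1 + \<bar>p\<bar> + \<bar>c\<bar> + D)"
  have nn: "C' \<ge> 0" "D \<ge> 0" "E \<ge> 0" "?N \<ge> 0" by (simp_all add: C'_def D_def E_def)
  have pin: "integrable (\<mu> m) (poly q)" for q by (rule M(11))
  have absin: "integrable (\<mu> m) (\<lambda>x. \<bar>x\<bar> ^ k)" for k
    using integrable_abs[OF M(10)[of k]] by (simp add: power_abs)
  have "(LINT x|sm_var (nik \<sigma> m j). (s * (x - c)) ^ k) \<le> K * R ^ k * (\<bar>moment (\<sigma> m) k\<bar> + 1)" for k
  proof -
    let ?u = "\<lambda>x. s * (x - c)" and ?q = "[:- s * c, s:] ^ k"
    have q: "poly ?q x = ?u x ^ k" for x by (simp add: algebra_simps)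
    have dq: "integrable (\<mu> m) (\<lambda>x. \<bar>?d x\<bar> * \<bar>?u x ^ k\<bar>)"
      using integrable_abs[OF integrable_poly_dens[OF m_in(1) j, of ?q]] by (simp only: q abs_mult)
    have "(LINT x|sm_var (nik \<sigma> m j). ?u x ^ k) \<le> (LINT x|\<mu> m. \<bar>?d x\<bar> * \<bar>?u x ^ k\<bar>)"
    proof -
      have "poly ?q = (\<lambda>x. ?u x ^ k)" by (rule ext) (rule q)
      from integral_nik_m_le[OF j, of ?q, unfolded this] u0 show ?thesis by simp
    qed
    also have "\<dots> \<le> (LINT x|\<mu> m. C' * (2 ^ k * (\<bar>x\<bar> ^ k + \<bar>c\<bar> ^ k)) + (D + 1) ^ k * \<bar>?d x\<bar>)"
    proof (rule integral_mono_AE[OF dq])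
      show "integrable (\<mu> m) (\<lambda>x. C' * (2 ^ k * (\<bar>x\<bar> ^ k + \<bar>c\<bar> ^ k)) + (D + 1) ^ k * \<bar>?d x\<bar>)"
        using absin[of k] integrable_dens[OF m_in(1) j] by auto
      show "AE x in \<mu> m. \<bar>?d x\<bar> * \<bar>?u x ^ k\<bar> \<le> C' * (2 ^ k * (\<bar>x\<bar> ^ k + \<bar>c\<bar> ^ k)) + (D + 1) ^ k * \<bar>?d x\<bar>"
        using AE_\<Delta>[OF m_in(1)]
      proof eventually_elim
        case (elim x)
        have au: "\<bar>?u x ^ k\<bar> = \<bar>x - c\<bar> ^ k" using s(1) by (auto simp: power_abs power_mult_distrib abs_mult)
        have nn2: "0 \<le> C' * (2 ^ k * (\<bar>x\<bar> ^ k + \<bar>c\<bar> ^ k))" "0 \<le> (D + 1) ^ k * \<bar>?d x\<bar>"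
          using nn by auto
        show ?case
        proof (cases "\<bar>x - p'\<bar> \<ge> 1")
          case True
          have "\<bar>x - c\<bar> ^ k \<le> (2 * max \<bar>x\<bar> \<bar>c\<bar>) ^ k" by (intro power_mono) auto
          also have "\<dots> = 2 ^ k * max \<bar>x\<bar> \<bar>c\<bar> ^ k" by (simp add: power_mult_distrib)
          also have "max \<bar>x\<bar> \<bar>c\<bar> ^ k \<le> \<bar>x\<bar> ^ k + \<bar>c\<bar> ^ k" by (auto simp: max_def)
          finally have "\<bar>x - c\<bar> ^ k \<le> 2 ^ k * (\<bar>x\<bar> ^ k + \<bar>c\<bar> ^ k)" by simp
          moreover have "\<bar>?d x\<bar> \<le> C'" using C[OF elim True] by (simp add: C'_def)
          ultimately have "\<bar>?d x\<bar> * \<bar>?u x ^ k\<bar> \<le> C' * (2 ^ k * (\<bar>x\<bar> ^ k + \<bar>c\<bar> ^ k))"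
            unfolding au by (intro mult_mono) (auto simp: nn)
          then show ?thesis using nn2 by linarith
        next
          case False
          then have "\<bar>x - c\<bar> \<le> D + 1" by (simp add: D_def)
          then have "\<bar>x - c\<bar> ^ k \<le> (D + 1) ^ k" by (intro power_mono) auto
          then have "\<bar>?d x\<bar> * \<bar>?u x ^ k\<bar> \<le> (D + 1) ^ k * \<bar>?d x\<bar>"
            unfolding au by (subst mult.commute) (intro mult_right_mono, auto)
          then show ?thesis using nn2 by linarith
        qed
      qed
    qed
    also have "\<dots> = C' * (2 ^ k * ((LINT x|\<mu> m. \<bar>x\<bar> ^ k) + \<bar>c\<bar> ^ k * ?N)) + (D + 1) ^ k * E"
      using absin[of k] integrable_dens[OF m_in(1) j] by (simp add: E_def)
    \<comment> \<open>\<open>s * x\<close> is nonnegative on \<open>\<Delta> m\<close> except where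
      \<open>\<bar>x\<bar>\<close> is at most \<open>\<bar>p\<bar>\<close>, so even odd moments
      control the absolute ones.\<close>
    also have "(LINT x|\<mu> m. \<bar>x\<bar> ^ k) \<le> \<bar>moment (\<sigma> m) k\<bar> + 2 * \<bar>p\<bar> ^ k * ?N"
    proof -
      have "(LINT x|\<mu> m. \<bar>x\<bar> ^ k) \<le> (LINT x|\<mu> m. s ^ k * x ^ k + 2 * \<bar>p\<bar> ^ k)"
      proof (rule integral_mono_AE[OF absin])
        show "integrable (\<mu> m) (\<lambda>x. s ^ k * x ^ k + 2 * \<bar>p\<bar> ^ k)" using M(10)[of k] by auto
        show "AE x in \<mu> m. \<bar>x\<bar> ^ k \<le> s ^ k * x ^ k + 2 * \<bar>p\<bar> ^ k"
          using AE_\<Delta>[OF m_in(1)]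
        proof eventually_elim
          case (elim x)
          have ax: "\<bar>s * x\<bar> = \<bar>x\<bar>" "\<bar>s * p\<bar> = \<bar>p\<bar>" using s(1) by (auto simp: abs_mult)
          show ?case
          proof (cases "s * x \<ge> 0")
            case True
            then have "\<bar>x\<bar> ^ k = s ^ k * x ^ k" using ax by (simp add: power_mult_distrib[symmetric])
            then show ?thesis by simp
          next
            case False
            have "s * p \<le> s * x" using s(2)[OF elim] by (simp add: algebra_simps)
            then have "\<bar>x\<bar> \<le> \<bar>p\<bar>" using False ax by linarith
            then have 1: "\<bar>x\<bar> ^ k \<le> \<bar>p\<bar> ^ k" by (intro power_mono) auto
            have "\<bar>s ^ k * x ^ k\<bar> = \<bar>x\<bar> ^ k" using ax by (simp add: power_mult_distrib[symmetric] power_abs)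
            then show ?thesis using 1 by linarith
          qed
        qed
      qed
      also have "\<dots> = s ^ k * (LINT x|\<mu> m. x ^ k) + 2 * \<bar>p\<bar> ^ k * ?N" using M(10)[of k] by simp
      also have "s ^ k * (LINT x|\<mu> m. x ^ k) \<le> \<bar>s ^ k * (LINT x|\<mu> m. x ^ k)\<bar>" by simp
      also have "\<dots> = \<bar>moment (\<sigma> m) k\<bar>"
        using s(1) M(1) by (auto simp: moment_def sm_integral_def abs_mult power_abs)
      finally show ?thesis by simp
    qed
    finally have "(LINT x|sm_var (nik \<sigma> m j). ?u x ^ k)
       \<le> C' * (2 ^ k * (\<bar>moment (\<sigma> m) k\<bar> + 2 * \<bar>p\<bar> ^ k * ?N + \<bar>c\<bar> ^ k * ?N)) + (D + 1) ^ k * E"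
      using nn by (simp add: mult_left_mono)
    also have "\<dots> = C' * (2 ^ k * \<bar>moment (\<sigma> m) k\<bar>) + C' * (2 * (2 * \<bar>p\<bar>) ^ k * ?N) + C' * ((2 * \<bar>c\<bar>) ^ k * ?N) + (D + 1) ^ k * E"
      by (simp add: power_mult_distrib algebra_simps)
    also have "\<dots> \<le> C' * (R ^ k * \<bar>moment (\<sigma> m) k\<bar>) + C' * (2 * R ^ k * ?N) + C' * (R ^ k * ?N) + R ^ k * E"
      using nn by (intro add_mono mult_left_mono mult_right_mono power_mono) (auto simp: R_def)
    also have "\<dots> = R ^ k * (C' * \<bar>moment (\<sigma> m) k\<bar> + 3 * C' * ?N + E)" by (simp add: algebra_simps)
    also have "\<dots> \<le> R ^ k * (K * (\<bar>moment (\<sigma> m) k\<bar> + 1))"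
    proof (rule mult_left_mono)
      have "C' * \<bar>moment (\<sigma> m) k\<bar> \<le> K * \<bar>moment (\<sigma> m) k\<bar>"
        using nn by (intro mult_right_mono) (auto simp: K_def)
      then show "C' * \<bar>moment (\<sigma> m) k\<bar> + 3 * C' * ?N + E \<le> K * (\<bar>moment (\<sigma> m) k\<bar> + 1)"
        using nn by (simp add: K_def algebra_simps)
      show "0 \<le> R ^ k" using nn by (simp add: R_def)
    qed
    finally show ?thesis by (simp add: mult_ac)
  qed
  moreover have "K \<ge> 1" "R \<ge> 1" using nn by (auto simp: K_def R_def)
  ultimately show ?thesis by blast
qed

text \<open>For such \<open>q\<close> and \<open>z = c - s\<close>, the polynomial \<open>(1 - q x) / (z - x)\<close> in \<open>x\<close> approximates the Cauchy
  kernel with error at most \<open>\<bar>q x\<bar>\<close>.\<close>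

lemma carleman_approximation:
  assumes carl: "carleman (\<sigma> m)" and j: "j \<in> {1..m}" and s: "s \<in> {1, -1}" "\<And>x. x \<in> \<Delta> m \<Longrightarrow> s * (x - p) \<ge> 0"
    and c: "s * (c - p) \<le> 0" and \<epsilon>: "\<epsilon> > 0"
  shows "\<exists>q \<eta>. poly q (c - s) = 1 \<and> (\<forall>x\<in>\<Delta> m. \<bar>poly q x\<bar> = \<eta> * poly q x) \<and>
    \<eta> * (LINT x|sm_var (nik \<sigma> m j). poly q x) < \<epsilon>"
proof -
  \<comment> \<open>The substitution u = s (x - c) maps \<open>\<Delta> m\<close> into u >= 0 and
    the point c - s to u = -1, where the small polynomials are normalised.\<close>
  let ?M = "sm_var (nik \<sigma> m j)" and ?t = "[:- s * c, s:]"
  define L where "L p = (LINT x|?M. poly (pcompose p ?t) x)" for p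
  have u0: "s * (x - c) \<ge> 0" if "x \<in> \<Delta> m" for x
    using s(2)[OF that] c by (simp add: algebra_simps)
  have t: "poly ?t x = s * (x - c)" for x by (simp add: algebra_simps)
  have dt: "degree ?t > 0" using s(1) by auto
  have nz: "pcompose p ?t \<noteq> 0" if "p \<noteq> 0" for p
    using that dt pcompose_eq_0 by blast
  note pint = class_MD(11)[OF nik_m[OF j]]
  interpret stieltjes_functional L
  proof
    show "L (p + q) = L p + L q" for p q by (simp add: L_def pcompose_add pint)
    show "L (smult c p) = c * L p" for c p by (simp add: L_def pcompose_smult)
    show "L (p * p) > 0" if "p \<noteq> 0" for p
      unfolding L_def using nz[OF that] by (intro integral_nik_m_pos[OF j]) (auto simp: pcompose_mult)
    show "L ([:0, 1:] * p * p) > 0" if "p \<noteq> 0" for p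
      unfolding L_def
    proof (rule integral_nik_m_pos[OF j])
      have "[:0, 1:] * p * p \<noteq> 0" using that by simp
      then show "pcompose ([:0, 1:] * p * p) ?t \<noteq> 0" by (rule nz)
      fix x assume x: "x \<in> \<Delta> m"
      have "poly (pcompose ([:0, 1:] * p * p) ?t) x = (s * (x - c)) * (poly (pcompose p ?t) x)\<^sup>2"
        by (simp add: poly_pcompose power2_eq_square algebra_simps)
      then show "poly (pcompose ([:0, 1:] * p * p) ?t) x \<ge> 0" using u0[OF x] by simp
    qed
  qed
  have Lm: "L (monom 1 k) = (LINT x|?M. (s * (x - c)) ^ k)" for k
  proof -
    have "poly (pcompose (monom 1 k) ?t) = (\<lambda>x. (s * (x - c)) ^ k)"
      by (rule ext) (simp only: poly_pcompose poly_monom t mult_1)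
    then show ?thesis unfolding L_def by (simp only:)
  qed
  obtain K R where KR: "K \<ge> 1" "R \<ge> 1" "\<And>k. L (monom 1 k) \<le> K * R ^ k * (\<bar>moment (\<sigma> m) k\<bar> + 1)"
    using moments_bound[OF j s c] unfolding Lm by blast
  have mpos: "L (monom 1 k) > 0" for k
    using h_pos[of k] h_le_moment[of k] by linarith
  have "\<not> summable (\<lambda>k. L (monom 1 (Suc k)) powr (- 1 / (2 * real (Suc k))))"
    by (rule carleman_comparison[where c = "moment (\<sigma> m)" and b = "\<lambda>k. L (monom 1 k)", OF _ mpos KR])
       (use carl in \<open>simp add: carleman_def\<close>)
  from carleman_small_polynomials[OF this \<epsilon>] obtain P where P: "poly P (-1) = 1"
    and small: "L (P * P) < \<epsilon> \<or> L ([:0, 1:] * P * P) < \<epsilon>" by blast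
  have tz: "poly ?t (c - s) = -1" using s(1) by auto
  from small show ?thesis
  proof
    assume *: "L (P * P) < \<epsilon>"
    show ?thesis
      by (rule exI[of _ "pcompose (P * P) ?t"], rule exI[of _ 1])
         (use * P tz in \<open>simp add: L_def poly_pcompose\<close>)
  next
    assume *: "L ([:0, 1:] * P * P) < \<epsilon>"
    have val: "poly (pcompose ([:0, 1:] * P * P) ?t) x = (s * (x - c)) * (poly (pcompose P ?t) x)\<^sup>2" for x
      by (simp add: poly_pcompose power2_eq_square algebra_simps)
    show ?thesis
    \<comment> \<open>The weight u equals -1 at the evaluation point, so the sign is reversed to
      reach the value 1; \<eta> = -1 compensates on \<open>\<Delta> m\<close>.\<close>
    proof (intro exI[of _ "- pcompose ([:0, 1:] * P * P) ?t"] exI[of _ "-1"] conjI ballI)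
      show "poly (- pcompose ([:0, 1:] * P * P) ?t) (c - s) = 1"
        using P tz by (simp add: poly_pcompose)
      show "- 1 * (LINT x|?M. poly (- pcompose ([:0, 1:] * P * P) ?t) x) < \<epsilon>"
        using * by (simp add: L_def)
      fix x assume "x \<in> \<Delta> m"
      then have "poly (pcompose ([:0, 1:] * P * P) ?t) x \<ge> 0" unfolding val using u0 by simp
      then show "\<bar>poly (- pcompose ([:0, 1:] * P * P) ?t) x\<bar> = - 1 * poly (- pcompose ([:0, 1:] * P * P) ?t) x"
        by (simp only: poly_minus abs_minus_cancel abs_of_nonneg)
    qed
  qed
qed

lemma solution_leading:
  assumes sol: "solution n b" and bm: "b m \<noteq> 0"
  obtains c where "c \<noteq> 0" "b m = smult c (nodal (Zs b m))"
proof -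
  note Z = zeros_exact[OF sol bm m_in(1)]
  have "nodal (Zs b m) dvd b m"
    by (rule nodal_dvd[OF Z(1)]) (simp add: Zs_def A_m)
  then obtain r where r: "b m = nodal (Zs b m) * r" by (rule dvdE)
  then have rz: "r \<noteq> 0" using bm by auto
  have "degree (b m) = card (Zs b m) + degree r"
    unfolding r using degree_mult_eq[OF nodal_nonzero rz] by (simp add: degree_nodal)
  then have "degree r = 0" using Z(2) solution_degree[OF sol bm] by simp
  then obtain c where c: "r = [:c:]" by (meson degree_eq_zeroE)
  show thesis
    by (rule that[of c]) (use c rz r in auto)
qed

lemma solution_quadrature:
  assumes sol: "solution n b" and bm: "b m \<noteq> 0" and n: "n \<ge> 1" and j: "j \<in> {1..m}"
  shows "\<exists>W e. quadrature (sm_var (nik \<sigma> m j)) (\<Delta> m) (Zs b m) W n e \<and> W \<subseteq> \<Delta> (m - 1) \<and> card W = n - 1"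
proof -
  let ?M = "sm_var (nik \<sigma> m j)" and ?X = "Zs b m"
  note M = class_MD[OF nik_m[OF j]]
  note Z = zeros_exact[OF sol bm m_in(1)]
  obtain W where W: "quasi_orth n b m j W" using quasi_orth_m[OF sol bm n j] by blast
  note WD = quasi_orthD[OF W m_in(1)]
  have W': "W \<subseteq> \<Delta> (m - 1)" "card W = n - 1"
    using W m2 S_subset[of "m - 1"] unfolding quasi_orth_def by auto
  obtain e where e: "e \<in> {1, -1}" "\<And>x. x \<in> \<Delta> m \<Longrightarrow> e * poly (nodal W) x > 0"
    using WD(5) by blast
  obtain c where c: "c \<noteq> 0" "b m = smult c (nodal ?X)"
    by (rule solution_leading[OF sol bm])
  have orth: "(LINT x|?M. poly q x * poly (nodal ?X) x / poly (nodal W) x) = 0" if "q = 0 \<or> degree q < n - 1" for q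
  proof -
    let ?f = "\<lambda>x. poly q x * poly (nodal ?X) x / poly (nodal W) x"
    have "(-1) ^ m * c * sm_integral (nik \<sigma> m j) ?f = sm_integral (\<sigma> m) (\<lambda>x. ((-1) ^ m * c) * (dens \<sigma> m j x *\<^sub>R ?f x))"
      unfolding sm_integral_cmult
      by (subst nik_integral(2)[OF m_in(1) j]) auto
    also have "\<dots> = sm_integral (\<sigma> m) (\<lambda>x. poly q x * A b m x * dens \<sigma> m j x / poly (nodal W) x)"
      unfolding A_m c(2) by (rule arg_cong[where f = "sm_integral _"]) (simp add: fun_eq_iff)
    also have "\<dots> = 0" by (rule WD(4)[OF that])
    finally show ?thesis using c(1) M(1) by (auto simp: sm_integral_def)
  qed
  have "quadrature ?M (\<Delta> m) ?X W n e"
  proof (rule quadrature.intro)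
    show "?X \<subseteq> \<Delta> m" using Zs_S S_subset by blast
    show "card W \<le> n - 1" using W' by simp
  qed (use M closed_\<Delta>[OF m_in(1)] Z WD(1,2) e n orth in auto)
  then show ?thesis using W' by blast
qed

definition qsum :: "(nat \<Rightarrow> real poly) \<Rightarrow> nat \<Rightarrow> 'a \<Rightarrow> 'a :: real_normed_field" where
  "qsum b j z = (\<Sum>x\<in>Zs b m. of_real (quadrature.wt (sm_var (nik \<sigma> m j)) (Zs b m) x) * (1 / (z - of_real x)))"

text \<open>The polynomial \<open>q\<close> depends on the tolerance only. As soon as n exceeds its
  degree, the error bound holds with a right side free of n.\<close>

lemma real_points_convergence_carleman:
  assumes sol: "\<And>n. n \<ge> 1 \<Longrightarrow> solution n (b n) \<and> b n m \<noteq> 0" and j: "j \<in> {1..m}"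
    and carl: "carleman (\<sigma> m)"
    and s: "s \<in> {1, -1}" "\<And>x. x \<in> \<Delta> m \<Longrightarrow> s * (x - p) \<ge> 0" and z: "s * (z - p) \<le> -1"
  shows "(\<lambda>n. qsum (b n) j z - (LINT x|sm_var (nik \<sigma> m j). 1 / (z - x))) \<longlonglongrightarrow> (0::real)"
proof (rule LIMSEQ_I)
  fix r :: real assume r: "r > 0"
  let ?M = "sm_var (nik \<sigma> m j)"
  \<comment> \<open>The centre z + s puts the normalisation point c - s of
    \<open>carleman_approximation\<close> at \<open>z\<close>.\<close>
  have c: "s * ((z + s) - p) \<le> 0" using z s(1) by auto
  obtain q \<eta> where q: "poly q z = 1" "\<And>x. x \<in> \<Delta> m \<Longrightarrow> \<bar>poly q x\<bar> = \<eta> * poly q x"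
      "\<eta> * (LINT x|?M. poly q x) < r / 2"
    using carleman_approximation[OF carl j s c, of "r / 2"] r by auto
  have d: "1 \<le> \<bar>z - x\<bar>" if "x \<in> \<Delta> m" for x
  proof -
    have "s * (x - z) = s * (x - p) - s * (z - p)" by (simp add: algebra_simps)
    then have "s * (x - z) \<ge> 1" using s(2)[OF that] z by linarith
    then show ?thesis using s(1) by auto
  qed
  show "\<exists>no. \<forall>n\<ge>no. norm (qsum (b n) j z - (LINT x|?M. 1 / (z - x)) - 0) < r"
  proof (intro exI allI impI)
    fix n assume dq: "n \<ge> Suc (degree q)"
    then have n1: "n \<ge> 1" by simp
    obtain W e where "quadrature ?M (\<Delta> m) (Zs (b n) m) W n e"
      using solution_quadrature[of n "b n" j] sol[OF n1] n1 j by blast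
    then interpret quadrature ?M "\<Delta> m" "Zs (b n) m" W n e .
    have "\<bar>(\<Sum>x\<in>Zs (b n) m. wt x * (1 / (z - x))) - (LINT x|?M. 1 / (z - x))\<bar> \<le> 2 * (\<eta> * (LINT x|?M. poly q x))"
      by (rule error_polynomial[OF d _ q(1,2)]) (use dq in auto)
    then show "norm (qsum (b n) j z - (LINT x|?M. 1 / (z - x)) - 0) < r"
      using q(3) unfolding qsum_def by simp
  qed
qed

lemma bounded_gap:
  assumes bdd: "bounded (\<Delta> (m - 1))" "\<Delta> (m - 1) \<inter> \<Delta> m = {}"
  obtains s \<alpha> \<beta> \<gamma> :: real where "s \<in> {1, -1}" "\<alpha> \<le> \<beta>" "\<beta> < \<gamma>"
    "\<And>x. x \<in> \<Delta> (m - 1) \<Longrightarrow> \<alpha> \<le> s * x \<and> s * x \<le> \<beta>" "\<And>x. x \<in> \<Delta> m \<Longrightarrow> \<gamma> \<le> s * x"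
proof -
  obtain s p where s: "s \<in> {1, -1}" "\<And>x. x \<in> \<Delta> m \<Longrightarrow> s * (x - p) \<ge> 0" "\<And>x. x \<in> \<Delta> (m - 1) \<Longrightarrow> s * (x - p) \<le> 0"
    by (rule last_interval_side) blast
  have comp: "compact (\<Delta> (m - 1))"
    using bdd(1) closed_\<Delta>[OF m_in(2)] by (simp add: compact_eq_bounded_closed)
  have ne: "\<Delta> (m - 1) \<noteq> {}" using infinite_\<Delta>[OF m_in(2)] by auto
  have cont: "continuous_on (\<Delta> (m - 1)) (\<lambda>x. s * x)" by (intro continuous_intros)
  obtain x1 where x1: "x1 \<in> \<Delta> (m - 1)" "\<And>x. x \<in> \<Delta> (m - 1) \<Longrightarrow> s * x \<le> s * x1"
    using continuous_attains_sup[OF comp ne cont] by blast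
  obtain x0 where x0: "x0 \<in> \<Delta> (m - 1)" "\<And>x. x \<in> \<Delta> (m - 1) \<Longrightarrow> s * x0 \<le> s * x"
    using continuous_attains_inf[OF comp ne cont] by blast
  have "x1 \<notin> of_real ` \<Delta> m" using x1(1) bdd(2) by auto
  then obtain e where e: "e > 0" "\<And>x. x \<in> \<Delta> m \<Longrightarrow> e \<le> norm (x1 - of_real x)"
    by (rule closed_of_real_dist[OF closed_\<Delta>[OF m_in(1)]]) metis
  have "s * x1 + e \<le> s * x" if x: "x \<in> \<Delta> m" for x
  proof -
    have "s * x1 \<le> s * x" using s(2)[OF x] s(3)[OF x1(1)] by (simp add: algebra_simps)
    moreover have "\<bar>s * x1 - s * x\<bar> = \<bar>x1 - x\<bar>" using s(1) by auto
    ultimately show ?thesis using e(2)[OF x] by simp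
  qed
  then show thesis
    using that[of s "s * x0" "s * x1" "s * x1 + e"] s(1) x0 x1 e(1) by auto
qed

lemma real_points_convergence_bounded:
  assumes sol: "\<And>n. n \<ge> 1 \<Longrightarrow> solution n (b n) \<and> b n m \<noteq> 0" and j: "j \<in> {1..m}"
    and s: "s \<in> {1, -1}" "\<alpha> \<le> \<beta>" "\<And>x. x \<in> \<Delta> (m - 1) \<Longrightarrow> \<alpha> \<le> s * x \<and> s * x \<le> \<beta>" "\<And>x. x \<in> \<Delta> m \<Longrightarrow> \<gamma> \<le> s * x"
    and z: "\<beta> < s * z" "s * z < \<gamma>"
  shows "(\<lambda>n. qsum (b n) j z - (LINT x|sm_var (nik \<sigma> m j). 1 / (z - x))) \<longlonglongrightarrow> (0::real)"
proof -
  let ?M = "sm_var (nik \<sigma> m j)"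
  \<comment> \<open>The largest ratio of \<open>\<bar>z - t\<bar>\<close> to
    \<open>\<bar>x - t\<bar>\<close>, approached with t at the far end \<alpha> and x at the near
    end \<gamma>; it is below 1 because \<open>z\<close> lies in the gap.\<close>
  define \<theta> where "\<theta> = (s * z - \<alpha>) / (\<gamma> - \<alpha>)"
  define d where "d = \<gamma> - s * z"
  have \<theta>: "0 \<le> \<theta>" "\<theta> < 1" using s(2) z by (auto simp: \<theta>_def)
  have d0: "d > 0" using z by (simp add: d_def)
  have as: "\<bar>u - v\<bar> = \<bar>s * u - s * v\<bar>" for u v using s(1) by auto
  have d: "d \<le> \<bar>z - x\<bar>" if "x \<in> \<Delta> m" for x
    using s(4)[OF that] unfolding as[of z x] d_def by linarith
  have factor: "\<bar>z - t\<bar> \<le> \<theta> * \<bar>x - t\<bar>" if t: "t \<in> \<Delta> (m - 1)" and x: "x \<in> \<Delta> m" for t x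
  proof -
    have *: "\<alpha> \<le> s * t" "s * t \<le> \<beta>" "\<gamma> \<le> s * x" using s(3)[OF t] s(4)[OF x] by auto
    have pos: "0 < \<gamma> - \<alpha>" using s(2) z by linarith
    have "(s * z - s * t) * (\<gamma> - \<alpha>) \<le> (s * z - \<alpha>) * (\<gamma> - s * t)"
    proof -
      have "(s * z - \<alpha>) * (\<gamma> - s * t) - (s * z - s * t) * (\<gamma> - \<alpha>) = (\<gamma> - s * z) * (s * t - \<alpha>)"
        by (simp add: algebra_simps)
      also have "\<dots> \<ge> 0" using * z by (intro mult_nonneg_nonneg) auto
      finally show ?thesis by simp
    qed
    then have "s * z - s * t \<le> (s * z - \<alpha>) * (\<gamma> - s * t) / (\<gamma> - \<alpha>)" using pos by (simp add: pos_le_divide_eq)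
    also have "\<dots> = \<theta> * (\<gamma> - s * t)" by (simp add: \<theta>_def)
    also have "\<dots> \<le> \<theta> * (s * x - s * t)" using \<theta>(1) *(3) by (intro mult_left_mono) auto
    finally have "s * z - s * t \<le> \<theta> * (s * x - s * t)" .
    then show ?thesis unfolding as[of z t] as[of x t] using * z by simp
  qed
  have bound: "norm (qsum (b n) j z - (LINT x|?M. 1 / (z - x))) \<le> 2 * (\<theta> ^ (n - 1) / d * measure ?M (space ?M))" if n: "n \<ge> 1" for n
  proof -
    obtain W e where q: "quadrature ?M (\<Delta> m) (Zs (b n) m) W n e" and W': "W \<subseteq> \<Delta> (m - 1)" "card W = n - 1"
      using solution_quadrature[of n "b n" j] sol[OF n] n j by blast
    interpret quadrature ?M "\<Delta> m" "Zs (b n) m" W n e by (rule q)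
    have "\<bar>poly (nodal W) z\<bar> \<le> \<theta> ^ (n - 1) * \<bar>poly (nodal W) x\<bar>" if x: "x \<in> \<Delta> m" for x
    proof -
      have "\<bar>poly (nodal W) z\<bar> = (\<Prod>t\<in>W. \<bar>z - t\<bar>)" by (simp add: poly_nodal abs_prod)
      also have "\<dots> \<le> (\<Prod>t\<in>W. \<theta> * \<bar>x - t\<bar>)"
        by (rule prod_mono) (use factor x W'(1) in auto)
      also have "\<dots> = \<theta> ^ (n - 1) * \<bar>poly (nodal W) x\<bar>"
        by (simp add: prod.distrib poly_nodal abs_prod W'(2))
      finally show ?thesis .
    qed
    from error_geometric[OF d0 d this] show ?thesis unfolding qsum_def by simp
  qed
  have "(\<lambda>n. \<theta> ^ n) \<longlonglongrightarrow> 0" using \<theta> by (rule LIMSEQ_realpow_zero)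
  then have "(\<lambda>n. \<theta> ^ (Suc n - 1)) \<longlonglongrightarrow> 0" by simp
  then have "(\<lambda>n. \<theta> ^ (n - 1)) \<longlonglongrightarrow> 0" by (rule filterlim_sequentially_Suc[THEN iffD1])
  from tendsto_mult_right[OF this, of "2 / d * measure ?M (space ?M)"]
  have lim: "(\<lambda>n. 2 * (\<theta> ^ (n - 1) / d * measure ?M (space ?M))) \<longlonglongrightarrow> 0"
    by (simp add: mult_ac)
  have "\<forall>\<^sub>F n in sequentially. norm (qsum (b n) j z - (LINT x|?M. 1 / (z - x))) \<le> 2 * (\<theta> ^ (n - 1) / d * measure ?M (space ?M))"
    using eventually_ge_at_top[of 1] by eventually_elim (rule bound)
  then show ?thesis by (rule Lim_null_comparison[OF _ lim])
qed

lemma real_points_convergence: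
  assumes sol: "\<And>n. n \<ge> 1 \<Longrightarrow> solution n (b n) \<and> b n m \<noteq> 0" and j: "j \<in> {1..m}"
    and hyp: "carleman (\<sigma> m) \<or> bounded (\<Delta> (m - 1)) \<and> \<Delta> (m - 1) \<inter> \<Delta> m = {}"
  obtains u v :: real where "u < v" "{u<..<v} \<inter> \<Delta> m = {}"
    "\<And>z. z \<in> {u<..<v} \<Longrightarrow> (\<lambda>n. qsum (b n) j z - (LINT x|sm_var (nik \<sigma> m j). 1 / (z - x))) \<longlonglongrightarrow> (0::real)"
  using hyp
proof
  assume carl: "carleman (\<sigma> m)"
  obtain s p where s: "s \<in> {1, -1}" "\<And>x. x \<in> \<Delta> m \<Longrightarrow> s * (x - p) \<ge> 0"
    by (rule last_interval_side) blast
  \<comment> \<open>A unit interval on the side of \<open>p\<close> away from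
    \<open>\<Delta> m\<close>, at distance at least 1 from \<open>p\<close>.\<close>
  define u where "u = (if s = 1 then p - 2 else p + 1)"
  have z: "s * (z - p) \<le> -1" if "z \<in> {u<..<u+1}" for z
    using that s(1) by (auto simp: u_def)
  show thesis
  proof (rule that[of u "u + 1"])
    show "{u<..<u + 1} \<inter> \<Delta> m = {}" using z s(2) by fastforce
    show "(\<lambda>n. qsum (b n) j z - (LINT x|sm_var (nik \<sigma> m j). 1 / (z - x))) \<longlonglongrightarrow> (0::real)" if "z \<in> {u<..<u + 1}" for z
      by (rule real_points_convergence_carleman[OF sol j carl s z[OF that]])
  qed simp
next
  assume "bounded (\<Delta> (m - 1)) \<and> \<Delta> (m - 1) \<inter> \<Delta> m = {}"
  then obtain s \<alpha> \<beta> \<gamma> where s: "s \<in> {1, -1}" "\<alpha> \<le> \<beta>" "\<beta> < \<gamma>"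
    "\<And>x. x \<in> \<Delta> (m - 1) \<Longrightarrow> \<alpha> \<le> s * x \<and> s * x \<le> \<beta>" "\<And>x. x \<in> \<Delta> m \<Longrightarrow> \<gamma> \<le> s * x"
    using bounded_gap by metis
  define u v where "u = (if s = 1 then \<beta> else - \<gamma>)" and "v = (if s = 1 then \<gamma> else - \<beta>)"
  have z: "\<beta> < s * z" "s * z < \<gamma>" if "z \<in> {u<..<v}" for z
    using that s(1) by (auto simp: u_def v_def)
  show thesis
  proof (rule that[of u v])
    show "u < v" using s(3) by (simp add: u_def v_def)
    show "{u<..<v} \<inter> \<Delta> m = {}" using z s(5) by fastforce
    show "(\<lambda>n. qsum (b n) j z - (LINT x|sm_var (nik \<sigma> m j). 1 / (z - x))) \<longlonglongrightarrow> (0::real)" if "z \<in> {u<..<v}" for z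
      by (rule real_points_convergence_bounded[OF sol j s(1,2,4,5) z[OF that]])
  qed
qed

lemma qsum_of_real: "qsum b j (of_real z :: complex) = of_real (qsum b j z)"
  by (simp add: qsum_def)

text \<open>Local boundedness is immediate: the weights are nonnegative and add up to the total
  mass, so sum and integral are each at most the mass divided by the distance from
  \<open>\<Delta> m\<close>.\<close>

lemma qsum_convergence:
  assumes sol: "\<And>n. n \<ge> 1 \<Longrightarrow> solution n (b n) \<and> b n m \<noteq> 0" and j: "j \<in> {1..m}"
    and hyp: "carleman (\<sigma> m) \<or> bounded (\<Delta> (m - 1)) \<and> \<Delta> (m - 1) \<inter> \<Delta> m = {}"
    and K: "compact K" "K \<inter> complex_of_real ` \<Delta> m = {}"
  shows "uniform_limit K (\<lambda>n z. qsum (b n) j z) (\<lambda>z. LINT x|sm_var (nik \<sigma> m j). 1 / (z - of_real x)) sequentially"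
proof -
  let ?M = "sm_var (nik \<sigma> m j)" and ?S = "- complex_of_real ` \<Delta> m" and ?mass = "measure (sm_var (nik \<sigma> m j)) (space (sm_var (nik \<sigma> m j)))"
  note M = class_MD[OF nik_m[OF j]]
  have one: "integrable ?M (\<lambda>x. 1 :: real)" using M(10)[of 0] by simp
  have closed: "closed (complex_of_real ` \<Delta> m)"
    by (rule closed_of_real_image[OF closed_\<Delta>[OF m_in(1)]])
  define F where "F z = (LINT x|?M. 1 / (z - of_real x))" for z :: complex
  \<comment> \<open>Solutions are given only for n >= 1; the value 0 at n = 0 keeps the bounds
    uniform in n.\<close>
  define G where "G n z = (if n = 0 then 0 else qsum (b n) j z - F z)" for n z
  obtain u v :: real where uv: "u < v" "{u<..<v} \<inter> \<Delta> m = {}"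
    "\<And>z. z \<in> {u<..<v} \<Longrightarrow> (\<lambda>n. qsum (b n) j z - (LINT x|?M. 1 / (z - x))) \<longlonglongrightarrow> (0::real)"
    using real_points_convergence[of b j, OF sol j hyp] by metis
  have Xsub: "Zs (b n) m \<subseteq> \<Delta> m" for n using Zs_S S_subset by blast
  have Fhol: "F holomorphic_on ?S"
  proof (rule holomorphic_onI)
    fix z assume "z \<in> ?S"
    then have "z \<notin> of_real ` \<Delta> m" by simp
    then obtain e where e: "e > 0" "\<And>x. x \<in> \<Delta> m \<Longrightarrow> e \<le> norm (z - of_real x)"
      by (rule closed_of_real_dist[OF closed_\<Delta>[OF m_in(1)]]) metis
    have "((\<lambda>z. LINT x|?M. 1 *\<^sub>R (1 / (z - of_real x))) has_field_derivative
           (- (LINT x|?M. 1 *\<^sub>R (1 / (z - of_real x)\<^sup>2)))) (at z)"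
      by (rule has_field_derivative_cauchy_kernel[OF M(2) one M(8) e])
    from has_field_derivative_at_within[OF this]
    have "(F has_field_derivative (- (LINT x|?M. 1 *\<^sub>R (1 / (z - of_real x)\<^sup>2)))) (at z within ?S)"
      unfolding F_def[abs_def] scaleR_one .
    then show "F field_differentiable at z within ?S"
      unfolding field_differentiable_def by (rule exI)
  qed
  have Ghol: "G n holomorphic_on ?S" for n
  proof (cases "n = 0")
    case False
    have "qsum (b n) j holomorphic_on ?S"
      unfolding qsum_def by (intro holomorphic_intros) (use Xsub in auto)
    then have "(\<lambda>z. qsum (b n) j z - F z) holomorphic_on ?S" using Fhol by (rule holomorphic_on_diff)
    then show ?thesis using False by (simp add: G_def[abs_def])
  qed (simp add: G_def[abs_def])
  have bdd: "\<exists>B. \<forall>n. \<forall>z\<in>K'. norm (G n z) \<le> B" if K': "compact K'" "K' \<subseteq> ?S" for K'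
  proof -
    have "K' \<inter> complex_of_real ` \<Delta> m = {}" using K'(2) by auto
    then obtain d where d: "d > 0" "\<And>z y. z \<in> K' \<Longrightarrow> y \<in> complex_of_real ` \<Delta> m \<Longrightarrow> d \<le> dist z y"
      using separate_compact_closed[OF K'(1) closed] by blast
    have ge: "d \<le> norm (z - of_real x)" if "z \<in> K'" "x \<in> \<Delta> m" for z x
      using d(2)[OF that(1), of "of_real x"] that(2) by (simp add: dist_norm)
    have ge': "norm (1 / (z - of_real x)) \<le> 1 / d" if "z \<in> K'" "x \<in> \<Delta> m" for z x
    proof -
      have "1 / norm (z - of_real x) \<le> 1 / d"
        using ge[OF that] d(1) by (intro divide_left_mono mult_pos_pos) linarith+
      then show ?thesis by (simp add: norm_divide)
    qed
    have "norm (G n z) \<le> 2 * (?mass / d)" if z: "z \<in> K'" for n z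
    proof (cases "n = 0")
      case True
      then show ?thesis using d(1) by (simp add: G_def)
    next
      case False
      then have n: "n \<ge> 1" by simp
      obtain W e where q: "quadrature ?M (\<Delta> m) (Zs (b n) m) W n e"
        using solution_quadrature[of n "b n" j] sol[OF n] n j by blast
      interpret quadrature ?M "\<Delta> m" "Zs (b n) m" W n e by (rule q)
      have "norm (qsum (b n) j z) \<le> (\<Sum>x\<in>Zs (b n) m. wt x * (1 / d))"
        unfolding qsum_def
      proof (rule order_trans[OF norm_sum], rule sum_mono)
        fix x assume x: "x \<in> Zs (b n) m"
        then have "x \<in> \<Delta> m" using Xsub[of n] by blast
        from mult_left_mono[OF ge'[OF z this] wt_nonneg[OF x]]
        show "norm (complex_of_real (wt x) * (1 / (z - of_real x))) \<le> wt x * (1 / d)"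
          unfolding norm_mult using wt_nonneg[OF x] by simp
      qed
      also have "\<dots> = ?mass / d" by (simp only: sum_distrib_right[symmetric] wt_sum) simp
      finally have 1: "norm (qsum (b n) j z) \<le> ?mass / d" .
      have "norm (F z) \<le> (LINT x|?M. norm (1 / (z - of_real x)))" unfolding F_def by (rule integral_norm_bound)
      also have "\<dots> \<le> (LINT x|?M. 1 / d)"
      proof (rule integral_mono_AE')
        show "integrable ?M (\<lambda>x. 1 / d)" using integrable_mult_right[OF one, of "1 / d"] by simp
        show "AE x in ?M. norm (1 / (z - of_real x)) \<le> 1 / d" using M(8) by eventually_elim (rule ge'[OF z])
      qed (use d(1) in simp)
      also have "\<dots> = ?mass / d" by simp
      finally show ?thesis using 1 False norm_triangle_ineq4[of "qsum (b n) j z" "F z"] by (simp add: G_def)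
    qed
    then show ?thesis by blast
  qed
  define U where "U = complex_of_real ` {u<..<v}"
  have lim: "(\<lambda>n. G n z) \<longlonglongrightarrow> 0" if "z \<in> U" for z
  proof -
    obtain x where x: "x \<in> {u<..<v}" "z = of_real x" using \<open>z \<in> U\<close> by (auto simp: U_def)
    have Fx: "F z = of_real (LINT t|?M. 1 / (x - t))"
      unfolding F_def x(2) by (subst integral_complex_of_real[symmetric]) simp
    have "(\<lambda>n. complex_of_real (qsum (b n) j x - (LINT t|?M. 1 / (x - t)))) \<longlonglongrightarrow> of_real 0"
      by (intro tendsto_of_real uv(3) x)
    then have "(\<lambda>n. qsum (b n) j z - F z) \<longlonglongrightarrow> 0"
      unfolding Fx unfolding x(2) qsum_of_real by simp
    moreover have "\<forall>\<^sub>F n in sequentially. qsum (b n) j z - F z = G n z"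
      by (auto simp: eventually_sequentially G_def intro!: exI[of _ 1])
    ultimately show ?thesis by (rule Lim_transform_eventually)
  qed
  define x0 where "x0 = (u + v) / 2"
  have x0: "x0 \<in> {u<..<v}" using uv(1) by (auto simp: x0_def)
  have isl: "complex_of_real x0 islimpt U"
  proof -
    have "x0 islimpt {u<..<v}" using x0 by (intro open_imp_islimpt) auto
    then show ?thesis unfolding U_def
      by (intro islimpt_isCont_image) (auto intro!: continuous_intros eventuallyI simp: eventually_at_filter)
  qed
  have ne: "\<Delta> m \<noteq> UNIV" using uv(2) x0 by auto
  have "uniform_limit K G (\<lambda>_. 0) sequentially"
  proof (rule vitali_zero[where S = ?S and U = U and \<xi> = "of_real x0"])
    show "open ?S" using closed by (simp add: open_Compl)
    show "connected ?S" by (rule connected_complement_of_real[OF closed_\<Delta>[OF m_in(1)] ne])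
    show "U \<subseteq> ?S" using uv(2) by (auto simp: U_def)
    then show "complex_of_real x0 \<in> ?S" using x0 unfolding U_def by blast
    show "K \<subseteq> ?S" using K(2) by auto
  qed (use Ghol bdd lim isl K in auto)
  then have "uniform_limit K (\<lambda>n z. G n z + F z) (\<lambda>z. 0 + F z) sequentially"
    by (intro uniform_limit_add uniform_limit_const)
  moreover have "\<forall>\<^sub>F n in sequentially. \<forall>z\<in>K. G n z + F z = qsum (b n) j z"
    by (auto simp: eventually_sequentially G_def intro!: exI[of _ 1])
  ultimately show ?thesis
    by (subst uniform_limit_cong[where g = "\<lambda>n z. G n z + F z" and i = "\<lambda>z. 0 + F z"])
       (auto simp: F_def elim: eventually_mono)
qed

end

section \<open>From the Hermite--Pade conditions to orthogonality\<close>

text \<open>Decay along the imaginary axis is all that is used of the non-tangential asymptotics.\<close>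

definition decay :: "nat \<Rightarrow> (complex \<Rightarrow> complex) \<Rightarrow> bool" where
  "decay N f \<longleftrightarrow> (\<exists>C Y. \<forall>y::real. \<bar>y\<bar> \<ge> Y \<longrightarrow> norm (f (\<i> * of_real y)) \<le> C / \<bar>y\<bar> ^ N)"

lemma decayE:
  assumes "decay N f"
  obtains C Y where "C \<ge> 0" "Y \<ge> 1" "\<And>y. \<bar>y\<bar> \<ge> Y \<Longrightarrow> norm (f (\<i> * of_real y)) \<le> C / \<bar>y\<bar> ^ N"
proof -
  obtain C Y where *: "\<And>y. \<bar>y\<bar> \<ge> Y \<Longrightarrow> norm (f (\<i> * of_real y)) \<le> C / \<bar>y\<bar> ^ N"
    using assms unfolding decay_def by blast
  have "norm (f (\<i> * of_real y)) \<le> \<bar>C\<bar> / \<bar>y\<bar> ^ N" if "\<bar>y\<bar> \<ge> max Y 1" for y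
    by (rule order_trans[OF *]) (use that in \<open>auto intro!: divide_right_mono\<close>)
  then show thesis by (intro that[of "\<bar>C\<bar>" "max Y 1"]) auto
qed

lemma decayI: "(\<And>y. \<bar>y\<bar> \<ge> Y \<Longrightarrow> norm (f (\<i> * of_real y)) \<le> C / \<bar>y\<bar> ^ N) \<Longrightarrow> decay N f"
  unfolding decay_def by blast

lemma decay_add:
  assumes "decay N f" "decay N g"
  shows "decay N (\<lambda>z. f z + g z)"
proof -
  obtain C Y where f: "C \<ge> 0" "Y \<ge> 1" "\<And>y. \<bar>y\<bar> \<ge> Y \<Longrightarrow> norm (f (\<i> * of_real y)) \<le> C / \<bar>y\<bar> ^ N"
    by (rule decayE[OF assms(1)]) blast
  obtain C' Y' where g: "C' \<ge> 0" "Y' \<ge> 1" "\<And>y. \<bar>y\<bar> \<ge> Y' \<Longrightarrow> norm (g (\<i> * of_real y)) \<le> C' / \<bar>y\<bar> ^ N"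
    by (rule decayE[OF assms(2)]) blast
  show ?thesis
  proof (rule decayI[of "max Y Y'" _ "C + C'"])
    fix y :: real assume "max Y Y' \<le> \<bar>y\<bar>"
    then show "norm (f (\<i> * of_real y) + g (\<i> * of_real y)) \<le> (C + C') / \<bar>y\<bar> ^ N"
      using f(3)[of y] g(3)[of y] norm_triangle_ineq[of "f (\<i> * of_real y)" "g (\<i> * of_real y)"]
      by (simp add: add_divide_distrib)
  qed
qed

lemma decay_cmult:
  assumes "decay N f"
  shows "decay N (\<lambda>z. c * f z)"
proof -
  obtain C Y where f: "C \<ge> 0" "Y \<ge> 1" "\<And>y. \<bar>y\<bar> \<ge> Y \<Longrightarrow> norm (f (\<i> * of_real y)) \<le> C / \<bar>y\<bar> ^ N"
    by (rule decayE[OF assms(1)]) blast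
  show ?thesis
  proof (rule decayI[of Y _ "norm c * C"])
    fix y :: real assume "Y \<le> \<bar>y\<bar>"
    from mult_left_mono[OF f(3)[OF this], of "norm c"]
    show "norm (c * f (\<i> * of_real y)) \<le> norm c * C / \<bar>y\<bar> ^ N" by (simp add: norm_mult)
  qed
qed

lemma decay_diff: "decay N f \<Longrightarrow> decay N g \<Longrightarrow> decay N (\<lambda>z. f z - g z)"
  using decay_add[of N f "\<lambda>z. (-1) * g z"] decay_cmult[of N g "-1"] by simp

lemma decay_cnj:
  assumes "decay N f"
  shows "decay N (\<lambda>z. cnj (f (cnj z)))"
proof -
  obtain C Y where f: "C \<ge> 0" "Y \<ge> 1" "\<And>y. \<bar>y\<bar> \<ge> Y \<Longrightarrow> norm (f (\<i> * of_real y)) \<le> C / \<bar>y\<bar> ^ N"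
    by (rule decayE[OF assms(1)]) blast
  show ?thesis
  proof (rule decayI[of Y _ C])
    fix y :: real assume "Y \<le> \<bar>y\<bar>"
    then show "norm (cnj (f (cnj (\<i> * of_real y)))) \<le> C / \<bar>y\<bar> ^ N"
      using f(3)[of "- y"] by simp
  qed
qed

lemma decay_power:
  assumes "decay (N + k) f"
  shows "decay N (\<lambda>z. z ^ k * f z)"
proof -
  obtain C Y where f: "C \<ge> 0" "Y \<ge> 1" "\<And>y. \<bar>y\<bar> \<ge> Y \<Longrightarrow> norm (f (\<i> * of_real y)) \<le> C / \<bar>y\<bar> ^ (N + k)"
    by (rule decayE[OF assms(1)]) blast
  show ?thesis
  proof (rule decayI[of Y _ C])
    fix y :: real assume y: "Y \<le> \<bar>y\<bar>"
    then have nz: "\<bar>y\<bar> > 0" using f(2) by linarith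
    from mult_left_mono[OF f(3)[OF y], of "\<bar>y\<bar> ^ k"]
    show "norm ((\<i> * of_real y) ^ k * f (\<i> * of_real y)) \<le> C / \<bar>y\<bar> ^ N"
      using nz by (simp add: norm_mult norm_power power_add)
  qed
qed

lemma decay_mono:
  assumes "decay N f" "M \<le> N"
  shows "decay M f"
proof -
  obtain C Y where f: "C \<ge> 0" "Y \<ge> 1" "\<And>y. \<bar>y\<bar> \<ge> Y \<Longrightarrow> norm (f (\<i> * of_real y)) \<le> C / \<bar>y\<bar> ^ N"
    by (rule decayE[OF assms(1)]) blast
  show ?thesis
  proof (rule decayI[of Y _ C])
    fix y :: real assume y: "Y \<le> \<bar>y\<bar>"
    then have 1: "\<bar>y\<bar> \<ge> 1" using f(2) by linarith
    then have "\<bar>y\<bar> ^ M \<le> \<bar>y\<bar> ^ N" using assms(2) by (intro power_increasing) auto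
    then have "C / \<bar>y\<bar> ^ N \<le> C / \<bar>y\<bar> ^ M" using f(1) 1 by (intro divide_left_mono mult_pos_pos zero_less_power) auto
    then show "norm (f (\<i> * of_real y)) \<le> C / \<bar>y\<bar> ^ M" using f(3)[OF y] by linarith
  qed
qed

lemma decay_poly_zero:
  fixes p :: "real poly"
  assumes "decay 1 f" "\<And>z. z \<notin> \<real> \<Longrightarrow> f z = cp p z"
  shows "p = 0"
proof -
  obtain C Y where f: "C \<ge> 0" "Y \<ge> 1" "\<And>y. \<bar>y\<bar> \<ge> Y \<Longrightarrow> norm (f (\<i> * of_real y)) \<le> C / \<bar>y\<bar> ^ 1"
    by (rule decayE[OF assms(1)]) blast
  have nr: "\<i> * of_real y \<notin> \<real>" if "y \<ge> Y" for y using that f(2) by (auto simp: complex_is_Real_iff)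
  have b: "norm (cp p (\<i> * of_real y)) \<le> C / y" if "y \<ge> Y" for y
    using f(3)[of y] that f(2) assms(2)[OF nr[OF that]] by simp
  obtain a q where p: "p = pCons a q" by (cases p)
  have "q = 0"
  proof (rule ccontr)
    assume "q \<noteq> 0"
    then have "map_poly of_real q \<noteq> (0 :: complex poly)" by (simp add: map_poly_of_real_eq_0)
    from poly_infinity[OF this, of "C + 1" "of_real a"]
    obtain r where r: "\<And>z. r \<le> norm z \<Longrightarrow> C + 1 \<le> norm (cp p z)"
      unfolding p by (auto simp: map_poly_pCons)
    define y where "y = max Y \<bar>r\<bar>"
    have "y \<ge> Y" "y \<ge> 1" "r \<le> norm (\<i> * complex_of_real y)" using f(2) by (auto simp: y_def norm_mult)
    then have "C + 1 \<le> C / y" using b r by (meson order_trans)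
    also have "\<dots> \<le> C / 1" using f(1) \<open>y \<ge> 1\<close> by (intro divide_left_mono) auto
    finally show False by simp
  qed
  then have p': "p = [:a:]" by (simp add: p)
  have "a = 0"
  proof (rule ccontr)
    assume a: "a \<noteq> 0"
    define y where "y = Y + C / \<bar>a\<bar>"
    have y: "y \<ge> Y" "y > C / \<bar>a\<bar>" using f(1,2) a by (auto simp: y_def)
    have "\<bar>a\<bar> \<le> C / y" using b[OF y(1)] by (simp add: p' map_poly_pCons)
    moreover have "y > 0" using y f(2) by linarith
    ultimately show False using y(2) a by (simp add: field_simps)
  qed
  then show ?thesis by (simp add: p')
qed

text \<open>The choice \<delta> = 1 suffices: a point iy on the imaginary axis has distance at least
  \<open>\<bar>y\<bar>\<close> from every real point.\<close>

lemma bigo_inf_decay: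
  assumes "bigo_inf D N f" "D \<noteq> {}"
  shows "decay N f"
proof -
  have "f \<in> O[inf at_infinity (principal {z. infdist z (complex_of_real ` D) \<ge> 1 * norm z})](\<lambda>z. 1 / z ^ N)"
    using assms(1) unfolding bigo_inf_def by (meson zero_less_one)
  then obtain c where "c > 0"
    "\<forall>\<^sub>F z in inf at_infinity (principal {z. infdist z (complex_of_real ` D) \<ge> 1 * norm z}). norm (f z) \<le> c * norm (1 / z ^ N)"
    by (rule landau_o.bigE)
  then obtain b where b: "\<And>z. b \<le> norm z \<Longrightarrow> infdist z (complex_of_real ` D) \<ge> norm z \<Longrightarrow> norm (f z) \<le> c * norm (1 / z ^ N)"
    unfolding eventually_inf_principal eventually_at_infinity by auto
  show ?thesis
  proof (rule decayI[of b _ c])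
    fix y :: real assume y: "b \<le> \<bar>y\<bar>"
    have "norm (\<i> * complex_of_real y) \<le> infdist (\<i> * complex_of_real y) (complex_of_real ` D)"
    proof -
      have ne: "complex_of_real ` D \<noteq> {}" using assms(2) by simp
      show ?thesis unfolding infdist_notempty[OF ne]
      proof (rule cINF_greatest[OF ne])
        fix w assume "w \<in> complex_of_real ` D"
        then have "Im (\<i> * complex_of_real y - w) = y" by auto
        then show "norm (\<i> * complex_of_real y) \<le> dist (\<i> * complex_of_real y) w"
          using abs_Im_le_cmod[of "\<i> * complex_of_real y - w"] by (simp add: dist_norm norm_mult)
      qed
    qed
    then show "norm (f (\<i> * complex_of_real y)) \<le> c / \<bar>y\<bar> ^ N"
      using b[of "\<i> * complex_of_real y"] y by (simp add: norm_mult norm_divide norm_power)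
  qed
qed

section \<open>Polynomial parts and moments of the forms\<close>

context nikishin_system
begin

lemma T_shift:
  fixes z :: complex
  assumes l: "l \<in> {1..m}" and f: "integrable (\<mu> l) f" and xf: "integrable (\<mu> l) (\<lambda>x. x * f x)" and z: "z \<notin> of_real ` \<Delta> l"
  shows "z * T l f z = T l (\<lambda>x. x * f x) z + of_real (sm_integral (\<sigma> l) f)"
proof -
  let ?k = "\<lambda>t. 1 / (z - complex_of_real t)"
  have [measurable_cong]: "sets (\<mu> l) = sets borel" using sets_\<mu> l by blast
  have [measurable]: "f \<in> borel_measurable (\<mu> l)" using f by auto
  have "z * T l f z = sm_sign (\<sigma> l) *\<^sub>R (LINT t|\<mu> l. z * (f t *\<^sub>R ?k t))"
    unfolding T_def sm_integral_def by (subst integral_mult_right_zero) (rule mult_scaleR_right)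
  also have "(LINT t|\<mu> l. z * (f t *\<^sub>R ?k t)) = (LINT t|\<mu> l. (t * f t) *\<^sub>R ?k t + of_real (f t))"
  proof (rule integral_cong_AE)
    show "AE t in \<mu> l. z * (f t *\<^sub>R ?k t) = (t * f t) *\<^sub>R ?k t + of_real (f t)"
      using AE_\<Delta>[OF l]
    proof eventually_elim
      case (elim t)
      then have "z - of_real t \<noteq> 0" using z by auto
      then have "z * ?k t = of_real t * ?k t + 1" by (simp add: field_simps)
      then have "of_real (f t) * (z * ?k t) = of_real (f t) * (of_real t * ?k t + 1)" by simp
      then show ?case by (simp add: scaleR_conv_of_real algebra_simps)
    qed
  qed measurable
  also have "\<dots> = (LINT t|\<mu> l. (t * f t) *\<^sub>R ?k t) + (LINT t|\<mu> l. of_real (f t))"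
    by (rule Bochner_Integration.integral_add[OF integrable_kernel[OF l xf z]]) (use f in simp)
  finally have eq: "z * T l f z = sm_sign (\<sigma> l) *\<^sub>R ((LINT t|\<mu> l. (t * f t) *\<^sub>R ?k t) + (LINT t|\<mu> l. of_real (f t)))" .
  show ?thesis unfolding eq
    by (simp add: T_def sm_integral_def scaleR_conv_of_real distrib_left)
qed

text \<open>P is the polynomial of the second kind, the integral of (p(z) - p(x)) / (z - x) against
  \<open>g\<close>; the induction is Horner's scheme.\<close>

lemma second_kind:
  assumes l: "l \<in> {1..m}" and g: "\<And>q. integrable (\<mu> l) (\<lambda>x. poly q x * g x)"
  shows "\<exists>P. \<forall>z. z \<notin> of_real ` \<Delta> l \<longrightarrow> cp p z * T l g z - T l (\<lambda>x. poly p x * g x) z = cp P z"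
proof (induction p)
  case 0
  show ?case by (intro exI[of _ 0]) (simp add: T_def sm_integral_def)
next
  case (pCons a p)
  then obtain P where P: "\<And>z. z \<notin> of_real ` \<Delta> l \<Longrightarrow> cp p z * T l g z - T l (\<lambda>x. poly p x * g x) z = cp P z" by blast
  let ?I = "sm_integral (\<sigma> l) (\<lambda>x. poly p x * g x)"
  show ?case
  proof (intro exI[of _ "pCons ?I P"] allI impI)
    fix z :: complex assume z: "z \<notin> of_real ` \<Delta> l"
    have i: "integrable (\<mu> l) (\<lambda>x. x * (poly p x * g x))" using g[of "pCons 0 p"] by (simp add: mult.assoc)
    have ig: "integrable (\<mu> l) g" using g[of 1] by simp
    have "(\<lambda>x. poly (pCons a p) x * g x) = (\<lambda>x. a * g x + x * (poly p x * g x))"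
      by (simp add: fun_eq_iff algebra_simps)
    then have "T l (\<lambda>x. poly (pCons a p) x * g x) z = T l (\<lambda>x. a * g x) z + T l (\<lambda>x. x * (poly p x * g x)) z"
      using T_add[OF l integrable_mult_right[OF ig, of a] i z] by simp
    also have "T l (\<lambda>x. x * (poly p x * g x)) z = z * T l (\<lambda>x. poly p x * g x) z - of_real ?I"
      using T_shift[OF l g[of p] i z] by simp
    finally have "cp (pCons a p) z * T l g z - T l (\<lambda>x. poly (pCons a p) x * g x) z
        = z * (cp p z * T l g z - T l (\<lambda>x. poly p x * g x) z) + of_real ?I"
      by (simp add: map_poly_pCons T_cmult algebra_simps)
    then show "cp (pCons a p) z * T l g z - T l (\<lambda>x. poly (pCons a p) x * g x) z = cp (pCons ?I P) z"
      unfolding P[OF z] by (simp add: map_poly_pCons)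
  qed
qed

lemma decay_T:
  assumes l: "l \<in> {1..m}" and g: "integrable (\<mu> l) g"
  shows "decay 1 (T l g)"
proof (rule decayI[of 1 _ "LINT x|\<mu> l. \<bar>g x\<bar>"])
  fix y :: real assume y: "1 \<le> \<bar>y\<bar>"
  let ?z = "\<i> * complex_of_real y"
  have k: "norm (1 / (?z - of_real t)) \<le> 1 / \<bar>y\<bar>" for t
  proof -
    have "\<bar>y\<bar> = \<bar>Im (?z - of_real t)\<bar>" by simp
    also have "\<dots> \<le> norm (?z - of_real t)" by (rule abs_Im_le_cmod)
    finally have "\<bar>y\<bar> \<le> norm (?z - of_real t)" .
    then have "1 / norm (?z - of_real t) \<le> 1 / \<bar>y\<bar>" using y by (intro divide_left_mono mult_pos_pos) linarith+
    then show ?thesis by (simp only: norm_divide norm_one)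
  qed
  have "norm (T l g ?z) = norm (LINT t|\<mu> l. g t *\<^sub>R (1 / (?z - of_real t)))"
    using class_MD(1)[OF class_M_gen[OF l]] by (auto simp: T_def sm_integral_def)
  also have "\<dots> \<le> (LINT t|\<mu> l. norm (g t *\<^sub>R (1 / (?z - of_real t))))" by (rule integral_norm_bound)
  also have "\<dots> \<le> (LINT t|\<mu> l. \<bar>g t\<bar> / \<bar>y\<bar>)"
  proof (rule integral_mono_AE')
    show "integrable (\<mu> l) (\<lambda>t. \<bar>g t\<bar> / \<bar>y\<bar>)" using g by auto
    show "AE t in \<mu> l. norm (g t *\<^sub>R (1 / (?z - of_real t))) \<le> \<bar>g t\<bar> / \<bar>y\<bar>"
      using mult_left_mono[OF k abs_ge_zero] by (intro AE_I2) (simp only: norm_scaleR times_divide_eq_right mult_1_right)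
  qed simp
  finally show "norm (T l g ?z) \<le> (LINT x|\<mu> l. \<bar>g x\<bar>) / \<bar>y\<bar> ^ 1" by simp
qed

text \<open>\<open>b j\<close> and the second-kind polynomials of the summands make up P. The
  recursion of the forms thus holds once this polynomial is shown to vanish.\<close>

lemma A_poly_part:
  assumes j: "j < m"
  shows "\<exists>P. \<forall>z. z \<notin> of_real ` \<Delta> (Suc j) \<longrightarrow> A b j z - T (Suc j) (A b (Suc j)) z = cp P z"
proof -
  let ?l = "Suc j"
  have l: "?l \<in> {1..m}" using j by auto
  have ig: "integrable (\<mu> ?l) (\<lambda>x. poly q x * dens \<sigma> ?l k x)" if "k \<in> {?l..m}" for k q
    using integrable_poly_dens[OF l, of k q] that by (simp add: mult.commute)
  have "\<forall>k\<in>{?l..m}. \<exists>P. \<forall>z. z \<notin> of_real ` \<Delta> ?l \<longrightarrow>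
      cp (b k) z * T ?l (dens \<sigma> ?l k) z - T ?l (\<lambda>x. poly (b k) x * dens \<sigma> ?l k x) z = cp P z"
    using second_kind[OF l ig] by blast
  then obtain P where P: "\<And>k z. k \<in> {?l..m} \<Longrightarrow> z \<notin> of_real ` \<Delta> ?l \<Longrightarrow>
      cp (b k) z * T ?l (dens \<sigma> ?l k) z - T ?l (\<lambda>x. poly (b k) x * dens \<sigma> ?l k x) z = cp (P k) z"
    by metis
  show ?thesis
  proof (intro exI allI impI)
    fix z :: complex assume z: "z \<notin> of_real ` \<Delta> ?l"
    have "{j..m} = insert j {?l..m}" using j by auto
    then have "A b j z = (-1) ^ j * cp (b j) z + (\<Sum>k=?l..m. (-1) ^ k * cp (b k) z * dens \<sigma> j k z)"
      by (simp add: A_def)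
    also have "(\<Sum>k=?l..m. (-1) ^ k * cp (b k) z * dens \<sigma> j k z) = (\<Sum>k=?l..m. (-1) ^ k * (cp (b k) z * T ?l (dens \<sigma> ?l k) z))"
    proof (rule sum.cong[OF refl])
      fix k assume k: "k \<in> {?l..m}"
      then have "dens \<sigma> j k z = cauchy_transform (nik \<sigma> ?l k) z" by (simp add: dens_def step_def)
      also have "\<dots> = T ?l (dens \<sigma> ?l k) z" by (rule fun_cong[OF cauchy_transform_T[OF l]]) (use k in auto)
      finally show "(-1) ^ k * cp (b k) z * dens \<sigma> j k z = (-1) ^ k * (cp (b k) z * T ?l (dens \<sigma> ?l k) z)" by simp
    qed
    finally have 1: "A b j z = (-1) ^ j * cp (b j) z + (\<Sum>k=?l..m. (-1) ^ k * (cp (b k) z * T ?l (dens \<sigma> ?l k) z))" .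
    have "T ?l (A b ?l) z = T ?l (\<lambda>x. \<Sum>k=?l..m. (-1) ^ k * (poly (b k) x * dens \<sigma> ?l k x)) z"
      by (rule arg_cong[where f = "\<lambda>g. T ?l g z"]) (simp add: A_real fun_eq_iff mult.assoc)
    also have "\<dots> = (\<Sum>k=?l..m. T ?l (\<lambda>x. (-1) ^ k * (poly (b k) x * dens \<sigma> ?l k x)) z)"
      by (rule T_sum[OF l _ z]) (intro integrable_mult_right ig)
    also have "\<dots> = (\<Sum>k=?l..m. (-1) ^ k * T ?l (\<lambda>x. poly (b k) x * dens \<sigma> ?l k x) z)"
      by (simp only: T_cmult) simp
    finally have 2: "T ?l (A b ?l) z = (\<Sum>k=?l..m. (-1) ^ k * T ?l (\<lambda>x. poly (b k) x * dens \<sigma> ?l k x) z)" .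
    have "A b j z - T ?l (A b ?l) z = (-1) ^ j * cp (b j) z + (\<Sum>k=?l..m. (-1) ^ k *
        (cp (b k) z * T ?l (dens \<sigma> ?l k) z - T ?l (\<lambda>x. poly (b k) x * dens \<sigma> ?l k x) z))"
      unfolding 1 2 by (simp add: sum_subtractf right_diff_distrib)
    also have "\<dots> = (-1) ^ j * cp (b j) z + (\<Sum>k=?l..m. (-1) ^ k * cp (P k) z)"
      using P[OF _ z] by simp
    also have "\<dots> = cp (smult ((-1) ^ j) (b j) + (\<Sum>k=?l..m. smult ((-1) ^ k) (P k))) z"
      by (simp add: map_poly_of_real_add map_poly_of_real_sum map_poly_of_real_smult poly_sum)
    finally show "A b j z - T ?l (A b ?l) z = cp (smult ((-1) ^ j) (b j) + (\<Sum>k=?l..m. smult ((-1) ^ k) (P k))) z" .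
  qed
qed

definition rep :: "(nat \<Rightarrow> real poly) \<Rightarrow> nat \<Rightarrow> bool" where
  "rep b j \<longleftrightarrow> (\<forall>z::complex. z \<notin> of_real ` \<Delta> (Suc j) \<longrightarrow> A b j z = T (Suc j) (A b (Suc j)) z)"

lemma rep_nonreal:
  assumes j: "j < m" and eq: "\<And>z::complex. z \<notin> \<real> \<Longrightarrow> A b j z = T (Suc j) (A b (Suc j)) z"
  shows "rep b j"
proof -
  obtain P where P: "\<And>z. z \<notin> of_real ` \<Delta> (Suc j) \<Longrightarrow> A b j z - T (Suc j) (A b (Suc j)) z = cp P z"
    using A_poly_part[OF j, of b] by blast
  have "P = 0"
  proof (rule real_poly_eqI)
    fix z :: complex assume z: "z \<notin> \<real>"
    then have "z \<notin> of_real ` \<Delta> (Suc j)" by auto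
    from P[OF this] eq[OF z] show "cp P z = cp 0 z" by simp
  qed
  then show ?thesis using P unfolding rep_def by simp
qed

lemma rep_decay:
  assumes j: "j < m" and dec: "decay 1 (A b j)"
  shows "rep b j"
proof -
  have l: "Suc j \<in> {1..m}" using j by auto
  obtain P where P: "\<And>z. z \<notin> of_real ` \<Delta> (Suc j) \<Longrightarrow> A b j z - T (Suc j) (A b (Suc j)) z = cp P z"
    using A_poly_part[OF j, of b] by blast
  have "decay 1 (\<lambda>z. A b j z - T (Suc j) (A b (Suc j)) z)"
    by (rule decay_diff[OF dec decay_T[OF l integrable_A[OF l]]])
  then have "P = 0" by (rule decay_poly_zero) (auto intro!: P)
  then show ?thesis using P unfolding rep_def by simp
qed

text \<open>Moments vanish one at a time: multiplying by one more power of z exposes the next moment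
  as a constant that decays on the imaginary axis, hence is 0.\<close>

lemma orth_decay:
  assumes dec: "decay (n + 1) (A b 0)" and r: "rep b 0" and q: "degree q < n"
  shows "sm_integral (\<sigma> 1) (\<lambda>x. poly q x * A b 1 x) = 0"
proof -
  have l: "1 \<in> {1..m}" using m2 by auto
  let ?A = "A b 1 :: real \<Rightarrow> real"
  let ?I = "\<lambda>i. sm_integral (\<sigma> 1) (\<lambda>x. x ^ i * ?A x)"
  have int: "integrable (\<mu> 1) (\<lambda>x. x ^ i * ?A x)" for i
    using integrable_poly_A[OF l, of "monom 1 i" b] by (simp add: poly_monom)
  have main: "(\<forall>i<\<nu>. ?I i = 0) \<and> (\<forall>z::complex. z \<notin> \<real> \<longrightarrow> T 1 (\<lambda>x. x ^ \<nu> * ?A x) z = z ^ \<nu> * A b 0 z)" if "\<nu> \<le> n" for \<nu>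
    using that
  proof (induction \<nu>)
    case 0
    have "A b 0 z = T 1 ?A z" if "z \<notin> \<real>" for z :: complex
    proof -
      have "z \<notin> of_real ` \<Delta> (Suc 0)" using that by auto
      then show ?thesis using r unfolding rep_def by simp
    qed
    then show ?case by simp
  next
    case (Suc \<nu>)
    then have IH: "\<And>z::complex. z \<notin> \<real> \<Longrightarrow> T 1 (\<lambda>x. x ^ \<nu> * ?A x) z = z ^ \<nu> * A b 0 z" "\<And>i. i < \<nu> \<Longrightarrow> ?I i = 0" by auto
    have sh: "z * T 1 (\<lambda>x. x ^ \<nu> * ?A x) z = T 1 (\<lambda>x. x ^ Suc \<nu> * ?A x) z + of_real (?I \<nu>)" if "z \<notin> \<real>" for z :: complex
    proof -
      have zn: "z \<notin> of_real ` \<Delta> 1" using that by auto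
      have "integrable (\<mu> 1) (\<lambda>x. x * (x ^ \<nu> * ?A x))" using int[of "Suc \<nu>"] by (simp add: mult.assoc)
      from T_shift[OF l int this zn] show ?thesis by (simp add: mult.assoc)
    qed
    have "decay 1 (\<lambda>z. z ^ Suc \<nu> * A b 0 z)"
    proof (rule decay_power)
      show "decay (1 + Suc \<nu>) (A b 0)" by (rule decay_mono[OF dec]) (use Suc.prems in simp)
    qed
    then have "decay 1 (\<lambda>z. z ^ Suc \<nu> * A b 0 z - T 1 (\<lambda>x. x ^ Suc \<nu> * ?A x) z)"
      by (rule decay_diff[OF _ decay_T[OF l int]])
    then have "[:?I \<nu>:] = 0"
    proof (rule decay_poly_zero)
      fix z :: complex assume z: "z \<notin> \<real>"
      show "z ^ Suc \<nu> * A b 0 z - T 1 (\<lambda>x. x ^ Suc \<nu> * ?A x) z = cp [:?I \<nu>:] z"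
        using sh[OF z] IH(1)[OF z] by (simp add: map_poly_pCons mult.assoc)
    qed
    then have I0: "?I \<nu> = 0" by simp
    show ?case
    proof (intro conjI allI impI)
      show "?I i = 0" if "i < Suc \<nu>" for i using IH(2)[of i] I0 that by (cases "i = \<nu>") auto
      show "T 1 (\<lambda>x. x ^ Suc \<nu> * ?A x) z = z ^ Suc \<nu> * A b 0 z" if "z \<notin> \<real>" for z :: complex
        using sh[OF that] IH(1)[OF that] I0 by (simp add: mult.assoc)
    qed
  qed
  have "(\<lambda>x. poly q x * ?A x) = (\<lambda>x. \<Sum>i\<le>degree q. coeff q i * (x ^ i * ?A x))"
    by (simp add: fun_eq_iff poly_altdef sum_distrib_right mult.assoc)
  then have "sm_integral (\<sigma> 1) (\<lambda>x. poly q x * ?A x) = (\<Sum>i\<le>degree q. coeff q i * ?I i)"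
    using int by (simp add: sm_integral_def sum_distrib_left mult_ac)
  also have "\<dots> = 0" by (rule sum.neutral) (use main[of n] q in auto)
  finally show ?thesis .
qed

lemma solutionI:
  assumes "degree (b m) \<le> n" "\<And>j. j < m \<Longrightarrow> rep b j" "decay (n + 1) (A b 0)"
  shows "solution n b"
  unfolding solution_def
  using assms orth_decay[OF assms(3)] m2 by (auto simp: rep_def)

end

lemma sum_triangle_swap:
  fixes f :: "nat \<Rightarrow> nat \<Rightarrow> 'a :: comm_monoid_add"
  shows "(\<Sum>l=j..m. \<Sum>k=l..m. f l k) = (\<Sum>k=j..m. \<Sum>l=j..k. f l k)"
proof -
  have "(\<Sum>l=j..m. \<Sum>k=l..m. f l k) = (\<Sum>(l, k)\<in>(SIGMA l:{j..m}. {l..m}). f l k)"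
    by (rule sum.Sigma) auto
  also have "\<dots> = (\<Sum>(k, l)\<in>(SIGMA k:{j..m}. {j..k}). f l k)"
    by (rule sum.reindex_bij_witness[of _ "\<lambda>(k, l). (l, k)" "\<lambda>(l, k). (k, l)"]) auto
  also have "\<dots> = (\<Sum>k=j..m. \<Sum>l=j..k. f l k)"
    by (rule sum.Sigma[symmetric]) auto
  finally show ?thesis .
qed

section \<open>The direct/reversed conditions and the recursion of the forms\<close>

context nikishin_system
begin

lemma T_cong:
  fixes z :: "'a :: {real_normed_field, banach, second_countable_topology}"
  assumes "l \<in> {1..m}" "AE x in \<mu> l. f x = g x" "f \<in> borel_measurable borel" "g \<in> borel_measurable borel"
  shows "T l f z = T l g z"
proof -
  have [measurable_cong]: "sets (\<mu> l) = sets borel" using sets_\<mu> assms(1) by blast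
  have [measurable]: "f \<in> borel_measurable borel" "g \<in> borel_measurable borel" by fact+
  have "(LINT t|\<mu> l. f t *\<^sub>R (1 / (z - of_real t))) = (LINT t|\<mu> l. g t *\<^sub>R (1 / (z - of_real t)))"
  proof (rule integral_cong_AE)
    show "AE t in \<mu> l. f t *\<^sub>R (1 / (z - of_real t)) = g t *\<^sub>R (1 / (z - of_real t))"
      using assms(2) by eventually_elim simp
  qed measurable
  then show ?thesis by (simp add: T_def sm_integral_def)
qed

lemma measurable_T:
  assumes "l \<in> {1..m}" "f \<in> borel_measurable borel"
  shows "(T l f :: real \<Rightarrow> real) \<in> borel_measurable borel"
proof -
  have [measurable_cong]: "sets (\<mu> l) = sets borel" using sets_\<mu> assms(1) by blast
  have [measurable]: "f \<in> borel_measurable borel" by fact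
  interpret sigma_finite_measure "\<mu> l" by (rule sigma_finite_\<mu>[OF assms(1)])
  show ?thesis unfolding T_def sm_integral_def by measurable
qed

lemma rep_real:
  assumes "rep b j" "x \<notin> \<Delta> (Suc j)"
  shows "A b j x = T (Suc j) (A b (Suc j)) (x::real)"
proof -
  have "complex_of_real x \<notin> of_real ` \<Delta> (Suc j)" using assms(2) by auto
  then have "A b j (complex_of_real x) = T (Suc j) (A b (Suc j)) (of_real x)"
    using assms(1) unfolding rep_def by blast
  then show ?thesis by (simp add: A_of_real T_of_real)
qed

lemma A_dens_shift:
  fixes z :: complex
  assumes z: "z \<notin> \<real>" and jl: "1 \<le> j" "j \<le> l" "l < m" and r: "rep b l"
  shows "A b l z * T l (dens \<sigma> l j) z
    = T l (\<lambda>x. A b l x * dens \<sigma> l j x) z + T (Suc l) (\<lambda>x. A b (Suc l) x * dens \<sigma> (Suc l) j x) z"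
proof -
  let ?L = "Suc l"
  have in1: "l \<in> {1..m}" "?L \<in> {1..m}" "j \<in> {1..m}" "?L \<noteq> j" and st: "step ?L j = l"
    using jl by (auto simp: step_def)
  have zn: "z \<notin> of_real ` \<Delta> i" for i using z by auto
  have int: "integrable (\<mu> ?L) (\<lambda>t. A b ?L t * dens \<sigma> ?L j t)"
    using integrable_poly_A_dens[of j ?L 1 b] jl by simp
  have "T ?L (A b ?L) z * T l (dens \<sigma> l j) z
      = T l (\<lambda>x. dens \<sigma> l j x * T ?L (A b ?L) x) z + T ?L (\<lambda>t. A b ?L t * dens \<sigma> ?L j t) z"
    using T_product[OF in1(2,3,4) measurable_A[OF in1(2)] integrable_A[OF in1(2)] int zn zn] unfolding st .
  also have "T ?L (A b ?L) z = A b l z" using r zn unfolding rep_def by simp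
  also have "T l (\<lambda>x. dens \<sigma> l j x * T ?L (A b ?L) x) z = T l (\<lambda>x. A b l x * dens \<sigma> l j x) z"
  proof (rule T_cong[OF in1(1)])
    show "AE x in \<mu> l. dens \<sigma> l j x * T ?L (A b ?L) x = A b l x * dens \<sigma> l j x"
      using AE_S[OF in1(1)]
      by eventually_elim (use rep_real[OF r] S_disjoint[OF jl(3)] in simp)
    have [measurable]: "(dens \<sigma> l j :: real \<Rightarrow> real) \<in> borel_measurable borel"
      "(A b l :: real \<Rightarrow> real) \<in> borel_measurable borel" "(T ?L (A b ?L) :: real \<Rightarrow> real) \<in> borel_measurable borel"
      by (rule measurable_dens[OF in1(1,3)] measurable_A[OF in1(1)] measurable_T[OF in1(2) measurable_A[OF in1(2)]])+
    show "(\<lambda>x. dens \<sigma> l j x * T ?L (A b ?L) x :: real) \<in> borel_measurable borel" by measurable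
    show "(\<lambda>x. A b l x * dens \<sigma> l j x :: real) \<in> borel_measurable borel" by measurable
  qed
  finally show ?thesis .
qed

lemma dens_T_up:
  assumes "1 \<le> j" "j \<le> k" "k \<le> m"
  shows "dens \<sigma> (j - 1) k z = T j (dens \<sigma> j k) z"
proof -
  have in1: "j \<in> {1..m}" "k \<in> {1..m}" using assms by auto
  have "dens \<sigma> (j - 1) k z = cauchy_transform (nik \<sigma> j k) z" using assms by (auto simp: dens_def step_def)
  also have "\<dots> = T j (dens \<sigma> j k) z" by (rule fun_cong[OF cauchy_transform_T[OF in1]])
  finally show ?thesis .
qed

text \<open>The alternating sum of \<open>A b l z\<close> times
  \<open>T l (dens \<sigma> l j) z\<close> is computed twice: it telescopes by
  \<open>A_dens_shift\<close>, and expanding the forms and exchanging sums collapses the inner sums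
  by \<open>dens_identity\<close>. The recursion is assumed only from level j on, which suits a
  descending induction.\<close>

lemma direct_formula:
  fixes z :: complex
  assumes z: "z \<notin> \<real>" and j: "j \<in> {1..m}" and r: "\<And>l. j \<le> l \<Longrightarrow> l < m \<Longrightarrow> rep b l"
  shows "(-1) ^ j * (T j (A b j) z - A b (j - 1) z)
    = cp (b (j - 1)) z - cp (b m) z * T m (dens \<sigma> m j) z + (-1) ^ m * T m (\<lambda>x. A b m x * dens \<sigma> m j x) z"
proof -
  define E where "E l = T l (\<lambda>x. A b l x * dens \<sigma> l j x) z" for l
  define V where "V l = T l (dens \<sigma> l j) z" for l
  have part: "(\<Sum>l=j..<n. (-1) ^ l * (A b l z * V l)) = (-1) ^ j * E j - (-1) ^ n * E n" if "j \<le> n" "n \<le> m" for n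
    using that
  proof (induction n rule: dec_induct)
    case (step n)
    then have "(\<Sum>l=j..<Suc n. (-1) ^ l * (A b l z * V l)) = (-1) ^ j * E j - (-1) ^ n * E n + (-1) ^ n * (A b n z * V n)"
      by simp
    also have "A b n z * V n = E n + E (Suc n)"
      unfolding V_def E_def by (rule A_dens_shift[OF z]) (use step j r in auto)
    finally show ?case by (simp add: algebra_simps)
  qed simp
  have all: "{j..m} = insert m {j..<m}" using j by auto
  have lhs: "(\<Sum>l=j..m. (-1) ^ l * (A b l z * V l)) = (-1) ^ j * E j - (-1) ^ m * E m + cp (b m) z * V m"
    unfolding all using part[of m] j by (simp add: A_def power_mult_distrib[symmetric] mult.assoc[symmetric])
  have "(\<Sum>l=j..m. (-1) ^ l * (A b l z * V l))
      = (\<Sum>l=j..m. \<Sum>k=l..m. (-1) ^ k * cp (b k) z * ((-1) ^ l * (V l * dens \<sigma> l k z)))"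
    unfolding A_def by (simp add: sum_distrib_left sum_distrib_right mult_ac)
  also have "\<dots> = (\<Sum>k=j..m. \<Sum>l=j..k. (-1) ^ k * cp (b k) z * ((-1) ^ l * (V l * dens \<sigma> l k z)))"
    by (rule sum_triangle_swap)
  also have "\<dots> = (\<Sum>k=j..m. (-1) ^ k * cp (b k) z * ((-1) ^ j * T j (dens \<sigma> j k) z))"
  proof (rule sum.cong[OF refl])
    fix k assume k: "k \<in> {j..m}"
    have "(\<Sum>l=j..k. (-1) ^ k * cp (b k) z * ((-1) ^ l * (V l * dens \<sigma> l k z)))
        = (-1) ^ k * cp (b k) z * (\<Sum>l=j..k. (-1) ^ l * (T l (dens \<sigma> l j) z * dens \<sigma> l k z))"
      unfolding V_def by (rule sum_distrib_left[symmetric])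
    then show "(\<Sum>l=j..k. (-1) ^ k * cp (b k) z * ((-1) ^ l * (V l * dens \<sigma> l k z)))
        = (-1) ^ k * cp (b k) z * ((-1) ^ j * T j (dens \<sigma> j k) z)"
      using dens_identity[OF z, of j k] j k by simp
  qed
  also have "\<dots> = (-1) ^ j * (\<Sum>k=j..m. (-1) ^ k * cp (b k) z * dens \<sigma> (j - 1) k z)"
    unfolding sum_distrib_left
  proof (rule sum.cong[OF refl])
    fix k assume "k \<in> {j..m}"
    then have "dens \<sigma> (j - 1) k z = T j (dens \<sigma> j k) z" using dens_T_up[of j k z] j by auto
    then show "(-1) ^ k * cp (b k) z * ((-1) ^ j * T j (dens \<sigma> j k) z)
        = (-1) ^ j * ((-1) ^ k * cp (b k) z * dens \<sigma> (j - 1) k z)" by simp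
  qed
  also have "(\<Sum>k=j..m. (-1) ^ k * cp (b k) z * dens \<sigma> (j - 1) k z) = A b (j - 1) z - (-1) ^ (j - 1) * cp (b (j - 1)) z"
  proof -
    have "{j - 1..m} = insert (j - 1) {j..m}" using j by auto
    moreover have "j - 1 \<notin> {j..m}" using j by auto
    ultimately show ?thesis by (simp add: A_def)
  qed
  also have "(-1) ^ j * (A b (j - 1) z - (-1) ^ (j - 1) * cp (b (j - 1)) z) = (-1) ^ j * A b (j - 1) z + cp (b (j - 1)) z"
    using j by (cases j) (auto simp: algebra_simps power_mult_distrib[symmetric] mult.assoc[symmetric])
  finally have "(-1) ^ j * E j - (-1) ^ m * E m + cp (b m) z * V m = (-1) ^ j * A b (j - 1) z + cp (b (j - 1)) z"
    unfolding lhs .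
  moreover have "E j = T j (A b j) z" by (simp add: E_def)
  ultimately show ?thesis by (simp add: E_def V_def algebra_simps)
qed

text \<open>Descending induction. Decay identifies \<open>b j\<close> with the second-kind
  polynomial of \<open>b m\<close>, so the right side of \<open>direct_formula\<close> vanishes, and
  the left side is the recursion at level j.\<close>

lemma direct_rep:
  assumes dr: "\<And>j. j \<in> {1..<m} \<Longrightarrow> decay 1 (\<lambda>z. cp (b j) z - cp (b m) z * T m (dens \<sigma> m (j + 1)) z)"
    and j: "1 \<le> j" "j < m"
  shows "rep b j"
proof -
  have m: "m \<in> {1..m}" using m2 by auto
  have gen: "\<forall>l. j \<le> l \<and> l < m \<longrightarrow> rep b l" if "1 \<le> j" "j \<le> m" for j
    using that(2,1)
  proof (induction j rule: inc_induct)
    case base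
    then show ?case by auto
  next
    case (step j)
    then have r: "\<And>l. Suc j \<le> l \<Longrightarrow> l < m \<Longrightarrow> rep b l" by auto
    have jn: "Suc j \<in> {1..m}" "j \<in> {1..<m}" using step by auto
    let ?g = "\<lambda>x. dens \<sigma> m (Suc j) x :: real"
    have ig: "integrable (\<mu> m) (\<lambda>x. poly q x * ?g x)" for q
      using integrable_poly_dens[OF m jn(1), of q] by (simp add: mult.commute)
    obtain P where P: "\<And>z. z \<notin> of_real ` \<Delta> m \<Longrightarrow> cp (b m) z * T m ?g z - T m (\<lambda>x. poly (b m) x * ?g x) z = cp P z"
      using second_kind[OF m ig] by blast
    have Am: "(-1) ^ m * T m (\<lambda>x. A b m x * ?g x) z = T m (\<lambda>x. poly (b m) x * ?g x) z" for z :: complex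
    proof -
      have "T m (\<lambda>x. A b m x * ?g x) z = of_real ((-1) ^ m) * T m (\<lambda>x. poly (b m) x * ?g x) z"
        unfolding T_cmult[symmetric] by (simp add: A_m mult.assoc)
      then show ?thesis by (simp add: mult.assoc[symmetric] power_mult_distrib[symmetric])
    qed
    have "decay 1 (\<lambda>z. (cp (b j) z - cp (b m) z * T m ?g z) + T m (\<lambda>x. poly (b m) x * ?g x) z)"
      using dr[OF jn(2)] by (intro decay_add decay_T[OF m ig]) simp
    then have "b j - P = 0"
    proof (rule decay_poly_zero)
      fix z :: complex assume "z \<notin> \<real>"
      then have "z \<notin> of_real ` \<Delta> m" by auto
      from P[OF this] show "(cp (b j) z - cp (b m) z * T m ?g z) + T m (\<lambda>x. poly (b m) x * ?g x) z = cp (b j - P) z"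
        by (simp add: map_poly_of_real_diff algebra_simps)
    qed
    then have bP: "b j = P" by simp
    have "rep b j"
    proof (rule rep_nonreal)
      show "j < m" using jn by simp
      fix z :: complex assume z: "z \<notin> \<real>"
      then have "z \<notin> of_real ` \<Delta> m" by auto
      from P[OF this] direct_formula[OF z jn(1) r]
      have "(-1) ^ Suc j * (T (Suc j) (A b (Suc j)) z - A b j z) = 0"
        unfolding Am by (simp add: bP algebra_simps)
      then show "A b j z = T (Suc j) (A b (Suc j)) z" by simp
    qed
    show ?case
    proof (intro allI impI)
      fix l assume l: "j \<le> l \<and> l < m"
      then show "rep b l" using r[of l] \<open>rep b j\<close> by (cases "l = j") auto
    qed
  qed
  show ?thesis using gen[OF j(1)] j by auto
qed


end

section \<open>Reduction to real coefficients\<close>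

lemma degree_map_poly_le: "f 0 = 0 \<Longrightarrow> degree (map_poly f p) \<le> degree p"
  by (rule degree_le) (simp add: coeff_map_poly coeff_eq_0)

lemma cp_Re: "cp (map_poly Re p) z = (poly p z + cnj (poly p (cnj z))) / 2"
proof (induction p)
  case (pCons a p)
  have "complex_of_real (Re a) = (a + cnj a) / 2" by (simp add: complex_add_cnj)
  then show ?case using pCons by (simp add: map_poly_pCons field_simps)
qed simp

lemma cp_Im: "cp (map_poly Im p) z = (poly p z - cnj (poly p (cnj z))) / (2 * \<i>)"
proof (induction p)
  case (pCons a p)
  have eq: "complex_of_real (Im a) = (a - cnj a) / (2 * \<i>)"
    by (simp add: complex_eq_iff)
  have "cp (map_poly Im (pCons a p)) z = of_real (Im a) + z * cp (map_poly Im p) z"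
    by (simp add: map_poly_pCons)
  also have "\<dots> = (a + z * poly p z - (cnj a + z * cnj (poly p (cnj z)))) / (2 * \<i>)"
    unfolding eq pCons.IH by (simp only: diff_divide_distrib add_divide_distrib right_diff_distrib
        times_divide_eq_right) (simp only: add_diff_add)
  finally show ?case by simp
qed simp

lemma poly_Re_Im: "p = map_poly of_real (map_poly Re p) + smult \<i> (map_poly of_real (map_poly Im p))"
  by (rule poly_eqI) (simp add: coeff_map_poly complex_eq_iff)

text \<open>The multipliers commute with conjugation, so combining f(z) with the conjugate of f at
  the conjugate point separates real and imaginary coefficients. Decay at both ends of the imaginary
  axis makes it stable under this.\<close>

lemma decay_Re_Im:
  assumes dec: "decay N (\<lambda>z. \<Sum>k\<in>I. poly (a k) z * \<phi> k z)"
    and cnj: "\<And>k z. k \<in> I \<Longrightarrow> \<phi> k (cnj z) = cnj (\<phi> k z)"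
  shows "decay N (\<lambda>z. \<Sum>k\<in>I. cp (map_poly Re (a k)) z * \<phi> k z)"
    and "decay N (\<lambda>z. \<Sum>k\<in>I. cp (map_poly Im (a k)) z * \<phi> k z)"
proof -
  let ?f = "\<lambda>z. \<Sum>k\<in>I. poly (a k) z * \<phi> k z"
  have c: "cnj (?f (cnj z)) = (\<Sum>k\<in>I. cnj (poly (a k) (cnj z)) * \<phi> k z)" for z
    unfolding cnj_sum by (rule sum.cong[OF refl]) (simp add: cnj)
  have "decay N (\<lambda>z. (1 / 2) * (?f z + cnj (?f (cnj z))))"
    by (intro decay_cmult decay_add decay_cnj dec)
  moreover have "(\<lambda>z. (1 / 2) * (?f z + cnj (?f (cnj z)))) = (\<lambda>z. \<Sum>k\<in>I. cp (map_poly Re (a k)) z * \<phi> k z)"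
    unfolding c by (simp add: fun_eq_iff cp_Re sum.distrib[symmetric] sum_divide_distrib algebra_simps add_divide_distrib)
  ultimately show "decay N (\<lambda>z. \<Sum>k\<in>I. cp (map_poly Re (a k)) z * \<phi> k z)" by simp
  have "decay N (\<lambda>z. (1 / (2 * \<i>)) * (?f z - cnj (?f (cnj z))))"
    by (intro decay_cmult decay_diff decay_cnj dec)
  moreover have "(\<lambda>z. (1 / (2 * \<i>)) * (?f z - cnj (?f (cnj z)))) = (\<lambda>z. \<Sum>k\<in>I. cp (map_poly Im (a k)) z * \<phi> k z)"
  proof
    fix z
    have "(1 / (2 * \<i>)) * (?f z - cnj (?f (cnj z)))
        = (\<Sum>k\<in>I. (1 / (2 * \<i>)) * (poly (a k) z * \<phi> k z - cnj (poly (a k) (cnj z)) * \<phi> k z))"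
      unfolding c sum_subtractf[symmetric] by (rule sum_distrib_left)
    also have "\<dots> = (\<Sum>k\<in>I. cp (map_poly Im (a k)) z * \<phi> k z)"
      by (rule sum.cong[OF refl]) (simp add: cp_Im left_diff_distrib[symmetric])
    finally show "(1 / (2 * \<i>)) * (?f z - cnj (?f (cnj z))) = (\<Sum>k\<in>I. cp (map_poly Im (a k)) z * \<phi> k z)" .
  qed
  ultimately show "decay N (\<lambda>z. \<Sum>k\<in>I. cp (map_poly Im (a k)) z * \<phi> k z)" by simp
qed

lemma cauchy_transform_cnj: "cauchy_transform s (cnj z) = cnj (cauchy_transform s z)"
proof -
  have "(LINT x|sm_var s. 1 / (cnj z - of_real x)) = (LINT x|sm_var s. cnj (1 / (z - of_real x)))" by simp
  also have "\<dots> = cnj (LINT x|sm_var s. 1 / (z - of_real x))" by (rule Bochner_Integration.integral_cnj)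
  finally show ?thesis by (simp add: cauchy_transform_def sm_integral_def)
qed

context nikishin_system
begin

lemma dens_cnj: "dens \<sigma> l k (cnj z) = cnj (dens \<sigma> l k z)"
  by (simp add: dens_def cauchy_transform_cnj)

text \<open>For a solution the left side of \<open>direct_formula\<close> is 0, so
  \<open>b (j - 1)\<close> is the second-kind polynomial of \<open>b m\<close> with respect to
  \<open>nik \<sigma> m j\<close>. Expanding the difference quotient integrates the Lagrange
  polynomials, and their integrals are the quadrature weights.\<close>

lemma solution_ratio:
  assumes sol: "solution n b" and bm: "b m \<noteq> 0" and n: "n \<ge> 1" and j: "j \<in> {1..m}"
  shows "cp (b (j - 1)) z = cp (b m) z * (of_real (sm_sign (nik \<sigma> m j)) * qsum b j z) \<or> z \<in> of_real ` \<Delta> m"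
proof -
  let ?s = "nik \<sigma> m j" and ?X = "Zs b m" and ?wt = "quadrature.wt (sm_var (nik \<sigma> m j)) (Zs b m)"
  note M = class_MD[OF nik_m[OF j]]
  note Z = zeros_exact[OF sol bm m_in(1)]
  obtain W e where "quadrature (sm_var ?s) (\<Delta> m) ?X W n e"
    using solution_quadrature[OF sol bm n j] by blast
  then interpret q: quadrature "sm_var ?s" "\<Delta> m" ?X W n e .
  have Xne: "?X \<noteq> {}" using Z(2) n by auto
  obtain c where c: "c \<noteq> 0" "b m = smult c (nodal ?X)"
    by (rule solution_leading[OF sol bm])
  let ?e = "sm_sign ?s"
  define R where "R = smult (c * ?e) (\<Sum>y\<in>?X. smult (?wt y) (nodal (?X - {y})))"
  have cpR: "cp R z = of_real (c * ?e) * (\<Sum>y\<in>?X. of_real (?wt y) * cp (nodal (?X - {y})) z)" for z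
    by (simp add: R_def map_poly_of_real_smult map_poly_of_real_sum poly_sum sum_distrib_left mult_ac)
  have rp: "rep b l" if "l < m" for l
    using sol that unfolding solution_def rep_def by blast
  have "b (j - 1) = R"
  proof (rule real_poly_eqI)
    fix z :: complex assume z: "z \<notin> \<real>"
    then have zn: "z \<notin> of_real ` \<Delta> i" for i by auto
    have jm: "j - 1 < m" "Suc (j - 1) = j" using j by auto
    have "A b (j - 1) z = T j (A b j) z" using rp[OF jm(1)] zn unfolding rep_def jm(2) by simp
    then have f: "cp (b (j - 1)) z = cp (b m) z * T m (dens \<sigma> m j) z - (-1) ^ m * T m (\<lambda>x. A b m x * dens \<sigma> m j x) z"
    proof -
      have "cp (b (j - 1)) z - cp (b m) z * T m (dens \<sigma> m j) z + (-1) ^ m * T m (\<lambda>x. A b m x * dens \<sigma> m j x) z = 0"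
        using direct_formula[OF z j rp] \<open>A b (j - 1) z = T j (A b j) z\<close> by simp
      then show ?thesis by (simp only: diff_add_eq right_minus_eq add_eq_0_iff2 eq_diff_eq)
    qed
    let ?k = "\<lambda>x. 1 / (z - complex_of_real x)"
    have [measurable_cong]: "sets (sm_var ?s) = sets borel" by (rule M(2))
    have T1: "T m (dens \<sigma> m j) z = sm_integral ?s ?k"
      unfolding T_def by (rule nik_integral(2)[OF m_in(1) j, symmetric]) measurable
    have T2: "(-1) ^ m * T m (\<lambda>x. A b m x * dens \<sigma> m j x) z = sm_integral ?s (\<lambda>x. poly (b m) x *\<^sub>R ?k x)"
    proof -
      have "(-1) ^ m * T m (\<lambda>x. A b m x * dens \<sigma> m j x) z = T m (\<lambda>x. (-1) ^ m * (A b m x * dens \<sigma> m j x)) z"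
        unfolding T_cmult by simp
      also have "\<dots> = sm_integral (\<sigma> m) (\<lambda>x. dens \<sigma> m j x *\<^sub>R (poly (b m) x *\<^sub>R ?k x))"
        unfolding T_def A_m by (rule arg_cong[where f = "sm_integral _"])
          (simp add: fun_eq_iff mult.assoc[symmetric] power_mult_distrib[symmetric])
      also have "\<dots> = sm_integral ?s (\<lambda>x. poly (b m) x *\<^sub>R ?k x)"
        by (rule nik_integral(2)[OF m_in(1) j, symmetric]) measurable
      finally show ?thesis .
    qed
    have i1: "integrable (sm_var ?s) ?k"
    proof -
      obtain d where d: "d > 0" "\<And>x. x \<in> \<Delta> m \<Longrightarrow> d \<le> norm (z - of_real x)"
        by (rule closed_of_real_dist[OF closed_\<Delta>[OF m_in(1)] zn]) metis
      from integrable_cauchy_kernel[OF M(2) _ M(8) d, of "\<lambda>_. 1"] show ?thesis using M(10)[of 0] by simp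
    qed
    have i2: "integrable (sm_var ?s) (\<lambda>x. poly (b m) x *\<^sub>R ?k x)"
    proof -
      obtain d where d: "d > 0" "\<And>x. x \<in> \<Delta> m \<Longrightarrow> d \<le> norm (z - of_real x)"
        by (rule closed_of_real_dist[OF closed_\<Delta>[OF m_in(1)] zn]) metis
      from integrable_cauchy_kernel[OF M(2) M(11) M(8) d] show ?thesis .
    qed
    have pt: "cp (b m) z * ?k x - poly (b m) x *\<^sub>R ?k x
        = of_real c * (\<Sum>y\<in>?X. of_real (poly (lagr ?X y) x) * cp (nodal (?X - {y})) z)" for x
    proof -
      have nz: "z - of_real x \<noteq> 0" using z by auto
      have "cp ([:- x, 1:] * (\<Sum>y\<in>?X. smult (poly (lagr ?X y) x) (nodal (?X - {y})))) z = cp (nodal ?X - [:poly (nodal ?X) x:]) z"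
        by (simp only: nodal_difference_quotient[OF Z(1) Xne])
      then have "(z - of_real x) * (\<Sum>y\<in>?X. of_real (poly (lagr ?X y) x) * cp (nodal (?X - {y})) z) = cp (nodal ?X) z - of_real (poly (nodal ?X) x)"
        by (simp only: map_poly_of_real_mult map_poly_of_real_diff map_poly_of_real_sum map_poly_of_real_smult poly_mult poly_diff poly_sum poly_smult)
           (simp add: map_poly_pCons)
      then have quot: "(\<Sum>y\<in>?X. of_real (poly (lagr ?X y) x) * cp (nodal (?X - {y})) z) = (cp (nodal ?X) z - of_real (poly (nodal ?X) x)) * ?k x"
        using nz by (simp add: field_simps)
      show ?thesis
        unfolding quot unfolding c(2)
        by (simp add: map_poly_of_real_smult scaleR_conv_of_real algebra_simps diff_divide_distrib)
    qed
    have "cp (b (j - 1)) z = of_real ?e * (cp (b m) z * (LINT x|sm_var ?s. ?k x) - (LINT x|sm_var ?s. poly (b m) x *\<^sub>R ?k x))"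
      unfolding f T1 T2 by (simp add: sm_integral_def scaleR_conv_of_real algebra_simps)
    also have "cp (b m) z * (LINT x|sm_var ?s. ?k x) - (LINT x|sm_var ?s. poly (b m) x *\<^sub>R ?k x)
        = (LINT x|sm_var ?s. cp (b m) z * ?k x - poly (b m) x *\<^sub>R ?k x)"
      by (subst Bochner_Integration.integral_diff[OF integrable_mult_right[OF i1] i2]) (subst integral_mult_right_zero, rule refl)
    also have "\<dots> = (LINT x|sm_var ?s. of_real c * (\<Sum>y\<in>?X. of_real (poly (lagr ?X y) x) * cp (nodal (?X - {y})) z))"
      unfolding pt ..
    also have "\<dots> = of_real c * (\<Sum>y\<in>?X. of_real (?wt y) * cp (nodal (?X - {y})) z)"
    proof -
      have "(LINT x|sm_var ?s. (\<Sum>y\<in>?X. of_real (poly (lagr ?X y) x) * cp (nodal (?X - {y})) z))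
          = (\<Sum>y\<in>?X. (LINT x|sm_var ?s. complex_of_real (poly (lagr ?X y) x) * cp (nodal (?X - {y})) z))"
        by (rule Bochner_Integration.integral_sum) (intro integrable_mult_left integrable_of_real q.poly_int)
      also have "\<dots> = (\<Sum>y\<in>?X. of_real (?wt y) * cp (nodal (?X - {y})) z)"
        unfolding integral_mult_left_zero integral_complex_of_real q.wt_def ..
      finally show ?thesis unfolding integral_mult_right_zero by simp
    qed
    finally show "cp (b (j - 1)) z = cp R z" unfolding cpR by (simp add: mult_ac)
  qed
  note bR = this
  show ?thesis
  proof (rule disjCI)
    assume zn: "z \<notin> of_real ` \<Delta> m"
    have Xsub: "?X \<subseteq> \<Delta> m" using Zs_S S_subset by blast
    have "cp (b (j - 1)) z = of_real (c * ?e) * (\<Sum>y\<in>?X. of_real (?wt y) * cp (nodal (?X - {y})) z)"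
      unfolding bR cpR ..
    also have "(\<Sum>y\<in>?X. of_real (?wt y) * cp (nodal (?X - {y})) z) = cp (nodal ?X) z * qsum b j z"
      unfolding qsum_def sum_distrib_left
    proof (rule sum.cong[OF refl])
      fix y assume y: "y \<in> ?X"
      have nz: "z - of_real y \<noteq> 0" using zn Xsub y by auto
      have "cp (nodal ?X) z = (z - of_real y) * cp (nodal (?X - {y})) z"
        by (subst nodal_remove[OF Z(1) y], subst map_poly_of_real_mult) (simp add: map_poly_pCons algebra_simps)
      then show "of_real (?wt y) * cp (nodal (?X - {y})) z = cp (nodal ?X) z * (of_real (?wt y) * (1 / (z - of_real y)))"
        using nz by simp
    qed
    also have "of_real (c * ?e) * (cp (nodal ?X) z * qsum b j z) = cp (b m) z * (of_real ?e * qsum b j z)"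
    proof -
      have "cp (b m) z = of_real c * cp (nodal ?X) z"
        by (subst c(2)) (simp add: map_poly_of_real_smult)
      then show ?thesis by (simp add: mult_ac)
    qed
    finally show "cp (b (j - 1)) z = cp (b m) z * (of_real ?e * qsum b j z)" .
  qed
qed

lemma cp_leading_nonzero:
  assumes sol: "solution n b" and bm: "b m \<noteq> 0" and z: "z \<notin> of_real ` \<Delta> m"
  shows "cp (b m) z \<noteq> 0"
proof -
  obtain c where c: "c \<noteq> 0" "b m = smult c (nodal (Zs b m))"
    by (rule solution_leading[OF sol bm])
  have fin: "finite (Zs b m)" by (rule zeros_exact(1)[OF sol bm m_in(1)])
  have sub: "Zs b m \<subseteq> \<Delta> m" using Zs_S S_subset by blast
  have "cp (nodal X) z = (\<Prod>y\<in>X. z - of_real y)" if "finite X" for X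
    using that
  proof (induction X rule: finite_induct)
    case empty
    then show ?case by (simp add: nodal_def one_pCons map_poly_pCons)
  next
    case (insert x X)
    then show ?case
      unfolding nodal_insert[OF insert.hyps] map_poly_of_real_mult by (simp add: map_poly_pCons algebra_simps)
  qed
  from this[OF fin] have "cp (nodal (Zs b m)) z \<noteq> 0" using fin sub z by auto
  then show ?thesis by (subst c(2)) (simp add: map_poly_of_real_smult c(1))
qed

lemma A_lincomb:
  "A (\<lambda>k. smult \<alpha> (u k) + smult \<beta> (v k)) l (z :: complex) = of_real \<alpha> * A u l z + of_real \<beta> * A v l z"
  "A (\<lambda>k. smult \<alpha> (u k) + smult \<beta> (v k)) l (x :: real) = \<alpha> * A u l x + \<beta> * A v l x"
  by (simp_all add: A_def map_poly_of_real_add map_poly_of_real_smult sum_distrib_left sum.distrib[symmetric] algebra_simps)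

lemma solution_lincomb:
  assumes u: "solution n u" and v: "solution n v"
  shows "solution n (\<lambda>k. smult \<alpha> (u k) + smult \<beta> (v k))"
proof -
  let ?w = "\<lambda>k. smult \<alpha> (u k) + smult \<beta> (v k)"
  have "degree (?w m) \<le> n"
    using u v unfolding solution_def
    by (intro degree_add_le order_trans[OF degree_smult_le]) auto
  moreover have "A ?w j z = T (Suc j) (A ?w (Suc j)) z" if "j < m" "z \<notin> of_real ` \<Delta> (Suc j)" for j and z :: complex
  proof -
    have l: "Suc j \<in> {1..m}" using that by auto
    have "T (Suc j) (A ?w (Suc j)) z = T (Suc j) (\<lambda>x. \<alpha> * A u (Suc j) x + \<beta> * A v (Suc j) x) z"
      by (rule arg_cong[where f = "\<lambda>g. T (Suc j) g z"]) (rule ext, rule A_lincomb(2))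
    also have "\<dots> = of_real \<alpha> * T (Suc j) (A u (Suc j)) z + of_real \<beta> * T (Suc j) (A v (Suc j)) z"
      unfolding T_cmult[symmetric]
      by (rule T_add[OF l integrable_mult_right[OF integrable_A[OF l]] integrable_mult_right[OF integrable_A[OF l]] that(2)])
    also have "\<dots> = A ?w j z"
      using u v that unfolding solution_def A_lincomb(1) by simp
    finally show ?thesis by simp
  qed
  moreover have "sm_integral (\<sigma> 1) (\<lambda>x. poly q x * A ?w 1 x) = 0" if "degree q < n" for q
  proof -
    have l: "1 \<in> {1..m}" using m2 by auto
    have "sm_integral (\<sigma> 1) (\<lambda>x. poly q x * A ?w 1 x)
        = sm_integral (\<sigma> 1) (\<lambda>x. \<alpha> * (poly q x * A u 1 x) + \<beta> * (poly q x * A v 1 x))"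
      unfolding A_lincomb(2) by (simp add: algebra_simps)
    also have "\<dots> = \<alpha> * sm_integral (\<sigma> 1) (\<lambda>x. poly q x * A u 1 x) + \<beta> * sm_integral (\<sigma> 1) (\<lambda>x. poly q x * A v 1 x)"
      unfolding sm_integral_cmult[symmetric]
      by (rule sm_integral_add) (intro integrable_mult_right integrable_poly_A[OF l])+
    also have "\<dots> = 0" using u v that unfolding solution_def by simp
    finally show ?thesis .
  qed
  ultimately show ?thesis unfolding solution_def by blast
qed

text \<open>Subtracting a multiple that cancels the coefficient of degree n leaves a solution whose
  last polynomial cannot have degree n, hence is 0, and \<open>solution_trivial\<close>
  finishes.\<close>

lemma solution_proportional:
  assumes u: "solution n u" "u m \<noteq> 0" and v: "solution n v"
  shows "\<exists>r. \<forall>k\<le>m. v k = smult r (u k)"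
proof -
  define \<beta> where "\<beta> = lead_coeff (u m)"
  define r where "r = coeff (v m) n / \<beta>"
  let ?w = "\<lambda>k. smult 1 (v k) + smult (- r) (u k)"
  have \<beta>: "\<beta> \<noteq> 0" "coeff (u m) n = \<beta>" using u solution_degree[OF u] by (auto simp: \<beta>_def)
  have w: "solution n ?w" by (rule solution_lincomb[OF v u(1)])
  have "coeff (?w m) n = 0" using \<beta> by (simp add: r_def)
  then have "?w m = 0" using solution_degree[OF w] leading_coeff_0_iff by metis
  then have "\<forall>k\<le>m. ?w k = 0" using solution_trivial[OF w] by blast
  then have "\<forall>k\<le>m. v k = smult r (u k)" by (auto simp: add_eq_0_iff)
  then show ?thesis by blast
qed

lemma hp_form_sum:
  "j < m \<Longrightarrow> hp_form m \<sigma> a j z = (\<Sum>k=j..m. poly (a k) z * ((-1) ^ k * dens \<sigma> j k z))"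
proof -
  assume j: "j < m"
  then have "{j..m} = insert j {j+1..m}" by auto
  then have "(\<Sum>k=j..m. poly (a k) z * ((-1) ^ k * dens \<sigma> j k z))
      = poly (a j) z * (-1) ^ j + (\<Sum>k=j+1..m. poly (a k) z * ((-1) ^ k * dens \<sigma> j k z))" by simp
  also have "(\<Sum>k=j+1..m. poly (a k) z * ((-1) ^ k * dens \<sigma> j k z))
      = (\<Sum>k=j+1..m. (-1) ^ k * poly (a k) z * cauchy_transform (nik \<sigma> (j + 1) k) z)"
    by (rule sum.cong[OF refl]) (simp add: dens_def step_def)
  finally show ?thesis by (simp add: hp_form_def mult.commute)
qed

lemma A_sum: "A b j z = (\<Sum>k=j..m. cp (b k) z * ((-1) ^ k * dens \<sigma> j k z))"
  by (simp add: A_def mult_ac)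

lemma hp_decay_parts:
  assumes "j < m" "decay N (hp_form m \<sigma> a j)"
  shows "decay N (A (\<lambda>k. map_poly Re (a k)) j)" "decay N (A (\<lambda>k. map_poly Im (a k)) j)"
proof -
  have "decay N (\<lambda>z. \<Sum>k\<in>{j..m}. poly (a k) z * ((-1) ^ k * dens \<sigma> j k z))"
    using assms(2) unfolding hp_form_sum[OF assms(1), abs_def] .
  from decay_Re_Im[OF this]
  show "decay N (A (\<lambda>k. map_poly Re (a k)) j)" "decay N (A (\<lambda>k. map_poly Im (a k)) j)"
    unfolding A_sum[abs_def] by (simp_all add: dens_cnj)
qed

lemma ml_parts:
  assumes ml: "ml_hermite_pade m \<Delta> \<sigma> n a" and ne: "\<And>l. l \<in> {1..m} \<Longrightarrow> \<Delta> l \<noteq> {}"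
  shows "solution n (\<lambda>k. map_poly Re (a k))" "solution n (\<lambda>k. map_poly Im (a k))"
proof -
  have deg: "degree (a m) \<le> n" using ml by (auto simp: ml_hermite_pade_def hp_degrees_def)
  have d0: "decay (n + 1) (hp_form m \<sigma> a 0)"
    using ml ne[of 1] m2 unfolding ml_hermite_pade_def by (intro bigo_inf_decay[of "\<Delta> 1"]) auto
  have d1: "decay 1 (hp_form m \<sigma> a j)" if "j < m" for j
  proof (cases "j = 0")
    case True
    then show ?thesis using decay_mono[OF d0, of 1] by simp
  next
    case False
    then show ?thesis using ml ne[of "j + 1"] that unfolding ml_hermite_pade_def
      by (intro bigo_inf_decay[of "\<Delta> (j + 1)"]) auto
  qed
  have m0: "0 < m" using m2 by simp
  show "solution n (\<lambda>k. map_poly Re (a k))"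
    by (rule solutionI) (use deg hp_decay_parts[OF _ d1] hp_decay_parts[OF m0 d0] degree_map_poly_le[where f = Re and p = "a m"] in
        \<open>auto intro: rep_decay le_trans\<close>)
  show "solution n (\<lambda>k. map_poly Im (a k))"
    by (rule solutionI) (use deg hp_decay_parts[OF _ d1] hp_decay_parts[OF m0 d0] degree_map_poly_le[where f = Im and p = "a m"] in
        \<open>auto intro: rep_decay le_trans\<close>)
qed

lemma dr_parts:
  assumes dr: "dr_hermite_pade m \<Delta> \<sigma> n a" and ne: "\<And>l. l \<in> {1..m} \<Longrightarrow> \<Delta> l \<noteq> {}"
  shows "solution n (\<lambda>k. map_poly Re (a k))" "solution n (\<lambda>k. map_poly Im (a k))"
proof -
  have deg: "degree (a m) \<le> n" using dr by (auto simp: dr_hermite_pade_def hp_degrees_def)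
  have m0: "0 < m" using m2 by simp
  have d0: "decay (n + 1) (hp_form m \<sigma> a 0)"
    using dr ne[of 1] m2 unfolding dr_hermite_pade_def by (intro bigo_inf_decay[of "\<Delta> 1"]) auto
  note D0 = hp_decay_parts[OF m0 d0]
  have parts: "decay 1 (\<lambda>z. cp (map_poly Re (a j)) z - cp (map_poly Re (a m)) z * T m (dens \<sigma> m (j + 1)) z)"
    "decay 1 (\<lambda>z. cp (map_poly Im (a j)) z - cp (map_poly Im (a m)) z * T m (dens \<sigma> m (j + 1)) z)" if j: "j \<in> {1..<m}" for j
  proof -
    \<comment> \<open>Writes the two-term condition as a sum over the indices j and m, the shape
      \<open>decay_Re_Im\<close> expects.\<close>
    define \<phi> where "\<phi> k z = (if k = m then - cauchy_transform (nik \<sigma> m (j + 1)) z else 1)" for k and z :: complex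
    have "decay 1 (\<lambda>z. poly (a j) z - poly (a m) z * cauchy_transform (nik \<sigma> m (j + 1)) z)"
      using dr ne[of m] m2 j unfolding dr_hermite_pade_def by (intro bigo_inf_decay[of "\<Delta> m"]) auto
    moreover have "(\<Sum>k\<in>{j, m}. f k * \<phi> k z) = f j - f m * cauchy_transform (nik \<sigma> m (j + 1)) z" for f :: "nat \<Rightarrow> complex" and z
      using j by (simp add: \<phi>_def)
    ultimately have "decay 1 (\<lambda>z. \<Sum>k\<in>{j, m}. poly (a k) z * \<phi> k z)" by simp
    note D = decay_Re_Im[OF this]
    have cn: "\<phi> k (cnj z) = cnj (\<phi> k z)" for k z by (simp add: \<phi>_def cauchy_transform_cnj)
    have T: "T m (dens \<sigma> m (j + 1)) z = cauchy_transform (nik \<sigma> m (j + 1)) z" for z :: complex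
      by (rule fun_cong[OF cauchy_transform_T[symmetric]]) (use j m2 in auto)
    show "decay 1 (\<lambda>z. cp (map_poly Re (a j)) z - cp (map_poly Re (a m)) z * T m (dens \<sigma> m (j + 1)) z)"
      using D(1)[OF cn] unfolding T using j by (simp add: \<phi>_def)
    show "decay 1 (\<lambda>z. cp (map_poly Im (a j)) z - cp (map_poly Im (a m)) z * T m (dens \<sigma> m (j + 1)) z)"
      using D(2)[OF cn] unfolding T using j by (simp add: \<phi>_def)
  qed
  have gen: "solution n b" if "degree (b m) \<le> n" "decay (n + 1) (A b 0)"
    "\<And>j. j \<in> {1..<m} \<Longrightarrow> decay 1 (\<lambda>z. cp (b j) z - cp (b m) z * T m (dens \<sigma> m (j + 1)) z)" for b
  proof (rule solutionI[of b n, OF that(1) _ that(2)])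
    fix j assume "j < m"
    show "rep b j"
    proof (cases "j = 0")
      case True
      have "decay 1 (A b 0)" by (rule decay_mono[OF that(2)]) simp
      then show ?thesis using rep_decay[OF m0] True by simp
    next
      case False
      then show ?thesis using direct_rep[of b j, OF that(3)] \<open>j < m\<close> by simp
    qed
  qed
  show "solution n (\<lambda>k. map_poly Re (a k))"
    by (rule gen) (use parts(1) D0(1) deg degree_map_poly_le[where f = Re and p = "a m"] in auto)
  show "solution n (\<lambda>k. map_poly Im (a k))"
    by (rule gen) (use parts(2) D0(2) deg degree_map_poly_le[where f = Im and p = "a m"] in auto)
qed

text \<open>Real and imaginary parts are both solutions, hence proportional; if the real part has no
  last polynomial, it is 0 altogether and the imaginary part serves.\<close>

lemma hermite_pade_real:
  assumes hp: "ml_hermite_pade m \<Delta> \<sigma> n a \<or> dr_hermite_pade m \<Delta> \<sigma> n a"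
  shows "\<exists>b \<gamma>. solution n b \<and> b m \<noteq> 0 \<and> \<gamma> \<noteq> 0 \<and> (\<forall>k\<le>m. a k = smult \<gamma> (map_poly of_real (b k)))"
proof -
  have ne: "\<Delta> l \<noteq> {}" if "l \<in> {1..m}" for l using infinite_\<Delta>[OF that] by auto
  define u v where "u k = map_poly Re (a k)" and "v k = map_poly Im (a k)" for k
  have u: "solution n u" and v: "solution n v"
    using hp ml_parts[OF _ ne] dr_parts[OF _ ne] unfolding u_def[abs_def] v_def[abs_def] by blast+
  have a: "a k = map_poly of_real (u k) + smult \<i> (map_poly of_real (v k))" for k
    unfolding u_def v_def by (rule poly_Re_Im)
  have nz: "\<exists>k\<le>m. a k \<noteq> 0"
    using hp by (auto simp: ml_hermite_pade_def dr_hermite_pade_def hp_degrees_def)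
  show ?thesis
  proof (cases "u m = 0")
    case False
    obtain r where r: "\<And>k. k \<le> m \<Longrightarrow> v k = smult r (u k)"
      using solution_proportional[OF u False v] by blast
    show ?thesis
    proof (intro exI[of _ u] exI[of _ "1 + \<i> * of_real r"] conjI allI impI)
      show "1 + \<i> * of_real r \<noteq> 0" by (simp add: complex_eq_iff)
      show "a k = smult (1 + \<i> * of_real r) (map_poly of_real (u k))" if "k \<le> m" for k
        unfolding a r[OF that] map_poly_of_real_smult by (simp add: smult_add_left)
    qed (use u False in auto)
  next
    case True
    have u0: "u k = 0" if "k \<le> m" for k by (rule solution_trivial[OF u True that])
    have "v m \<noteq> 0"
    proof
      assume "v m = 0"
      then have "v k = 0" if "k \<le> m" for k using solution_trivial[OF v _ that] by blast
      then show False using nz u0 a by auto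
    qed
    then show ?thesis
      by (intro exI[of _ v] exI[of _ \<i>]) (use v u0 a in auto)
  qed
qed

end

section \<open>Convergence of the approximants\<close>

lemma uniform_limit_sum':
  fixes f :: "'i \<Rightarrow> nat \<Rightarrow> complex \<Rightarrow> complex"
  assumes "\<And>i. i \<in> I \<Longrightarrow> uniform_limit K (f i) (g i) F"
  shows "uniform_limit K (\<lambda>n z. \<Sum>i\<in>I. f i n z) (\<lambda>z. \<Sum>i\<in>I. g i z) F"
  using assms
  by (induction I rule: infinite_finite_induct) (auto intro!: uniform_limit_add uniform_limit_const)

context nikishin_system
begin

lemma isCont_cauchy_transform:
  assumes "l \<in> {1..m}" "k \<in> {1..m}" "(z :: complex) \<notin> of_real ` \<Delta> l"
  shows "isCont (cauchy_transform (nik \<sigma> l k)) z"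
proof -
  have "isCont (T l (dens \<sigma> l k)) z"
    using T_has_derivative[OF assms(1) integrable_dens[OF assms(1,2)] assms(3)] DERIV_isCont by blast
  moreover have "cauchy_transform (nik \<sigma> l k) = (T l (dens \<sigma> l k) :: complex \<Rightarrow> complex)"
    by (rule cauchy_transform_T[OF assms(1,2)])
  ultimately show ?thesis by simp
qed

text \<open>The limit of the k-th polynomial divided by the m-th, including the trivial case k =
  m.\<close>

definition vtail :: "nat \<Rightarrow> complex \<Rightarrow> complex" where
  "vtail k z = (if k = m then 1 else cauchy_transform (nik \<sigma> m (k + 1)) z)"

text \<open>\<open>dens_identity\<close> says that one triangular matrix is a left inverse of another; the limits in the
  second part of the theorem require the right inverse.\<close>

lemma inverse_identity_nonreal:
  assumes z: "z \<notin> \<real>" and j: "j < m"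
  shows "(\<Sum>k=j..m. (-1) ^ k * dens \<sigma> j k z * vtail k z) = 0"
proof -
  define W where "W l = (\<Sum>k=l..m. (-1) ^ k * dens \<sigma> l k z * vtail k z)" for l
  \<comment> \<open>Triangular with entries of modulus 1 on the diagonal; \<open>ortho\<close>
    states that it inverts the matrix of the \<open>dens \<sigma> l k z\<close> from the left, up to
    signs.\<close>
  define V where "V j l = (if l = j then (-1) ^ l else (-1) ^ l * T l (dens \<sigma> l (Suc j)) z)" for j l
  have ortho: "(\<Sum>l=j..k. V j l * dens \<sigma> l k z) = (if k = j then (-1) ^ j else 0)" if "j \<le> k" "k \<le> m" for j k
  proof (cases "k = j")
    case True
    then show ?thesis by (simp add: V_def)
  next
    case False
    then have jk: "Suc j \<le> k" "j < k" using that by auto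
    then have "{j..k} = insert j {Suc j..k}" by auto
    then have "(\<Sum>l=j..k. V j l * dens \<sigma> l k z) = (-1) ^ j * dens \<sigma> j k z + (\<Sum>l=Suc j..k. V j l * dens \<sigma> l k z)"
      by (simp add: V_def)
    also have "(\<Sum>l=Suc j..k. V j l * dens \<sigma> l k z) = (\<Sum>l=Suc j..k. (-1) ^ l * (T l (dens \<sigma> l (Suc j)) z * dens \<sigma> l k z))"
      by (rule sum.cong[OF refl]) (auto simp: V_def)
    also have "\<dots> = (-1) ^ Suc j * T (Suc j) (dens \<sigma> (Suc j) k) z"
      by (rule dens_identity[OF z _ jk(1) that(2)]) simp
    also have "T (Suc j) (dens \<sigma> (Suc j) k) z = dens \<sigma> j k z"
      using dens_T_up[of "Suc j" k z] jk that by simp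
    finally show ?thesis using False by simp
  qed
  \<comment> \<open>The full sum up to m equals \<open>vtail j z\<close>, and the term l = m alone
    already has this value. What remains is a homogeneous triangular system for the
    \<open>W l\<close> with l < m.\<close>
  have sumVW: "(\<Sum>l=j..<m. V j l * W l) = 0" if j: "j < m" for j
  proof -
    have "(\<Sum>l=j..m. V j l * W l) = (\<Sum>l=j..m. \<Sum>k=l..m. (-1) ^ k * vtail k z * (V j l * dens \<sigma> l k z))"
      unfolding W_def sum_distrib_left by (intro sum.cong refl) (simp add: mult_ac)
    also have "\<dots> = (\<Sum>k=j..m. \<Sum>l=j..k. (-1) ^ k * vtail k z * (V j l * dens \<sigma> l k z))"
      by (rule sum_triangle_swap)
    also have "\<dots> = (\<Sum>k=j..m. if k = j then vtail j z else 0)"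
    proof (rule sum.cong[OF refl])
      fix k assume k: "k \<in> {j..m}"
      have "(\<Sum>l=j..k. (-1) ^ k * vtail k z * (V j l * dens \<sigma> l k z)) = (-1) ^ k * vtail k z * (if k = j then (-1) ^ j else 0)"
        unfolding sum_distrib_left[symmetric] using ortho k by simp
      then show "(\<Sum>l=j..k. (-1) ^ k * vtail k z * (V j l * dens \<sigma> l k z)) = (if k = j then vtail j z else 0)"
        by (simp add: power_mult_distrib[symmetric])
    qed
    also have "\<dots> = vtail j z" using j by simp
    finally have 1: "(\<Sum>l=j..m. V j l * W l) = vtail j z" .
    have "V j m * W m = vtail j z"
    proof -
      have "T m (dens \<sigma> m (Suc j)) z = cauchy_transform (nik \<sigma> m (Suc j)) z"
        by (rule fun_cong[OF cauchy_transform_T[symmetric]]) (use j m2 in auto)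
      then show ?thesis
        using j by (simp add: V_def W_def vtail_def mult_ac power_mult_distrib[symmetric] mult.assoc[symmetric])
    qed
    moreover have "{j..m} = insert m {j..<m}" using j by auto
    ultimately show ?thesis using 1 by simp
  qed
  have "W j = 0" if "j < m" for j
    using that
  proof (induction "m - j" arbitrary: j rule: less_induct)
    case less
    have "(\<Sum>l=j..<m. V j l * W l) = V j j * W j + (\<Sum>l=Suc j..<m. V j l * W l)"
      using less.prems by (rule sum.atLeast_Suc_lessThan)
    also have "(\<Sum>l=Suc j..<m. V j l * W l) = 0"
      by (rule sum.neutral) (use less in auto)
    finally have "V j j * W j = 0" using sumVW[OF less.prems] by simp
    then show ?case by (simp add: V_def)
  qed
  then show ?thesis using j unfolding W_def by blast
qed

definition limit_form :: "nat \<Rightarrow> complex \<Rightarrow> complex" where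
  "limit_form j z = (-1) ^ j * cauchy_transform (nik \<sigma> m (j + 1)) z
     + (\<Sum>k=j+1..m-1. (-1) ^ k * cauchy_transform (nik \<sigma> m (k + 1)) z * cauchy_transform (nik \<sigma> (j + 1) k) z)
     + (-1) ^ m * cauchy_transform (nik \<sigma> (j + 1) m) z"

text \<open>At a real point off both intervals the form is continuous, and approaching vertically
  reaches it through nonreal points, where \<open>inverse_identity_nonreal\<close> applies.\<close>

lemma limit_form_zero:
  assumes j: "j < m" and z: "z \<notin> of_real ` (\<Delta> (j + 1) \<union> \<Delta> m)"
  shows "limit_form j z = 0"
proof -
  have nonreal: "limit_form j w = 0" if w: "w \<notin> \<real>" for w
  proof -
    have "{j..m} = insert j (insert m {j+1..m-1})" using j by auto
    moreover have "j \<notin> insert m {j+1..m-1}" "m \<notin> {j+1..m-1}" using j by auto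
    ultimately have "(\<Sum>k=j..m. (-1) ^ k * dens \<sigma> j k w * vtail k w)
        = (-1) ^ j * vtail j w + ((-1) ^ m * dens \<sigma> j m w + (\<Sum>k=j+1..m-1. (-1) ^ k * dens \<sigma> j k w * vtail k w))"
      by (simp add: vtail_def)
    also have "(\<Sum>k=j+1..m-1. (-1) ^ k * dens \<sigma> j k w * vtail k w)
        = (\<Sum>k=j+1..m-1. (-1) ^ k * cauchy_transform (nik \<sigma> m (k + 1)) w * cauchy_transform (nik \<sigma> (j + 1) k) w)"
      by (rule sum.cong[OF refl]) (auto simp: vtail_def dens_def step_def)
    finally show ?thesis
      using inverse_identity_nonreal[OF w j] j by (simp add: limit_form_def vtail_def dens_def step_def add_ac)
  qed
  have in1: "j + 1 \<in> {1..m}" "m \<in> {1..m}" using j by auto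
  have zn: "z \<notin> of_real ` \<Delta> (j + 1)" "z \<notin> of_real ` \<Delta> m" using z by auto
  have cont: "isCont (limit_form j) z"
    unfolding limit_form_def[abs_def]
    by (intro continuous_intros isCont_cauchy_transform zn in1) (use j in auto)
  have "(\<lambda>n. z + \<i> * of_real (inverse (real (Suc n)))) \<longlonglongrightarrow> z + \<i> * of_real 0"
    by (intro tendsto_intros LIMSEQ_inverse_real_of_nat)
  then have "(\<lambda>n. z + \<i> * of_real (inverse (real (Suc n)))) \<longlonglongrightarrow> z" by simp
  from isCont_tendsto_compose[OF cont this] have lim: "(\<lambda>n. limit_form j (z + \<i> * of_real (inverse (real (Suc n))))) \<longlonglongrightarrow> limit_form j z" .
  show ?thesis
  proof (cases "z \<in> \<real>")
    case True
    have "z + \<i> * of_real (inverse (real (Suc n))) \<notin> \<real>" for n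
      using True by (simp add: complex_is_Real_iff)
    then have "(\<lambda>n. limit_form j (z + \<i> * of_real (inverse (real (Suc n))))) = (\<lambda>n. 0)"
      by (intro ext) (rule nonreal)
    from lim[unfolded this] show ?thesis by (simp add: LIMSEQ_const_iff)
  qed (rule nonreal)
qed

lemma bounded_cauchy_transform:
  assumes "l \<in> {1..m}" "k \<in> {1..m}" "compact K" "K \<inter> complex_of_real ` \<Delta> l = {}"
  shows "bounded (cauchy_transform (nik \<sigma> l k) ` K)"
proof (rule compact_imp_bounded, rule compact_continuous_image[OF _ assms(3)])
  show "continuous_on K (cauchy_transform (nik \<sigma> l k))"
    using assms(4) by (intro continuous_at_imp_continuous_on ballI isCont_cauchy_transform[OF assms(1,2)]) auto
qed

lemma convergence:
  assumes hp: "\<And>n. n \<ge> 1 \<Longrightarrow> ml_hermite_pade m \<Delta> \<sigma> n (a n) \<or> dr_hermite_pade m \<Delta> \<sigma> n (a n)"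
    and hyp: "carleman (\<sigma> m) \<or> bounded (\<Delta> (m - 1)) \<and> \<Delta> (m - 1) \<inter> \<Delta> m = {}"
    and j: "j < m" and K: "compact K" "K \<inter> complex_of_real ` \<Delta> m = {}"
  shows "\<forall>\<^sub>F n in sequentially. \<forall>z\<in>K. poly (a n m) z \<noteq> 0"
    and "uniform_limit K (\<lambda>n z. poly (a n j) z / poly (a n m) z) (cauchy_transform (nik \<sigma> m (j + 1))) sequentially"
proof -
  have "\<forall>n. \<exists>b \<gamma>. n \<ge> 1 \<longrightarrow> solution n b \<and> b m \<noteq> 0 \<and> \<gamma> \<noteq> 0 \<and> (\<forall>k\<le>m. a n k = smult \<gamma> (map_poly of_real (b k)))"
    using hermite_pade_real[OF hp] by blast
  then obtain b \<gamma> where b: "\<And>n. n \<ge> 1 \<Longrightarrow> solution n (b n) \<and> b n m \<noteq> 0"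
    and a: "\<And>n. n \<ge> 1 \<Longrightarrow> \<gamma> n \<noteq> 0 \<and> (\<forall>k\<le>m. a n k = smult (\<gamma> n) (map_poly of_real (b n k)))"
    by metis
  let ?s = "nik \<sigma> m (j + 1)"
  have j1: "j + 1 \<in> {1..m}" using j by auto
  have nz: "poly (a n m) z \<noteq> 0" if "n \<ge> 1" "z \<in> K" for n z
  proof -
    have "z \<notin> of_real ` \<Delta> m" using K(2) that(2) by auto
    then show ?thesis using cp_leading_nonzero[of n "b n" z] b[OF that(1)] a[OF that(1)] by simp
  qed
  have ratio: "poly (a n j) z / poly (a n m) z = of_real (sm_sign ?s) * qsum (b n) (j + 1) z" if n: "n \<ge> 1" and "z \<in> K" for n z
  proof -
    have zn: "z \<notin> of_real ` \<Delta> m" using K(2) that(2) by auto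
    have "cp (b n j) z = cp (b n m) z * (of_real (sm_sign ?s) * qsum (b n) (j + 1) z)"
      using solution_ratio[of n "b n" "j + 1" z] b[OF n] n j1 zn by simp
    moreover have "cp (b n m) z \<noteq> 0" using cp_leading_nonzero[of n "b n" z] b[OF n] zn by blast
    ultimately show ?thesis using a[OF n] j by simp
  qed
  show "\<forall>\<^sub>F n in sequentially. \<forall>z\<in>K. poly (a n m) z \<noteq> 0"
    using eventually_ge_at_top[of 1] by eventually_elim (use nz in blast)
  have "uniform_limit K (\<lambda>n z. qsum (b n) (j + 1) z) (\<lambda>z. LINT x|sm_var ?s. 1 / (z - of_real x)) sequentially"
    by (rule qsum_convergence[of b "j + 1" K, OF b j1 hyp K])
  then have "uniform_limit K (\<lambda>n z. of_real (sm_sign ?s) * qsum (b n) (j + 1) z)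
      (\<lambda>z. of_real (sm_sign ?s) * (LINT x|sm_var ?s. 1 / (z - of_real x))) sequentially"
    by (rule bounded_linear.uniform_limit[OF bounded_linear_mult_right])
  moreover have "(\<lambda>z. of_real (sm_sign ?s) * (LINT x|sm_var ?s. 1 / (z - complex_of_real x))) = cauchy_transform ?s"
    by (simp add: fun_eq_iff cauchy_transform_def sm_integral_def scaleR_conv_of_real)
  ultimately have lim: "uniform_limit K (\<lambda>n z. of_real (sm_sign ?s) * qsum (b n) (j + 1) z) (cauchy_transform ?s) sequentially"
    by simp
  have "\<forall>\<^sub>F n in sequentially. \<forall>z\<in>K. poly (a n j) z / poly (a n m) z = of_real (sm_sign ?s) * qsum (b n) (j + 1) z"
    using eventually_ge_at_top[of 1] by eventually_elim (use ratio in blast)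
  then show "uniform_limit K (\<lambda>n z. poly (a n j) z / poly (a n m) z) (cauchy_transform ?s) sequentially"
    using lim by (subst uniform_limit_cong) auto
qed

lemma convergence_forms:
  assumes hp: "\<And>n. n \<ge> 1 \<Longrightarrow> ml_hermite_pade m \<Delta> \<sigma> n (a n) \<or> dr_hermite_pade m \<Delta> \<sigma> n (a n)"
    and hyp: "carleman (\<sigma> m) \<or> bounded (\<Delta> (m - 1)) \<and> \<Delta> (m - 1) \<inter> \<Delta> m = {}"
    and j: "j < m" and K: "compact K" "K \<inter> complex_of_real ` (\<Delta> (j + 1) \<union> \<Delta> m) = {}"
  shows "uniform_limit K
    (\<lambda>n z. (-1) ^ j * (poly (a n j) z / poly (a n m) z)
      + (\<Sum>k=j+1..m-1. (-1) ^ k * (poly (a n k) z / poly (a n m) z) * cauchy_transform (nik \<sigma> (j + 1) k) z)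
      + (-1) ^ m * cauchy_transform (nik \<sigma> (j + 1) m) z) (\<lambda>_. 0) sequentially"
proof -
  let ?r = "\<lambda>k n z. poly (a n k) z / poly (a n m) z"
  have K': "K \<inter> complex_of_real ` \<Delta> (j + 1) = {}" "K \<inter> complex_of_real ` \<Delta> m = {}" using K(2) by auto
  have in1: "j + 1 \<in> {1..m}" "m \<in> {1..m}" using j by auto
  have r: "uniform_limit K (?r k) (cauchy_transform (nik \<sigma> m (k + 1))) sequentially" if "k < m" for k
    by (rule convergence(2)[OF hp hyp that K(1) K'(2)])
  have c: "uniform_limit K (\<lambda>n z. c * ?r k n z) (\<lambda>z. c * cauchy_transform (nik \<sigma> m (k + 1)) z) sequentially" if "k < m" for k c
    by (rule bounded_linear.uniform_limit[OF bounded_linear_mult_right r[OF that]])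
  have prod: "uniform_limit K (\<lambda>n z. (-1) ^ k * ?r k n z * cauchy_transform (nik \<sigma> (j + 1) k) z)
      (\<lambda>z. (-1) ^ k * cauchy_transform (nik \<sigma> m (k + 1)) z * cauchy_transform (nik \<sigma> (j + 1) k) z) sequentially"
    if k: "k \<in> {j+1..m-1}" for k
  proof (rule uniform_lim_mult[OF c uniform_limit_const])
    have k': "k < m" "k + 1 \<in> {1..m}" "k \<in> {1..m}" using k by auto
    then show "k < m" by simp
    have "bounded ((\<lambda>z. (-1) ^ k * z) ` (cauchy_transform (nik \<sigma> m (k + 1)) ` K))"
      by (rule bounded_linear_image[OF bounded_cauchy_transform[OF in1(2) k'(2) K(1) K'(2)] bounded_linear_mult_right])
    then show "bounded ((\<lambda>z. (-1) ^ k * cauchy_transform (nik \<sigma> m (k + 1)) z) ` K)" by (simp add: image_image)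
    show "bounded (cauchy_transform (nik \<sigma> (j + 1) k) ` K)"
      by (rule bounded_cauchy_transform[OF in1(1) k'(3) K(1) K'(1)])
  qed
  have "uniform_limit K
    (\<lambda>n z. (-1) ^ j * ?r j n z + (\<Sum>k=j+1..m-1. (-1) ^ k * ?r k n z * cauchy_transform (nik \<sigma> (j + 1) k) z)
      + (-1) ^ m * cauchy_transform (nik \<sigma> (j + 1) m) z) (limit_form j) sequentially"
    unfolding limit_form_def[abs_def]
    by (intro uniform_limit_add uniform_limit_const c[OF j] uniform_limit_sum' prod)
  note U = this
  have "limit_form j z = 0" if "z \<in> K" for z
    by (rule limit_form_zero[OF j]) (use K(2) that in auto)
  then show ?thesis
    by (intro uniform_limit_cong'[THEN iffD1, OF _ _ U] refl)
qed

end

theorem theorem1p6: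
  fixes m :: nat and \<Delta> :: "nat \<Rightarrow> real set" and \<sigma> :: "nat \<Rightarrow> sgn_measure"
    and a :: "nat \<Rightarrow> nat \<Rightarrow> complex poly"
  assumes "m \<ge> 2"
    and "nikishin m \<Delta> \<sigma>"
    and "\<forall>n\<ge>1. ml_hermite_pade m \<Delta> \<sigma> n (a n) \<or> dr_hermite_pade m \<Delta> \<sigma> n (a n)"
    and "carleman (\<sigma> m) \<or> (bounded (\<Delta> (m - 1)) \<and> \<Delta> (m - 1) \<inter> \<Delta> m = {})"
  shows "(\<forall>j<m. \<forall>K. compact K \<and> K \<inter> complex_of_real ` \<Delta> m = {} \<longrightarrow>
           (\<forall>\<^sub>F n in sequentially. \<forall>z\<in>K. poly (a n m) z \<noteq> 0) \<and>
           uniform_limit K (\<lambda>n z. poly (a n j) z / poly (a n m) z)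
             (cauchy_transform (nik \<sigma> m (j + 1))) sequentially) \<and>
         (\<forall>j<m. \<forall>K. compact K \<and> K \<inter> complex_of_real ` (\<Delta> (j + 1) \<union> \<Delta> m) = {} \<longrightarrow>
           uniform_limit K
             (\<lambda>n z. (-1) ^ j * (poly (a n j) z / poly (a n m) z)
                + (\<Sum>k=j+1..m-1. (-1) ^ k * (poly (a n k) z / poly (a n m) z)
                     * cauchy_transform (nik \<sigma> (j + 1) k) z)
                + (-1) ^ m * cauchy_transform (nik \<sigma> (j + 1) m) z)
             (\<lambda>_. 0) sequentially)"
proof -
  interpret nikishin_system m \<Delta> \<sigma>
    using assms(1,2) by unfold_locales
  have hp: "\<And>n. n \<ge> 1 \<Longrightarrow> ml_hermite_pade m \<Delta> \<sigma> n (a n) \<or> dr_hermite_pade m \<Delta> \<sigma> n (a n)"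
    using assms(3) by blast
  show ?thesis
    using convergence[OF hp assms(4)] convergence_forms[OF hp assms(4)] by blast
qed

end
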